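(* Let $T\in\mathbb R^{3\times3\times5}$ be a Gaussian tensor and let $M_0,\dots,M_3\in\mathbb R^{3\times3}$ be independent Gaussian matrices. Define the random cubic surface $S=\{[z_0:\dots:z_3]\in\mathbb P^3:\det(z_0M_0+\dots+z_3M_3)=0\}$. Then $$\Pr\{\mathrm{rank}(T)=5\}=\Pr\{\text{all 27 lines on } S \text{ are real}\}.$$
   Context: A Gaussian tensor (resp. matrix) has i.i.d. standard Gaussian entries. Tensor rank is the minimal number of rank-one tensors $a\otimes b\otimes c$ summing to $T$. With probability one $S$ is a smooth real cubic surface, which contains 27 complex lines, of which 3, 7, 15 or 27 are real. *)

theory Defs
  imports "HOL-Probability.Probability" "Jordan_Normal_Form.Determinant"
begin

definition std_gauss :: "real measure" where
  "std_gauss = density lborel std_normal_density"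

definition tensor_idx :: "(nat \<times> nat \<times> nat) set" where
  "tensor_idx = {(i,j,k). i < 3 \<and> j < 3 \<and> k < 5}"

definition gauss_tensor :: "(nat \<times> nat \<times> nat \<Rightarrow> real) measure" where
  "gauss_tensor = PiM tensor_idx (\<lambda>_. std_gauss)"

definition tensor_rank :: "(nat \<times> nat \<times> nat \<Rightarrow> real) \<Rightarrow> nat" where
  "tensor_rank T = (LEAST r. \<exists>a b c :: nat \<Rightarrow> nat \<Rightarrow> real.
      \<forall>i j k. (i,j,k) \<in> tensor_idx \<longrightarrow> T (i,j,k) = (\<Sum>l<r. a l i * b l j * c l k))"

text \<open>Four independent 3 x 3 Gaussian matrices M_0..M_3: entry (r,c) of M_l is M (l,r,c).\<close>
definition pencil_idx :: "(nat \<times> nat \<times> nat) set" where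
  "pencil_idx = {(l,r,c). l < 4 \<and> r < 3 \<and> c < 3}"

definition gauss_pencil :: "(nat \<times> nat \<times> nat \<Rightarrow> real) measure" where
  "gauss_pencil = PiM pencil_idx (\<lambda>_. std_gauss)"

definition pencil_mat :: "(nat \<times> nat \<times> nat \<Rightarrow> real) \<Rightarrow> (nat \<Rightarrow> complex) \<Rightarrow> complex mat" where
  "pencil_mat M z = mat 3 3 (\<lambda>(r,c). \<Sum>l<4. z l * complex_of_real (M (l,r,c)))"

text \<open>Affine cone over the complex cubic surface S in P^3 (points of C^4, coordinates 0..3).\<close>
definition cvec4 :: "(nat \<Rightarrow> complex) set" where
  "cvec4 = {u. \<forall>l\<ge>4. u l = 0}"

definition surface_cone :: "(nat \<times> nat \<times> nat \<Rightarrow> real) \<Rightarrow> (nat \<Rightarrow> complex) set" where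
  "surface_cone M = {z \<in> cvec4. det (pencil_mat M z) = 0}"

text \<open>Complex span of two vectors; a projective line in P^3(C) is a 2-dimensional
  subspace of C^4.\<close>
definition cspan2 :: "(nat \<Rightarrow> complex) \<Rightarrow> (nat \<Rightarrow> complex) \<Rightarrow> (nat \<Rightarrow> complex) set" where
  "cspan2 u v = {(\<lambda>l. a * u l + b * v l) | a b. True}"

definition indep2 :: "(nat \<Rightarrow> complex) \<Rightarrow> (nat \<Rightarrow> complex) \<Rightarrow> bool" where
  "indep2 u v \<longleftrightarrow> (\<forall>a b. (\<lambda>l. a * u l + b * v l) = (\<lambda>_. 0) \<longrightarrow> a = 0 \<and> b = 0)"

definition cline :: "(nat \<Rightarrow> complex) set \<Rightarrow> bool" where
  "cline L \<longleftrightarrow> (\<exists>u v. u \<in> cvec4 \<and> v \<in> cvec4 \<and> indep2 u v \<and> L = cspan2 u v)"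

definition real_line :: "(nat \<Rightarrow> complex) set \<Rightarrow> bool" where
  "real_line L \<longleftrightarrow> (\<exists>u v. u \<in> cvec4 \<and> v \<in> cvec4 \<and> (\<forall>l. Im (u l) = 0 \<and> Im (v l) = 0)
      \<and> indep2 u v \<and> L = cspan2 u v)"

definition lines_on :: "(nat \<times> nat \<times> nat \<Rightarrow> real) \<Rightarrow> (nat \<Rightarrow> complex) set set" where
  "lines_on M = {L. cline L \<and> L \<subseteq> surface_cone M}"

definition all_27_lines_real :: "(nat \<times> nat \<times> nat \<Rightarrow> real) \<Rightarrow> bool" where
  "all_27_lines_real M \<longleftrightarrow> card (lines_on M) = 27 \<and> (\<forall>L \<in> lines_on M. real_line L)"

end

theory Submission
  imports Defs
begin

text \<open>Let \<open>W\<close> be the span of the five slices of \<open>T\<close>, and let \<open>M\<close> be a basis of \<open>W\<^sup>\<bottom>\<close>. A rank-one matrix \<open>x y\<^sup>T\<close> lies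
  in \<open>W\<close> iff \<open>x\<^sup>T M\<^sub>l y = 0\<close> for all \<open>l\<close>; generically there are six of these over the complex numbers, they correspond
  to the six points whose blow-up is \<open>S\<close>, and \<open>T\<close> has rank 5 iff five of them are real. The sixth
  is rational in those five, hence real as well. Each of the six contributes the lines \<open>{z. x\<^sup>T M(z) = 0}\<close> and \<open>{z. M(z) y = 0}\<close>, each
  pair contributes the line \<open>{z. x\<^sup>T M(z) y' = x'\<^sup>T M(z) y = 0}\<close>, and by the classification of singular pencils of
  matrices these \<open>6 + 6 + 15\<close> lines are all the lines on \<open>S\<close>. So for generic \<open>T\<close> rank 5 is equivalent to the reality of
  the lines of the surface attached to \<open>W\<^sup>\<bottom>\<close>. Both events only depend on a subspace, and the spans of Gaussian families
  are rotation invariant; averaging over the rotations obtained from a Gaussian frame by Gram--Schmidt identifies the law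
  of \<open>W\<^sup>\<bottom>\<close> with that of the span of four Gaussian matrices.\<close>

text \<open>No count of six by intersection theory enters. Once five real rank-one matrices are
  given, an algebraic case distinction shows that the list of six is complete, over the complex
  numbers as well. Conversely, if all lines are real, each of them comes from real rank-one
  matrices, and four or fewer of these account for at most 4 + 4 + 16 = 24 lines. Genericity is a
  short list of forbidden configurations, excluded by counting parameters: solutions must be simple,
  share no factor and have no three collinear factors. The two Gaussian laws live on different
  spaces, so random tensors and random pencils are never matched directly. A fixed orthogonal pair
  \<open>T'\<close>, \<open>M\<close> is rotated by a random frame \<open>G\<close> of nine Gaussian
  matrices instead; the probability of either event under \<open>G\<close> does not depend on the
  pair, and Fubini identifies it with the two probabilities. This requires Borel events, which is
  why rank and lines are also described through continuous images of closed sets.\<close>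

no_notation Matrix.vec_index (infixl "$" 100)
no_notation Matrix.scalar_prod (infix "\<bullet>" 70)
hide_const (open) Matrix.orthogonal

section \<open>Bilinear algebra in dimension three\<close>

lemmas cart_eq_iff = Finite_Cartesian_Product.vec_eq_iff

text \<open>Bilinear and without conjugation, so that the same algebra serves real and complex
  vectors; the real \<open>\<bullet>\<close> enters only with the subspaces spanned by
  slices.\<close>

definition dt :: "'a::comm_ring_1 ^ 'n \<Rightarrow> 'a ^ 'n \<Rightarrow> 'a" where
  "dt x y = (\<Sum>i\<in>UNIV. x $ i * y $ i)"

definition crs :: "'a::comm_ring_1 ^ 3 \<Rightarrow> 'a ^ 3 \<Rightarrow> 'a ^ 3" where
  "crs x y = vector [x$2 * y$3 - x$3 * y$2, x$3 * y$1 - x$1 * y$3, x$1 * y$2 - x$2 * y$1]"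

definition det3 :: "'a::comm_ring_1 ^ 3 \<Rightarrow> 'a ^ 3 \<Rightarrow> 'a ^ 3 \<Rightarrow> 'a" where
  "det3 a b c = dt a (crs b c)"

definition ind2 :: "'a::field ^ 'n \<Rightarrow> 'a ^ 'n \<Rightarrow> bool" where
  "ind2 u v \<longleftrightarrow> (\<forall>a b. a *s u + b *s v = 0 \<longrightarrow> a = 0 \<and> b = 0)"

lemma vec3_eq_iff: "x = y \<longleftrightarrow> x$1 = y$1 \<and> x$2 = y$2 \<and> x$3 = (y$3 :: 'a)" for x y :: "'a^3"
  by (simp add: cart_eq_iff forall_3)

lemma crs_nth [simp]:
  "crs x y $ 1 = x$2 * y$3 - x$3 * y$2"
  "crs x y $ 2 = x$3 * y$1 - x$1 * y$3"
  "crs x y $ 3 = x$1 * y$2 - x$2 * y$1"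
  by (simp_all add: crs_def)

lemma dt_3: "dt x y = x$1 * y$1 + x$2 * y$2 + x$3 * y$3" for x y :: "'a::comm_ring_1^3"
  by (simp add: dt_def sum_3)

lemma det3_expand: "det3 a b c = a$1 * (b$2 * c$3 - b$3 * c$2) + a$2 * (b$3 * c$1 - b$1 * c$3)
    + a$3 * (b$1 * c$2 - b$2 * c$1)"
  by (simp add: det3_def dt_3)

lemmas vec3_simps = vec3_eq_iff dt_3 det3_expand

lemma dt_linear [simp]:
  "dt (x + x') y = dt x y + dt x' y" "dt x (y + y') = dt x y + dt x y'"
  "dt (c *s x) y = c * dt x y" "dt x (c *s y) = c * dt x y"
  "dt (x - x') y = dt x y - dt x' y" "dt x (y - y') = dt x y - dt x y'"
  "dt 0 y = 0" "dt x 0 = 0" "dt (- x) y = - dt x y" "dt x (- y) = - dt x y"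
  by (simp_all add: dt_def algebra_simps sum.distrib sum_distrib_left sum_subtractf sum_negf)

lemma dt_commute: "dt x y = dt y x"
  by (simp add: dt_def mult.commute)

lemma dt_axis [simp]: "dt (axis i 1) y = y $ i" "dt y (axis i 1) = y $ i"
  by (simp_all add: dt_def axis_def if_distrib [of "\<lambda>x. x * _"] if_distrib [of "\<lambda>x. _ * x"] cong: if_cong)

lemma dt_eq_0_all: "(\<forall>y. dt x y = 0) \<longleftrightarrow> x = 0"
proof
  assume "\<forall>y. dt x y = 0"
  then have "x $ i = 0" for i using dt_axis(2)[of x i] by metis
  then show "x = 0" by (simp add: cart_eq_iff)
qed simp

text \<open>Cramer's rule with the denominator cleared, hence valid in every commutative
  ring.\<close>

lemma det3_cramer:
  "det3 a b e *s c = det3 c b e *s a + det3 a c e *s b + det3 a b c *s (e :: 'a::comm_ring_1^3)"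
  by (simp add: vec3_simps algebra_simps)

lemma basis3_combination:
  fixes a b e c :: "'a::field^3"
  assumes "det3 a b e \<noteq> 0"
  obtains p q r where "c = p *s a + q *s b + r *s e"
proof
  let ?d = "det3 a b e"
  have "c = (1/?d) *s (?d *s c)" using assms by simp
  also have "\<dots> = (det3 c b e/?d) *s a + (det3 a c e/?d) *s b + (det3 a b c/?d) *s e"
    unfolding det3_cramer[of a b e c] by (simp add: vector_add_ldistrib)
  finally show "c = \<dots>" .
qed

lemma crs_commute: "crs y x = - crs x y" by (simp add: vec3_eq_iff)
lemma crs_scale [simp]: "crs (c *s x) y = c *s crs x y" "crs x (c *s y) = c *s crs x y"
  by (simp_all add: vec3_eq_iff algebra_simps)
lemma crs_add [simp]: "crs (x + x') y = crs x y + crs x' y" "crs x (y + y') = crs x y + crs x y'"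
  by (simp_all add: vec3_eq_iff algebra_simps)
lemma crs_diff [simp]: "crs (x - x') y = crs x y - crs x' y" "crs x (y - y') = crs x y - crs x y'"
  by (simp_all add: vec3_eq_iff algebra_simps)
lemma crs_self [simp]: "crs x x = 0" "crs 0 x = 0" "crs x 0 = 0"
  by (simp_all add: vec3_eq_iff)
lemma crs_eq_0_commute: "crs y x = 0 \<longleftrightarrow> crs x y = 0"
  by (metis crs_commute neg_equal_0_iff_equal)
lemma dt_crs [simp]: "dt x (crs x y) = 0" "dt y (crs x y) = 0" "dt (crs x y) x = 0" "dt (crs x y) y = 0"
  by (simp_all add: dt_3 algebra_simps)
lemma det3_linear [simp]:
  "det3 (a + a') b c = det3 a b c + det3 a' b c" "det3 a (b + b') c = det3 a b c + det3 a b' c"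
  "det3 a b (c + c') = det3 a b c + det3 a b c'"
  "det3 (k *s a) b c = k * det3 a b c" "det3 a (k *s b) c = k * det3 a b c" "det3 a b (k *s c) = k * det3 a b c"
  "det3 a a c = 0" "det3 a b a = 0" "det3 a b b = 0"
  "det3 0 b c = 0" "det3 a 0 c = 0" "det3 a b 0 = 0"
  by (simp_all add: det3_expand algebra_simps)

lemma det3_perm:
  "det3 b a c = - det3 a b c" "det3 a c b = - det3 a b c" "det3 c b a = - det3 a b c"
  "det3 b c a = det3 a b c" "det3 c a b = det3 a b c"
  by (simp_all add: det3_expand algebra_simps)

lemma crs_eq_0_imp_scale:
  fixes x y :: "'a::field^3"
  assumes "x \<noteq> 0" "crs x y = 0"
  obtains c where "y = c *s x"
proof -
  obtain i where i: "x $ i \<noteq> 0" using assms(1) by (auto simp: cart_eq_iff)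
  have "y = (y$i / x$i) *s x"
    using i assms(2) exhaust_3[of i] by (auto simp: vec3_eq_iff field_simps)
  then show ?thesis using that by blast
qed

lemma det3_eq_0_imp:
  fixes a b c :: "'a::field^3"
  assumes "crs a b \<noteq> 0" "det3 a b c = 0"
  obtains p q where "c = p *s a + q *s b"
proof -
  obtain i where i: "crs a b $ i \<noteq> 0" using assms(1) by (auto simp: cart_eq_iff)
  define e where "e = axis i (1::'a)"
  have d: "det3 a b e \<noteq> 0" using i det3_perm(5)[of e a b] by (simp add: e_def det3_def)
  have "det3 a b e *s c = det3 c b e *s a + det3 a c e *s b"
    using det3_cramer[of a b e c] assms(2) by simp
  then have "c = (1/det3 a b e) *s (det3 c b e *s a + det3 a c e *s b)"
    using d by (metis divide_self_if mult.commute times_divide_eq_left vector_smult_assoc vector_smult_lid mult_1)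
  then show ?thesis using that[of "det3 c b e/det3 a b e" "det3 a c e/det3 a b e"]
    by (simp add: vector_add_ldistrib)
qed

lemma perp1:
  fixes n :: "'a::field^3"
  assumes "n \<noteq> 0"
  obtains x1 x2 where "crs x1 x2 \<noteq> 0" "dt x1 n = 0" "dt x2 n = 0"
proof -
  consider "n$1 \<noteq> 0" | "n$2 \<noteq> 0" | "n$3 \<noteq> 0" using assms by (auto simp: vec3_eq_iff)
  then show ?thesis
  proof cases
    case 1 show ?thesis by (rule that[of "vector [-n$2, n$1, 0]" "vector [-n$3, 0, n$1]"])
      (use 1 in \<open>auto simp: vec3_simps\<close>)
  next
    case 2 show ?thesis by (rule that[of "vector [n$2, -n$1, 0]" "vector [0, -n$3, n$2]"])
      (use 2 in \<open>auto simp: vec3_simps\<close>)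
  next
    case 3 show ?thesis by (rule that[of "vector [n$3, 0, -n$1]" "vector [0, n$3, -n$2]"])
      (use 3 in \<open>auto simp: vec3_simps\<close>)
  qed
qed

lemma perp2:
  fixes a b :: "'a::field^3"
  obtains c where "c \<noteq> 0" "dt c a = 0" "dt c b = 0"
proof (cases "crs a b = 0")
  case False then show ?thesis using that[of "crs a b"] by simp
next
  case True
  show ?thesis
  proof (cases "a = 0")
    case False
    obtain k where "b = k *s a" using crs_eq_0_imp_scale[OF False True] by blast
    moreover obtain x1 x2 where "crs x1 x2 \<noteq> 0" "dt x1 a = 0" using perp1[OF False] by blast
    ultimately show ?thesis using that[of x1] by fastforce
  next
    case a: True
    show ?thesis
    proof (cases "b = 0")
      case True then show ?thesis using a that[of "axis 1 1"] by (simp add: axis_eq_0_iff)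
    next
      case False
      obtain x1 x2 where "crs x1 x2 \<noteq> 0" "dt x1 b = 0" using perp1[OF False] by blast
      then show ?thesis using a that[of x1] by fastforce
    qed
  qed
qed

lemma basis3_extend1:
  fixes a :: "'a::field^3"
  assumes "a \<noteq> 0"
  obtains b c where "det3 a b c \<noteq> 0"
proof -
  consider "a$1 \<noteq> 0" | "a$2 \<noteq> 0" | "a$3 \<noteq> 0" using assms by (auto simp: vec3_eq_iff)
  then show ?thesis
  proof cases
    case 1 show ?thesis by (rule that[of "axis 2 1" "axis 3 1"]) (use 1 in \<open>auto simp: det3_expand axis_def\<close>)
  next
    case 2 show ?thesis by (rule that[of "axis 3 1" "axis 1 1"]) (use 2 in \<open>auto simp: det3_expand axis_def\<close>)
  next
    case 3 show ?thesis by (rule that[of "axis 1 1" "axis 2 1"]) (use 3 in \<open>auto simp: det3_expand axis_def\<close>)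
  qed
qed

lemma basis3_extend2:
  fixes a b :: "'a::field^3"
  assumes "crs a b \<noteq> 0"
  obtains c where "det3 a b c \<noteq> 0"
proof -
  obtain i where i: "crs a b $ i \<noteq> 0" using assms(1) by (auto simp: cart_eq_iff)
  have d: "det3 a b (axis i 1) \<noteq> 0" using i det3_perm(5)[of "axis i 1" a b] by (simp add: det3_def)
  then show ?thesis using that by blast
qed

lemma det3_neq_0_crs: 
  assumes "det3 a b c \<noteq> (0::'a::field)" shows "crs a b \<noteq> 0" "crs a c \<noteq> 0" "crs b c \<noteq> 0" "a \<noteq> 0" "b \<noteq> 0" "c \<noteq> 0"
proof -
  have "det3 a b c = dt c (crs a b)" "det3 a b c = - dt b (crs a c)" "det3 a b c = dt a (crs b c)"
    by (simp_all add: vec3_simps algebra_simps)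
  then show "crs a b \<noteq> 0" "crs a c \<noteq> 0" "crs b c \<noteq> 0" "a \<noteq> 0" "b \<noteq> 0" "c \<noteq> 0" using assms by auto
qed

lemma ind2_3: "ind2 a b \<longleftrightarrow> crs a b \<noteq> (0 :: 'a::field^3)"
proof
  assume i: "ind2 a b"
  show "crs a b \<noteq> 0"
  proof
    assume c: "crs a b = 0"
    have "a \<noteq> 0" using i unfolding ind2_def by (metis add.right_neutral one_neq_zero vector_smult_lzero vector_smult_rzero)
    then obtain k where "b = k *s a" using crs_eq_0_imp_scale[OF _ c] by blast
    then have "(-k) *s a + 1 *s b = 0" by (simp add: cart_eq_iff)
    then show False using i unfolding ind2_def by (metis one_neq_zero)
  qed
next
  assume c: "crs a b \<noteq> 0"
  show "ind2 a b" unfolding ind2_def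
  proof (intro allI impI)
    fix p q assume e: "p *s a + q *s b = 0"
    have "p *s crs a b = crs (p *s a + q *s b) b" by simp
    moreover have "q *s crs a b = crs a (p *s a + q *s b)" by simp
    ultimately have "p *s crs a b = 0" "q *s crs a b = 0" using e by (simp_all del: crs_add crs_scale)
    then show "p = 0 \<and> q = 0" using c by (metis vector_mul_eq_0)
  qed
qed

section \<open>Planes in four-space and the forms vanishing on them\<close>

lemma ind2_minor:
  assumes "ind2 (u::'a::field^'n) v"
  obtains i j where "i \<noteq> j" "u$i * v$j - u$j * v$i \<noteq> 0"
proof -
  have "u \<noteq> 0" using assms unfolding ind2_def
    by (metis add.right_neutral one_neq_zero vector_smult_lzero vector_smult_rzero)
  then obtain i where i: "u $ i \<noteq> 0" by (auto simp: cart_eq_iff)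
  have "\<exists>j. u$i * v$j - u$j * v$i \<noteq> 0"
  proof (rule ccontr)
    assume "\<not> ?thesis"
    then have "(- v$i) *s u + u$i *s v = 0" by (simp add: cart_eq_iff algebra_simps)
    then show False using assms i unfolding ind2_def by metis
  qed
  then show ?thesis using that i by (metis diff_self mult.commute)
qed

lemma two_complement_4:
  assumes "i \<noteq> (j::4)"
  obtains k l where "k \<noteq> l" "k \<noteq> i" "k \<noteq> j" "l \<noteq> i" "l \<noteq> j" "UNIV = {i,j,k,l}"
proof -
  have "card (UNIV - {i,j}) = 2" using assms by (simp add: card_Diff_subset)
  then obtain k l where "UNIV - {i,j} = {k,l}" "k \<noteq> l" by (meson card_2_iff)
  then show ?thesis using that[of k l] by blast
qed

lemma dt_UNIV4:
  assumes "UNIV = {i,j,k,l::4}" "distinct [i,j,k,l]"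
  shows "dt x y = x$i*y$i + x$j*y$j + x$k*y$k + x$l*y$l"
  using assms unfolding dt_def assms(1) by (simp add: add_ac)

lemma all_UNIV4:
  assumes "UNIV = {i,j,k,l}"
  shows "(\<forall>s. P s) \<longleftrightarrow> P i \<and> P j \<and> P k \<and> P l"
proof -
  have "(\<forall>s. P s) \<longleftrightarrow> (\<forall>s\<in>UNIV. P s)" by simp
  also have "\<dots> \<longleftrightarrow> P i \<and> P j \<and> P k \<and> P l" unfolding assms by simp
  finally show ?thesis .
qed

text \<open>Forms vanishing on a plane of four-space fill only a two-dimensional space. The relation
  \<open>c\<close> is chosen to kill the coordinates \<open>k\<close>, \<open>l\<close> of the
  combination; the nonzero minor of \<open>u\<close>, \<open>v\<close> at \<open>i\<close>,
  \<open>j\<close> then kills the other two.\<close>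

lemma perp_pair_dependent:
  fixes u v f1 f2 f3 :: "'a::field^4"
  assumes i: "ind2 u v" and p: "\<And>f. f \<in> {f1,f2,f3} \<Longrightarrow> dt f u = 0 \<and> dt f v = 0"
  obtains c :: "'a^3" where "c \<noteq> 0" "c$1 *s f1 + c$2 *s f2 + c$3 *s f3 = 0"
proof -
  obtain i j where ij: "i \<noteq> j" and m: "u$i * v$j - u$j * v$i \<noteq> 0" using ind2_minor[OF i] .
  obtain k l where kl: "k \<noteq> l" "k \<noteq> i" "k \<noteq> j" "l \<noteq> i" "l \<noteq> j" "UNIV = {i,j,k,l}"
    using two_complement_4[OF ij] .
  obtain c :: "'a^3" where c: "c \<noteq> 0" "dt c (vector [f1$k,f2$k,f3$k]) = 0" "dt c (vector [f1$l,f2$l,f3$l]) = 0"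
    using perp2 .
  define g where "g = c$1 *s f1 + c$2 *s f2 + c$3 *s f3"
  have gk: "g$k = 0" "g$l = 0" using c(2,3) by (simp_all add: g_def dt_3)
  have "dt g u = 0" "dt g v = 0" using p by (simp_all add: g_def)
  then have e: "g$i * u$i + g$j * u$j = 0" "g$i * v$i + g$j * v$j = 0"
    using kl ij gk by (simp_all add: dt_UNIV4[of i j k l])
  have "g$i * (u$i * v$j - u$j * v$i) = v$j * (g$i * u$i + g$j * u$j) - u$j * (g$i * v$i + g$j * v$j)"
    "g$j * (u$i * v$j - u$j * v$i) = u$i * (g$i * v$i + g$j * v$j) - v$i * (g$i * u$i + g$j * u$j)"
    by (simp_all add: algebra_simps)
  then have "g$i = 0" "g$j = 0" using m by (simp_all add: e)
  then have "g = 0" using gk by (simp add: cart_eq_iff all_UNIV4[OF kl(6)])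
  with that[OF c(1)] show ?thesis by (simp only: g_def)
qed

definition span2 :: "'a::field^'n \<Rightarrow> 'a^'n \<Rightarrow> ('a^'n) set" where
  "span2 u v = {a *s u + b *s v | a b. True}"

lemma span2I: "a *s u + b *s v \<in> span2 u v"
  unfolding span2_def by blast

lemma span2_base: "u \<in> span2 u v" "v \<in> span2 u v"
  using span2I[of 1 u 0 v] span2I[of 0 u 1 v] by simp_all

lemma span2_eqI:
  fixes u v u' v' :: "'a::field^'n"
  assumes i: "ind2 u v" and s: "u \<in> span2 u' v'" "v \<in> span2 u' v'"
  shows "span2 u v = span2 u' v'"
proof -
  obtain a b c d where u: "u = a *s u' + b *s v'" and v: "v = c *s u' + d *s v'" using s by (auto simp: span2_def)
  define D where "D = a * d - b * c"
  have e1: "d *s u + (-b) *s v = D *s u'" and e2: "(-c) *s u + a *s v = D *s v'"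
    by (simp_all add: u v D_def cart_eq_iff algebra_simps)
  have "D \<noteq> 0"
  proof
    assume "D = 0"
    then have "d = 0 \<and> -b = 0" "-c = 0 \<and> a = 0" using e1 e2 i unfolding ind2_def by (metis vector_smult_lzero)+
    then have "u = 0" using u by simp
    then show False using i unfolding ind2_def by (metis add.right_neutral one_neq_zero vector_smult_lzero vector_smult_rzero)
  qed
  then have u': "u' = (d/D) *s u + (-b/D) *s v" and v': "v' = (-c/D) *s u + (a/D) *s v"
    using arg_cong[OF e1, of "\<lambda>x. (1/D) *s x"] arg_cong[OF e2, of "\<lambda>x. (1/D) *s x"]
    by (simp_all add: vector_add_ldistrib)
  show ?thesis
  proof
    show "span2 u v \<subseteq> span2 u' v'"
    proof
      fix w assume "w \<in> span2 u v"
      then obtain p q where "w = p *s u + q *s v" by (auto simp: span2_def)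
      then have "w = (p*a+q*c) *s u' + (p*b+q*d) *s v'" by (simp add: u v cart_eq_iff algebra_simps)
      then show "w \<in> span2 u' v'" unfolding span2_def by blast
    qed
    show "span2 u' v' \<subseteq> span2 u v"
    proof
      fix w assume "w \<in> span2 u' v'"
      then obtain p q where w: "w = p *s u' + q *s v'" by (auto simp: span2_def)
      have "w = (p*(d/D)+q*(-c/D)) *s u + (p*(-b/D)+q*(a/D)) *s v"
        unfolding w arg_cong[OF u', of "\<lambda>x. p *s x"] arg_cong[OF v', of "\<lambda>x. q *s x"]
        by (simp add: vector_add_ldistrib vector_sadd_rdistrib vector_smult_assoc add_ac)
      then show "w \<in> span2 u v" unfolding span2_def by blast
    qed
  qed
qed

lemma span2_subset_eq:
  "ind2 u v \<Longrightarrow> span2 u v \<subseteq> span2 u' v' \<Longrightarrow> span2 u v = span2 u' v'"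
  using span2_eqI span2_base by blast

lemma ind2_kernel:
  fixes f g :: "'a::field^4"
  assumes i: "ind2 f g"
  obtains u v where "ind2 u v" "{z. dt f z = 0 \<and> dt g z = 0} = span2 u v"
proof -
  obtain i j where ij: "i \<noteq> j" and m: "f$i * g$j - f$j * g$i \<noteq> 0" using ind2_minor[OF i] .
  obtain k l where kl: "k \<noteq> l" "k \<noteq> i" "k \<noteq> j" "l \<noteq> i" "l \<noteq> j" "UNIV = {i,j,k,l}"
    using two_complement_4[OF ij] .
  define D where "D = f$i * g$j - f$j * g$i"
  have D: "D \<noteq> 0" using m by (simp add: D_def)
  \<comment> \<open>Cramer's rule for the unknowns \<open>i\<close>, \<open>j\<close>, with the free
    coordinate \<open>t\<close> set to 1 and the other free coordinate to 0.\<close>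
  define w where "w = (\<lambda>t::4. (\<chi> s. if s = t then 1 else if s = i then (f$j * g$t - f$t * g$j)/D
      else if s = j then (f$t * g$i - f$i * g$t)/D else 0))"
  have wk: "w k $ k = 1" "w k $ l = 0" "w k $ i = (f$j * g$k - f$k * g$j)/D" "w k $ j = (f$k * g$i - f$i * g$k)/D"
    "w l $ k = 0" "w l $ l = 1" "w l $ i = (f$j * g$l - f$l * g$j)/D" "w l $ j = (f$l * g$i - f$i * g$l)/D"
    using kl ij by (simp_all add: w_def)
  note all = all_UNIV4[OF kl(6)]
  have dtw: "dt x y = x$i*y$i + x$j*y$j + x$k*y$k + x$l*y$l" for x y :: "'a^4"
    using kl ij by (intro dt_UNIV4) auto
  show ?thesis
  proof (rule that[of "w k" "w l"])
    show "ind2 (w k) (w l)" unfolding ind2_def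
    proof (intro allI impI)
      fix a b assume "a *s w k + b *s w l = 0"
      then have "(a *s w k + b *s w l) $ k = 0" "(a *s w k + b *s w l) $ l = 0" by simp_all
      then show "a = 0 \<and> b = 0" by (simp add: wk)
    qed
    show "{z. dt f z = 0 \<and> dt g z = 0} = span2 (w k) (w l)"
    proof (intro equalityI subsetI)
      fix z assume "z \<in> {z. dt f z = 0 \<and> dt g z = 0}"
      then have e: "f$i*z$i + f$j*z$j + f$k*z$k + f$l*z$l = 0" "g$i*z$i + g$j*z$j + g$k*z$k + g$l*z$l = 0"
        by (simp_all add: dtw)
      have e': "f$i*z$i + f$j*z$j = - (f$k*z$k + f$l*z$l)" "g$i*z$i + g$j*z$j = - (g$k*z$k + g$l*z$l)"
        using e by (simp_all only: eq_neg_iff_add_eq_0 add.assoc)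
      have "D * z$i = g$j * (f$i*z$i + f$j*z$j) - f$j * (g$i*z$i + g$j*z$j)" by (simp add: D_def algebra_simps)
      then have zi: "D * z$i = z$k * (f$j*g$k - f$k*g$j) + z$l * (f$j*g$l - f$l*g$j)"
        unfolding e' by (simp add: algebra_simps)
      have "D * z$j = f$i * (g$i*z$i + g$j*z$j) - g$i * (f$i*z$i + f$j*z$j)" by (simp add: D_def algebra_simps)
      then have zj: "D * z$j = z$k * (f$k*g$i - f$i*g$k) + z$l * (f$l*g$i - f$i*g$l)"
        unfolding e' by (simp add: algebra_simps)
      have "z$i = (D * z$i)/D" "z$j = (D*z$j)/D" using D by simp_all
      then have "z = z$k *s w k + z$l *s w l"
        unfolding cart_eq_iff all by (simp add: wk zi zj add_divide_distrib)
      then show "z \<in> span2 (w k) (w l)" unfolding span2_def by blast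
    next
      fix z assume "z \<in> span2 (w k) (w l)"
      then obtain a b where z: "z = a *s w k + b *s w l" by (auto simp: span2_def)
      have "D * dt f (w k) = 0" "D * dt g (w k) = 0" "D * dt f (w l) = 0" "D * dt g (w l) = 0"
        using D by (simp_all add: dtw wk distrib_left) (simp_all add: D_def algebra_simps)
      then have "dt f (w k) = 0" "dt g (w k) = 0" "dt f (w l) = 0" "dt g (w l) = 0" using D by simp_all
      then show "z \<in> {z. dt f z = 0 \<and> dt g z = 0}" by (simp add: z)
    qed
  qed
qed

section \<open>Singular pencils of matrices\<close>

lemma mat_vec_simps [simp]:
  fixes A :: "'a::field^'n^'m"
  shows "A *v (x + y) = A *v x + A *v y" "A *v (c *s x) = c *s (A *v x)" "A *v (x - y) = A *v x - A *v y"
    "A *v 0 = 0"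
  by (simp_all add: matrix_vector_mult_def cart_eq_iff algebra_simps sum.distrib sum_distrib_left sum_subtractf)

definition sing :: "'a::field^3^3 \<Rightarrow> bool" where
  "sing N \<longleftrightarrow> (\<exists>y. y \<noteq> 0 \<and> N *v y = 0)"

lemma det3_crs: "dt (crs a b) c = det3 a b c"
  by (simp add: vec3_simps algebra_simps)

lemma kernel3: "(\<exists>y. y \<noteq> 0 \<and> dt a y = 0 \<and> dt b y = 0 \<and> dt c y = 0) \<longleftrightarrow> det3 a b c = (0::'a::field)"
proof
  assume "\<exists>y. y \<noteq> 0 \<and> dt a y = 0 \<and> dt b y = 0 \<and> dt c y = 0"
  then obtain y where y: "y \<noteq> 0" "dt a y = 0" "dt b y = 0" "dt c y = 0" by blast
  have "det3 a b c *s y = dt a y *s crs b c + dt b y *s crs c a + dt c y *s crs a b"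
    by (simp add: vec3_simps algebra_simps)
  then have "det3 a b c *s y = 0" using y by simp
  then show "det3 a b c = 0" using y(1) by (simp add: vector_mul_eq_0)
next
  assume d: "det3 a b c = 0"
  show "\<exists>y. y \<noteq> 0 \<and> dt a y = 0 \<and> dt b y = 0 \<and> dt c y = 0"
  proof (cases "crs a b = 0")
    case False
    then obtain p q where "c = p *s a + q *s b" using det3_eq_0_imp d by blast
    then show ?thesis using False by (intro exI[of _ "crs a b"]) simp
  next
    case True
    show ?thesis
    proof (cases "a = 0")
      case True
      obtain y where "y \<noteq> 0" "dt y b = 0" "dt y c = 0" using perp2 .
      then show ?thesis using True by (auto simp: dt_commute)
    next
      case False
      then obtain k where k: "b = k *s a" using crs_eq_0_imp_scale True by blast
      obtain y where "y \<noteq> 0" "dt y a = 0" "dt y c = 0" using perp2 .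
      then show ?thesis unfolding k by (auto simp: dt_commute)
    qed
  qed
qed

lemma matrix_vector_3: "N *v y = y$1 *s (\<chi> i. N$i$1) + y$2 *s (\<chi> i. N$i$2) + y$3 *s (\<chi> i. N$i$3)"
  for N :: "'a::field^3^'n"
  by (simp add: matrix_vector_mult_def cart_eq_iff sum_3 mult.commute)

lemma sing_iff_left_kernel: "sing N \<longleftrightarrow> (\<exists>x. x \<noteq> 0 \<and> (\<forall>y. dt x (N *v y) = 0))"
proof -
  have "sing N \<longleftrightarrow> det3 (N$1) (N$2) (N$3) = 0"
    unfolding sing_def kernel3[symmetric]
    by (simp add: matrix_vector_mult_def dt_def cart_eq_iff[of _ 0] forall_3)
  also have "det3 (N$1) (N$2) (N$3) = det3 (\<chi> i. N$i$1) (\<chi> i. N$i$2) (\<chi> i. N$i$3)"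
    by (simp add: det3_expand algebra_simps)
  also have "\<dots> = 0 \<longleftrightarrow> (\<exists>x. x \<noteq> 0 \<and> dt x (\<chi> i. N$i$1) = 0 \<and> dt x (\<chi> i. N$i$2) = 0 \<and> dt x (\<chi> i. N$i$3) = 0)"
    unfolding kernel3[symmetric] by (simp add: dt_commute)
  also have "\<dots> \<longleftrightarrow> (\<exists>x. x \<noteq> 0 \<and> (\<forall>y. dt x (N *v y) = 0))"
  proof -
    have "dt x (\<chi> i. N$i$1) = 0 \<and> dt x (\<chi> i. N$i$2) = 0 \<and> dt x (\<chi> i. N$i$3) = 0 \<longleftrightarrow> (\<forall>y. dt x (N *v y) = 0)" for x
    proof
      assume "\<forall>y. dt x (N *v y) = 0"
      then have "dt x (N *v axis k 1) = 0" for k by blast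
      moreover have "N *v axis k 1 = (\<chi> i. N$i$k)" for k
        by (simp add: matrix_vector_mult_def axis_def if_distrib cong: if_cong)
      ultimately show "dt x (\<chi> i. N$i$1) = 0 \<and> dt x (\<chi> i. N$i$2) = 0 \<and> dt x (\<chi> i. N$i$3) = 0" by simp
    qed (simp add: matrix_vector_3)
    then show ?thesis by simp
  qed
  finally show ?thesis .
qed

text \<open>The types of a singular pencil of 3x3 matrices: for k = 3, 1, 2 in this order, every
  member sends one k-dimensional space into one fixed space of dimension k - 1.\<close>

definition compression_space :: "'a::field^3^3 \<Rightarrow> 'a^3^3 \<Rightarrow> bool" where
  "compression_space A B \<longleftrightarrow>
    (\<exists>x. x \<noteq> 0 \<and> (\<forall>y. dt x (A *v y) = 0 \<and> dt x (B *v y) = 0)) \<or>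
    (\<exists>y. y \<noteq> 0 \<and> A *v y = 0 \<and> B *v y = 0) \<or>
    (\<exists>x1 x2 y1 y2. crs x1 x2 \<noteq> 0 \<and> crs y1 y2 \<noteq> 0 \<and>
      (\<forall>x\<in>{x1,x2}. \<forall>y\<in>{y1,y2}. dt x (A *v y) = 0 \<and> dt x (B *v y) = 0))"

lemma compression_space_swap: "compression_space A B \<Longrightarrow> compression_space B A"
  unfolding compression_space_def by meson

lemma compression_space_add: "compression_space (A + B) B \<Longrightarrow> compression_space A B"
proof -
  have 1: "dt x ((A + B) *v y) = 0 \<and> dt x (B *v y) = 0 \<longleftrightarrow> dt x (A *v y) = 0 \<and> dt x (B *v y) = 0" for x y
    by (auto simp: matrix_vector_mult_add_rdistrib)
  have 2: "(A + B) *v y = 0 \<and> B *v y = 0 \<longleftrightarrow> A *v y = 0 \<and> B *v y = 0" for y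
    by (auto simp: matrix_vector_mult_add_rdistrib)
  show "compression_space (A + B) B \<Longrightarrow> compression_space A B"
    unfolding compression_space_def 1 2 .
qed

lemma singular_pencil_det3:
  assumes "\<And>a b. sing (\<chi> i j. a * A$i$j + b * B$i$j)"
  shows "det3 (a *s (A *v p) + b *s (B *v p)) (a *s (A *v q) + b *s (B *v q)) (a *s (A *v r) + b *s (B *v r)) = 0"
proof -
  let ?N = "\<chi> i j. a * A$i$j + b * B$i$j"
  have N: "?N *v y = a *s (A *v y) + b *s (B *v y)" for y
    by (simp add: matrix_vector_mult_def cart_eq_iff algebra_simps sum.distrib sum_distrib_left)
  obtain x where "x \<noteq> 0" "\<And>y. dt x (?N *v y) = 0" using assms sing_iff_left_kernel by blast
  then show ?thesis unfolding kernel3[symmetric] N[symmetric] by (auto simp: dt_commute)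
qed

text \<open>A Kronecker chain is started: \<open>A *v u = 0\<close>, then
  \<open>A *v v = B *v u\<close>. Where it stops decides the case. \<open>B *v u = 0\<close> gives a
  common kernel vector; \<open>B *v v\<close> parallel to \<open>B *v u\<close> gives a plane mapped
  into a line; otherwise all images of \<open>A\<close> and \<open>B\<close> lie in the span of
  \<open>B *v u\<close> and \<open>B *v v\<close>, and their cross product is a common left kernel
  vector.\<close>

lemma singular_pencil_rank2:
  fixes A B :: "'a::field_char_0^3^3"
  assumes S: "\<And>a b. sing (\<chi> i j. a * A$i$j + b * B$i$j)" and r: "crs (A *v e) (A *v f) \<noteq> 0"
  shows "compression_space A B"
proof -
  note D = singular_pencil_det3[OF S]
  have "sing A" using S[of 1 0] by simp
  then obtain u where u: "u \<noteq> 0" "A *v u = 0" by (auto simp: sing_def)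
  \<comment> \<open>For the member \<open>A + t B\<close> the image of \<open>u\<close> is
    \<open>t *s (B *v u)\<close>, so \<open>P t\<close> vanishes for \<open>t \<noteq> 0\<close>. It
    is quadratic in \<open>t\<close>, and its value at 0 is interpolated from 1, -1 and 2.\<close>
  define P where "P = (\<lambda>t. det3 (B *v u) (A *v e + t *s (B *v e)) (A *v f + t *s (B *v f)))"
  have P0: "P t = 0" if "t \<noteq> 0" for t
    using D[of 1 u t e f] that u by (simp add: P_def del: det3_linear(1,2,3))
  have "3 * det3 (B *v u) (A *v e) (A *v f) = 3 * P 1 + P (-1) - P 2"
    by (simp add: P_def algebra_simps)
  then have "det3 (B *v u) (A *v e) (A *v f) = 0" by (simp add: P0)
  then have "det3 (A *v e) (A *v f) (B *v u) = 0" by (simp only: det3_perm(4)[of "A *v e" "A *v f" "B *v u"])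
  then obtain l m where "B *v u = l *s (A *v e) + m *s (A *v f)" using det3_eq_0_imp[OF r] by metis
  then have v': "B *v u = A *v (l *s e + m *s f)" by simp
  obtain v where v: "B *v u = A *v v" using v' ..
  show ?thesis
  proof (cases "B *v u = 0")
    case True then show ?thesis using u unfolding compression_space_def by blast
  next
    case False
    show ?thesis
    proof (cases "crs (B *v u) (B *v v) = 0")
      case True
      then obtain c where c: "B *v v = c *s (B *v u)" using crs_eq_0_imp_scale False by blast
      obtain x1 x2 where x: "crs x1 x2 \<noteq> 0" "dt x1 (B *v u) = 0" "dt x2 (B *v u) = 0" using perp1[OF False] .
      have "crs u v \<noteq> 0"
      proof
        assume "crs u v = 0"
        then obtain k where "v = k *s u" using crs_eq_0_imp_scale u(1) by blast
        then show False using v u False by simp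
      qed
      moreover have "\<forall>x\<in>{x1,x2}. \<forall>y\<in>{u,v}. dt x (A *v y) = 0 \<and> dt x (B *v y) = 0"
        using x c u v by auto
      ultimately show ?thesis using x(1) unfolding compression_space_def by blast
    next
      case nz: False
      \<comment> \<open>Two factors \<open>t\<close> come out because \<open>A *v u = 0\<close> and
        \<open>A *v v = B *v u\<close>; what remains is linear in \<open>t\<close>, so the values at
        1 and 2 determine it.\<close>
      define P where "P = (\<lambda>t y. det3 (B *v u) (B *v v) (A *v y + t *s (B *v y)))"
      have P0: "P t y = 0" if "t \<noteq> 0" for t y
      proof -
        have "t * t * P t y = 0"
          using D[of 1 u t v y] u v by (simp add: P_def algebra_simps)
        then show ?thesis using that by simp
      qed
      have "det3 (B *v u) (B *v v) (B *v y) = P 2 y - P 1 y" "det3 (B *v u) (B *v v) (A *v y) = 2 * P 1 y - P 2 y" for y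
        by (simp_all add: P_def algebra_simps)
      then have "det3 (B *v u) (B *v v) (B *v y) = 0" "det3 (B *v u) (B *v v) (A *v y) = 0" for y
        by (simp_all add: P0)
      then have "\<forall>y. dt (crs (B *v u) (B *v v)) (A *v y) = 0 \<and> dt (crs (B *v u) (B *v v)) (B *v y) = 0"
        by (simp add: det3_crs)
      then show ?thesis using nz unfolding compression_space_def by blast
    qed
  qed
qed

text \<open>If one of \<open>A\<close>, \<open>B\<close>, \<open>A + B\<close> has rank two, the
  chain argument applies to a pencil with the same span. If all three have rank at most one, then
  either all images lie on one line or a kernel vector of \<open>B\<close> is killed by
  \<open>A\<close> too.\<close>

lemma singular_pencil_cases:
  fixes A B :: "'a::field_char_0^3^3"
  assumes S: "\<And>a b. sing (\<chi> i j. a * A$i$j + b * B$i$j)"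
  shows "compression_space A B"
proof -
  have S1: "sing (\<chi> i j. a * B$i$j + b * A$i$j)" for a b using S[of b a] by (simp add: add.commute)
  have S2: "sing (\<chi> i j. a * (A+B)$i$j + b * B$i$j)" for a b using S[of a "a+b"] by (simp add: algebra_simps)
  consider (A) e f where "crs (A *v e) (A *v f) \<noteq> 0" | (B) e f where "crs (B *v e) (B *v f) \<noteq> 0"
    | (C) e f where "crs ((A+B) *v e) ((A+B) *v f) \<noteq> 0"
    | (D) "\<And>e f. crs (A *v e) (A *v f) = 0" "\<And>e f. crs (B *v e) (B *v f) = 0"
       "\<And>e f. crs ((A+B) *v e) ((A+B) *v f) = 0" by blast
  then show ?thesis
  proof cases
    case A then show ?thesis using singular_pencil_rank2[OF S] by blast
  next
    case B then show ?thesis using singular_pencil_rank2[OF S1] compression_space_swap by blast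
  next
    case C then show ?thesis using singular_pencil_rank2[OF S2] compression_space_add by blast
  next
    case D
    have sB: "sing B" using S[of 0 1] by simp
    then obtain y where y: "y \<noteq> 0" "B *v y = 0" by (auto simp: sing_def)
    show ?thesis
    proof (cases "\<forall>e. A *v e = 0")
      case True then show ?thesis using y unfolding compression_space_def by blast
    next
      case False
      then obtain e where e: "A *v e \<noteq> 0" by blast
      define p where "p = A *v e"
      have Ap: "\<exists>c. A *v g = c *s p" for g using crs_eq_0_imp_scale[OF e D(1)] unfolding p_def by blast
      show ?thesis
      proof (cases "\<forall>f. crs p (B *v f) = 0")
        case True
        then have Bp: "\<exists>c. B *v g = c *s p" for g using crs_eq_0_imp_scale[OF e] unfolding p_def by blast
        obtain x1 x2 where x: "crs x1 x2 \<noteq> 0" "dt x1 p = 0" using perp1 e p_def by metis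
        have "dt x1 (A *v g) = 0 \<and> dt x1 (B *v g) = 0" for g
          using Ap[of g] Bp[of g] x(2) by auto
        moreover have "x1 \<noteq> 0" using x(1) by auto
        ultimately show ?thesis unfolding compression_space_def by blast
      next
        case False
        then obtain f where f: "crs p (B *v f) \<noteq> 0" by blast
        obtain a where a: "A *v f = a *s p" using Ap by blast
        obtain a' where a': "A *v y = a' *s p" using Ap by blast
        have "crs ((A+B) *v y) ((A+B) *v f) = 0" by (rule D)
        then have "a' *s crs p (B *v f) = 0"
          by (simp add: matrix_vector_mult_add_rdistrib a a' y)
        then have "A *v y = 0" using f a' by (simp add: vector_mul_eq_0)
        then show ?thesis using y unfolding compression_space_def by blast
      qed
    qed
  qed
qed

text \<open>Coefficients of the linear form z -> x^T M(z) y, where M(z) is \<open>pmat M z\<close>.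
  The equation \<open>fl M x y = 0\<close> says that x y^T is orthogonal to every slice.\<close>

definition fl :: "'a::field^3^3^'l \<Rightarrow> 'a^3 \<Rightarrow> 'a^3 \<Rightarrow> 'a^'l" where
  "fl M x y = (\<chi> l. dt x (M$l *v y))"

definition pmat :: "'a::field^3^3^'l \<Rightarrow> 'a^'l \<Rightarrow> 'a^3^3" where
  "pmat M z = (\<chi> i j. \<Sum>l\<in>UNIV. z$l * M$l$i$j)"

definition trM :: "'a^3^3^'l \<Rightarrow> 'a^3^3^'l" where
  "trM M = (\<chi> l i j. M$l$j$i)"

lemma fl_linear [simp]:
  "fl M (x + x') y = fl M x y + fl M x' y" "fl M x (y + y') = fl M x y + fl M x y'"
  "fl M (x - x') y = fl M x y - fl M x' y" "fl M x (y - y') = fl M x y - fl M x y'"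
  "fl M (c *s x) y = c *s fl M x y" "fl M x (c *s y) = c *s fl M x y"
  "fl M 0 y = 0" "fl M x 0 = 0"
  by (simp_all add: fl_def cart_eq_iff)

lemma fl_trM [simp]: "fl (trM M) x y = fl M y x"
  by (simp add: fl_def trM_def dt_def matrix_vector_mult_def cart_eq_iff sum_3 algebra_simps)

lemma trM_trM [simp]: "trM (trM M) = M"
  by (simp add: trM_def cart_eq_iff)

lemma dt_fl: "dt (fl M x y) z = dt x (pmat M z *v y)"
  unfolding fl_def pmat_def dt_def matrix_vector_mult_def
  by (simp add: sum_3 sum_distrib_left sum_distrib_right sum.distrib algebra_simps)

lemma pmat_linear: "pmat M (a *s u + b *s v) = (\<chi> i j. a * pmat M u$i$j + b * pmat M v$i$j)"
  by (simp add: pmat_def cart_eq_iff algebra_simps sum.distrib sum_distrib_left)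

lemma pmat_mult_eq_0: "pmat M z *v y = 0 \<longleftrightarrow> (\<forall>x. dt (fl M x y) z = 0)"
  unfolding dt_fl by (metis dt_commute dt_eq_0_all)

lemma sing_pmat: "sing (pmat M z) \<longleftrightarrow> (\<exists>y. y \<noteq> 0 \<and> (\<forall>x. dt (fl M x y) z = 0))"
  "sing (pmat M z) \<longleftrightarrow> (\<exists>x. x \<noteq> 0 \<and> (\<forall>y. dt (fl M x y) z = 0))"
  unfolding sing_def pmat_mult_eq_0[symmetric] by (simp, simp add: dt_fl sing_iff_left_kernel[symmetric] sing_def)

lemma sing_pmat_trM: "sing (pmat (trM M) z) \<longleftrightarrow> sing (pmat M z)"
  unfolding sing_pmat(1)[of "trM M"] sing_pmat(2)[of M] by simp

lemma line_cases:
  fixes M :: "'a::field_char_0^3^3^'l"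
  assumes "\<And>z. z \<in> span2 u v \<Longrightarrow> sing (pmat M z)"
  obtains (left) x where "x \<noteq> 0" "\<And>y. dt (fl M x y) u = 0 \<and> dt (fl M x y) v = 0"
  | (right) y where "y \<noteq> 0" "\<And>x. dt (fl M x y) u = 0 \<and> dt (fl M x y) v = 0"
  | (plane) x1 x2 y1 y2 where "crs x1 x2 \<noteq> 0" "crs y1 y2 \<noteq> 0"
     "\<And>x y. x \<in> {x1,x2} \<Longrightarrow> y \<in> {y1,y2} \<Longrightarrow> dt (fl M x y) u = 0 \<and> dt (fl M x y) v = 0"
proof -
  have "sing (\<chi> i j. a * pmat M u$i$j + b * pmat M v$i$j)" for a b
    unfolding pmat_linear[symmetric] by (rule assms) (rule span2I)
  then have "compression_space (pmat M u) (pmat M v)" by (rule singular_pencil_cases)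
  then show ?thesis
    unfolding compression_space_def pmat_mult_eq_0 dt_fl[symmetric]
    apply (elim disjE exE conjE)
    subgoal for x using left by blast
    subgoal for y using right by blast
    subgoal for x1 x2 y1 y2 by (rule plane[of x1 x2 y1 y2]) auto
    done
qed

lemma fl_basis_expand: "fl M x y = y$1 *s fl M x (axis 1 1) + y$2 *s fl M x (axis 2 1) + y$3 *s fl M x (axis 3 1)"
proof -
  have "y = y$1 *s axis 1 1 + y$2 *s axis 2 1 + y$3 *s axis 3 1"
    by (simp add: vec3_eq_iff axis_def)
  then show ?thesis by (metis fl_linear(2,6))
qed

text \<open>The forms obtained from \<open>x\<close> and the three coordinate vectors vanish on a
  plane of four-space, so they are dependent; the coefficients of a relation are the coordinates of
  \<open>y\<close>. Thus a line of matrices with a common left kernel vector produces a rank-one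
  matrix orthogonal to the pencil.\<close>

lemma left_kernel_solution:
  fixes M :: "'a::field^3^3^4"
  assumes "ind2 u v" and "\<And>y. dt (fl M x y) u = 0 \<and> dt (fl M x y) v = 0"
  obtains y where "y \<noteq> 0" "fl M x y = 0"
proof -
  obtain c :: "'a^3" where "c \<noteq> 0" "c$1 *s fl M x (axis 1 1) + c$2 *s fl M x (axis 2 1) + c$3 *s fl M x (axis 3 1) = 0"
    using perp_pair_dependent[OF assms(1), of "fl M x (axis 1 1)" "fl M x (axis 2 1)" "fl M x (axis 3 1)"] assms(2) by blast
  then show ?thesis using that[of c] by (simp add: fl_basis_expand[of M x c])
qed

text \<open>The four functionals attached to \<open>{x, x'} \<times> {y, y'}\<close> vanish on a plane, hence span a space of
  dimension at most two; \<open>fl M x y' \<noteq> 0\<close> and \<open>fl M x' y \<noteq> 0\<close> independent then express the fourth one.\<close>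
lemma second_solution:
  fixes M :: "'a::field^3^3^4"
  assumes uv: "ind2 u v" and s: "fl M x y = 0" and i: "ind2 (fl M x y') (fl M x' y)"
    and k: "\<And>p q. p \<in> {x,x'} \<Longrightarrow> q \<in> {y,y'} \<Longrightarrow> dt (fl M p q) u = 0 \<and> dt (fl M p q) v = 0"
  obtains a b where "fl M (x' + a *s x) (y' + b *s y) = 0"
proof -
  obtain c :: "'a^3" where c: "c \<noteq> 0" "c$1 *s fl M x y' + c$2 *s fl M x' y + c$3 *s fl M x' y' = 0"
    using perp_pair_dependent[OF uv, of "fl M x y'" "fl M x' y" "fl M x' y'"] k by blast
  have "c$3 \<noteq> 0"
  proof
    assume "c$3 = 0"
    with c have "c$1 *s fl M x y' + c$2 *s fl M x' y = 0" by simp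
    then have "c$1 = 0" "c$2 = 0" using i unfolding ind2_def by blast+
    with c(1) \<open>c$3 = 0\<close> show False by (simp add: vec3_eq_iff)
  qed
  have "fl M (x' + (c$1/c$3) *s x) (y' + (c$2/c$3) *s y) = (1/c$3) *s (c$1 *s fl M x y' + c$2 *s fl M x' y + c$3 *s fl M x' y')"
    using \<open>c$3 \<noteq> 0\<close> by (simp add: s vector_add_ldistrib add_ac)
  then have "fl M (x' + (c$1/c$3) *s x) (y' + (c$2/c$3) *s y) = 0" by (simp only: c(2) vector_smult_rzero)
  then show ?thesis by (rule that)
qed

section \<open>Lines on a determinantal cubic surface\<close>

definition cv :: "real^'n \<Rightarrow> complex^'n" where "cv x = (\<chi> i. of_real (x$i))"
definition Rev :: "complex^'n \<Rightarrow> real^'n" where "Rev x = (\<chi> i. Re (x$i))"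
definition Imv :: "complex^'n \<Rightarrow> real^'n" where "Imv x = (\<chi> i. Im (x$i))"
definition cM :: "real^3^3^'l \<Rightarrow> complex^3^3^'l" where "cM M = (\<chi> l i j. of_real (M$l$i$j))"

lemma cv_nth [simp]: "cv x $ i = of_real (x$i)" "Rev z $ i = Re (z$i)" "Imv z $ i = Im (z$i)"
  by (simp_all add: cv_def Rev_def Imv_def)

lemma complex_vec_split: "z = cv (Rev z) + \<i> *s cv (Imv z)"
  by (simp add: cart_eq_iff complex_eq_iff)

lemma cv_linear [simp]: "cv (x + y) = cv x + cv y" "cv (c *s x) = of_real c *s cv x" "cv 0 = 0"
  by (simp_all add: cart_eq_iff)

lemma cv_eq_0 [simp]: "cv x = 0 \<longleftrightarrow> x = 0"
  by (simp add: cart_eq_iff)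

lemma Rev_Imv_add [simp]: "Rev (x + y) = Rev x + Rev y" "Imv (x + y) = Imv x + Imv y"
  by (simp_all add: cart_eq_iff)

lemma Rev_Imv_cv [simp]:
  "Rev (c *s cv x) = Re c *s x" "Imv (c *s cv x) = Im c *s x" "Rev (cv x) = x" "Imv (cv x) = 0"
  "Rev 0 = 0" "Imv 0 = 0"
  by (simp_all add: cart_eq_iff)

lemma complex_vec_eq_0: "z = 0 \<longleftrightarrow> Rev z = 0 \<and> Imv z = 0"
  by (auto simp add: cart_eq_iff complex_eq_iff)

lemma cv_add_i_eq_0: "cv a + \<i> *s cv b = 0 \<longleftrightarrow> a = 0 \<and> b = 0"
  by (simp add: cart_eq_iff complex_eq_iff all_conj_distrib)

lemma dt_cv: "dt (cv x) (cv y) = of_real (dt x y)" by (simp add: dt_def)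
lemma crs_cv: "crs (cv x) (cv y) = cv (crs x y)" by (simp add: vec3_eq_iff)
lemma det3_cv: "det3 (cv x) (cv y) (cv z) = of_real (det3 x y z)" by (simp add: det3_expand)
lemma fl_cM: "fl (cM M) (cv x) (cv y) = cv (fl M x y)"
  by (simp add: fl_def cart_eq_iff dt_def matrix_vector_mult_def cM_def)
lemma trM_cM: "trM (cM M) = cM (trM M)" by (simp add: trM_def cM_def)

lemma fl_cM_real_left: "fl (cM M) (cv x) q = cv (fl M x (Rev q)) + \<i> *s cv (fl M x (Imv q))"
  by (subst complex_vec_split[of q]) (simp add: fl_cM)

lemma fl_cM_real_right: "fl (cM M) p (cv y) = cv (fl M (Rev p) y) + \<i> *s cv (fl M (Imv p) y)"
  by (subst complex_vec_split[of p]) (simp add: fl_cM)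

lemma ind2_cv: "ind2 u v \<Longrightarrow> ind2 (cv u) (cv v)"
  unfolding ind2_def
proof (intro allI impI)
  fix a b assume i: "\<forall>a b. a *s u + b *s v = 0 \<longrightarrow> a = 0 \<and> b = 0" and e: "a *s cv u + b *s cv v = 0"
  have "Re a *s u + Re b *s v = Rev (a *s cv u + b *s cv v)" "Im a *s u + Im b *s v = Imv (a *s cv u + b *s cv v)"
    by simp_all
  then show "a = 0 \<and> b = 0" using i unfolding e by (simp add: complex_eq_iff)
qed

lemma ind2_nonzero: "ind2 u v \<Longrightarrow> u \<noteq> 0" "ind2 u v \<Longrightarrow> v \<noteq> 0"
  unfolding ind2_def by (metis add.right_neutral one_neq_zero vector_smult_lzero vector_smult_rzero,
   metis add.left_neutral one_neq_zero vector_smult_lzero vector_smult_rzero)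

lemma span2_in_kernel:
  "dt f u = 0 \<Longrightarrow> dt f v = 0 \<Longrightarrow> z \<in> span2 u v \<Longrightarrow> dt f z = 0"
  by (auto simp: span2_def)

lemma real_ind2_kernel:
  fixes f g :: "real^4"
  assumes "ind2 f g"
  obtains u v where "ind2 u v" "{z. dt (cv f) z = 0 \<and> dt (cv g) z = 0} = span2 (cv u) (cv v)"
proof -
  obtain u v where uv: "ind2 u v" "{z. dt f z = 0 \<and> dt g z = 0} = span2 u v" using ind2_kernel[OF assms] .
  obtain u' v' where uv': "{z. dt (cv f) z = 0 \<and> dt (cv g) z = 0} = span2 u' v'"
    using ind2_kernel[OF ind2_cv[OF assms]] .
  have "dt f u = 0 \<and> dt g u = 0" "dt f v = 0 \<and> dt g v = 0" using uv(2) span2_base by blast+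
  then have "cv u \<in> span2 u' v'" "cv v \<in> span2 u' v'" unfolding uv'[symmetric] by (simp_all add: dt_cv)
  then have "span2 (cv u) (cv v) = span2 u' v'" using span2_eqI ind2_cv uv(1) by blast
  then show ?thesis using that uv(1) uv' by simp
qed

text \<open>Lets dependent forms be treated like independent ones: enlarging their span only shrinks
  the common kernel, which still contains a plane.\<close>

lemma ind2_enlarge:
  fixes f g :: "'a::field^4"
  obtains f' g' where "ind2 f' g'" "f \<in> span2 f' g'" "g \<in> span2 f' g'"
proof (cases "ind2 f g")
  case True then show ?thesis using that span2_base by blast
next
  case False
  have "\<exists>h a b. f = a *s h \<and> g = b *s h"
  proof (cases "f = 0")
    case True
    then have "f = 0 *s g \<and> g = 1 *s g" by simp
    then show ?thesis by blast
  next
    case f: False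
    obtain a b where ab: "a *s f + b *s g = 0" "\<not> (a = 0 \<and> b = 0)" using False unfolding ind2_def by blast
    then have "b \<noteq> 0" using f by (auto simp: vector_mul_eq_0)
    have "b *s g = (-a) *s f" using ab(1) by (simp add: cart_eq_iff add_eq_0_iff)
    then have "(1/b) *s (b *s g) = (1/b) *s ((-a) *s f)" by simp
    then have "g = (-a/b) *s f" using \<open>b \<noteq> 0\<close> by (simp add: vector_smult_assoc)
    then have "f = 1 *s f \<and> g = (-a/b) *s f" by simp
    then show ?thesis by blast
  qed
  then obtain h a b where h: "f = a *s h" "g = b *s h" by blast
  have "\<exists>h'. h' \<noteq> 0 \<and> f \<in> range (\<lambda>a. a *s h') \<and> g \<in> range (\<lambda>a. a *s h')"
  proof (cases "h = 0")
    case True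
    then have "f = 0 *s axis 1 1" "g = 0 *s axis 1 1" using h by simp_all
    then show ?thesis by (intro exI[of _ "axis 1 1"]) (auto simp: axis_eq_0_iff)
  next
    case False then show ?thesis using h by blast
  qed
  then obtain h' a' b' where h': "h' \<noteq> 0" "f = a' *s h'" "g = b' *s h'" by blast
  obtain i where i: "h' $ i \<noteq> 0" using h'(1) by (auto simp: cart_eq_iff)
  define j :: 4 where "j = i + 1"
  have j: "j \<noteq> i" by (simp add: j_def)
  have "ind2 h' (axis j 1)" unfolding ind2_def
  proof (intro allI impI)
    fix p q :: 'a assume e: "p *s h' + q *s axis j 1 = 0"
    then have "(p *s h' + q *s axis j 1) $ i = 0" "(p *s h' + q *s axis j 1) $ j = 0" by simp_all
    then show "p = 0 \<and> q = 0" using i j by (auto simp: axis_def)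
  qed
  moreover have "f \<in> span2 h' (axis j 1)" "g \<in> span2 h' (axis j 1)"
    using span2I[of a' h' 0 "axis j 1"] span2I[of b' h' 0 "axis j 1"] h' by simp_all
  ultimately show ?thesis using that by blast
qed

lemma kernel_contains_line:
  fixes f g :: "'a::field^4"
  obtains u v where "ind2 u v" "\<And>z. z \<in> span2 u v \<Longrightarrow> dt f z = 0 \<and> dt g z = 0"
proof -
  obtain f' g' where fg: "ind2 f' g'" "f \<in> span2 f' g'" "g \<in> span2 f' g'" using ind2_enlarge .
  obtain u v where uv: "ind2 u v" "{z. dt f' z = 0 \<and> dt g' z = 0} = span2 u v" using ind2_kernel[OF fg(1)] .
  have "dt f z = 0 \<and> dt g z = 0" if "z \<in> span2 u v" for z
    using that fg(2,3) unfolding uv(2)[symmetric] by (auto simp: span2_def)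
  then show ?thesis using that uv(1) by blast
qed

lemma singular2:
  fixes a b c d :: "'a::field"
  assumes "a * d - b * c = 0"
  obtains p q where "\<not> (p = 0 \<and> q = 0)" "a * p + b * q = 0" "c * p + d * q = 0"
proof (cases "a = 0 \<and> b = 0")
  case True
  show ?thesis
  proof (cases "c = 0 \<and> d = 0")
    case t: True show ?thesis by (rule that[of 1 0]) (use True t in auto)
  next
    case False show ?thesis by (rule that[of d "-c"]) (use True False in auto)
  qed
next
  case False show ?thesis by (rule that[of b "-a"]) (use False assms in \<open>auto simp: algebra_simps\<close>)
qed

lemma complex_quadratic_root:
  fixes A B C :: complex
  obtains p q where "\<not> (p = 0 \<and> q = 0)" "A * p\<^sup>2 + B * p * q + C * q\<^sup>2 = 0"
proof (cases "A = 0")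
  case True show ?thesis by (rule that[of 1 0]) (use True in auto)
next
  case False
  define s where "s = csqrt (B\<^sup>2 - 4 * A * C)"
  have s: "s * s = B\<^sup>2 - 4 * A * C" by (metis s_def power2_csqrt power2_eq_square)
  have "4 * A * (A * ((- B + s) / (2 * A))\<^sup>2 + B * ((- B + s) / (2 * A)) + C) = s * s - (B\<^sup>2 - 4 * A * C)"
    using False by (simp add: field_simps power2_eq_square)
  then have "A * ((- B + s) / (2 * A))\<^sup>2 + B * ((- B + s) / (2 * A)) + C = 0" using s False by simp
  then show ?thesis using that[of "(- B + s) / (2 * A)" 1] by simp
qed

text \<open>All four forms lie in the two-dimensional annihilator of the plane, so the sum is a
  bilinear map of C^2 x C^2 into C^2. For fixed p it is a 2x2 matrix acting on q, whose determinant
  is a quadratic form in p and therefore has a complex zero.\<close>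

lemma bilinear_zero:
  fixes f11 f12 f21 f22 u v :: "complex^4"
  assumes uv: "ind2 u v" and k: "\<And>f. f \<in> {f11,f12,f21,f22} \<Longrightarrow> dt f u = 0 \<and> dt f v = 0"
  obtains p1 p2 q1 q2 where "\<not> (p1 = 0 \<and> p2 = 0)" "\<not> (q1 = 0 \<and> q2 = 0)"
    "(p1*q1) *s f11 + (p1*q2) *s f12 + (p2*q1) *s f21 + (p2*q2) *s f22 = 0"
proof -
  obtain g h where gh: "{f. dt u f = 0 \<and> dt v f = 0} = span2 g h" using ind2_kernel[OF uv] .
  have m: "f \<in> span2 g h" if "f \<in> {f11,f12,f21,f22}" for f
    using k[OF that] unfolding gh[symmetric] by (simp add: dt_commute)
  obtain a11 b11 a12 b12 a21 b21 a22 b22 where f: "f11 = a11 *s g + b11 *s h" "f12 = a12 *s g + b12 *s h"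
    "f21 = a21 *s g + b21 *s h" "f22 = a22 *s g + b22 *s h"
    using m[of f11] m[of f12] m[of f21] m[of f22] by (auto simp: span2_def)
  obtain p1 p2 where p: "\<not> (p1 = 0 \<and> p2 = 0)" "(a11*b12 - a12*b11) * p1\<^sup>2 + (a11*b22 + a21*b12 - a12*b21 - a22*b11) * p1 * p2
     + (a21*b22 - a22*b21) * p2\<^sup>2 = 0" using complex_quadratic_root .
  have "(p1*a11+p2*a21) * (p1*b12+p2*b22) - (p1*a12+p2*a22) * (p1*b11+p2*b21) = 0"
    using p(2) by (simp add: algebra_simps power2_eq_square)
  then obtain q1 q2 where q: "\<not> (q1 = 0 \<and> q2 = 0)" "(p1*a11+p2*a21)*q1 + (p1*a12+p2*a22)*q2 = 0"
    "(p1*b11+p2*b21)*q1 + (p1*b12+p2*b22)*q2 = 0" by (rule singular2)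
  have "(p1*q1) *s f11 + (p1*q2) *s f12 + (p2*q1) *s f21 + (p2*q2) *s f22
     = ((p1*a11+p2*a21)*q1 + (p1*a12+p2*a22)*q2) *s g + ((p1*b11+p2*b21)*q1 + (p1*b12+p2*b22)*q2) *s h"
    by (simp add: f cart_eq_iff algebra_simps)
  then have "(p1*q1) *s f11 + (p1*q2) *s f12 + (p2*q1) *s f21 + (p2*q2) *s f22 = 0" unfolding q by simp
  then show ?thesis using that p(1) q(1) by blast
qed

definition surf :: "real^3^3^4 \<Rightarrow> (complex^4) set" where
  "surf M = {z. sing (pmat (cM M) z)}"

definition lines :: "real^3^3^4 \<Rightarrow> (complex^4) set set" where
  "lines M = {span2 u v | u v. ind2 u v \<and> span2 u v \<subseteq> surf M}"

definition real_span :: "(complex^4) set \<Rightarrow> bool" where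
  "real_span L \<longleftrightarrow> (\<exists>u v. ind2 u v \<and> L = span2 (cv u) (cv v))"

definition left_set :: "real^3^3^4 \<Rightarrow> complex^3 \<Rightarrow> (complex^4) set" where
  "left_set M x = {z. \<forall>y. dt (fl (cM M) x y) z = 0}"

definition cross_set :: "real^3^3^4 \<Rightarrow> real^3 \<Rightarrow> real^3 \<Rightarrow> real^3 \<Rightarrow> real^3 \<Rightarrow> (complex^4) set" where
  "cross_set M x y x' y' = {z. dt (cv (fl M x y')) z = 0 \<and> dt (cv (fl M x' y)) z = 0}"

lemma surf_trM: "surf (trM M) = surf M"
  unfolding surf_def trM_cM[symmetric] sing_pmat_trM ..

lemma left_set_surf: "x \<noteq> 0 \<Longrightarrow> left_set M x \<subseteq> surf M"
  unfolding left_set_def surf_def sing_pmat(2) by blast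

lemma left_setI:
  assumes "\<And>y. dt (fl M x y) u = 0"
  shows "cv u \<in> left_set M (cv x)"
  unfolding left_set_def fl_cM_real_left by (simp add: dt_cv assms)

lemma span2_left_set:
  "u \<in> left_set M x \<Longrightarrow> v \<in> left_set M x \<Longrightarrow> span2 u v \<subseteq> left_set M x"
  unfolding left_set_def by (auto simp: span2_def)

lemma span2_cross_set:
  "u \<in> cross_set M x y x' y' \<Longrightarrow> v \<in> cross_set M x y x' y' \<Longrightarrow> span2 u v \<subseteq> cross_set M x y x' y'"
  unfolding cross_set_def by (auto simp: span2_def)

section \<open>Generic pencils, and the lines they carry if all of these are real\<close>

definition sols :: "real^3^3^4 \<Rightarrow> ((real^3) \<times> (real^3)) set" where
  "sols M = {(x,y). x \<noteq> 0 \<and> y \<noteq> 0 \<and> fl M x y = 0}"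

text \<open>With W the orthogonal complement of the slices: by \<open>g1\<close> and
  \<open>g1'\<close> no two different solutions (rank-one matrices in W, up to scaling) share a
  factor; by \<open>g2\<close> and \<open>g2'\<close> no three left or right factors are collinear
  as points of the projective plane; by \<open>g3\<close> W meets the tangent space of the rank-one
  matrices at a solution only in the multiples of that solution. Scalars are absorbed in the
  vectors, hence the plain sums in \<open>g2\<close> and \<open>g2'\<close>.\<close>

locale gpencil =
  fixes M :: "real^3^3^4"
  assumes indep: "pmat M z = 0 \<Longrightarrow> z = 0"
    and g1: "x \<noteq> 0 \<Longrightarrow> fl M x y = 0 \<Longrightarrow> fl M x y' = 0 \<Longrightarrow> crs y y' = 0"
    and g1': "y \<noteq> 0 \<Longrightarrow> fl M x y = 0 \<Longrightarrow> fl M x' y = 0 \<Longrightarrow> crs x x' = 0"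
    and g2: "y1 \<noteq> 0 \<Longrightarrow> y2 \<noteq> 0 \<Longrightarrow> y3 \<noteq> 0 \<Longrightarrow> fl M x1 y1 = 0 \<Longrightarrow> fl M x2 y2 = 0
        \<Longrightarrow> fl M (x1 + x2) y3 = 0 \<Longrightarrow> crs x1 x2 = 0"
    and g2': "x1 \<noteq> 0 \<Longrightarrow> x2 \<noteq> 0 \<Longrightarrow> x3 \<noteq> 0 \<Longrightarrow> fl M x1 y1 = 0 \<Longrightarrow> fl M x2 y2 = 0
        \<Longrightarrow> fl M x3 (y1 + y2) = 0 \<Longrightarrow> crs y1 y2 = 0"
    and g3: "x \<noteq> 0 \<Longrightarrow> y \<noteq> 0 \<Longrightarrow> fl M x y = 0 \<Longrightarrow> fl M x v + fl M u y = 0 \<Longrightarrow> crs u x = 0"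
begin

text \<open>Once \<open>u\<close> is a multiple of \<open>x\<close>, its term vanishes and
  \<open>g1\<close> applies to \<open>v\<close>.\<close>

lemma g3': 
  assumes "x \<noteq> 0" "y \<noteq> 0" "fl M x y = 0" "fl M x v + fl M u y = 0" shows "crs v y = 0"
proof -
  have "crs x u = 0" using g3[OF assms] crs_eq_0_commute by blast
  then obtain c where c: "u = c *s x" using crs_eq_0_imp_scale assms(1) by blast
  have "fl M x v = 0" using assms(3,4) c by simp
  then show ?thesis using g1 assms by blast
qed

lemma pmat_trM: "pmat (trM M) z = 0 \<longleftrightarrow> pmat M z = 0" for z
  by (auto simp: pmat_def trM_def cart_eq_iff)

lemma gpencil_trM: "gpencil (trM M)"
proof (unfold_locales, unfold pmat_trM fl_trM)
  show "z = 0" if "pmat M z = 0" for z by (rule indep) fact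
  show "crs y y' = 0" if "x \<noteq> 0" "fl M y x = 0" "fl M y' x = 0" for x y y'
    by (rule g1'[OF that])
  show "crs x x' = 0" if "y \<noteq> 0" "fl M y x = 0" "fl M y x' = 0" for y x x'
    by (rule g1[OF that])
  show "crs x1 x2 = 0" if "y1 \<noteq> 0" "y2 \<noteq> 0" "y3 \<noteq> 0" "fl M y1 x1 = 0" "fl M y2 x2 = 0" "fl M y3 (x1 + x2) = 0"
    for x1 x2 y1 y2 y3 by (rule g2'[OF that])
  show "crs y1 y2 = 0" if "x1 \<noteq> 0" "x2 \<noteq> 0" "x3 \<noteq> 0" "fl M y1 x1 = 0" "fl M y2 x2 = 0" "fl M (y1 + y2) x3 = 0"
    for x1 x2 x3 y1 y2 by (rule g2[OF that])
  show "crs u x = 0" if "x \<noteq> 0" "y \<noteq> 0" "fl M y x = 0" "fl M v x + fl M y u = 0" for x y u v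
    by (rule g3'[of y x u v]) (use that in \<open>simp_all add: add.commute\<close>)
qed

lemma sol_ind2:
  assumes s: "x \<noteq> 0" "y \<noteq> 0" "fl M x y = 0" and i: "crs x x' \<noteq> 0" "crs y y' \<noteq> 0"
  shows "ind2 (fl M x y') (fl M x' y)"
  unfolding ind2_def
proof (intro allI impI)
  fix a b assume e: "a *s fl M x y' + b *s fl M x' y = 0"
  then have e': "fl M x (a *s y') + fl M (b *s x') y = 0" by simp
  from g3[OF s e'] have "b *s crs x' x = 0" by simp
  moreover have "crs x' x \<noteq> 0" using i crs_eq_0_commute by blast
  ultimately have "b = 0" by (simp add: vector_mul_eq_0)
  moreover from g3'[OF s e'] have "a *s crs y' y = 0" by simp
  moreover have "crs y' y \<noteq> 0" using i crs_eq_0_commute by blast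
  ultimately show "a = 0 \<and> b = 0" by (simp add: vector_mul_eq_0)
qed

text \<open>By \<open>g1\<close> only the multiples of \<open>y\<close> are annihilated together
  with \<open>x\<close>, so the conditions on \<open>z\<close> coming from the three right
  coordinates have rank exactly two.\<close>

lemma left_line:
  assumes s: "x \<noteq> 0" "y \<noteq> 0" "fl M x y = 0"
  obtains u v where "ind2 u v" "left_set M (cv x) = span2 (cv u) (cv v)"
proof -
  obtain y2 y3 where d: "det3 y y2 y3 \<noteq> 0" using basis3_extend1 s(2) by blast
  have "ind2 (fl M x y2) (fl M x y3)" unfolding ind2_def
  proof (intro allI impI)
    fix a b assume "a *s fl M x y2 + b *s fl M x y3 = 0"
    then have "fl M x (a *s y2 + b *s y3) = 0" by simp
    then have c: "crs y (a *s y2 + b *s y3) = 0" using g1 s by blast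
    have "a * det3 y y2 y3 = dt y3 (crs y (a *s y2 + b *s y3))" "b * det3 y y2 y3 = - dt y2 (crs y (a *s y2 + b *s y3))"
      by (simp_all add: vec3_simps algebra_simps)
    then show "a = 0 \<and> b = 0" unfolding c using d by simp
  qed
  then obtain u v where uv: "ind2 u v" "{z. dt (cv (fl M x y2)) z = 0 \<and> dt (cv (fl M x y3)) z = 0} = span2 (cv u) (cv v)"
    using real_ind2_kernel by blast
  have "left_set M (cv x) = {z. dt (cv (fl M x y2)) z = 0 \<and> dt (cv (fl M x y3)) z = 0}"
  proof (intro equalityI subsetI)
    fix z assume z: "z \<in> {z. dt (cv (fl M x y2)) z = 0 \<and> dt (cv (fl M x y3)) z = 0}"
    have "dt (fl (cM M) (cv x) q) z = 0" for q
    proof -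
      have "det3 (cv y) (cv y2) (cv y3) \<noteq> 0" using d by (simp add: det3_cv)
      then obtain a b c where "q = a *s cv y + b *s cv y2 + c *s cv y3" using basis3_combination by metis
      then show ?thesis using z s(3) by (simp add: fl_cM)
    qed
    then show "z \<in> left_set M (cv x)" by (simp add: left_set_def)
  qed (auto simp: left_set_def fl_cM[symmetric])
  then show ?thesis using that uv by simp
qed

lemma cross_line:
  assumes s: "x \<noteq> 0" "y \<noteq> 0" "fl M x y = 0" and i: "crs x x' \<noteq> 0" "crs y y' \<noteq> 0"
  obtains u v where "ind2 u v" "cross_set M x y x' y' = span2 (cv u) (cv v)"
  using real_ind2_kernel[OF sol_ind2[OF s i]] unfolding cross_set_def .

lemma line_in_left_set:
  assumes "ind2 u v" "x \<noteq> 0" "\<And>y. dt (fl M x y) u = 0 \<and> dt (fl M x y) v = 0"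
  obtains y where "y \<noteq> 0" "fl M x y = 0" "span2 (cv u) (cv v) = left_set M (cv x)"
proof -
  obtain y where y: "y \<noteq> 0" "fl M x y = 0" using left_kernel_solution assms(1,3) by blast
  obtain u' v' where uv: "left_set M (cv x) = span2 (cv u') (cv v')" using left_line[OF assms(2) y] .
  have "span2 (cv u) (cv v) \<subseteq> left_set M (cv x)"
    by (intro span2_left_set left_setI) (use assms(3) in auto)
  then show ?thesis using that y span2_subset_eq[OF ind2_cv[OF assms(1)]] uv by metis
qed

lemma real_sing:
  assumes "cv z \<in> surf M" shows "sing (pmat M z)"
proof -
  obtain q where q: "q \<noteq> 0" "\<And>x. dt (fl (cM M) x q) (cv z) = 0" using assms unfolding surf_def sing_pmat(1) by blast
  have "dt (fl M x (Rev q)) z = 0 \<and> dt (fl M x (Imv q)) z = 0" for x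
    using q(2)[of "cv x"] unfolding fl_cM_real_left by (simp add: dt_cv complex_eq_iff)
  moreover have "Rev q \<noteq> 0 \<or> Imv q \<noteq> 0" using q(1) complex_vec_eq_0 by blast
  ultimately show ?thesis unfolding sing_pmat(1) by blast
qed

text \<open>On the two planes there is always a complex solution \<open>P\<close>, \<open>Q\<close>.
  If \<open>P\<close> is a multiple of a real vector, the real or the imaginary part of
  \<open>Q\<close> completes it. Otherwise \<open>P\<close> yields a line on the surface, which is
  real by assumption; along a real basis of it \<open>Rev P\<close>, \<open>Imv P\<close> and their
  sum are left kernel vectors, so each of them has a right factor. These are three collinear left
  factors, against \<open>g2\<close>.\<close>

lemma real_solution_in_plane:
  assumes all_real: "\<And>L. L \<in> lines M \<Longrightarrow> real_span L"
    and uv: "ind2 u v" and x: "crs x1 x2 \<noteq> 0" and y: "crs y1 y2 \<noteq> 0"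
    and k: "\<And>x y. x \<in> {x1,x2} \<Longrightarrow> y \<in> {y1,y2} \<Longrightarrow> dt (fl M x y) u = 0 \<and> dt (fl M x y) v = 0"
  obtains x y where "x \<noteq> 0" "y \<noteq> 0" "fl M x y = 0" "x \<in> span2 x1 x2" "y \<in> span2 y1 y2"
proof -
  have k': "dt f (cv u) = 0 \<and> dt f (cv v) = 0"
    if "f \<in> {cv (fl M x1 y1), cv (fl M x1 y2), cv (fl M x2 y1), cv (fl M x2 y2)}" for f
    using that k[of x1 y1] k[of x1 y2] k[of x2 y1] k[of x2 y2] by (auto simp: dt_cv)
  obtain p1 p2 q1 q2 where p: "\<not> (p1 = 0 \<and> p2 = 0)" and q: "\<not> (q1 = 0 \<and> q2 = 0)" and e:
    "(p1*q1) *s cv (fl M x1 y1) + (p1*q2) *s cv (fl M x1 y2) + (p2*q1) *s cv (fl M x2 y1) + (p2*q2) *s cv (fl M x2 y2) = 0"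
    using bilinear_zero[OF ind2_cv[OF uv] k'] .
  define P Q where "P = p1 *s cv x1 + p2 *s cv x2" and "Q = q1 *s cv y1 + q2 *s cv y2"
  have PQ: "fl (cM M) P Q = 0"
    using e by (simp add: P_def Q_def fl_cM vector_smult_assoc algebra_simps)
  have "P \<noteq> 0" using p ind2_cv[OF x[folded ind2_3]] unfolding ind2_def P_def by blast
  have "Q \<noteq> 0" using q ind2_cv[OF y[folded ind2_3]] unfolding ind2_def Q_def by blast
  have Ps: "Rev P \<in> span2 x1 x2" "Imv P \<in> span2 x1 x2" unfolding P_def by (simp_all add: span2I)
  have Qs: "Rev Q \<in> span2 y1 y2" "Imv Q \<in> span2 y1 y2" unfolding Q_def by (simp_all add: span2I)
  show ?thesis
  proof (cases "crs (Rev P) (Imv P) = 0")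
    case True
    obtain x c where xc: "x \<noteq> 0" "x \<in> span2 x1 x2" "P = c *s cv x"
    proof (cases "Rev P = 0")
      case True
      then have "P = \<i> *s cv (Imv P)" using complex_vec_split[of P] by simp
      then show ?thesis using that[of "Imv P" \<i>] Ps \<open>P \<noteq> 0\<close> True complex_vec_eq_0 by blast
    next
      case False
      then obtain k where k: "Imv P = k *s Rev P" using crs_eq_0_imp_scale True by blast
      have "P = (1 + \<i> * of_real k) *s cv (Rev P)"
        by (subst complex_vec_split[of P]) (simp add: k cart_eq_iff algebra_simps)
      then show ?thesis using that[of "Rev P"] Ps False by blast
    qed
    have "c \<noteq> 0" using xc(3) \<open>P \<noteq> 0\<close> by auto
    then have "fl (cM M) (cv x) Q = 0" using PQ xc(3) by (simp add: vector_mul_eq_0)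
    then have z: "fl M x (Rev Q) = 0" "fl M x (Imv Q) = 0" unfolding fl_cM_real_left cv_add_i_eq_0 by auto
    have "Rev Q \<noteq> 0 \<or> Imv Q \<noteq> 0" using \<open>Q \<noteq> 0\<close> complex_vec_eq_0 by blast
    then show ?thesis using that xc z Qs by blast
  next
    case False
    \<comment> \<open>As \<open>Q\<close> already solves the equation, two further directions cut
      out the points with left kernel vector \<open>P\<close>. The two forms may be dependent; any
      plane in their common kernel will do.\<close>
    obtain Q2 Q3 where d: "det3 Q Q2 Q3 \<noteq> 0" using basis3_extend1 \<open>Q \<noteq> 0\<close> by blast
    obtain a b where ab: "ind2 a b" "\<And>z. z \<in> span2 a b \<Longrightarrow> dt (fl (cM M) P Q2) z = 0 \<and> dt (fl (cM M) P Q3) z = 0"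
      using kernel_contains_line[of "fl (cM M) P Q2" "fl (cM M) P Q3"] by blast
    have sub: "span2 a b \<subseteq> left_set M P" unfolding left_set_def
    proof clarify
      fix z q assume z: "z \<in> span2 a b"
      obtain r s t where "q = r *s Q + s *s Q2 + t *s Q3" using basis3_combination[OF d] by metis
      then show "dt (fl (cM M) P q) z = 0" using ab(2)[OF z] PQ by simp
    qed
    then have "span2 a b \<in> lines M" using left_set_surf[OF \<open>P \<noteq> 0\<close>] ab(1) unfolding lines_def by blast
    then obtain u' v' where uv': "ind2 u' v'" "span2 a b = span2 (cv u') (cv v')" using all_real real_span_def by metis
    have in': "cv u' \<in> left_set M P" "cv v' \<in> left_set M P" using sub span2_base uv'(2) by blast+
    have kill: "dt (fl M (Rev P) y) w = 0 \<and> dt (fl M (Imv P) y) w = 0" if "cv w \<in> left_set M P" for w y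
    proof -
      have "dt (fl (cM M) P (cv y)) (cv w) = 0" using that by (simp add: left_set_def)
      then show ?thesis unfolding fl_cM_real_right by (simp add: dt_cv complex_eq_iff)
    qed
    obtain r1 where r1: "r1 \<noteq> 0" "fl M (Rev P) r1 = 0"
      by (rule left_kernel_solution[OF uv'(1), of M "Rev P"]) (use kill in' in auto)
    obtain r2 where r2: "r2 \<noteq> 0" "fl M (Imv P) r2 = 0"
      by (rule left_kernel_solution[OF uv'(1), of M "Imv P"]) (use kill in' in auto)
    obtain r3 where r3: "r3 \<noteq> 0" "fl M (Rev P + Imv P) r3 = 0"
      by (rule left_kernel_solution[OF uv'(1), of M "Rev P + Imv P"]) (use kill in' in auto)
    have "crs (Rev P) (Imv P) = 0" using g2[OF r1(1) r2(1) r3(1) r1(2) r2(2) r3(2)] .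
    with False show ?thesis ..
  qed
qed

text \<open>The classification of singular pencils is applied over the reals. A common kernel vector
  acquires its companion factor by \<open>left_kernel_solution\<close>. A compressed pair of planes
  contains one real solution because all lines are real, and then a second one, and these two cut
  out the line.\<close>

lemma real_line_cases:
  assumes all_real: "\<And>L. L \<in> lines M \<Longrightarrow> real_span L" and L: "L \<in> lines M"
  obtains (left) x y where "(x,y) \<in> sols M" "L = left_set M (cv x)"
  | (right) x y where "(x,y) \<in> sols M" "L = left_set (trM M) (cv y)"
  | (cross) x y x' y' where "(x,y) \<in> sols M" "(x',y') \<in> sols M" "L = cross_set M x y x' y'"
proof -
  interpret tr: gpencil "trM M" by (rule gpencil_trM)
  obtain u v where uv: "ind2 u v" "L = span2 (cv u) (cv v)" using all_real[OF L] real_span_def by blast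
  have Ls: "L \<subseteq> surf M" using L by (auto simp: lines_def)
  have S: "sing (pmat M z)" if zs: "z \<in> span2 u v" for z
  proof (rule real_sing)
    obtain a b where "z = a *s u + b *s v" using zs by (auto simp: span2_def)
    then have "cv z \<in> L" unfolding uv(2) by (simp add: span2I)
    then show "cv z \<in> surf M" using Ls by blast
  qed
  consider (left) x where "x \<noteq> 0" "\<And>y. dt (fl M x y) u = 0 \<and> dt (fl M x y) v = 0"
  | (right) y where "y \<noteq> 0" "\<And>x. dt (fl M x y) u = 0 \<and> dt (fl M x y) v = 0"
  | (plane) x1 x2 y1 y2 where "crs x1 x2 \<noteq> 0" "crs y1 y2 \<noteq> 0"
     "\<And>x y. x \<in> {x1,x2} \<Longrightarrow> y \<in> {y1,y2} \<Longrightarrow> dt (fl M x y) u = 0 \<and> dt (fl M x y) v = 0"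
    by (rule line_cases[OF S]) blast+
  then show ?thesis
  proof cases
    case (left x)
    obtain y where "y \<noteq> 0" "fl M x y = 0" "L = left_set M (cv x)"
      using line_in_left_set[OF uv(1) left] uv(2) by metis
    then show ?thesis using that(1)[of x y] left(1) by (simp add: sols_def)
  next
    case (right y)
    obtain x where "x \<noteq> 0" "fl (trM M) y x = 0" "L = left_set (trM M) (cv y)"
      using tr.line_in_left_set[OF uv(1) right(1)] right(2) uv(2) by (metis fl_trM)
    then show ?thesis using that(2)[of x y] right(1) by (simp add: sols_def)
  next
    case (plane x1 x2 y1 y2)
    obtain x y where xy: "x \<noteq> 0" "y \<noteq> 0" "fl M x y = 0" and xs: "x \<in> span2 x1 x2" and ys: "y \<in> span2 y1 y2"
      using real_solution_in_plane[OF all_real uv(1) plane] .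
    obtain a1 a2 where xa: "x = a1 *s x1 + a2 *s x2" using xs by (auto simp: span2_def)
    obtain b1 b2 where yb: "y = b1 *s y1 + b2 *s y2" using ys by (auto simp: span2_def)
    \<comment> \<open>The solution \<open>x\<close> and one of the two spanning vectors form a basis
      of the plane again, as \<open>second_solution\<close> expects.\<close>
    obtain x' where x': "x' \<in> {x1,x2}" "crs x x' \<noteq> 0"
    proof (cases "crs x x1 = 0 \<and> crs x x2 = 0")
      case True
      have "crs x x1 = a2 *s crs x2 x1" "crs x x2 = a1 *s crs x1 x2" by (simp_all add: xa)
      moreover have "crs x2 x1 \<noteq> 0" using plane(1) crs_eq_0_commute by blast
      ultimately have "a1 = 0" "a2 = 0" using True plane(1) by (auto simp: vector_mul_eq_0)
      then show ?thesis using xy(1) xa by simp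
    qed (use that in blast)
    obtain y' where y': "y' \<in> {y1,y2}" "crs y y' \<noteq> 0"
    proof (cases "crs y y1 = 0 \<and> crs y y2 = 0")
      case True
      have "crs y y1 = b2 *s crs y2 y1" "crs y y2 = b1 *s crs y1 y2" by (simp_all add: yb)
      moreover have "crs y2 y1 \<noteq> 0" using plane(2) crs_eq_0_commute by blast
      ultimately have "b1 = 0" "b2 = 0" using True plane(2) by (auto simp: vector_mul_eq_0)
      then show ?thesis using xy(2) yb by simp
    qed (use that in blast)
    have K: "dt (fl M p q) u = 0 \<and> dt (fl M p q) v = 0" if "p \<in> span2 x1 x2" "q \<in> span2 y1 y2" for p q
      using that plane(3) by (auto simp: span2_def)
    have K': "dt (fl M p q) u = 0 \<and> dt (fl M p q) v = 0" if "p \<in> {x,x'}" "q \<in> {y,y'}" for p q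
      by (rule K) (use that xs ys x'(1) y'(1) span2_base in auto)
    obtain a b where ab: "fl M (x' + a *s x) (y' + b *s y) = 0"
      using second_solution[OF uv(1) xy(3) sol_ind2[OF xy x'(2) y'(2)] K'] by blast
    define x'' y'' where "x'' = x' + a *s x" and "y'' = y' + b *s y"
    have c: "crs x x'' \<noteq> 0" "crs y y'' \<noteq> 0" using x'(2) y'(2) by (simp_all add: x''_def y''_def)
    then have nz: "x'' \<noteq> 0" "y'' \<noteq> 0" by auto
    have "dt (fl M x y'') u = 0 \<and> dt (fl M x y'') v = 0" "dt (fl M x'' y) u = 0 \<and> dt (fl M x'' y) v = 0"
      using K' by (simp_all add: x''_def y''_def)
    then have sub: "L \<subseteq> cross_set M x y x'' y''"
      unfolding uv(2) by (intro span2_cross_set) (simp_all add: cross_set_def dt_cv)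
    obtain u' v' where "cross_set M x y x'' y'' = span2 (cv u') (cv v')" using cross_line[OF xy c] .
    then have "L = cross_set M x y x'' y''" using sub span2_subset_eq[OF ind2_cv[OF uv(1)]] uv(2) by metis
    then show ?thesis using that(3)[of x y x'' y''] xy nz ab[folded x''_def y''_def] by (simp add: sols_def)
  qed
qed

lemma left_set_scale: "c \<noteq> 0 \<Longrightarrow> left_set K (cv (c *s x)) = left_set K (cv x)" for K
  by (simp add: left_set_def)

lemma cross_set_scale: "c \<noteq> 0 \<Longrightarrow> c' \<noteq> 0 \<Longrightarrow> d \<noteq> 0 \<Longrightarrow> d' \<noteq> 0 \<Longrightarrow>
    cross_set M (c *s x) (d *s y) (c' *s x') (d' *s y') = cross_set M x y x' y'"
  by (simp add: cross_set_def)

text \<open>A maximal set \<open>R\<close> of solutions with pairwise independent left factors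
  represents all solutions up to scaling, hence all lines. With at most four elements it would give
  too few of them, even if pairs are counted with order and diagonal.\<close>

lemma five_solutions:
  assumes all_real: "\<And>L. L \<in> lines M \<Longrightarrow> real_span L" and card: "card (lines M) = 27"
  obtains R where "R \<subseteq> sols M" "finite R" "card R = 5" "\<And>s t. s \<in> R \<Longrightarrow> t \<in> R \<Longrightarrow> s \<noteq> t \<Longrightarrow> crs (fst s) (fst t) \<noteq> 0"
proof (rule ccontr)
  note goal = that
  assume neg: "\<not> thesis"
  define P where "P R \<longleftrightarrow> finite R \<and> R \<subseteq> sols M \<and> (\<forall>s\<in>R. \<forall>t\<in>R. s \<noteq> t \<longrightarrow> crs (fst s) (fst t) \<noteq> 0)" for R
  have bd: "card R < 5" if "P R" for R
  proof (rule ccontr)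
    assume "\<not> card R < 5"
    then obtain R' where "R' \<subseteq> R" "card R' = 5" "finite R'" using obtain_subset_with_card_n[of 5 R] by auto
    then show False using goal[of R'] neg that unfolding P_def by blast
  qed
  have "P {}" by (simp add: P_def)
  then obtain R where R: "P R" "\<And>R'. P R' \<Longrightarrow> card R' \<le> card R"
    using ex_has_greatest_nat[of P "{}" card 5] bd by (metis less_imp_le)
  have rep: "\<exists>r\<in>R. \<exists>c d. c \<noteq> 0 \<and> d \<noteq> 0 \<and> x = c *s fst r \<and> y = d *s snd r" if s: "(x,y) \<in> sols M" for x y
  proof -
    have "\<exists>r\<in>R. crs (fst r) x = 0"
    proof (rule ccontr)
      assume n: "\<not> ?thesis"
      then have nr: "(x,y) \<notin> R" by (metis crs_self(1) fst_conv)
      have "P (insert (x,y) R)" using R(1) s n crs_eq_0_commute unfolding P_def by auto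
      then have "card (insert (x,y) R) \<le> card R" by (rule R(2))
      then show False using nr R(1) by (simp add: P_def)
    qed
    then obtain r where r: "r \<in> R" "crs (fst r) x = 0" by blast
    obtain p q where pq: "r = (p,q)" by (cases r)
    have rs: "p \<noteq> 0" "q \<noteq> 0" "fl M p q = 0" using r(1) R(1) unfolding P_def pq sols_def by auto
    have xy: "x \<noteq> 0" "y \<noteq> 0" "fl M x y = 0" using s by (auto simp: sols_def)
    obtain c where c: "x = c *s p" using crs_eq_0_imp_scale rs(1) r(2) pq by auto
    have c0: "c \<noteq> 0" using xy c by auto
    have "fl M p y = 0" using xy(3) c c0 by (simp add: vector_mul_eq_0)
    then have "crs q y = 0" using g1 rs by blast
    then obtain d where d: "y = d *s q" using crs_eq_0_imp_scale rs(2) by blast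
    have "d \<noteq> 0" using xy d by auto
    then have "c \<noteq> 0 \<and> d \<noteq> 0 \<and> x = c *s fst r \<and> y = d *s snd r" using c c0 d pq by simp
    then show ?thesis using r(1) by blast
  qed
  have "lines M \<subseteq> (\<lambda>r. left_set M (cv (fst r))) ` R \<union> (\<lambda>r. left_set (trM M) (cv (snd r))) ` R
     \<union> (\<lambda>(r,s). cross_set M (fst r) (snd r) (fst s) (snd s)) ` (R \<times> R)" (is "_ \<subseteq> ?A \<union> ?B \<union> ?C")
  proof
    fix L assume L: "L \<in> lines M"
    consider (left) x y where "(x,y) \<in> sols M" "L = left_set M (cv x)"
      | (right) x y where "(x,y) \<in> sols M" "L = left_set (trM M) (cv y)"
      | (cross) x y x' y' where "(x,y) \<in> sols M" "(x',y') \<in> sols M" "L = cross_set M x y x' y'"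
      by (rule real_line_cases[OF _ L]) (use all_real in blast)+
    then show "L \<in> ?A \<union> ?B \<union> ?C"
    proof cases
      case (left x y)
      obtain r c d where "r\<in>R" "c \<noteq> 0" "x = c *s fst r" using rep[OF left(1)] by blast
      then show ?thesis using left(2) left_set_scale[of c M "fst r"] by auto
    next
      case (right x y)
      obtain r c d where "r\<in>R" "d \<noteq> 0" "y = d *s snd r" using rep[OF right(1)] by blast
      then show ?thesis using right(2) left_set_scale[of d "trM M" "snd r"] by auto
    next
      case (cross x y x' y')
      obtain r c d where r: "r\<in>R" "c \<noteq> 0" "d \<noteq> 0" "x = c *s fst r" "y = d *s snd r" using rep[OF cross(1)] by blast
      obtain r' c' d' where r': "r'\<in>R" "c' \<noteq> 0" "d' \<noteq> 0" "x' = c' *s fst r'" "y' = d' *s snd r'" using rep[OF cross(2)] by blast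
      have "L = cross_set M (fst r) (snd r) (fst r') (snd r')"
        unfolding cross(3) r(4,5) r'(4,5) by (rule cross_set_scale) (use r r' in auto)
      then show ?thesis using r(1) r'(1) by force
    qed
  qed
  moreover have fR: "finite R" using R(1) P_def by blast
  ultimately have "card (lines M) \<le> card (?A \<union> ?B \<union> ?C)" by (intro card_mono) auto
  also have "\<dots> \<le> card ?A + card ?B + card ?C"
    by (meson add_le_mono1 card_Un_le le_trans)
  also have "\<dots> \<le> card R + card R + card (R \<times> R)"
    by (intro add_mono card_image_le finite_cartesian_product fR)
  also have "\<dots> \<le> 4 + 4 + 4 * 4"
    unfolding card_cartesian_product by (intro add_mono mult_mono) (use bd[OF R(1)] in auto)
  finally show False using card by simp
qed

end

section \<open>Six points and the 27 lines\<close>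

lemma obtain_three_of_card:
  assumes "3 \<le> card A"
  obtains i j k where "i \<in> A" "j \<in> A" "k \<in> A" "i \<noteq> j" "j \<noteq> k" "i \<noteq> k"
proof -
  obtain B where B: "B \<subseteq> A" "card B = 3" using obtain_subset_with_card_n[OF assms] by blast
  then obtain i j k where "B = {i,j,k}" "i \<noteq> j" "j \<noteq> k" "i \<noteq> k" unfolding card_3_iff by blast
  then show ?thesis using that B by blast
qed

lemma sol_scale_in_span2:
  assumes "x = c *s y" "c \<noteq> 0" "x \<in> span2 a b"
  shows "y \<in> span2 a (b :: 'a::field^'n)"
proof -
  obtain p q where "x = p *s a + q *s b" using assms(3) by (auto simp: span2_def)
  then have "y = (1/c) *s (p *s a + q *s b)" using assms(1,2) by (metis nonzero_divide_eq_eq vector_smult_assoc vector_smult_lid)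
  then have "y = (p/c) *s a + (q/c) *s b" by (simp add: vector_add_ldistrib)
  then show ?thesis by (simp add: span2I)
qed

lemma crs_combination_nonzero:
  assumes "crs a b \<noteq> (0::'a::field^3)" "x \<in> span2 a b" "x \<noteq> 0"
  obtains x' where "x' \<in> {a,b}" "crs x x' \<noteq> 0"
proof -
  obtain p q where x: "x = p *s a + q *s b" using assms(2) by (auto simp: span2_def)
  have e: "crs x a = q *s crs b a" "crs x b = p *s crs a b" by (simp_all add: x)
  have "crs b a \<noteq> 0" using assms(1) crs_eq_0_commute by blast
  then have "crs x a \<noteq> 0 \<or> crs x b \<noteq> 0" using assms(1,3) unfolding e by (auto simp: vector_mul_eq_0 x)
  then show ?thesis using that by blast
qed

context gpencil
begin

text \<open>The given solution is real, so the equation splits into one for the real and one for the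
  imaginary parts.\<close>

lemma g3_complex:
  assumes s: "x \<noteq> 0" "y \<noteq> 0" "fl M x y = 0" and e: "fl (cM M) (cv x) v + fl (cM M) u (cv y) = 0"
  shows "crs u (cv x) = 0" "crs v (cv y) = 0"
proof -
  have "cv (fl M x (Rev v) + fl M (Rev u) y) + \<i> *s cv (fl M x (Imv v) + fl M (Imv u) y) = 0"
    using e unfolding fl_cM_real_left fl_cM_real_right by (simp add: vector_add_ldistrib add_ac)
  then have r: "fl M x (Rev v) + fl M (Rev u) y = 0" and i: "fl M x (Imv v) + fl M (Imv u) y = 0"
    unfolding cv_add_i_eq_0 by auto
  have "crs u (cv x) = cv (crs (Rev u) x) + \<i> *s cv (crs (Imv u) x)"
    by (subst complex_vec_split[of u]) (simp add: crs_cv)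
  then show "crs u (cv x) = 0" using g3[OF s r] g3[OF s i] by simp
  have "crs v (cv y) = cv (crs (Rev v) y) + \<i> *s cv (crs (Imv v) y)"
    by (subst complex_vec_split[of v]) (simp add: crs_cv)
  then show "crs v (cv y) = 0" using g3'[OF s r] g3'[OF s i] by simp
qed

lemma sol_ind2_complex:
  assumes s: "x \<noteq> 0" "y \<noteq> 0" "fl M x y = 0" and i: "crs (cv x) x' \<noteq> 0" "crs (cv y) y' \<noteq> 0"
  shows "ind2 (fl (cM M) (cv x) y') (fl (cM M) x' (cv y))"
  unfolding ind2_def
proof (intro allI impI)
  fix a b assume e: "a *s fl (cM M) (cv x) y' + b *s fl (cM M) x' (cv y) = 0"
  then have e': "fl (cM M) (cv x) (a *s y') + fl (cM M) (b *s x') (cv y) = 0" by simp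
  have "b *s crs x' (cv x) = 0" "a *s crs y' (cv y) = 0" using g3_complex[OF s e'] by simp_all
  moreover have "crs x' (cv x) \<noteq> 0" "crs y' (cv y) \<noteq> 0" using i crs_eq_0_commute by blast+
  ultimately show "a = 0 \<and> b = 0" by (simp add: vector_mul_eq_0)
qed

lemma indep_complex:
  assumes "\<And>p q. dt (fl (cM M) p q) z = 0" shows "z = 0"
proof -
  have "dt (fl M p q) (Rev z) = 0 \<and> dt (fl M p q) (Imv z) = 0" for p q
  proof -
    have "dt (cv (fl M p q)) z = of_real (dt (fl M p q) (Rev z)) + \<i> * of_real (dt (fl M p q) (Imv z))"
      by (subst complex_vec_split[of z]) (simp add: dt_cv)
    then show ?thesis using assms[of "cv p" "cv q"] by (simp add: fl_cM complex_eq_iff)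
  qed
  then have "pmat M (Rev z) *v q = 0" "pmat M (Imv z) *v q = 0" for q
    unfolding pmat_mult_eq_0 by auto
  then have "pmat M (Rev z) = 0" "pmat M (Imv z) = 0"
    by (metis matrix_eq matrix_vector_mult_0)+
  then show ?thesis using indep complex_vec_eq_0 by blast
qed

end

text \<open>Completeness is demanded of complex solutions, because lines that might a priori be
  nonreal have to be matched with the list.\<close>

locale six_points = gpencil +
  fixes x y :: "nat \<Rightarrow> real^3"
  assumes sol: "i < 6 \<Longrightarrow> x i \<noteq> 0" "i < 6 \<Longrightarrow> y i \<noteq> 0" "i < 6 \<Longrightarrow> fl M (x i) (y i) = 0"
    and xdist: "i < 6 \<Longrightarrow> j < 6 \<Longrightarrow> i \<noteq> j \<Longrightarrow> crs (x i) (x j) \<noteq> 0"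
    and complete: "p \<noteq> 0 \<Longrightarrow> q \<noteq> 0 \<Longrightarrow> fl (cM M) p q = 0 \<Longrightarrow>
       \<exists>i<6. crs (cv (x i)) p = 0 \<and> crs (cv (y i)) q = 0"
begin

lemma ydist:
  assumes "i < 6" "j < 6" "i \<noteq> j" shows "crs (y i) (y j) \<noteq> 0"
proof
  assume "crs (y i) (y j) = 0"
  then obtain c where c: "y j = c *s y i" using crs_eq_0_imp_scale sol(2)[OF assms(1)] by blast
  then have "c \<noteq> 0" using sol(2)[OF assms(2)] by auto
  then have "fl M (x j) (y i) = 0" using sol(3)[OF assms(2)] c by (simp add: vector_mul_eq_0)
  then have "crs (x i) (x j) = 0" using g1'[OF sol(2)[OF assms(1)] sol(3)[OF assms(1)]] by blast
  then show False using xdist assms by blast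
qed

text \<open>Transposition exchanges the two factors, so that every fact about left kernels is
  available for right kernels.\<close>

lemma six_points_trM: "six_points (trM M) y x"
proof -
  interpret tr: gpencil "trM M" by (rule gpencil_trM)
  show ?thesis
  proof
    fix p q :: "complex^3" assume "p \<noteq> 0" "q \<noteq> 0" "fl (cM (trM M)) p q = 0"
    then show "\<exists>i<6. crs (cv (y i)) p = 0 \<and> crs (cv (x i)) q = 0"
      using complete[of q p] unfolding trM_cM[symmetric] fl_trM by blast
  qed (use sol ydist in auto)
qed

lemma gpx:
  assumes "i < 6" "j < 6" "k < 6" "i \<noteq> j" "j \<noteq> k" "i \<noteq> k" shows "det3 (x i) (x j) (x k) \<noteq> 0"
proof
  assume "det3 (x i) (x j) (x k) = 0"
  then obtain p q where e: "x k = p *s x i + q *s x j" using det3_eq_0_imp xdist assms by metis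
  have "crs (x k) (x j) = p *s crs (x i) (x j)" "crs (x k) (x i) = q *s crs (x j) (x i)" by (simp_all add: e)
  then have "p \<noteq> 0" "q \<noteq> 0" using xdist[of k j] xdist[of k i] assms by auto
  moreover have k: "fl M (p *s x i + q *s x j) (y k) = 0" using sol(3)[OF assms(3)] unfolding e .
  have "crs (p *s x i) (q *s x j) = 0"
    by (rule g2[OF sol(2)[OF assms(1)] sol(2)[OF assms(2)] sol(2)[OF assms(3)] _ _ k]) (simp_all add: sol assms)
  ultimately show False using xdist[of i j] assms by (simp add: vector_mul_eq_0)
qed

lemma gpx_cv:
  assumes "i < 6" "j < 6" "k < 6" "i \<noteq> j" "j \<noteq> k" "i \<noteq> k" shows "det3 (cv (x i)) (cv (x j)) (cv (x k)) \<noteq> 0"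
  using gpx[OF assms] by (simp add: det3_cv)

text \<open>A left kernel \<open>w1, w2\<close> makes \<open>pmat (cM M) z = p \<otimes> r\<close> of rank at most one, orthogonal to all
  \<open>x i \<otimes> y i\<close>; but \<open>p\<close> annihilates at most two of the \<open>x i\<close> and \<open>r\<close> at most two of the \<open>y i\<close>.\<close>
lemma no_rank_one:
  assumes z: "z \<noteq> 0" and w: "crs w1 w2 \<noteq> 0" and k: "\<And>q. dt (fl (cM M) w1 q) z = 0" "\<And>q. dt (fl (cM M) w2 q) z = 0"
  shows False
proof -
  interpret tr: six_points "trM M" y x by (rule six_points_trM)
  obtain w3 where d: "det3 w1 w2 w3 \<noteq> 0" using basis3_extend2[OF w] .
  define B where "B = {i\<in>{..<6}. det3 w1 w2 (cv (x i)) = 0}"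
  have "card B \<le> 2"
  proof (rule ccontr)
    assume "\<not> card B \<le> 2"
    then obtain i j l where ijl: "i \<in> B" "j \<in> B" "l \<in> B" "i \<noteq> j" "j \<noteq> l" "i \<noteq> l"
      using obtain_three_of_card[of B] by auto
    have "dt (cv (x m)) (crs w1 w2) = 0" if "m \<in> B" for m
      using that det3_perm(4)[of w1 w2 "cv (x m)"] by (simp add: B_def det3_def)
    then have "det3 (cv (x i)) (cv (x j)) (cv (x l)) = 0" unfolding kernel3[symmetric] using w ijl by blast
    then show False using gpx_cv[of i j l] ijl by (auto simp: B_def)
  qed
  moreover have "B \<subseteq> {..<6}" by (auto simp: B_def)
  ultimately have "3 \<le> card ({..<6} - B)" by (simp add: card_Diff_subset finite_subset)
  then obtain i j l where ijl: "i \<in> {..<6} - B" "j \<in> {..<6} - B" "l \<in> {..<6} - B" "i \<noteq> j" "j \<noteq> l" "i \<noteq> l"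
    by (rule obtain_three_of_card)
  have r0: "dt (fl (cM M) w3 (cv (y m))) z = 0" if "m \<in> {..<6} - B" for m
  proof -
    obtain a b c where abc: "cv (x m) = a *s w1 + b *s w2 + c *s w3" using basis3_combination[OF d] .
    have "det3 w1 w2 (cv (x m)) = c * det3 w1 w2 w3" by (simp add: abc)
    then have "c \<noteq> 0" using that by (auto simp: B_def)
    have "fl (cM M) (cv (x m)) (cv (y m)) = 0" using sol(3)[of m] that by (simp add: fl_cM)
    then have "dt (fl (cM M) (a *s w1 + b *s w2 + c *s w3) (cv (y m))) z = 0" unfolding abc by simp
    then have "c * dt (fl (cM M) w3 (cv (y m))) z = 0" by (simp add: k)
    then show ?thesis using \<open>c \<noteq> 0\<close> by simp
  qed
  have r: "dt (fl (cM M) w3 q) z = 0" for q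
  proof -
    have "det3 (cv (y i)) (cv (y j)) (cv (y l)) \<noteq> 0" by (rule tr.gpx_cv) (use ijl in auto)
    then obtain a b c where "q = a *s cv (y i) + b *s cv (y j) + c *s cv (y l)" using basis3_combination by blast
    then show ?thesis using r0 ijl by simp
  qed
  have "dt (fl (cM M) p q) z = 0" for p q
  proof -
    obtain a b c where "p = a *s w1 + b *s w2 + c *s w3" using basis3_combination[OF d] .
    then show ?thesis using r k by simp
  qed
  then show False using indep_complex z by blast
qed

text \<open>Modulo the common kernel vectors the pencil consists of 2x2 matrices, whose determinant
  is a binary quadratic form. At a complex zero of it the left kernel grows to dimension two, which
  \<open>no_rank_one\<close> excludes.\<close>

lemma no_common_kernels:
  assumes uv: "ind2 u v" and w0: "w0 \<noteq> 0" and u0: "u0 \<noteq> 0"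
    and kw: "\<And>z q. z \<in> span2 u v \<Longrightarrow> dt (fl (cM M) w0 q) z = 0"
    and ku: "\<And>z p. z \<in> span2 u v \<Longrightarrow> dt (fl (cM M) p u0) z = 0"
  shows False
proof -
  obtain w1 w2 where w: "det3 w0 w1 w2 \<noteq> 0" using basis3_extend1[OF w0] .
  obtain q1 q2 where q: "det3 u0 q1 q2 \<noteq> 0" using basis3_extend1[OF u0] .
  define f where "f p q z = dt (fl (cM M) p q) z" for p q z
  obtain a b where ab: "\<not> (a = 0 \<and> b = 0)" "(f w1 q1 u * f w2 q2 u - f w2 q1 u * f w1 q2 u) * a\<^sup>2
     + (f w1 q1 u * f w2 q2 v + f w1 q1 v * f w2 q2 u - f w2 q1 u * f w1 q2 v - f w2 q1 v * f w1 q2 u) * a * b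
     + (f w1 q1 v * f w2 q2 v - f w2 q1 v * f w1 q2 v) * b\<^sup>2 = 0" by (rule complex_quadratic_root)
  define z where "z = a *s u + b *s v"
  have fz: "f p q z = a * f p q u + b * f p q v" for p q by (simp add: f_def z_def)
  have "f w1 q1 z * f w2 q2 z - f w2 q1 z * f w1 q2 z = 0"
    using ab(2) unfolding fz by (simp add: algebra_simps power2_eq_square)
  then obtain c d where cd: "\<not> (c = 0 \<and> d = 0)" "f w1 q1 z * c + f w2 q1 z * d = 0" "f w1 q2 z * c + f w2 q2 z * d = 0"
    by (rule singular2)
  have zs: "z \<in> span2 u v" by (simp add: z_def span2I)
  have "z \<noteq> 0" using uv ab(1) unfolding ind2_def z_def by blast
  moreover have "crs w0 (c *s w1 + d *s w2) \<noteq> 0"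
  proof
    assume 0: "crs w0 (c *s w1 + d *s w2) = 0"
    have "dt w2 (crs w0 (c *s w1 + d *s w2)) = c * det3 w0 w1 w2" "dt w1 (crs w0 (c *s w1 + d *s w2)) = - d * det3 w0 w1 w2"
      by (simp_all add: vec3_simps algebra_simps)
    then show False using cd(1) w unfolding 0 by auto
  qed
  moreover have "dt (fl (cM M) (c *s w1 + d *s w2) q) z = 0" for q
  proof -
    obtain r s t where "q = r *s u0 + s *s q1 + t *s q2" using basis3_combination[OF \<open>det3 u0 q1 q2 \<noteq> 0\<close>] .
    then have "dt (fl (cM M) (c *s w1 + d *s w2) q) z = s * (f w1 q1 z * c + f w2 q1 z * d) + t * (f w1 q2 z * c + f w2 q2 z * d)"
      by (simp add: ku[OF zs] f_def algebra_simps)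
    then show ?thesis using cd by simp
  qed
  ultimately show False using no_rank_one[of z w0] kw[OF zs] by blast
qed

text \<open>\<open>E\<close> and \<open>G\<close> are the two halves of a Schlaefli double-six,
  \<open>F\<close> consists of the other fifteen lines.\<close>

definition E where "E i = left_set M (cv (x i))"
definition G where "G i = left_set (trM M) (cv (y i))"
definition F where "F i j = cross_set M (x i) (y i) (x j) (y j)"

lemma F_sym: "F i j = F j i"
  by (auto simp: F_def cross_set_def)

lemma E_mem: "z \<in> E i \<longleftrightarrow> (\<forall>q. dt (fl (cM M) (cv (x i)) q) z = 0)"
  by (simp add: E_def left_set_def)
lemma G_mem: "z \<in> G i \<longleftrightarrow> (\<forall>p. dt (fl (cM M) p (cv (y i))) z = 0)"
  by (simp add: G_def left_set_def trM_cM[symmetric])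
lemma F_mem: "z \<in> F i j \<longleftrightarrow> dt (fl (cM M) (cv (x i)) (cv (y j))) z = 0 \<and> dt (fl (cM M) (cv (x j)) (cv (y i))) z = 0"
  by (simp add: F_def cross_set_def fl_cM)

lemma sol_cv: "i < 6 \<Longrightarrow> fl (cM M) (cv (x i)) (cv (y i)) = 0"
  using sol(3) by (simp add: fl_cM)

lemma E_G_tr: "six_points.E (trM M) y = G" "six_points.G (trM M) x = E"
proof -
  interpret tr: six_points "trM M" y x by (rule six_points_trM)
  show "tr.E = G" "tr.G = E" by (simp_all add: fun_eq_iff tr.E_def G_def tr.G_def E_def)
qed

lemma F_tr: "six_points.F (trM M) y x = F"
proof -
  interpret tr: six_points "trM M" y x by (rule six_points_trM)
  show "tr.F = F" by (auto simp: fun_eq_iff tr.F_def F_def cross_set_def)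
qed

lemma E_real: "i < 6 \<Longrightarrow> \<exists>u v. ind2 u v \<and> E i = span2 (cv u) (cv v)"
  using left_line sol unfolding E_def by metis

lemma F_real: "i < 6 \<Longrightarrow> j < 6 \<Longrightarrow> i \<noteq> j \<Longrightarrow> \<exists>u v. ind2 u v \<and> F i j = span2 (cv u) (cv v)"
  using cross_line[of "x i" "y i" "x j" "y j"] sol[of i] xdist[of i j] ydist[of i j] unfolding F_def by metis

lemma E_surf: "i < 6 \<Longrightarrow> E i \<subseteq> surf M"
  unfolding E_def by (rule left_set_surf) (use sol in auto)

lemma third_index:
  obtains k where "k < 6" "k \<noteq> i" "k \<noteq> (j::nat)"
proof -
  have "\<exists>k<6. k \<noteq> i \<and> k \<noteq> j"
  proof (rule ccontr)
    assume "\<not> ?thesis"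
    then have "{..<6} \<subseteq> {i,j}" by auto
    then have "card {..<6::nat} \<le> card {i,j}" by (intro card_mono) auto
    also have "\<dots> \<le> 2" by (simp add: card_insert_if)
    finally show False by simp
  qed
  then show ?thesis using that by blast
qed

text \<open>At a point of \<open>F i j\<close> the matrix sends the span of \<open>y i\<close> and
  \<open>y j\<close> into the line orthogonal to \<open>x i\<close> and \<open>x j\<close>, so it
  kills some \<open>q\<close> in that span. A third vector \<open>x k\<close> reads off the two
  values \<open>r\<close>, \<open>s\<close> on that line.\<close>

lemma F_surf:
  assumes ij: "i < 6" "j < 6" "i \<noteq> j" shows "F i j \<subseteq> surf M"
proof
  fix z assume z: "z \<in> F i j"
  obtain k where k: "k < 6" "k \<noteq> i" "k \<noteq> j" by (rule third_index)
  define r s where "r = dt (fl (cM M) (cv (x k)) (cv (y i))) z" and "s = dt (fl (cM M) (cv (x k)) (cv (y j))) z"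
  obtain a b where ab: "\<not> (a = 0 \<and> b = 0)" "r * a + s * b = 0" using singular2[of r 0 s 0] by auto
  define q where "q = a *s cv (y i) + b *s cv (y j)"
  have "ind2 (cv (y i)) (cv (y j))" using ydist[OF ij] ind2_3 ind2_cv by blast
  then have "q \<noteq> 0" using ab(1) unfolding q_def ind2_def by blast
  moreover have "dt (fl (cM M) p q) z = 0" for p
  proof -
    obtain c d e where p: "p = c *s cv (x i) + d *s cv (x j) + e *s cv (x k)"
      using basis3_combination[OF gpx_cv[of i j k]] ij k by metis
    have "dt (fl (cM M) p q) z = e * (r * a + s * b)"
      using z ij unfolding F_mem by (simp add: p q_def r_def s_def sol_cv algebra_simps)
    then show ?thesis using ab by simp
  qed
  ultimately show "z \<in> surf M" unfolding surf_def sing_pmat(1) by blast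
qed

lemma lines_intros: 
  "i < 6 \<Longrightarrow> E i \<in> lines M" "i < 6 \<Longrightarrow> G i \<in> lines M" "i < 6 \<Longrightarrow> j < 6 \<Longrightarrow> i \<noteq> j \<Longrightarrow> F i j \<in> lines M"
  "i < 6 \<Longrightarrow> real_span (E i)" "i < 6 \<Longrightarrow> real_span (G i)" "i < 6 \<Longrightarrow> j < 6 \<Longrightarrow> i \<noteq> j \<Longrightarrow> real_span (F i j)"
proof -
  interpret tr: six_points "trM M" y x by (rule six_points_trM)
  have l: "L \<in> lines M \<and> real_span L" if e: "\<exists>u v. ind2 u v \<and> L = span2 (cv u) (cv v)" and s: "L \<subseteq> surf M" for L
  proof -
    obtain u v where "ind2 u v" "L = span2 (cv u) (cv v)" using e by blast
    then show ?thesis using ind2_cv s unfolding lines_def real_span_def by blast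
  qed
  show "E i \<in> lines M" "real_span (E i)" if "i < 6" for i
    using l[OF E_real[OF that] E_surf[OF that]] by auto
  show "G i \<in> lines M" "real_span (G i)" if "i < 6" for i
    using l[OF tr.E_real[OF that, unfolded E_G_tr] tr.E_surf[OF that, unfolded E_G_tr surf_trM]] by auto
  show "F i j \<in> lines M" "real_span (F i j)" if "i < 6" "j < 6" "i \<noteq> j" for i j
    using l[OF F_real[OF that] F_surf[OF that]] by auto
qed

lemma left_kernel_line:
  assumes uv: "ind2 u v" and p: "p \<noteq> 0" "\<And>q. dt (fl (cM M) p q) u = 0 \<and> dt (fl (cM M) p q) v = 0"
  shows "\<exists>i<6. span2 u v = E i"
proof -
  obtain q where q: "q \<noteq> 0" "fl (cM M) p q = 0" using left_kernel_solution[OF uv p(2)] .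
  obtain i where i: "i < 6" "crs (cv (x i)) p = 0" using complete[OF p(1) q] by blast
  obtain c where c: "p = c *s cv (x i)" using crs_eq_0_imp_scale[of "cv (x i)" p] i sol by auto
  then have "c \<noteq> 0" using p by auto
  then have "span2 u v \<subseteq> E i"
    unfolding E_def by (intro span2_left_set) (use p(2) c in \<open>auto simp: left_set_def\<close>)
  then show ?thesis using E_real[OF i(1)] span2_subset_eq[OF uv] i(1) by metis
qed

text \<open>The argument for real lines is repeated over the complex numbers, with completeness of
  the list in place of the reality of all lines.\<close>

lemma lines_cases:
  assumes L: "L \<in> lines M"
  shows "(\<exists>i<6. L = E i) \<or> (\<exists>i<6. L = G i) \<or> (\<exists>i<6. \<exists>j<6. i \<noteq> j \<and> L = F i j)"
proof -
  interpret tr: six_points "trM M" y x by (rule six_points_trM)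
  obtain u v where uv: "ind2 u v" "L = span2 u v" and Ls: "L \<subseteq> surf M" using L by (auto simp: lines_def)
  have S: "sing (pmat (cM M) z)" if zs: "z \<in> span2 u v" for z using zs Ls uv(2) by (auto simp: surf_def)
  consider (left) p where "p \<noteq> 0" "\<And>q. dt (fl (cM M) p q) u = 0 \<and> dt (fl (cM M) p q) v = 0"
  | (right) q where "q \<noteq> 0" "\<And>p. dt (fl (cM M) p q) u = 0 \<and> dt (fl (cM M) p q) v = 0"
  | (plane) x1 x2 y1 y2 where "crs x1 x2 \<noteq> 0" "crs y1 y2 \<noteq> 0"
     "\<And>p q. p \<in> {x1,x2} \<Longrightarrow> q \<in> {y1,y2} \<Longrightarrow> dt (fl (cM M) p q) u = 0 \<and> dt (fl (cM M) p q) v = 0"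
    by (rule line_cases[OF S]) blast+
  then show ?thesis
  proof cases
    case (left p)
    then show ?thesis using left_kernel_line[OF uv(1) left] uv(2) by blast
  next
    case (right q)
    have "\<exists>i<6. span2 u v = tr.E i"
      by (rule tr.left_kernel_line[OF uv(1) right(1)]) (use right(2) in \<open>simp add: trM_cM[symmetric]\<close>)
    then show ?thesis unfolding E_G_tr uv(2) by blast
  next
    case (plane x1 x2 y1 y2)
    have K: "dt (fl (cM M) p q) u = 0 \<and> dt (fl (cM M) p q) v = 0" if "p \<in> span2 x1 x2" "q \<in> span2 y1 y2" for p q
      using that plane(3) by (auto simp: span2_def)
    have k': "dt f u = 0 \<and> dt f v = 0"
      if "f \<in> {fl (cM M) x1 y1, fl (cM M) x1 y2, fl (cM M) x2 y1, fl (cM M) x2 y2}" for f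
      using that plane(3) by blast
    obtain p1 p2 q1 q2 where pq: "\<not> (p1 = 0 \<and> p2 = 0)" "\<not> (q1 = 0 \<and> q2 = 0)"
      "(p1*q1) *s fl (cM M) x1 y1 + (p1*q2) *s fl (cM M) x1 y2 + (p2*q1) *s fl (cM M) x2 y1 + (p2*q2) *s fl (cM M) x2 y2 = 0"
      using bilinear_zero[OF uv(1) k'] .
    define P Q where "P = p1 *s x1 + p2 *s x2" and "Q = q1 *s y1 + q2 *s y2"
    have "fl (cM M) P Q = 0" using pq(3) by (simp add: P_def Q_def vector_smult_assoc algebra_simps)
    moreover have nz: "P \<noteq> 0" "Q \<noteq> 0" using pq(1,2) plane(1,2) unfolding ind2_3[symmetric] ind2_def P_def Q_def by blast+
    ultimately obtain i where i: "i < 6" "crs (cv (x i)) P = 0" "crs (cv (y i)) Q = 0" using complete by blast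
    obtain c where c: "P = c *s cv (x i)" using crs_eq_0_imp_scale[of "cv (x i)" P] i sol by auto
    obtain d where d: "Q = d *s cv (y i)" using crs_eq_0_imp_scale[of "cv (y i)" Q] i sol by auto
    have cd: "c \<noteq> 0" "d \<noteq> 0" using nz c d by auto
    have s: "cv (x i) \<in> span2 x1 x2" "cv (y i) \<in> span2 y1 y2"
      using sol_scale_in_span2[OF c cd(1)] sol_scale_in_span2[OF d cd(2)] unfolding P_def Q_def by (simp_all add: span2I)
    obtain x' where x': "x' \<in> {x1,x2}" "crs (cv (x i)) x' \<noteq> 0"
      using crs_combination_nonzero[OF plane(1) s(1)] sol i by auto
    obtain y' where y': "y' \<in> {y1,y2}" "crs (cv (y i)) y' \<noteq> 0"
      using crs_combination_nonzero[OF plane(2) s(2)] sol i by auto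
    have K': "dt (fl (cM M) p q) u = 0 \<and> dt (fl (cM M) p q) v = 0" if "p \<in> {cv (x i),x'}" "q \<in> {cv (y i),y'}" for p q
      by (rule K) (use that s x'(1) y'(1) span2_base in auto)
    obtain a b where ab: "fl (cM M) (x' + a *s cv (x i)) (y' + b *s cv (y i)) = 0"
      using second_solution[OF uv(1) sol_cv[OF i(1)] sol_ind2_complex[OF sol[OF i(1)] x'(2) y'(2)] K'] by blast
    define x'' y'' where "x'' = x' + a *s cv (x i)" and "y'' = y' + b *s cv (y i)"
    have cr: "crs (cv (x i)) x'' \<noteq> 0" "crs (cv (y i)) y'' \<noteq> 0" using x'(2) y'(2) by (simp_all add: x''_def y''_def)
    then have nz'': "x'' \<noteq> 0" "y'' \<noteq> 0" by auto
    then obtain j where j: "j < 6" "crs (cv (x j)) x'' = 0" "crs (cv (y j)) y'' = 0"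
      using complete[of x'' y''] ab unfolding x''_def y''_def by blast
    have ij: "i \<noteq> j" using cr(1) j(2) by blast
    obtain c where c: "x'' = c *s cv (x j)" using crs_eq_0_imp_scale[of "cv (x j)" x''] j sol by auto
    obtain d where d: "y'' = d *s cv (y j)" using crs_eq_0_imp_scale[of "cv (y j)" y''] j sol by auto
    have cd: "c \<noteq> 0" "d \<noteq> 0" using nz'' c d by auto
    have "dt (fl (cM M) (cv (x i)) y'') w = 0 \<and> dt (fl (cM M) x'' (cv (y i))) w = 0" if "w \<in> {u,v}" for w
      using K' that by (auto simp: x''_def y''_def)
    then have "u \<in> F i j" "v \<in> F i j" unfolding F_mem c d using cd by auto
    then have "span2 u v \<subseteq> F i j" unfolding F_def by (rule span2_cross_set)
    then have "L = F i j" using F_real[OF i(1) j(1) ij] span2_subset_eq[OF uv(1)] uv(2) by metis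
    then show ?thesis using i(1) j(1) ij by blast
  qed
qed

text \<open>A common point would have two independent left kernel vectors.\<close>

lemma E_inj:
  assumes "i < 6" "j < 6" "i \<noteq> j" shows "E i \<noteq> E j"
proof
  assume e: "E i = E j"
  obtain u v where uv: "ind2 u v" "E i = span2 (cv u) (cv v)" using E_real assms by blast
  have "cv u \<in> E i" "cv u \<in> E j" using uv(2) e span2_base by auto
  moreover have "cv u \<noteq> 0" using ind2_nonzero(1)[OF uv(1)] by simp
  ultimately show False using no_rank_one[of "cv u" "cv (x i)" "cv (x j)"] xdist assms
    by (simp add: crs_cv E_mem)
qed

lemma E_neq_G:
  assumes "i < 6" "j < 6" shows "E i \<noteq> G j"
proof
  assume e: "E i = G j"
  obtain u v where uv: "ind2 u v" "E i = span2 (cv u) (cv v)" using E_real assms by blast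
  show False
  proof (rule no_common_kernels[OF ind2_cv[OF uv(1)], of "cv (x i)" "cv (y j)"])
    fix z assume "z \<in> span2 (cv u) (cv v)"
    then have z: "z \<in> E i" "z \<in> G j" using uv(2) e by auto
    show "dt (fl (cM M) (cv (x i)) q) z = 0" "dt (fl (cM M) p (cv (y j))) z = 0" for p q
      using z unfolding E_mem G_mem by blast+
  qed (use sol assms in simp_all)
qed

text \<open>Choose \<open>t\<close> among \<open>j\<close>, \<open>k\<close> different from
  \<open>i\<close>. On \<open>F j k\<close> the row x_t^T M(z) vanishes on \<open>y j\<close> and
  \<open>y k\<close>, so one linear condition, which has a nonzero solution on the line, makes the
  row zero. Together with \<open>x i\<close> this gives a two-dimensional left kernel.\<close>

lemma E_neq_F:
  assumes i: "i < 6" and jk: "j < 6" "k < 6" "j \<noteq> k" shows "E i \<noteq> F j k"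
proof
  assume e: "E i = F j k"
  obtain t where t: "t = j \<or> t = k" "t \<noteq> i" using jk by metis
  interpret tr: six_points "trM M" y x by (rule six_points_trM)
  obtain u v where uv: "ind2 u v" "E i = span2 (cv u) (cv v)" using E_real i by blast
  obtain m where m: "m < 6" "m \<noteq> j" "m \<noteq> k" by (rule third_index)
  define f where "f z = dt (fl (cM M) (cv (x t)) (cv (y m))) z" for z
  obtain a b where ab: "\<not> (a = 0 \<and> b = 0)" "f (cv u) * a + f (cv v) * b = 0" using singular2[of "f (cv u)" 0 "f (cv v)" 0] by auto
  define z where "z = a *s cv u + b *s cv v"
  have "z \<noteq> 0" using ab(1) ind2_cv[OF uv(1)] unfolding ind2_def z_def by blast
  have fz: "f z = 0" using ab(2) by (simp add: f_def z_def mult.commute)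
  have "z \<in> E i" using uv(2) span2I z_def by metis
  then have zE: "dt (fl (cM M) (cv (x i)) q) z = 0" and zF: "z \<in> F j k" for q using E_mem e by blast+
  have zt: "dt (fl (cM M) (cv (x t)) q) z = 0" for q
  proof -
    obtain c d g where q: "q = c *s cv (y j) + d *s cv (y k) + g *s cv (y m)"
      using basis3_combination[OF tr.gpx_cv[of j k m]] jk m by metis
    show ?thesis using zF t jk fz unfolding F_mem f_def q by (auto simp: sol_cv)
  qed
  have "t < 6" using t jk by auto
  then have "crs (cv (x i)) (cv (x t)) \<noteq> 0" using xdist i t(2) by (simp add: crs_cv)
  then show False using no_rank_one[OF \<open>z \<noteq> 0\<close> _ zE zt] by blast
qed

lemma plane_intersection:
  assumes ij: "i < 6" "j < 6" "i \<noteq> j" and kl: "k < 6" "l < 6" "k \<noteq> l" and k: "k \<noteq> i" "k \<noteq> j"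
  obtains w where "w \<noteq> 0" "w \<in> span2 (x i) (x j)" "w \<in> span2 (x k) (x l)"
proof -
  obtain a b c where abc: "x l = a *s x i + b *s x j + c *s x k"
    using basis3_combination[OF gpx[of i j k]] ij kl k by metis
  define w where "w = a *s x i + b *s x j"
  have w: "w = (-c) *s x k + 1 *s x l" by (simp add: abc w_def cart_eq_iff)
  have "w \<noteq> 0"
  proof
    assume "w = 0"
    then have "x l = c *s x k" using abc by (simp add: w_def)
    then show False using xdist[of k l] kl by simp
  qed
  then show ?thesis using that w_def w span2I by metis
qed

text \<open>Let \<open>w\<close> be common to the planes of left factors. Then w^T M(z) vanishes on
  \<open>y i\<close> and \<open>y j\<close> through \<open>F i j\<close> and on \<open>y k\<close>
  through \<open>F k l\<close>, so \<open>w\<close> is a left kernel vector along the whole line,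
  and \<open>w'\<close> likewise a right one. The index \<open>l\<close> may coincide with
  \<open>i\<close> or \<open>j\<close>.\<close>

lemma F_inj_aux:
  assumes ij: "i < 6" "j < 6" "i \<noteq> j" and kl: "k < 6" "l < 6" "k \<noteq> l" and k: "k \<noteq> i" "k \<noteq> j"
  shows "F i j \<noteq> F k l"
proof
  assume e: "F i j = F k l"
  interpret tr: six_points "trM M" y x by (rule six_points_trM)
  obtain u v where uv: "ind2 u v" "F i j = span2 (cv u) (cv v)" using F_real ij by blast
  obtain w where w: "w \<noteq> 0" "w \<in> span2 (x i) (x j)" "w \<in> span2 (x k) (x l)" using plane_intersection[OF assms] .
  obtain w' where w': "w' \<noteq> 0" "w' \<in> span2 (y i) (y j)" "w' \<in> span2 (y k) (y l)" using tr.plane_intersection[OF assms] .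
  obtain a b c d where ab: "w = a *s x i + b *s x j" "w = c *s x k + d *s x l" using w(2,3) unfolding span2_def by blast
  obtain a' b' c' d' where ab': "w' = a' *s y i + b' *s y j" "w' = c' *s y k + d' *s y l" using w'(2,3) unfolding span2_def by blast
  show False
  proof (rule no_common_kernels[OF ind2_cv[OF uv(1)]])
    show "cv w \<noteq> 0" "cv w' \<noteq> 0" using w w' by simp_all
    fix z assume "z \<in> span2 (cv u) (cv v)"
    then have z: "z \<in> F i j" "z \<in> F k l" using uv(2) e by auto
    show "dt (fl (cM M) (cv w) q) z = 0" for q
    proof -
      obtain r s t where q: "q = r *s cv (y i) + s *s cv (y j) + t *s cv (y k)"
        using basis3_combination[OF tr.gpx_cv[of i j k]] ij kl k by metis
      have 1: "dt (fl (cM M) (cv w) (cv (y i))) z = 0" "dt (fl (cM M) (cv w) (cv (y j))) z = 0"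
        using z(1) unfolding ab(1) F_mem by (simp_all add: sol_cv ij)
      have 2: "dt (fl (cM M) (cv w) (cv (y k))) z = 0"
        using z(2) unfolding ab(2) F_mem by (simp add: sol_cv kl)
      show ?thesis by (simp add: q 1 2)
    qed
    show "dt (fl (cM M) p (cv w')) z = 0" for p
    proof -
      obtain r s t where p: "p = r *s cv (x i) + s *s cv (x j) + t *s cv (x k)"
        using basis3_combination[OF gpx_cv[of i j k]] ij kl k by metis
      have 1: "dt (fl (cM M) (cv (x i)) (cv w')) z = 0" "dt (fl (cM M) (cv (x j)) (cv w')) z = 0"
        using z(1) unfolding ab'(1) F_mem by (simp_all add: sol_cv ij)
      have 2: "dt (fl (cM M) (cv (x k)) (cv w')) z = 0"
        using z(2) unfolding ab'(2) F_mem by (simp add: sol_cv kl)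
      show ?thesis by (simp add: p 1 2)
    qed
  qed
qed

lemma F_inj:
  assumes "i < j" "j < 6" "k < l" "l < 6" "F i j = F k l" shows "i = k \<and> j = l"
proof (rule ccontr)
  assume n: "\<not> (i = k \<and> j = l)"
  then have "(k \<noteq> i \<and> k \<noteq> j) \<or> (l \<noteq> i \<and> l \<noteq> j)" using assms by auto
  then show False
    using F_inj_aux[of i j k l] F_inj_aux[of i j l k] F_sym[of l k] assms by auto
qed

theorem lines_card: "card (lines M) = 27" "L \<in> lines M \<Longrightarrow> real_span L"
proof -
  interpret tr: six_points "trM M" y x by (rule six_points_trM)
  \<comment> \<open>Unordered pairs, each listed once with the larger index first; there are
    15.\<close>
  let ?P = "Sigma {..<6} (\<lambda>j. {..<j}) :: (nat \<times> nat) set"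
  let ?F = "\<lambda>(j,i). F i j"
  have eq: "lines M = E ` {..<6} \<union> (G ` {..<6} \<union> ?F ` ?P)"
  proof (intro equalityI subsetI)
    fix L assume "L \<in> lines M"
    then consider i where "i < 6" "L = E i" | i where "i < 6" "L = G i" | i j where "i < 6" "j < 6" "i \<noteq> j" "L = F i j"
      using lines_cases by blast
    then show "L \<in> E ` {..<6} \<union> (G ` {..<6} \<union> ?F ` ?P)"
    proof cases
      case (3 i j)
      then have "(j,i) \<in> ?P \<or> (i,j) \<in> ?P" by auto
      moreover have "L = ?F (j,i)" "L = ?F (i,j)" using 3 F_sym by simp_all
      ultimately show ?thesis by (metis UnI2 imageI)
    qed auto
  qed (use lines_intros in \<open>auto\<close>)
  have iE: "inj_on E {..<6}" using E_inj by (auto simp: inj_on_def)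
  have iG: "inj_on G {..<6}" using tr.E_inj unfolding E_G_tr by (auto simp: inj_on_def)
  have iF: "inj_on ?F ?P" using F_inj by (auto simp: inj_on_def)
  have GF: "G i \<noteq> F j k" if "i < 6" "j < 6" "k < 6" "j \<noteq> k" for i j k
    using tr.E_neq_F[OF that] unfolding E_G_tr F_tr .
  have d1: "E ` {..<6} \<inter> (G ` {..<6} \<union> ?F ` ?P) = {}"
    using E_neq_G E_neq_F by fastforce
  have d2: "G ` {..<6} \<inter> ?F ` ?P = {}"
    using GF by fastforce
  have cP: "card ?P = 15" by (simp add: lessThan_Suc numeral_eq_Suc)
  have "card (lines M) = 6 + (6 + 15)"
    unfolding eq by (subst card_Un_disjoint, simp, simp, rule d1)
      (subst card_Un_disjoint, simp, simp, rule d2, simp only: card_image[OF iE] card_image[OF iG] card_image[OF iF] cP card_lessThan)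
  then show "card (lines M) = 27" by simp
  show "real_span L" if "L \<in> lines M" using lines_cases[OF that] lines_intros by metis
qed

end

section \<open>The sixth point\<close>

definition comb3 :: "'a::field^3 \<Rightarrow> 'a^3 \<Rightarrow> 'a^3 \<Rightarrow> 'a \<Rightarrow> 'a \<Rightarrow> 'a \<Rightarrow> 'a^3" where
  "comb3 x1 x2 x3 p q r = p *s x1 + q *s x2 + r *s x3"

lemma crs_comb3:
  assumes "det3 x1 x2 x3 \<noteq> 0" "crs (comb3 x1 x2 x3 u1 u2 u3) (comb3 x1 x2 x3 v1 v2 v3) = 0"
  shows "u1 * v2 = u2 * v1" "u1 * v3 = u3 * v1" "u2 * v3 = u3 * v2"
proof -
  let ?c = "crs (comb3 x1 x2 x3 u1 u2 u3) (comb3 x1 x2 x3 v1 v2 v3)"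
  have "dt x3 ?c = (u1 * v2 - u2 * v1) * det3 x1 x2 x3"
    "dt x2 ?c = (u3 * v1 - u1 * v3) * det3 x1 x2 x3"
    "dt x1 ?c = (u2 * v3 - u3 * v2) * det3 x1 x2 x3"
    by (simp_all add: comb3_def vec3_simps algebra_simps)
  then show "u1 * v2 = u2 * v1" "u1 * v3 = u3 * v1" "u2 * v3 = u3 * v2"
    using assms by simp_all
qed

lemma cv_comb3: "cv (comb3 x1 x2 x3 p q r) = comb3 (cv x1) (cv x2) (cv x3) (of_real p) (of_real q) (of_real r)"
  by (simp add: comb3_def)

text \<open>Any ratio of coordinates can be read off away from the diagonal: \<open>p1\<close>
  against \<open>p3\<close> in column 2, \<open>p1\<close> against \<open>p2\<close> in column 3,
  and dually for \<open>q\<close> in rows 3 and 2. So a rank-one matrix is recovered from its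
  off-diagonal part.\<close>

lemma proportional_of_offdiagonal:
  fixes p1 p2 p3 q1 q2 q3 :: "'a::field"
  assumes k: "k \<noteq> 0" and P: "P1 \<noteq> 0" "P2 \<noteq> 0" "P3 \<noteq> 0" "Q1 \<noteq> 0" "Q2 \<noteq> 0" "Q3 \<noteq> 0"
    and e: "p1 * q2 = k * (P1 * Q2)" "p1 * q3 = k * (P1 * Q3)" "p2 * q1 = k * (P2 * Q1)"
     "p2 * q3 = k * (P2 * Q3)" "p3 * q1 = k * (P3 * Q1)" "p3 * q2 = k * (P3 * Q2)"
  shows "(\<exists>s. p1 = s * P1 \<and> p2 = s * P2 \<and> p3 = s * P3) \<and> (\<exists>s. q1 = s * Q1 \<and> q2 = s * Q2 \<and> q3 = s * Q3)"
proof -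
  have nz: "p1 \<noteq> 0" "p2 \<noteq> 0" "p3 \<noteq> 0" "q1 \<noteq> 0" "q2 \<noteq> 0" "q3 \<noteq> 0" using e k P by auto
  have "q2 * (k * Q2) * (p1 * P3) = q2 * (k * Q2) * (p3 * P1)" "q3 * (k * Q3) * (p1 * P2) = q3 * (k * Q3) * (p2 * P1)"
    "p3 * (k * P3) * (q1 * Q2) = p3 * (k * P3) * (q2 * Q1)" "p2 * (k * P2) * (q1 * Q3) = p2 * (k * P2) * (q3 * Q1)"
  proof -
    have "q2 * (k * Q2) * (p1 * P3) = (p1 * q2) * (k * (P3 * Q2))" "q2 * (k * Q2) * (p3 * P1) = (p3 * q2) * (k * (P1 * Q2))"
      "q3 * (k * Q3) * (p1 * P2) = (p1 * q3) * (k * (P2 * Q3))" "q3 * (k * Q3) * (p2 * P1) = (p2 * q3) * (k * (P1 * Q3))"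
      "p3 * (k * P3) * (q1 * Q2) = (p3 * q1) * (k * (P3 * Q2))" "p3 * (k * P3) * (q2 * Q1) = (p3 * q2) * (k * (P3 * Q1))"
      "p2 * (k * P2) * (q1 * Q3) = (p2 * q1) * (k * (P2 * Q3))" "p2 * (k * P2) * (q3 * Q1) = (p2 * q3) * (k * (P2 * Q1))"
      by (simp_all only: mult_ac)
    then show "q2 * (k * Q2) * (p1 * P3) = q2 * (k * Q2) * (p3 * P1)" "q3 * (k * Q3) * (p1 * P2) = q3 * (k * Q3) * (p2 * P1)"
    "p3 * (k * P3) * (q1 * Q2) = p3 * (k * P3) * (q2 * Q1)" "p2 * (k * P2) * (q1 * Q3) = p2 * (k * P2) * (q3 * Q1)"
      unfolding e by (simp_all only: mult_ac)
  qed
  then have "p1 * P3 = p3 * P1" "p1 * P2 = p2 * P1" "q1 * Q2 = q2 * Q1" "q1 * Q3 = q3 * Q1"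
    using nz k P by simp_all
  then have "p1 = p1/P1 * P1 \<and> p2 = p1/P1 * P2 \<and> p3 = p1/P1 * P3" "q1 = q1/Q1 * Q1 \<and> q2 = q1/Q1 * Q2 \<and> q3 = q1/Q1 * Q3"
    using P by (simp_all add: field_simps)
  then show ?thesis by blast
qed

text \<open>In the coordinates below the five given points are \<open>e\<^sub>i \<otimes> e\<^sub>i\<close>, \<open>1 \<otimes> 1\<close> and \<open>a \<otimes> b\<close>. A rank-one matrix \<open>m\<close> in
  their span satisfies \<open>m\<^sub>1\<^sub>2 m\<^sub>2\<^sub>3 m\<^sub>3\<^sub>1 = m\<^sub>1\<^sub>3 m\<^sub>3\<^sub>2 m\<^sub>2\<^sub>1\<close>, that is \<open>c\<^sub>4 c\<^sub>5 (\<alpha> c\<^sub>4 + \<beta> c\<^sub>5) = 0\<close>; the last factor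
  yields the sixth point, which works out to the Cremona-type formulas \<open>P\<close>, \<open>Q\<close>.\<close>
lemma six_rank_one_matrices:
  fixes a1 a2 a3 b1 b2 b3 :: "'a::field"
  defines "D12 \<equiv> a1 * b2 - a2 * b1" and "D23 \<equiv> a2 * b3 - a3 * b2" and "D31 \<equiv> a3 * b1 - a1 * b3"
  assumes nz: "a1 \<noteq> 0" "a2 \<noteq> 0" "a3 \<noteq> 0" "b1 \<noteq> 0" "b2 \<noteq> 0" "b3 \<noteq> 0"
    and ad: "a1 \<noteq> a2" "a2 \<noteq> a3" "a1 \<noteq> a3" and bd: "b1 \<noteq> b2" "b2 \<noteq> b3" "b1 \<noteq> b3"
    and D: "D12 \<noteq> 0" "D23 \<noteq> 0" "D31 \<noteq> 0"
    and m: "p1 * q2 = c4 + c5 * (a1 * b2)" "p1 * q3 = c4 + c5 * (a1 * b3)" "p2 * q1 = c4 + c5 * (a2 * b1)"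
     "p2 * q3 = c4 + c5 * (a2 * b3)" "p3 * q1 = c4 + c5 * (a3 * b1)" "p3 * q2 = c4 + c5 * (a3 * b2)"
    and p: "\<not> (p1 = 0 \<and> p2 = 0 \<and> p3 = 0)" and q: "\<not> (q1 = 0 \<and> q2 = 0 \<and> q3 = 0)"
  shows "(p2 = 0 \<and> p3 = 0 \<and> q2 = 0 \<and> q3 = 0) \<or> (p1 = 0 \<and> p3 = 0 \<and> q1 = 0 \<and> q3 = 0) \<or> (p1 = 0 \<and> p2 = 0 \<and> q1 = 0 \<and> q2 = 0)
    \<or> (\<exists>s. p1 = s \<and> p2 = s \<and> p3 = s) \<and> (\<exists>s. q1 = s \<and> q2 = s \<and> q3 = s)
    \<or> (\<exists>s. p1 = s * a1 \<and> p2 = s * a2 \<and> p3 = s * a3) \<and> (\<exists>s. q1 = s * b1 \<and> q2 = s * b2 \<and> q3 = s * b3)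
    \<or> (\<exists>s. p1 = s * ((b2-b3)*D31*D12) \<and> p2 = s * ((b3-b1)*D12*D23) \<and> p3 = s * ((b1-b2)*D23*D31))
      \<and> (\<exists>s. q1 = s * ((a2-a3)*D31*D12) \<and> q2 = s * ((a3-a1)*D12*D23) \<and> q3 = s * ((a1-a2)*D23*D31))"
proof -
  define \<alpha> where "\<alpha> = a1*b2 + a2*b3 + a3*b1 - a1*b3 - a3*b2 - a2*b1"
  define \<beta> where "\<beta> = a1*b2*a2*b3 + a2*b3*a3*b1 + a3*b1*a1*b2 - a1*b3*a3*b2 - a3*b2*a2*b1 - a1*b3*a2*b1"
  have "(p1*q2)*(p2*q3)*(p3*q1) = (p1*q3)*(p3*q2)*(p2*q1)" by (simp only: mult_ac)
  then have "c4 * c5 * (\<alpha> * c4 + \<beta> * c5) = 0" unfolding m \<alpha>_def \<beta>_def by (simp add: algebra_simps)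
  then consider "c4 = 0" "c5 = 0" | "c4 \<noteq> 0" "c5 = 0" | "c4 = 0" "c5 \<noteq> 0" | "c4 \<noteq> 0" "c5 \<noteq> 0" "\<alpha> * c4 + \<beta> * c5 = 0" by auto
  then show ?thesis
  proof cases
    case 1 then show ?thesis using m p q by auto
  next
    case 2
    then show ?thesis using proportional_of_offdiagonal[of c4 1 1 1 1 1 1 p1 q2 q3 p2 q1 p3] m by simp
  next
    case 3
    then show ?thesis using proportional_of_offdiagonal[of c5 a1 a2 a3 b1 b2 b3 p1 q2 q3 p2 q1 p3] m nz by simp
  next
    case 4
    \<comment> \<open>Up to a scalar the off-diagonal entries of the remaining candidate are
      \<open>\<alpha>*(ai*bj) - \<beta>\<close>, and each of them splits into factors known to be
      nonzero. The first one also yields \<open>\<alpha> \<noteq> 0\<close>.\<close>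
    have id: "\<alpha>*(a1*b2) - \<beta> = (b2-b3)*(a1-a3)*D12" "\<alpha>*(a2*b1) - \<beta> = (b3-b1)*(a3-a2)*D12"
      "\<alpha>*(a1*b3) - \<beta> = (b2-b3)*(a2-a1)*D31" "\<alpha>*(a3*b1) - \<beta> = (b1-b2)*(a3-a2)*D31"
      "\<alpha>*(a2*b3) - \<beta> = (b3-b1)*(a2-a1)*D23" "\<alpha>*(a3*b2) - \<beta> = (b1-b2)*(a1-a3)*D23"
      unfolding \<alpha>_def \<beta>_def D12_def D23_def D31_def by (simp_all add: algebra_simps)
    have "\<alpha> \<noteq> 0"
    proof
      assume "\<alpha> = 0"
      then have "\<beta> = 0" using 4 by simp
      then have "(b2-b3)*(a1-a3)*D12 = 0" using id(1) \<open>\<alpha> = 0\<close> by simp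
      then show False using ad bd D by auto
    qed
    define k where "k = c5/\<alpha>"
    have k: "k \<noteq> 0" using 4 \<open>\<alpha> \<noteq> 0\<close> by (simp add: k_def)
    have c5: "c5 = k * \<alpha>" using \<open>\<alpha> \<noteq> 0\<close> by (simp add: k_def)
    have "\<alpha> * (c4 + \<beta> * k) = 0" using 4 c5 by (simp add: algebra_simps)
    then have c4: "c4 = - (\<beta> * k)" using \<open>\<alpha> \<noteq> 0\<close> by (simp add: eq_neg_iff_add_eq_0)
    have cc: "c4 + c5 * t = k * (\<alpha> * t - \<beta>)" for t unfolding c4 c5 by (simp add: algebra_simps)
    \<comment> \<open>Each product of one coordinate of the claimed \<open>p\<close> and one of the
      claimed \<open>q\<close> contains all three minors, one of them twice, and has the opposite
      sign; \<open>K\<close> absorbs the common part.\<close>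
    define K where "K = - k / (D12 * D23 * D31)"
    have k': "k = - K * (D12 * D23 * D31)" using D by (simp add: K_def)
    have K0: "K \<noteq> 0" using k k' by auto
    show ?thesis
      using proportional_of_offdiagonal[of K "(b2-b3)*D31*D12" "(b3-b1)*D12*D23" "(b1-b2)*D23*D31"
         "(a2-a3)*D31*D12" "(a3-a1)*D12*D23" "(a1-a2)*D23*D31" p1 q2 q3 p2 q1 p3] K0 D ad bd
      unfolding m cc id k' by (simp add: algebra_simps)
  qed
qed

text \<open>Five solutions in coordinates where they read e_i e_i^T, 1 1^T and a b^T. The conditions
  on single coordinates express that no three factors are collinear; conditions on the minors are
  derived below from \<open>g3\<close>.\<close>

locale frame = gpencil +
  fixes x1 x2 x3 y1 y2 y3 :: "real^3" and a1 a2 a3 b1 b2 b3 :: real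
  assumes dx: "det3 x1 x2 x3 \<noteq> 0" and dy: "det3 y1 y2 y3 \<noteq> 0"
    and n1: "fl M x1 y1 = 0" and n2: "fl M x2 y2 = 0" and n3: "fl M x3 y3 = 0"
    and n4: "fl M (comb3 x1 x2 x3 1 1 1) (comb3 y1 y2 y3 1 1 1) = 0"
    and n5: "fl M (comb3 x1 x2 x3 a1 a2 a3) (comb3 y1 y2 y3 b1 b2 b3) = 0"
    and nz: "a1 \<noteq> 0" "a2 \<noteq> 0" "a3 \<noteq> 0" "b1 \<noteq> 0" "b2 \<noteq> 0" "b3 \<noteq> 0"
    and ad: "a1 \<noteq> a2" "a2 \<noteq> a3" "a1 \<noteq> a3" and bd: "b1 \<noteq> b2" "b2 \<noteq> b3" "b1 \<noteq> b3"
begin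

abbreviation X where "X \<equiv> comb3 x1 x2 x3"
abbreviation Y where "Y \<equiv> comb3 y1 y2 y3"

lemma fl_comb: "fl M (X p1 p2 p3) (Y q1 q2 q3) $ l =
    p1*q2 * fl M x1 y2$l + p1*q3 * fl M x1 y3$l + p2*q1 * fl M x2 y1$l
  + p2*q3 * fl M x2 y3$l + p3*q1 * fl M x3 y1$l + p3*q2 * fl M x3 y2$l"
  by (simp add: comb3_def n1 n2 n3 algebra_simps)

lemma nonzero: "x1 \<noteq> 0" "x2 \<noteq> 0" "x3 \<noteq> 0" "y1 \<noteq> 0" "y2 \<noteq> 0" "y3 \<noteq> 0"
  using det3_neq_0_crs[OF dx] det3_neq_0_crs[OF dy] by auto

lemma comb3_eq_0: "X p q r = 0 \<Longrightarrow> p = 0 \<and> q = 0 \<and> r = 0" "Y p q r = 0 \<Longrightarrow> p = 0 \<and> q = 0 \<and> r = 0"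
proof -
  have e: "det3 (comb3 x y z p q r) y z = p * det3 x y z" "det3 x (comb3 x y z p q r) z = q * det3 x y z"
    "det3 x y (comb3 x y z p q r) = r * det3 x y z" for x y z :: "real^3"
    by (simp_all add: comb3_def)
  show "X p q r = 0 \<Longrightarrow> p = 0 \<and> q = 0 \<and> r = 0" using e[of x1 x2 x3] dx by simp
  show "Y p q r = 0 \<Longrightarrow> p = 0 \<and> q = 0 \<and> r = 0" using e[of y1 y2 y3] dy by simp
qed

text \<open>If the entries (2,3) and (3,2) of a b^T both equal \<open>t\<close>, subtracting
  \<open>t\<close> times the all-ones solution leaves, modulo the diagonal, only the first row and
  column. That is a tangent vector at the first solution, and \<open>g3\<close> forces it to be
  trivial.\<close>

lemma D23: "a2 * b3 - a3 * b2 \<noteq> 0"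
proof
  assume 0: "a2 * b3 - a3 * b2 = 0"
  define t where "t = a2 * b3"
  have t: "t = a2 * b3" "t = a3 * b2" using 0 by (simp_all add: t_def)
  have "fl M (X 1 0 0) (Y 0 (a1*b2-t) (a1*b3-t)) + fl M (X 0 (a2*b1-t) (a3*b1-t)) (Y 1 0 0) = 0"
  proof -
    have "(fl M (X 1 0 0) (Y 0 (a1*b2-t) (a1*b3-t)) + fl M (X 0 (a2*b1-t) (a3*b1-t)) (Y 1 0 0)) $ l
       = fl M (X a1 a2 a3) (Y b1 b2 b3) $ l - t * fl M (X 1 1 1) (Y 1 1 1) $ l
          + (t - a2*b3) * fl M x2 y3 $ l + (t - a3*b2) * fl M x3 y2 $ l" for l
      unfolding vector_add_component fl_comb by (simp add: algebra_simps)
    then show ?thesis using t by (simp add: n4 n5 cart_eq_iff)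
  qed
  then have "fl M x1 (Y 0 (a1*b2-t) (a1*b3-t)) + fl M (X 0 (a2*b1-t) (a3*b1-t)) y1 = 0"
    by (simp add: comb3_def)
  then have "crs (X 0 (a2*b1-t) (a3*b1-t)) x1 = 0" using g3 n1 nonzero by blast
  then have "crs (X 0 (a2*b1-t) (a3*b1-t)) (X 1 0 0) = 0" by (simp add: comb3_def)
  from crs_comb3[OF dx this] have "a2 * b1 = t" by simp
  then show False using t(1) nz bd by simp
qed

text \<open>The expression is the determinant with rows (1,1,1), \<open>a\<close>, \<open>b\<close>.
  It vanishes exactly if the off-diagonal part of a b^T has the form 1 v^T + u 1^T, a tangent vector
  at the all-ones solution.\<close>

lemma alpha: "a1*b2 + a2*b3 + a3*b1 - a1*b3 - a3*b2 - a2*b1 \<noteq> 0"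
proof
  assume 0: "a1*b2 + a2*b3 + a3*b1 - a1*b3 - a3*b2 - a2*b1 = 0"
  \<comment> \<open>With the first coordinate of u normalised to 0, five of the six off-diagonal
    equations determine u and v; the sixth, at position (3,2), is the assumption
    \<open>0\<close>.\<close>
  define u2 where "u2 = a2*b3 - a1*b3"
  define v1 where "v1 = a2*b1 - u2"
  define u3 where "u3 = a3*b1 - v1"
  have "fl M (X 1 1 1) (Y v1 (a1*b2) (a1*b3)) + fl M (X 0 u2 u3) (Y 1 1 1) = 0"
  proof -
    have "(fl M (X 1 1 1) (Y v1 (a1*b2) (a1*b3)) + fl M (X 0 u2 u3) (Y 1 1 1)) $ l
       = fl M (X a1 a2 a3) (Y b1 b2 b3) $ l + (a1*b2 + a2*b3 + a3*b1 - a1*b3 - a3*b2 - a2*b1) * fl M x3 y2 $ l" for l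
      unfolding vector_add_component fl_comb u2_def v1_def u3_def by (simp add: algebra_simps)
    then show ?thesis using 0 by (simp add: n5 cart_eq_iff)
  qed
  then have "crs (X 0 u2 u3) (X 1 1 1) = 0"
    using g3[OF _ _ n4] comb3_eq_0 by (metis one_neq_zero)
  from crs_comb3[OF dx this] have "u2 = 0" by simp
  then show False using nz ad by (simp add: u2_def)
qed

lemma frame_rotate: "frame M x2 x3 x1 y2 y3 y1 a2 a3 a1 b2 b3 b1"
  using n1 n2 n3 n4 n5 nz ad bd dx dy
  by unfold_locales (auto simp: comb3_def add_ac det3_perm(4)[of x2 x3 x1] det3_perm(4)[of y2 y3 y1])

text \<open>Rescaling the coordinate vectors by \<open>a\<close> and \<open>b\<close> turns the
  fifth solution into the all-ones one and the fourth into the one with inverted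
  coordinates.\<close>

lemma frame_swap: "frame M (a1 *s x1) (a2 *s x2) (a3 *s x3) (b1 *s y1) (b2 *s y2) (b3 *s y3) (1/a1) (1/a2) (1/a3) (1/b1) (1/b2) (1/b3)"
  using n1 n2 n3 n4 n5 nz ad bd dx dy
  by unfold_locales (auto simp: comb3_def simp del: fl_linear(1-4))

text \<open>This is \<open>alpha\<close> for the swapped frame, up to the product of all
  coordinates.\<close>

lemma beta: "a1*b2*a2*b3 + a2*b3*a3*b1 + a3*b1*a1*b2 - a1*b3*a3*b2 - a3*b2*a2*b1 - a1*b3*a2*b1 \<noteq> 0"
proof
  assume 0: "a1*b2*a2*b3 + a2*b3*a3*b1 + a3*b1*a1*b2 - a1*b3*a3*b2 - a3*b2*a2*b1 - a1*b3*a2*b1 = 0"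
  interpret s: frame M "a1 *s x1" "a2 *s x2" "a3 *s x3" "b1 *s y1" "b2 *s y2" "b3 *s y3" "1/a1" "1/a2" "1/a3" "1/b1" "1/b2" "1/b3"
    by (rule frame_swap)
  have "1/a1*(1/b2) + 1/a2*(1/b3) + 1/a3*(1/b1) - 1/a1*(1/b3) - 1/a3*(1/b2) - 1/a2*(1/b1)
     = (a1*b2*a2*b3 + a2*b3*a3*b1 + a3*b1*a1*b2 - a1*b3*a3*b2 - a3*b2*a2*b1 - a1*b3*a2*b1) / (a1*a2*a3*b1*b2*b3)"
    using nz by (simp add: field_simps)
  then show False using s.alpha 0 by simp
qed

lemma D31: "a3 * b1 - a1 * b3 \<noteq> 0" and D12: "a1 * b2 - a2 * b1 \<noteq> 0"
proof -
  interpret r: frame M x2 x3 x1 y2 y3 y1 a2 a3 a1 b2 b3 b1 by (rule frame_rotate)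
  show "a3 * b1 - a1 * b3 \<noteq> 0" by (rule r.D23)
  interpret rr: frame M x3 x1 x2 y3 y1 y2 a3 a1 a2 b3 b1 b2 by (rule r.frame_rotate)
  show "a1 * b2 - a2 * b1 \<noteq> 0" by (rule rr.D23)
qed

definition "P1 = (b2-b3)*(a3 * b1 - a1 * b3)*(a1 * b2 - a2 * b1)"
definition "P2 = (b3-b1)*(a1 * b2 - a2 * b1)*(a2 * b3 - a3 * b2)"
definition "P3 = (b1-b2)*(a2 * b3 - a3 * b2)*(a3 * b1 - a1 * b3)"
definition "Q1 = (a2-a3)*(a3 * b1 - a1 * b3)*(a1 * b2 - a2 * b1)"
definition "Q2 = (a3-a1)*(a1 * b2 - a2 * b1)*(a2 * b3 - a3 * b2)"
definition "Q3 = (a1-a2)*(a2 * b3 - a3 * b2)*(a3 * b1 - a1 * b3)"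

lemma PQ_nonzero: "P1 \<noteq> 0" "P2 \<noteq> 0" "P3 \<noteq> 0" "Q1 \<noteq> 0" "Q2 \<noteq> 0" "Q3 \<noteq> 0"
  using D12 D23 D31 ad bd by (auto simp: P1_def P2_def P3_def Q1_def Q2_def Q3_def)

text \<open>Off the diagonal the product of the two factors is \<open>- \<Delta>\<close> times the
  combination \<open>\<alpha>\<close> a b^T - \<open>\<beta>\<close> 1 1^T of the fifth and fourth
  solutions, and the diagonal contributes nothing because the e_i e_i^T are solutions.\<close>

lemma sixth: "fl M (X P1 P2 P3) (Y Q1 Q2 Q3) = 0"
proof -
  define \<alpha> where "\<alpha> = a1*b2 + a2*b3 + a3*b1 - a1*b3 - a3*b2 - a2*b1"
  define \<beta> where "\<beta> = a1*b2*a2*b3 + a2*b3*a3*b1 + a3*b1*a1*b2 - a1*b3*a3*b2 - a3*b2*a2*b1 - a1*b3*a2*b1"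
  define d12 where "d12 = a1 * b2 - a2 * b1"
  define d23 where "d23 = a2 * b3 - a3 * b2"
  define d31 where "d31 = a3 * b1 - a1 * b3"
  define \<Delta> where "\<Delta> = d12 * d23 * d31"
  have id: "\<alpha>*(a1*b2) - \<beta> = (b2-b3)*(a1-a3)*d12" "\<alpha>*(a2*b1) - \<beta> = (b3-b1)*(a3-a2)*d12"
      "\<alpha>*(a1*b3) - \<beta> = (b2-b3)*(a2-a1)*d31" "\<alpha>*(a3*b1) - \<beta> = (b1-b2)*(a3-a2)*d31"
      "\<alpha>*(a2*b3) - \<beta> = (b3-b1)*(a2-a1)*d23" "\<alpha>*(a3*b2) - \<beta> = (b1-b2)*(a1-a3)*d23"
    unfolding \<alpha>_def \<beta>_def d12_def d23_def d31_def by (simp_all add: algebra_simps)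
  have e: "P1 * Q2 = - \<Delta> * (\<alpha>*(a1*b2) - \<beta>)" "P2 * Q1 = - \<Delta> * (\<alpha>*(a2*b1) - \<beta>)"
      "P1 * Q3 = - \<Delta> * (\<alpha>*(a1*b3) - \<beta>)" "P3 * Q1 = - \<Delta> * (\<alpha>*(a3*b1) - \<beta>)"
      "P2 * Q3 = - \<Delta> * (\<alpha>*(a2*b3) - \<beta>)" "P3 * Q2 = - \<Delta> * (\<alpha>*(a3*b2) - \<beta>)"
    unfolding id \<Delta>_def P1_def P2_def P3_def Q1_def Q2_def Q3_def d12_def[symmetric] d23_def[symmetric] d31_def[symmetric]
    by (simp_all add: algebra_simps)
  have "fl M (X P1 P2 P3) (Y Q1 Q2 Q3) $ l = - \<Delta> * (\<alpha> * fl M (X a1 a2 a3) (Y b1 b2 b3) $ l - \<beta> * fl M (X 1 1 1) (Y 1 1 1) $ l)" for l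
    unfolding fl_comb e by (simp add: algebra_simps)
  then show ?thesis by (simp add: n4 n5 cart_eq_iff)
qed

lemma P_not_ones: "\<not> (P1 = P2 \<and> P1 = P3)"
proof -
  have "P1 - P2 = - b3 * (a1 * b2 - a2 * b1) * (a1*b2 + a2*b3 + a3*b1 - a1*b3 - a3*b2 - a2*b1)"
    unfolding P1_def P2_def by (simp add: algebra_simps)
  then show ?thesis using alpha D12 nz by auto
qed

lemma P_not_a: "\<not> (P1 * a2 = P2 * a1 \<and> P1 * a3 = P3 * a1)"
proof -
  have "P1 * a2 - P2 * a1 = - (a1 * b2 - a2 * b1) * (a1*b2*a2*b3 + a2*b3*a3*b1 + a3*b1*a1*b2 - a1*b3*a3*b2 - a3*b2*a2*b1 - a1*b3*a2*b1)"
    unfolding P1_def P2_def by (simp add: algebra_simps)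
  then show ?thesis using beta D12 by auto
qed

definition "xs6 = (!) [X 1 0 0, X 0 1 0, X 0 0 1, X 1 1 1, X a1 a2 a3, X P1 P2 P3]"
definition "ys6 = (!) [Y 1 0 0, Y 0 1 0, Y 0 0 1, Y 1 1 1, Y b1 b2 b3, Y Q1 Q2 Q3]"

lemma less_6: "i < 6 \<longleftrightarrow> i = 0 \<or> i = 1 \<or> i = 2 \<or> i = 3 \<or> i = 4 \<or> i = (5::nat)" by auto

text \<open>\<open>W\<close> expresses that the five solutions span the orthogonal complement of the
  pencil. For a complex solution p q^T the real and the imaginary part lie in this real span, so p
  q^T is a complex combination of the five. Off the diagonal only the last two coefficients matter,
  and \<open>six_rank_one_matrices\<close> lists what is possible.\<close>

lemma six_points:
  assumes W: "\<And>w :: real^3^3. (\<And>l. (\<Sum>i\<in>UNIV. \<Sum>j\<in>UNIV. M$l$i$j * w$i$j) = 0) \<Longrightarrow>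
     \<exists>c1 c2 c3 c4 c5. \<forall>i j. w$i$j = c1 * (x1$i * y1$j) + c2 * (x2$i * y2$j) + c3 * (x3$i * y3$j)
        + c4 * (X 1 1 1$i * Y 1 1 1$j) + c5 * (X a1 a2 a3$i * Y b1 b2 b3$j)"
  shows "six_points M xs6 ys6"
proof
  have x: "xs6 0 = X 1 0 0" "xs6 1 = X 0 1 0" "xs6 2 = X 0 0 1" "xs6 3 = X 1 1 1" "xs6 4 = X a1 a2 a3" "xs6 5 = X P1 P2 P3"
    "ys6 0 = Y 1 0 0" "ys6 1 = Y 0 1 0" "ys6 2 = Y 0 0 1" "ys6 3 = Y 1 1 1" "ys6 4 = Y b1 b2 b3" "ys6 5 = Y Q1 Q2 Q3"
    by (simp_all add: xs6_def ys6_def)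
  have n: "fl M (X 1 0 0) (Y 1 0 0) = 0" "fl M (X 0 1 0) (Y 0 1 0) = 0" "fl M (X 0 0 1) (Y 0 0 1) = 0"
    by (simp_all add: comb3_def n1 n2 n3)
  note x' = x[unfolded One_nat_def]
  show "xs6 i \<noteq> 0" if "i < 6" for i
    using that comb3_eq_0(1) nz PQ_nonzero unfolding less_6 by (auto simp: x x' dest!: comb3_eq_0(1))
  show "ys6 i \<noteq> 0" if "i < 6" for i
    using that comb3_eq_0(2) nz PQ_nonzero unfolding less_6 by (auto simp: x x' dest!: comb3_eq_0(2))
  show "fl M (xs6 i) (ys6 i) = 0" if "i < 6" for i
    using that n n4 n5 sixth unfolding less_6 by (elim disjE) (simp_all only: x)
  have cr: "crs (X u1 u2 u3) (X v1 v2 v3) \<noteq> 0" if "\<not> (u1 * v2 = u2 * v1 \<and> u1 * v3 = u3 * v1 \<and> u2 * v3 = u3 * v2)"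
    for u1 u2 u3 v1 v2 v3
    using crs_comb3[OF dx, of u1 u2 u3 v1 v2 v3] that by blast
  have "\<not> (1 * P2 = 1 * P1 \<and> 1 * P3 = 1 * P1 \<and> 1 * P3 = 1 * P2)" using P_not_ones by fastforce
  then have c35: "crs (X 1 1 1) (X P1 P2 P3) \<noteq> 0" by (rule cr)
  have "\<not> (a1 * P2 = a2 * P1 \<and> a1 * P3 = a3 * P1 \<and> a2 * P3 = a3 * P2)" using P_not_a by (metis mult.commute)
  then have c45: "crs (X a1 a2 a3) (X P1 P2 P3) \<noteq> 0" by (rule cr)
  have c13: "crs (X 1 0 0) (X 0 1 0) \<noteq> 0" "crs (X 1 0 0) (X 0 0 1) \<noteq> 0" "crs (X 1 0 0) (X 1 1 1) \<noteq> 0" "crs (X 1 0 0) (X a1 a2 a3) \<noteq> 0" "crs (X 1 0 0) (X P1 P2 P3) \<noteq> 0" "crs (X 0 1 0) (X 0 0 1) \<noteq> 0" "crs (X 0 1 0) (X 1 1 1) \<noteq> 0" "crs (X 0 1 0) (X a1 a2 a3) \<noteq> 0" "crs (X 0 1 0) (X P1 P2 P3) \<noteq> 0" "crs (X 0 0 1) (X 1 1 1) \<noteq> 0" "crs (X 0 0 1) (X a1 a2 a3) \<noteq> 0" "crs (X 0 0 1) (X P1 P2 P3) \<noteq> 0" "crs (X 1 1 1) (X a1 a2 a3) \<noteq> 0"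
    by (rule cr; simp add: nz ad PQ_nonzero)+
  note c15 = c13 c35 c45
  have lt: "crs (xs6 i) (xs6 j) \<noteq> 0" if ij: "i < j" "j < 6" for i j
  proof -
    have "i = 0 \<and> j = 1 \<or> i = 0 \<and> j = 2 \<or> i = 0 \<and> j = 3 \<or> i = 0 \<and> j = 4 \<or> i = 0 \<and> j = 5 \<or> i = 1 \<and> j = 2 \<or> i = 1 \<and> j = 3 \<or> i = 1 \<and> j = 4 \<or> i = 1 \<and> j = 5 \<or> i = 2 \<and> j = 3 \<or> i = 2 \<and> j = 4 \<or> i = 2 \<and> j = 5 \<or> i = 3 \<and> j = 4 \<or> i = 3 \<and> j = 5 \<or> i = 4 \<and> j = 5"
    proof -
      have "i < 6" using ij by simp
      with ij show ?thesis unfolding less_6 by (elim disjE) simp_all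
    qed
    then show ?thesis by (elim disjE conjE) (simp_all only: x c15 simp_thms)
  qed
  then show "crs (xs6 i) (xs6 j) \<noteq> 0" if "i < 6" "j < 6" "i \<noteq> j" for i j
  proof (cases "i < j")
    case True then show ?thesis using lt that by blast
  next
    case False
    then have "crs (xs6 j) (xs6 i) \<noteq> 0" using lt[of j i] that by simp
    then show ?thesis using crs_eq_0_commute by metis
  qed
  fix p q :: "complex^3"
  assume p: "p \<noteq> 0" and q: "q \<noteq> 0" and s: "fl (cM M) p q = 0"
  have "(\<Sum>i\<in>UNIV. \<Sum>j\<in>UNIV. of_real (M$l$i$j) * (p$i * q$j)) = 0" for l
  proof -
    have "(\<Sum>i\<in>UNIV. \<Sum>j\<in>UNIV. of_real (M$l$i$j) * (p$i * q$j)) = fl (cM M) p q $ l"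
      by (simp add: fl_def dt_def matrix_vector_mult_def cM_def sum_distrib_left mult_ac)
    then show ?thesis using s by simp
  qed
  then have "(\<Sum>i\<in>UNIV. \<Sum>j\<in>UNIV. M$l$i$j * Re (p$i * q$j)) = 0 \<and> (\<Sum>i\<in>UNIV. \<Sum>j\<in>UNIV. M$l$i$j * Im (p$i * q$j)) = 0" for l
    unfolding complex_eq_iff[of _ 0] Re_sum Im_sum by simp
  then have RI: "(\<Sum>i\<in>UNIV. \<Sum>j\<in>UNIV. M$l$i$j * (\<chi> i j. Re (p$i * q$j))$i$j) = 0"
    "(\<Sum>i\<in>UNIV. \<Sum>j\<in>UNIV. M$l$i$j * (\<chi> i j. Im (p$i * q$j))$i$j) = 0" for l
    unfolding vec_lambda_beta by blast+
  obtain c1 c2 c3 c4 c5 where c: "\<forall>i j. (\<chi> i j. Re (p$i * q$j))$i$j = c1 * (x1$i * y1$j) + c2 * (x2$i * y2$j) + c3 * (x3$i * y3$j) + c4 * (X 1 1 1$i * Y 1 1 1$j) + c5 * (X a1 a2 a3$i * Y b1 b2 b3$j)"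
    using W[OF RI(1)] by (elim exE) (rule that)
  obtain d1 d2 d3 d4 d5 where d: "\<forall>i j. (\<chi> i j. Im (p$i * q$j))$i$j = d1 * (x1$i * y1$j) + d2 * (x2$i * y2$j) + d3 * (x3$i * y3$j) + d4 * (X 1 1 1$i * Y 1 1 1$j) + d5 * (X a1 a2 a3$i * Y b1 b2 b3$j)"
    using W[OF RI(2)] by (elim exE) (rule that)
  note c = c[unfolded vec_lambda_beta] and d = d[unfolded vec_lambda_beta]
  define e1 e2 e3 e4 e5 where e: "e1 = Complex c1 d1" "e2 = Complex c2 d2" "e3 = Complex c3 d3" "e4 = Complex c4 d4" "e5 = Complex c5 d5"
  have pq: "p$i * q$j = e1 * (cv x1$i * cv y1$j) + e2 * (cv x2$i * cv y2$j) + e3 * (cv x3$i * cv y3$j)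
        + e4 * (cv (X 1 1 1)$i * cv (Y 1 1 1)$j) + e5 * (cv (X a1 a2 a3)$i * cv (Y b1 b2 b3)$j)" for i j
  proof -
    have h: "Re (Complex s t * (of_real u * of_real v)) = s * (u * v)" "Im (Complex s t * (of_real u * of_real v)) = t * (u * v)"
      for s t u v by simp_all
    show ?thesis using c d unfolding complex_eq_iff e cv_nth plus_complex.sel h by simp
  qed
  have ev: "dt f p * dt g q = e1 * (dt f (cv x1) * dt g (cv y1)) + e2 * (dt f (cv x2) * dt g (cv y2)) + e3 * (dt f (cv x3) * dt g (cv y3))
        + e4 * (dt f (cv (X 1 1 1)) * dt g (cv (Y 1 1 1))) + e5 * (dt f (cv (X a1 a2 a3)) * dt g (cv (Y b1 b2 b3)))" for f g
  proof -
    have "dt f p * dt g q = (\<Sum>i\<in>UNIV. \<Sum>j\<in>UNIV. f$i * g$j * (p$i * q$j))"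
      by (simp add: dt_def sum_product mult_ac)
    also have "\<dots> = e1 * (\<Sum>i\<in>UNIV. \<Sum>j\<in>UNIV. f$i * g$j * (cv x1$i * cv y1$j)) + e2 * (\<Sum>i\<in>UNIV. \<Sum>j\<in>UNIV. f$i * g$j * (cv x2$i * cv y2$j))
       + e3 * (\<Sum>i\<in>UNIV. \<Sum>j\<in>UNIV. f$i * g$j * (cv x3$i * cv y3$j)) + e4 * (\<Sum>i\<in>UNIV. \<Sum>j\<in>UNIV. f$i * g$j * (cv (X 1 1 1)$i * cv (Y 1 1 1)$j))
       + e5 * (\<Sum>i\<in>UNIV. \<Sum>j\<in>UNIV. f$i * g$j * (cv (X a1 a2 a3)$i * cv (Y b1 b2 b3)$j))"
      unfolding pq by (simp only: distrib_left sum.distrib sum_distrib_left mult_ac)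
    finally show ?thesis by (simp only: dt_def sum_product mult_ac)
  qed
  have dxc: "det3 (cv x1) (cv x2) (cv x3) \<noteq> 0" and dyc: "det3 (cv y1) (cv y2) (cv y3) \<noteq> 0" using dx dy by (simp_all add: det3_cv)
  obtain p1 p2 p3 where p': "p = p1 *s cv x1 + p2 *s cv x2 + p3 *s cv x3" using basis3_combination[OF dxc] .
  obtain q1 q2 q3 where q': "q = q1 *s cv y1 + q2 *s cv y2 + q3 *s cv y3" using basis3_combination[OF dyc] .
  let ?dx = "det3 (cv x1) (cv x2) (cv x3)" and ?dy = "det3 (cv y1) (cv y2) (cv y3)"
  \<comment> \<open>Cross products of the frame vectors form the dual basis up to the determinant,
    so pairing with them reads off coordinates.\<close>
  have dual: "dt (crs v2 v3) (comb3 v1 v2 v3 r1 r2 r3) = r1 * det3 v1 v2 v3" "dt (crs v3 v1) (comb3 v1 v2 v3 r1 r2 r3) = r2 * det3 v1 v2 v3"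
    "dt (crs v1 v2) (comb3 v1 v2 v3 r1 r2 r3) = r3 * det3 v1 v2 v3" for v1 v2 v3 :: "complex^3" and r1 r2 r3
    by (simp_all add: comb3_def vec3_simps algebra_simps)
  have cx: "cv x1 = comb3 (cv x1) (cv x2) (cv x3) 1 0 0" "cv x2 = comb3 (cv x1) (cv x2) (cv x3) 0 1 0" "cv x3 = comb3 (cv x1) (cv x2) (cv x3) 0 0 1"
    and cy: "cv y1 = comb3 (cv y1) (cv y2) (cv y3) 1 0 0" "cv y2 = comb3 (cv y1) (cv y2) (cv y3) 0 1 0" "cv y3 = comb3 (cv y1) (cv y2) (cv y3) 0 0 1"
    by (simp_all add: comb3_def)
  have px: "p = comb3 (cv x1) (cv x2) (cv x3) p1 p2 p3" and qy: "q = comb3 (cv y1) (cv y2) (cv y3) q1 q2 q3"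
    using p' q' by (simp_all add: comb3_def)
  have D: "dt (crs (cv x2) (cv x3)) (cv x1) = ?dx" "dt (crs (cv x2) (cv x3)) (cv x2) = 0" "dt (crs (cv x2) (cv x3)) (cv x3) = 0"
    "dt (crs (cv x3) (cv x1)) (cv x2) = ?dx" "dt (crs (cv x3) (cv x1)) (cv x1) = 0" "dt (crs (cv x3) (cv x1)) (cv x3) = 0"
    "dt (crs (cv x1) (cv x2)) (cv x3) = ?dx" "dt (crs (cv x1) (cv x2)) (cv x1) = 0" "dt (crs (cv x1) (cv x2)) (cv x2) = 0"
    "dt (crs (cv y2) (cv y3)) (cv y1) = ?dy" "dt (crs (cv y2) (cv y3)) (cv y2) = 0" "dt (crs (cv y2) (cv y3)) (cv y3) = 0"
    "dt (crs (cv y3) (cv y1)) (cv y2) = ?dy" "dt (crs (cv y3) (cv y1)) (cv y1) = 0" "dt (crs (cv y3) (cv y1)) (cv y3) = 0"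
    "dt (crs (cv y1) (cv y2)) (cv y3) = ?dy" "dt (crs (cv y1) (cv y2)) (cv y1) = 0" "dt (crs (cv y1) (cv y2)) (cv y2) = 0"
    by (simp_all add: det3_crs) (simp_all add: det3_expand algebra_simps)
  have m: "p1 * q2 = e4 + e5 * (complex_of_real a1 * complex_of_real b2)" "p1 * q3 = e4 + e5 * (complex_of_real a1 * complex_of_real b3)"
    "p2 * q1 = e4 + e5 * (complex_of_real a2 * complex_of_real b1)" "p2 * q3 = e4 + e5 * (complex_of_real a2 * complex_of_real b3)"
    "p3 * q1 = e4 + e5 * (complex_of_real a3 * complex_of_real b1)" "p3 * q2 = e4 + e5 * (complex_of_real a3 * complex_of_real b2)"
  proof -
    have canc: "A = B" if "A * (?dx * ?dy) = B * (?dx * ?dy)" for A B using that dxc dyc by simp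
    note ev' = ev[of "crs (cv x2) (cv x3)" "crs (cv y3) (cv y1)"] ev[of "crs (cv x2) (cv x3)" "crs (cv y1) (cv y2)"]
       ev[of "crs (cv x3) (cv x1)" "crs (cv y2) (cv y3)"] ev[of "crs (cv x3) (cv x1)" "crs (cv y1) (cv y2)"]
       ev[of "crs (cv x1) (cv x2)" "crs (cv y2) (cv y3)"] ev[of "crs (cv x1) (cv x2)" "crs (cv y3) (cv y1)"]
    note ev'' = ev'[unfolded cv_comb3 px qy dual D]
    show "p1 * q2 = e4 + e5 * (complex_of_real a1 * complex_of_real b2)" by (rule canc) (use ev''(1) in \<open>simp add: algebra_simps\<close>)
    show "p1 * q3 = e4 + e5 * (complex_of_real a1 * complex_of_real b3)" by (rule canc) (use ev''(2) in \<open>simp add: algebra_simps\<close>)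
    show "p2 * q1 = e4 + e5 * (complex_of_real a2 * complex_of_real b1)" by (rule canc) (use ev''(3) in \<open>simp add: algebra_simps\<close>)
    show "p2 * q3 = e4 + e5 * (complex_of_real a2 * complex_of_real b3)" by (rule canc) (use ev''(4) in \<open>simp add: algebra_simps\<close>)
    show "p3 * q1 = e4 + e5 * (complex_of_real a3 * complex_of_real b1)" by (rule canc) (use ev''(5) in \<open>simp add: algebra_simps\<close>)
    show "p3 * q2 = e4 + e5 * (complex_of_real a3 * complex_of_real b2)" by (rule canc) (use ev''(6) in \<open>simp add: algebra_simps\<close>)
  qed
  have par: "crs (cv (comb3 v1 v2 v3 r1 r2 r3)) (comb3 (cv v1) (cv v2) (cv v3) (s * of_real r1) (s * of_real r2) (s * of_real r3)) = 0"
    for v1 v2 v3 and r1 r2 r3 :: real and s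
    by (simp add: cv_comb3 comb3_def vec3_eq_iff algebra_simps)
  have pn: "\<not> (p1 = 0 \<and> p2 = 0 \<and> p3 = 0)" and qn: "\<not> (q1 = 0 \<and> q2 = 0 \<and> q3 = 0)" using p q p' q' by auto
  have or: "complex_of_real r - complex_of_real s \<noteq> 0 \<longleftrightarrow> r - s \<noteq> 0" for r s by simp
  have "(p2 = 0 \<and> p3 = 0 \<and> q2 = 0 \<and> q3 = 0) \<or> (p1 = 0 \<and> p3 = 0 \<and> q1 = 0 \<and> q3 = 0) \<or> (p1 = 0 \<and> p2 = 0 \<and> q1 = 0 \<and> q2 = 0)
    \<or> (\<exists>s. p1 = s \<and> p2 = s \<and> p3 = s) \<and> (\<exists>s. q1 = s \<and> q2 = s \<and> q3 = s)
    \<or> (\<exists>s. p1 = s * of_real a1 \<and> p2 = s * of_real a2 \<and> p3 = s * of_real a3) \<and> (\<exists>s. q1 = s * of_real b1 \<and> q2 = s * of_real b2 \<and> q3 = s * of_real b3)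
    \<or> (\<exists>s. p1 = s * of_real P1 \<and> p2 = s * of_real P2 \<and> p3 = s * of_real P3)
      \<and> (\<exists>s. q1 = s * of_real Q1 \<and> q2 = s * of_real Q2 \<and> q3 = s * of_real Q3)"
    unfolding P1_def P2_def P3_def Q1_def Q2_def Q3_def of_real_mult of_real_diff
    by (rule six_rank_one_matrices[OF _ _ _ _ _ _ _ _ _ _ _ _ _ _ _ m pn qn])
      (use nz ad bd D12 D23 D31 in \<open>simp_all add: of_real_mult[symmetric] or del: of_real_mult\<close>)
  then show "\<exists>i<6. crs (cv (xs6 i)) p = 0 \<and> crs (cv (ys6 i)) q = 0"
  proof (elim disjE conjE exE)
    assume "p2 = 0" "p3 = 0" "q2 = 0" "q3 = 0"
    then show ?thesis using par[of x1 x2 x3 1 0 0 p1] par[of y1 y2 y3 1 0 0 q1]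
      by (intro exI[of _ 0]) (simp add: x px qy)
  next
    assume "p1 = 0" "p3 = 0" "q1 = 0" "q3 = 0"
    then show ?thesis using par[of x1 x2 x3 0 1 0 p2] par[of y1 y2 y3 0 1 0 q2]
      by (intro exI[of _ 1]) (simp add: x x' px qy)
  next
    assume "p1 = 0" "p2 = 0" "q1 = 0" "q2 = 0"
    then show ?thesis using par[of x1 x2 x3 0 0 1 p3] par[of y1 y2 y3 0 0 1 q3]
      by (intro exI[of _ 2]) (simp add: x px qy)
  next
    fix s s' assume "p1 = s" "p2 = s" "p3 = s" "q1 = s'" "q2 = s'" "q3 = s'"
    then show ?thesis using par[of x1 x2 x3 1 1 1 s] par[of y1 y2 y3 1 1 1 s']
      by (intro exI[of _ 3]) (simp add: x px qy)
  next
    fix s s' assume "p1 = s * of_real a1" "p2 = s * of_real a2" "p3 = s * of_real a3"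
       "q1 = s' * of_real b1" "q2 = s' * of_real b2" "q3 = s' * of_real b3"
    then show ?thesis using par[of x1 x2 x3 a1 a2 a3 s] par[of y1 y2 y3 b1 b2 b3 s']
      by (intro exI[of _ 4]) (simp add: x px qy)
  next
    fix s s' assume "p1 = s * of_real P1" "p2 = s * of_real P2" "p3 = s * of_real P3"
       "q1 = s' * of_real Q1" "q2 = s' * of_real Q2" "q3 = s' * of_real Q3"
    then show ?thesis using par[of x1 x2 x3 P1 P2 P3 s] par[of y1 y2 y3 Q1 Q2 Q3 s']
      by (intro exI[of _ 5]) (simp add: x px qy)
  qed
qed

end

section \<open>Rank of a tensor and lines of the orthogonal pencil\<close>

text \<open>Independence of an indexed family: a repeated vector counts as a dependence, as it would
  not for the image set.\<close>

definition findep :: "'i set \<Rightarrow> ('i \<Rightarrow> 'e::euclidean_space) \<Rightarrow> bool" where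
  "findep I f \<longleftrightarrow> (\<forall>c. (\<Sum>i\<in>I. c i *\<^sub>R f i) = 0 \<longrightarrow> (\<forall>i\<in>I. c i = 0))"

lemma findepD: "findep I f \<Longrightarrow> (\<Sum>i\<in>I. c i *\<^sub>R f i) = 0 \<Longrightarrow> i \<in> I \<Longrightarrow> c i = 0"
  unfolding findep_def by blast

lemma findep_iff:
  assumes "finite I"
  shows "findep I f \<longleftrightarrow> inj_on f I \<and> independent (f ` I)"
proof
  assume F: "findep I f"
  have "inj_on f I"
  proof (rule inj_onI, rule ccontr)
    fix i j assume ij: "i \<in> I" "j \<in> I" "f i = f j" "i \<noteq> j"
    have "(\<Sum>l\<in>I. (of_bool (l = i) - of_bool (l = j)) *\<^sub>R f l)
       = (\<Sum>l\<in>I. if l = i then f l else 0) - (\<Sum>l\<in>I. if l = j then f l else 0)"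
      by (subst sum_subtractf[symmetric]) (intro sum.cong, auto)
    also have "\<dots> = 0" using ij assms by (simp add: sum.delta)
    finally show False using findepD[OF F _ ij(1), of "\<lambda>l. of_bool (l = i) - of_bool (l = j)"] ij(4) by simp
  qed
  moreover have "independent (f ` I)"
  proof (rule independent_if_scalars_zero)
    fix g x assume "(\<Sum>x\<in>f ` I. g x *\<^sub>R x) = 0" "x \<in> f ` I"
    then show "g x = 0" using findepD[OF F, of "\<lambda>i. g (f i)"] by (auto simp: sum.reindex[OF \<open>inj_on f I\<close>])
  qed (use assms in simp)
  ultimately show "inj_on f I \<and> independent (f ` I)" ..
next
  assume A: "inj_on f I \<and> independent (f ` I)"
  show "findep I f" unfolding findep_def
  proof (intro allI impI ballI)
    fix c i assume s: "(\<Sum>i\<in>I. c i *\<^sub>R f i) = 0" and i: "i \<in> I"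
    have "(\<Sum>x\<in>f ` I. c (the_inv_into I f x) *\<^sub>R x) = (\<Sum>i\<in>I. c i *\<^sub>R f i)"
      using A by (subst sum.reindex) (auto intro!: sum.cong simp: the_inv_into_f_f)
    then have "c (the_inv_into I f (f i)) = 0"
      using independentD[of "f ` I" "f ` I" "\<lambda>x. c (the_inv_into I f x)" "f i"] A assms s i by simp
    then show "c i = 0" using A i by (simp add: the_inv_into_f_f)
  qed
qed

lemma findep_dim:
  assumes "finite I" "findep I f" shows "dim (span (f ` I)) = card I"
  using assms by (simp add: findep_iff dim_eq_card_independent card_image)

lemma span_image_combination:
  assumes "finite I" "w \<in> span (f ` I)"
  obtains c where "w = (\<Sum>i\<in>I. c i *\<^sub>R f i)"
proof -
  have "\<exists>c. w = (\<Sum>i\<in>I. c i *\<^sub>R f i)"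
    using assms(2)
  proof (induction rule: span_induct_alt)
    case base show ?case by (rule exI[of _ "\<lambda>_. 0"]) simp
  next
    case (step a x y)
    then obtain c i where c: "y = (\<Sum>i\<in>I. c i *\<^sub>R f i)" and i: "i \<in> I" "x = f i" by blast
    have "(\<Sum>l\<in>I. (c l + a * of_bool (l = i)) *\<^sub>R f l) = (\<Sum>l\<in>I. c l *\<^sub>R f l) + (\<Sum>l\<in>I. if l = i then a *\<^sub>R f l else 0)"
      by (subst sum.distrib[symmetric]) (intro sum.cong, auto simp: algebra_simps)
    also have "\<dots> = a *\<^sub>R x + y" using assms(1) i c by simp
    finally show ?case by metis
  qed
  then show ?thesis using that by blast
qed

definition outer :: "real^3 \<Rightarrow> real^3 \<Rightarrow> real^3^3" where
  "outer x y = (\<chi> i j. x$i * y$j)"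

lemma outer_nth [simp]: "outer x y $ i $ j = x$i * y$j" by (simp add: outer_def)

lemma outer_linear [simp]: "outer (x + x') y = outer x y + outer x' y" "outer x (y + y') = outer x y + outer x y'"
  "outer (c *s x) y = c *\<^sub>R outer x y" "outer x (c *s y) = c *\<^sub>R outer x y" "outer 0 y = 0" "outer x 0 = 0"
  by (simp_all add: cart_eq_iff algebra_simps)

lemma fl_outer: "fl M x y $ l = M$l \<bullet> outer x y"
  by (simp add: fl_def dt_def matrix_vector_mult_def inner_vec_def sum_distrib_left mult_ac)

lemma inner_mat: "A \<bullet> w = (\<Sum>i\<in>UNIV. \<Sum>j\<in>UNIV. A$i$j * w$i$j)" for A w :: "real^3^3"
  by (simp add: inner_vec_def)

lemma pmat_sum: "pmat M z = (\<Sum>l\<in>UNIV. z$l *\<^sub>R M$l)" for M :: "real^3^3^'l"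
  by (simp add: pmat_def cart_eq_iff)

text \<open>The conditions of \<open>gpencil\<close> phrased for a subspace, so that they see a
  tensor only through the span of its slices.\<close>

definition good_space :: "(real^3^3) set \<Rightarrow> bool" where
  "good_space W \<longleftrightarrow>
    (\<forall>x y y'. x \<noteq> 0 \<longrightarrow> outer x y \<in> W \<longrightarrow> outer x y' \<in> W \<longrightarrow> crs y y' = 0) \<and>
    (\<forall>y x x'. y \<noteq> 0 \<longrightarrow> outer x y \<in> W \<longrightarrow> outer x' y \<in> W \<longrightarrow> crs x x' = 0) \<and>
    (\<forall>x1 x2 y1 y2 y3. y1 \<noteq> 0 \<longrightarrow> y2 \<noteq> 0 \<longrightarrow> y3 \<noteq> 0 \<longrightarrow> outer x1 y1 \<in> W \<longrightarrow> outer x2 y2 \<in> W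
        \<longrightarrow> outer (x1 + x2) y3 \<in> W \<longrightarrow> crs x1 x2 = 0) \<and>
    (\<forall>x1 x2 x3 y1 y2. x1 \<noteq> 0 \<longrightarrow> x2 \<noteq> 0 \<longrightarrow> x3 \<noteq> 0 \<longrightarrow> outer x1 y1 \<in> W \<longrightarrow> outer x2 y2 \<in> W
        \<longrightarrow> outer x3 (y1 + y2) \<in> W \<longrightarrow> crs y1 y2 = 0) \<and>
    (\<forall>x y u v. x \<noteq> 0 \<longrightarrow> y \<noteq> 0 \<longrightarrow> outer x y \<in> W \<longrightarrow> outer x v + outer u y \<in> W \<longrightarrow> crs u x = 0)"

definition rank_le5 :: "(real^3^3)^5 \<Rightarrow> bool" where
  "rank_le5 T \<longleftrightarrow> (\<exists>a b. \<forall>k. T$k \<in> span ((\<lambda>i. outer (a i) (b i)) ` {..<5::nat}))"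

text \<open>One inclusion is immediate, and 9 - 4 = 5 makes the dimensions agree.\<close>

lemma orthogonal_complement_frame:
  fixes T :: "(real^3^3)^5" and M :: "(real^3^3)^4"
  assumes T: "findep UNIV (($) T)" and M: "findep UNIV (($) M)" and o: "\<And>k l. M$l \<bullet> T$k = 0"
  shows "span (range (($) T)) = {w. \<forall>l. M$l \<bullet> w = 0}"
proof -
  have dT: "dim (span (range (($) T))) = 5" using findep_dim[OF _ T] by simp
  have dM: "dim (span (range (($) M))) = 4" using findep_dim[OF _ M] by simp
  have e: "{w. \<forall>l. M$l \<bullet> w = 0} = {y \<in> UNIV. \<forall>x \<in> span (range (($) M)). orthogonal x y}" (is "?L = ?R")
  proof
    show "?R \<subseteq> ?L"
    proof clarify
      fix y l assume "\<forall>x\<in>span (range (($) M)). orthogonal x y"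
      moreover have "M$l \<in> span (range (($) M))" by (intro span_base) simp
      ultimately show "M$l \<bullet> y = 0" unfolding Linear_Algebra.orthogonal_def by blast
    qed
    show "?L \<subseteq> ?R"
    proof
      fix w assume w: "w \<in> ?L"
      have "orthogonal x w" if "x \<in> span (range (($) M))" for x
        using that by (induction rule: span_induct_alt) (use w in \<open>auto simp: Linear_Algebra.orthogonal_def inner_add_left\<close>)
      then show "w \<in> ?R" by simp
    qed
  qed
  have "dim ?R + dim (span (range (($) M))) = dim (UNIV :: (real^3^3) set)"
    by (rule dim_subspace_orthogonal_to_vectors) (simp_all add: subspace_span)
  then have d: "dim ?R = 5" unfolding dM by simp
  have "subspace {w. \<forall>l. M$l \<bullet> w = 0}" by (auto simp: subspace_def inner_add_right)
  moreover have "span (range (($) T)) \<subseteq> {w. \<forall>l. M$l \<bullet> w = 0}"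
    by (rule span_minimal) (use o calculation in auto)
  ultimately show ?thesis
    using d dT unfolding e by (intro subspace_dim_equal) (auto simp: e[symmetric])
qed

context gpencil
begin

lemma sols_det3:
  assumes s: "\<And>i. i \<in> {i1,i2,i3} \<Longrightarrow> x i \<noteq> 0 \<and> y i \<noteq> 0 \<and> fl M (x i) (y i) = 0"
    and c: "crs (x i1) (x i2) \<noteq> 0" "crs (x i1) (x i3) \<noteq> 0" "crs (x i2) (x i3) \<noteq> 0"
  shows "det3 (x i1) (x i2) (x i3) \<noteq> 0"
proof
  assume "det3 (x i1) (x i2) (x i3) = 0"
  then obtain p q where e: "x i3 = p *s x i1 + q *s x i2" using det3_eq_0_imp c by metis
  have "crs (x i2) (x i3) = p *s crs (x i2) (x i1)" "crs (x i1) (x i3) = q *s crs (x i1) (x i2)" by (simp_all add: e)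
  then have pq: "p \<noteq> 0" "q \<noteq> 0" using c by auto
  have k: "fl M (p *s x i1 + q *s x i2) (y i3) = 0" using s[of i3] unfolding e by simp
  have "crs (p *s x i1) (q *s x i2) = 0"
    using s[of i1] s[of i2] s[of i3] by (intro g2[of "y i1" "y i2" "y i3", OF _ _ _ _ _ k]) simp_all
  then show False using c pq by (simp add: vector_mul_eq_0)
qed

lemma sols_crs_snd:
  assumes "x \<noteq> 0" "y \<noteq> 0" "fl M x y = 0" "x' \<noteq> 0" "y' \<noteq> 0" "fl M x' y' = 0" "crs x x' \<noteq> 0"
  shows "crs y y' \<noteq> 0"
proof
  assume "crs y y' = 0"
  then obtain c where c: "y' = c *s y" using crs_eq_0_imp_scale assms(2) by blast
  then have "c \<noteq> 0" using assms(5) by auto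
  then have "fl M x' y = 0" using assms(6) c by (simp add: vector_mul_eq_0)
  then show False using g1'[OF assms(2,3)] assms(7) by blast
qed

end

lemma dt_outer_sum:
  assumes "finite I" "(\<Sum>i\<in>I. c i *\<^sub>R outer (x i) (y i)) = 0"
  shows "(\<Sum>i\<in>I. c i * (dt f (x i) * dt g (y i))) = 0"
proof -
  define ev where "ev w = (\<Sum>i\<in>UNIV. \<Sum>j\<in>UNIV. f$i * g$j * (w$i$j))" for w :: "real^3^3"
  have "ev 0 = 0" by (simp add: ev_def)
  have a: "ev (v + w) = ev v + ev w" for v w by (simp add: ev_def algebra_simps sum.distrib)
  have s: "ev (k *\<^sub>R outer p q) = k * (dt f p * dt g q)" for k p q
    by (simp add: ev_def dt_3 sum_3 algebra_simps)
  have "ev (\<Sum>i\<in>I. c i *\<^sub>R outer (x i) (y i)) = (\<Sum>i\<in>I. ev (c i *\<^sub>R outer (x i) (y i)))"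
    using assms(1) by (induction I rule: finite_induct) (simp_all add: \<open>ev 0 = 0\<close> a)
  then show ?thesis using assms(2) \<open>ev 0 = 0\<close> by (simp add: s)
qed

locale frame_pair =
  fixes T :: "(real^3^3)^5" and M :: "(real^3^3)^4"
  assumes T: "findep UNIV (($) T)" and M: "findep UNIV (($) M)" and o: "\<And>k l. M$l \<bullet> T$k = 0"
    and good: "good_space (span (range (($) T)))"
begin

lemma span_T: "span (range (($) T)) = {w. \<forall>l. M$l \<bullet> w = 0}"
  by (rule orthogonal_complement_frame[OF T M o])

lemma mem_W: "outer x y \<in> span (range (($) T)) \<longleftrightarrow> fl M x y = 0"
  "outer x v + outer u y \<in> span (range (($) T)) \<longleftrightarrow> fl M x v + fl M u y = 0"
  unfolding span_T by (simp_all add: cart_eq_iff fl_outer inner_add_right)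

sublocale gpencil M
proof
  show "z = 0" if "pmat M z = 0" for z
    using findepD[OF M, of "\<lambda>l. z$l"] that by (simp add: pmat_sum cart_eq_iff)
  note g = good[unfolded good_space_def mem_W]
  show "crs y y' = 0" if "x \<noteq> 0" "fl M x y = 0" "fl M x y' = 0" for x y y'
    by (rule g[THEN conjunct1, rule_format, OF that])
  show "crs x x' = 0" if "y \<noteq> 0" "fl M x y = 0" "fl M x' y = 0" for y x x'
    by (rule g[THEN conjunct2, THEN conjunct1, rule_format, OF that])
  show "crs x1 x2 = 0" if "y1 \<noteq> 0" "y2 \<noteq> 0" "y3 \<noteq> 0" "fl M x1 y1 = 0" "fl M x2 y2 = 0" "fl M (x1 + x2) y3 = 0"
    for x1 x2 y1 y2 y3 by (rule g[THEN conjunct2, THEN conjunct2, THEN conjunct1, rule_format, OF that])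
  show "crs y1 y2 = 0" if "x1 \<noteq> 0" "x2 \<noteq> 0" "x3 \<noteq> 0" "fl M x1 y1 = 0" "fl M x2 y2 = 0" "fl M x3 (y1 + y2) = 0"
    for x1 x2 x3 y1 y2 by (rule g[THEN conjunct2, THEN conjunct2, THEN conjunct2, THEN conjunct1, rule_format, OF that])
  show "crs u x = 0" if "x \<noteq> 0" "y \<noteq> 0" "fl M x y = 0" "fl M x v + fl M u y = 0" for x y u v
    by (rule g[THEN conjunct2, THEN conjunct2, THEN conjunct2, THEN conjunct2, rule_format, OF that])
qed

text \<open>For each index the other four split into two pairs. A form vanishing on the left factors
  of one pair times a form vanishing on the right factors of the other kills all terms but the
  chosen one, which survives since no three factors are collinear. So the five matrices are
  independent and span the same space as the slices.\<close>

lemma rank_le5_if_solutions: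
  assumes R: "R \<subseteq> sols M" "finite R" "card R = 5" "\<And>s t. s \<in> R \<Longrightarrow> t \<in> R \<Longrightarrow> s \<noteq> t \<Longrightarrow> crs (fst s) (fst t) \<noteq> 0"
  shows "rank_le5 T"
proof -
  interpret tr: gpencil "trM M" by (rule gpencil_trM)
  obtain e where e: "bij_betw e {..<5::nat} R" using R(2,3) ex_bij_betw_nat_finite[of R] by (metis atLeast0LessThan)
  define x y where "x i = fst (e i)" and "y i = snd (e i)" for i
  have eR: "e i \<in> R" if "i < 5" for i using e that by (auto simp: bij_betw_def)
  have s: "x i \<noteq> 0 \<and> y i \<noteq> 0 \<and> fl M (x i) (y i) = 0" if "i < 5" for i
    using eR[OF that] R(1) by (auto simp: sols_def x_def y_def split: prod.splits)
  have cx: "crs (x i) (x j) \<noteq> 0" if "i < 5" "j < 5" "i \<noteq> j" for i j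
    unfolding x_def using that e by (intro R(4) eR) (auto simp: bij_betw_def inj_on_def)
  have cy: "crs (y i) (y j) \<noteq> 0" if "i < 5" "j < 5" "i \<noteq> j" for i j
    using sols_crs_snd[of "x i" "y i" "x j" "y j"] s cx that by blast
  have dx: "det3 (x i) (x j) (x k) \<noteq> 0" if "i < 5" "j < 5" "k < 5" "i \<noteq> j" "i \<noteq> k" "j \<noteq> k" for i j k
    by (rule sols_det3[of i j k x y]) (use that s cx in auto)
  have dy: "det3 (y i) (y j) (y k) \<noteq> 0" if "i < 5" "j < 5" "k < 5" "i \<noteq> j" "i \<noteq> k" "j \<noteq> k" for i j k
    by (rule tr.sols_det3[of i j k y x]) (use that s cy in auto)
  have ind: "findep {..<5::nat} (\<lambda>i. outer (x i) (y i))" unfolding findep_def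
  proof (intro allI impI ballI)
    fix c :: "nat \<Rightarrow> real" and m :: nat assume c: "(\<Sum>i<5. c i *\<^sub>R outer (x i) (y i)) = 0" and "m \<in> {..<5}"
    have key: "c m = 0" if m: "m < 5" and I: "{..<5} = {m,i,j,k,l}" "distinct [m,i,j,k,l]" for m i j k l :: nat
    proof -
      have lt: "i < 5" "j < 5" "k < 5" "l < 5" using I(1) by auto
      have "(\<Sum>n<5. c n * (dt (crs (x i) (x j)) (x n) * dt (crs (y k) (y l)) (y n))) = 0"
        by (rule dt_outer_sum[OF _ c]) simp
      then have "c m * (det3 (x i) (x j) (x m) * det3 (y k) (y l) (y m)) = 0"
        unfolding I(1) using I(2) by (simp add: det3_crs)
      moreover have "det3 (x i) (x j) (x m) \<noteq> 0" "det3 (y k) (y l) (y m) \<noteq> 0"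
        using dx[of i j m] dy[of k l m] I(2) lt m by auto
      ultimately show ?thesis by simp
    qed
    have "m = 0 \<or> m = 1 \<or> m = 2 \<or> m = 3 \<or> m = 4" using \<open>m \<in> {..<5}\<close> by auto
    moreover have "{..<5} = {0,1,2,3,4::nat}" by auto
    ultimately show "c m = 0"
      using key[of 0 1 2 3 4] key[of 1 0 2 3 4] key[of 2 0 1 3 4] key[of 3 0 1 2 4] key[of 4 0 1 2 3]
      by (elim disjE) (auto simp: insert_commute)
  qed
  let ?S = "(\<lambda>i. outer (x i) (y i)) ` {..<5::nat}"
  have "?S \<subseteq> span (range (($) T))" using s by (auto simp: mem_W)
  moreover have "independent ?S" "card ?S = 5" using ind by (auto simp: findep_iff card_image)
  moreover have "dim (span (range (($) T))) = 5" using findep_dim[OF _ T] by simp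
  ultimately have "span (range (($) T)) \<subseteq> span ?S"
    by (intro card_ge_dim_independent[of ?S "span (range (($) T))"]) simp_all
  then show ?thesis unfolding rank_le5_def by (meson span_base rangeI subsetD)
qed

text \<open>Five independent slices inside the span of five rank-one matrices force the two spans to
  be equal. Hence the rank-one matrices are solutions, and it remains to bring them into the normal
  form of \<open>frame\<close>.\<close>

lemma six_points_if_rank_le5:
  assumes "rank_le5 T"
  shows "\<exists>x y. six_points M x y"
proof -
  obtain x y where xy: "\<And>k. T$k \<in> span ((\<lambda>i. outer (x i) (y i)) ` {..<5::nat})" using assms unfolding rank_le5_def by blast
  let ?S = "(\<lambda>i. outer (x i) (y i)) ` {..<5::nat}"
  interpret tr: gpencil "trM M" by (rule gpencil_trM)
  have dT: "dim (span (range (($) T))) = 5" using findep_dim[OF _ T] by simp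
  have sub: "span (range (($) T)) \<subseteq> span ?S" by (rule span_minimal) (use xy in \<open>auto simp: subspace_span\<close>)
  have "5 \<le> dim (span ?S)" using dim_subset[OF sub] dT by simp
  moreover have cS: "card ?S \<le> 5" using card_image_le[of "{..<5::nat}" "\<lambda>i. outer (x i) (y i)"] by simp
  ultimately have c5: "card ?S = 5" "dim (span ?S) = 5" using dim_le_card'[of ?S] by simp_all
  have inj: "inj_on (\<lambda>i. outer (x i) (y i)) {..<5::nat}" using c5(1) by (intro eq_card_imp_inj_on) simp_all
  have "independent ?S" by (rule card_le_dim_spanning[of _ "span ?S"]) (use c5 in \<open>auto simp: span_superset\<close>)
  then have ind: "findep {..<5::nat} (\<lambda>i. outer (x i) (y i))" using inj by (simp add: findep_iff)
  have eqS: "span (range (($) T)) = span ?S" by (rule subspace_dim_equal) (use sub c5 dT in \<open>auto simp: subspace_span\<close>)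
  have nz: "x i \<noteq> 0 \<and> y i \<noteq> 0" if "i < 5" for i
  proof (rule ccontr)
    assume "\<not> ?thesis"
    then have "outer (x i) (y i) = 0" by auto
    then have "0 \<in> ?S" by (intro image_eqI[of _ _ i]) (use that in simp_all)
    from real_vector.dependent_zero[OF this] show False using \<open>independent ?S\<close> by contradiction
  qed
  have fl0: "fl M (x i) (y i) = 0" if "i < 5" for i
    unfolding mem_W(1)[symmetric] eqS using that by (intro span_base) auto
  have s: "x i \<noteq> 0 \<and> y i \<noteq> 0 \<and> fl M (x i) (y i) = 0" if "i < 5" for i
    using nz fl0 that by blast
  have cx: "crs (x i) (x j) \<noteq> 0" if ij: "i < 5" "j < 5" "i \<noteq> j" for i j
  proof
    assume "crs (x i) (x j) = 0"
    then obtain c where c: "x j = c *s x i" using crs_eq_0_imp_scale s ij by blast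
    then have "c \<noteq> 0" using s[OF ij(2)] by auto
    then have "fl M (x i) (y j) = 0" using fl0[OF ij(2)] c by (simp add: vector_mul_eq_0)
    then have "crs (y i) (y j) = 0" using g1 s ij by blast
    then obtain d where d: "y j = d *s y i" using crs_eq_0_imp_scale s ij by blast
    have "(\<Sum>l<5. (c * d * of_bool (l = i) - of_bool (l = j)) *\<^sub>R outer (x l) (y l))
      = (\<Sum>l<5. if l = i then (c * d) *\<^sub>R outer (x l) (y l) else 0) - (\<Sum>l<5. if l = j then outer (x l) (y l) else 0)"
      by (subst sum_subtractf[symmetric]) (intro sum.cong, auto simp: algebra_simps)
    also have "\<dots> = 0" using ij by (simp add: c d)
    finally have z: "(\<Sum>l<5. (c * d * of_bool (l = i) - of_bool (l = j)) *\<^sub>R outer (x l) (y l)) = 0" .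
    from findepD[OF ind z, of j] ij show False by simp
  qed
  have cy: "crs (y i) (y j) \<noteq> 0" if "i < 5" "j < 5" "i \<noteq> j" for i j
    using sols_crs_snd[of "x i" "y i" "x j" "y j"] s cx that by blast
  have dx: "det3 (x i) (x j) (x k) \<noteq> 0" if "i < 5" "j < 5" "k < 5" "i \<noteq> j" "i \<noteq> k" "j \<noteq> k" for i j k
    by (rule sols_det3[of i j k x y]) (use that s cx in auto)
  have dy: "det3 (y i) (y j) (y k) \<noteq> 0" if "i < 5" "j < 5" "k < 5" "i \<noteq> j" "i \<noteq> k" "j \<noteq> k" for i j k
    by (rule tr.sols_det3[of i j k y x]) (use that s cy in auto)
  \<comment> \<open>The scales of the first three vectors are fixed by making the fourth their sum.
    The coordinates of the fifth, and their differences, are then quotients of determinants of three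
    of the given vectors, up to nonzero scalars.\<close>
  have normalise: "\<exists>p1 p2 p3 a1 a2 a3. z 3 = comb3 (p1 *s z 0) (p2 *s z 1) (p3 *s z 2) 1 1 1 \<and>
      z 4 = comb3 (p1 *s z 0) (p2 *s z 1) (p3 *s z 2) a1 a2 a3 \<and> p1 \<noteq> 0 \<and> p2 \<noteq> 0 \<and> p3 \<noteq> 0 \<and>
      det3 (p1 *s z 0) (p2 *s z 1) (p3 *s z 2) \<noteq> 0 \<and>
      a1 \<noteq> 0 \<and> a2 \<noteq> 0 \<and> a3 \<noteq> 0 \<and> a1 \<noteq> a2 \<and> a2 \<noteq> a3 \<and> a1 \<noteq> a3"
    if D': "\<forall>i<5. \<forall>j<5. \<forall>k<5. i \<noteq> j \<longrightarrow> i \<noteq> k \<longrightarrow> j \<noteq> k \<longrightarrow> det3 (z i) (z j) (z k) \<noteq> 0" for z :: "nat \<Rightarrow> real^3"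
  proof -
    note D = D'[rule_format]
    have d: "det3 (z 0) (z 1) (z 2) \<noteq> 0" by (rule D) simp_all
    obtain p1 p2 p3 where z3: "z 3 = p1 *s z 0 + p2 *s z 1 + p3 *s z 2" using basis3_combination[OF d] .
    have "det3 (z 3) (z 1) (z 2) \<noteq> 0" "det3 (z 0) (z 3) (z 2) \<noteq> 0" "det3 (z 0) (z 1) (z 3) \<noteq> 0" by (rule D; simp)+
    then have p: "p1 \<noteq> 0" "p2 \<noteq> 0" "p3 \<noteq> 0" by (auto simp: z3)
    define w1 w2 w3 where w: "w1 = p1 *s z 0" "w2 = p2 *s z 1" "w3 = p3 *s z 2"
    have dw: "det3 w1 w2 w3 \<noteq> 0" using d p by (simp add: w)
    obtain a1 a2 a3 where z4: "z 4 = a1 *s w1 + a2 *s w2 + a3 *s w3" using basis3_combination[OF dw] .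
    have "det3 (z 4) (z 1) (z 2) \<noteq> 0" "det3 (z 0) (z 4) (z 2) \<noteq> 0" "det3 (z 0) (z 1) (z 4) \<noteq> 0" by (rule D; simp)+
    then have a: "a1 \<noteq> 0" "a2 \<noteq> 0" "a3 \<noteq> 0" by (auto simp: z4 w)
    have "det3 (z 3) (z 4) (z 2) \<noteq> 0" "det3 (z 3) (z 0) (z 4) \<noteq> 0" "det3 (z 3) (z 4) (z 1) \<noteq> 0" by (rule D; simp)+
    moreover have "p3 * det3 (z 3) (z 4) (z 2) = (a2 - a1) * det3 w1 w2 w3" "p1 * det3 (z 3) (z 0) (z 4) = (a2 - a3) * det3 w1 w2 w3"
       "p2 * det3 (z 3) (z 4) (z 1) = (a1 - a3) * det3 w1 w2 w3"
      unfolding z4 z3 w by (simp_all add: det3_expand algebra_simps)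
    ultimately have "a1 \<noteq> a2" "a2 \<noteq> a3" "a1 \<noteq> a3" using p by auto
    moreover have "z 3 = comb3 w1 w2 w3 1 1 1" "z 4 = comb3 w1 w2 w3 a1 a2 a3"
      unfolding comb3_def z4 by (simp_all add: z3 w)
    ultimately have fin: "z 3 = comb3 w1 w2 w3 1 1 1 \<and> z 4 = comb3 w1 w2 w3 a1 a2 a3 \<and> p1 \<noteq> 0 \<and> p2 \<noteq> 0 \<and> p3 \<noteq> 0 \<and>
      det3 w1 w2 w3 \<noteq> 0 \<and> a1 \<noteq> 0 \<and> a2 \<noteq> 0 \<and> a3 \<noteq> 0 \<and> a1 \<noteq> a2 \<and> a2 \<noteq> a3 \<and> a1 \<noteq> a3"
      using a p dw by (intro conjI)
    show ?thesis
      by (rule exI[of _ p1], rule exI[of _ p2], rule exI[of _ p3], rule exI[of _ a1], rule exI[of _ a2], rule exI[of _ a3])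
        (rule fin[unfolded w])
  qed
  have dx': "\<forall>i<5. \<forall>j<5. \<forall>k<5. i \<noteq> j \<longrightarrow> i \<noteq> k \<longrightarrow> j \<noteq> k \<longrightarrow> det3 (x i) (x j) (x k) \<noteq> 0"
    and dy': "\<forall>i<5. \<forall>j<5. \<forall>k<5. i \<noteq> j \<longrightarrow> i \<noteq> k \<longrightarrow> j \<noteq> k \<longrightarrow> det3 (y i) (y j) (y k) \<noteq> 0"
    by (intro allI impI dx dy; assumption)+
  obtain p1 p2 p3 a1 a2 a3 where X: "x 3 = comb3 (p1 *s x 0) (p2 *s x 1) (p3 *s x 2) 1 1 1"
      "x 4 = comb3 (p1 *s x 0) (p2 *s x 1) (p3 *s x 2) a1 a2 a3" "p1 \<noteq> 0" "p2 \<noteq> 0" "p3 \<noteq> 0"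
      "det3 (p1 *s x 0) (p2 *s x 1) (p3 *s x 2) \<noteq> 0"
      "a1 \<noteq> 0" "a2 \<noteq> 0" "a3 \<noteq> 0" "a1 \<noteq> a2" "a2 \<noteq> a3" "a1 \<noteq> a3" using normalise[OF dx'] by blast
  obtain q1 q2 q3 b1 b2 b3 where Y: "y 3 = comb3 (q1 *s y 0) (q2 *s y 1) (q3 *s y 2) 1 1 1"
      "y 4 = comb3 (q1 *s y 0) (q2 *s y 1) (q3 *s y 2) b1 b2 b3" "q1 \<noteq> 0" "q2 \<noteq> 0" "q3 \<noteq> 0"
      "det3 (q1 *s y 0) (q2 *s y 1) (q3 *s y 2) \<noteq> 0"
      "b1 \<noteq> 0" "b2 \<noteq> 0" "b3 \<noteq> 0" "b1 \<noteq> b2" "b2 \<noteq> b3" "b1 \<noteq> b3" using normalise[OF dy'] by blast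
  interpret fr: frame M "p1 *s x 0" "p2 *s x 1" "p3 *s x 2" "q1 *s y 0" "q2 *s y 1" "q3 *s y 2" a1 a2 a3 b1 b2 b3
  proof
    show "fl M (p1 *s x 0) (q1 *s y 0) = 0" "fl M (p2 *s x 1) (q2 *s y 1) = 0" "fl M (p3 *s x 2) (q3 *s y 2) = 0"
      using fl0[of 0] fl0[of 1] fl0[of 2] by simp_all
    show "fl M (comb3 (p1 *s x 0) (p2 *s x 1) (p3 *s x 2) 1 1 1) (comb3 (q1 *s y 0) (q2 *s y 1) (q3 *s y 2) 1 1 1) = 0"
      using fl0[of 3] unfolding X(1) Y(1) by simp
    show "fl M (comb3 (p1 *s x 0) (p2 *s x 1) (p3 *s x 2) a1 a2 a3) (comb3 (q1 *s y 0) (q2 *s y 1) (q3 *s y 2) b1 b2 b3) = 0"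
      using fl0[of 4] unfolding X(2) Y(2) by simp
  qed (use X Y in simp_all)
  have "six_points M fr.xs6 fr.ys6"
  proof (rule fr.six_points)
    fix w :: "real^3^3" assume "\<And>l. (\<Sum>i\<in>UNIV. \<Sum>j\<in>UNIV. M$l$i$j * w$i$j) = 0"
    then have "w \<in> span ?S" unfolding eqS[symmetric] span_T by (simp add: inner_mat)
    then obtain c where c: "w = (\<Sum>i<5. c i *\<^sub>R outer (x i) (y i))" by (rule span_image_combination[rotated]) auto
    have I: "{..<5} = {0,1,2,3,4::nat}" by auto
    have "w$i$j = c 0 * (x 0$i * y 0$j) + c 1 * (x 1$i * y 1$j) + c 2 * (x 2$i * y 2$j) + c 3 * (x 3$i * y 3$j) + c 4 * (x 4$i * y 4$j)" for i j
      unfolding c I by simp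
    then have "w$i$j = c 0/(p1*q1) * ((p1 *s x 0)$i * (q1 *s y 0)$j) + c 1/(p2*q2) * ((p2 *s x 1)$i * (q2 *s y 1)$j)
       + c 2/(p3*q3) * ((p3 *s x 2)$i * (q3 *s y 2)$j) + c 3 * (x 3$i * y 3$j) + c 4 * (x 4$i * y 4$j)" for i j
      using X(3-5) Y(3-5) by simp
    then show "\<exists>c1 c2 c3 c4 c5. \<forall>i j. w$i$j = c1 * ((p1 *s x 0)$i * (q1 *s y 0)$j) + c2 * ((p2 *s x 1)$i * (q2 *s y 1)$j)
        + c3 * ((p3 *s x 2)$i * (q3 *s y 2)$j)
        + c4 * (comb3 (p1 *s x 0) (p2 *s x 1) (p3 *s x 2) 1 1 1$i * comb3 (q1 *s y 0) (q2 *s y 1) (q3 *s y 2) 1 1 1$j)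
        + c5 * (comb3 (p1 *s x 0) (p2 *s x 1) (p3 *s x 2) a1 a2 a3$i * comb3 (q1 *s y 0) (q2 *s y 1) (q3 *s y 2) b1 b2 b3$j)"
      unfolding X(1,2)[symmetric] Y(1,2)[symmetric] by blast
  qed
  then show ?thesis by blast
qed

theorem rank_le5_iff: "rank_le5 T \<longleftrightarrow> card (lines M) = 27 \<and> (\<forall>L\<in>lines M. real_span L)"
proof
  assume "rank_le5 T"
  then obtain x y where "six_points M x y" using six_points_if_rank_le5 by blast
  then interpret six_points M x y .
  show "card (lines M) = 27 \<and> (\<forall>L\<in>lines M. real_span L)" using lines_card by blast
next
  assume "card (lines M) = 27 \<and> (\<forall>L\<in>lines M. real_span L)"
  then show "rank_le5 T" using five_solutions rank_le5_if_solutions by metis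
qed

end

section \<open>Coordinates and measurability\<close>

text \<open>A closed set is a countable union of compact ones, so its continuous image is an F_sigma
  set. Both events are differences of two such images.\<close>

lemma borel_closed_image:
  fixes f :: "'a::euclidean_space \<Rightarrow> 'b::euclidean_space"
  assumes "closed S" "continuous_on UNIV f"
  shows "f ` S \<in> sets borel"
proof -
  have "S = (\<Union>n::nat. S \<inter> cball 0 (real n))"
    by (auto simp: real_arch_simple)
  then have "f ` S = (\<Union>n::nat. f ` (S \<inter> cball 0 (real n)))" by (metis image_UN)
  moreover have "closed (f ` (S \<inter> cball 0 (real n)))" for n :: nat
    using assms by (intro compact_imp_closed compact_continuous_image closed_Int_compact[OF assms(1) compact_cball])
      (auto intro: continuous_on_subset)
  ultimately show ?thesis by (auto intro!: borel_closed)
qed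

section \<open>Passage from natural-number indices to vectors over numeral types\<close>

definition ix :: "nat \<Rightarrow> 'n::finite" where
  "ix = (SOME f. bij_betw f {..<CARD('n)} UNIV)"

definition jx :: "'n::finite \<Rightarrow> nat" where
  "jx = the_inv_into {..<CARD('n)} ix"

lemma bij_ix: "bij_betw (ix :: nat \<Rightarrow> 'n::finite) {..<CARD('n)} UNIV"
proof -
  have "\<exists>f. bij_betw f {..<CARD('n)} (UNIV :: 'n set)"
    using ex_bij_betw_nat_finite[of "UNIV :: 'n set"] by (simp add: atLeast0LessThan)
  then show ?thesis unfolding ix_def by (rule someI_ex)
qed

lemma ix_jx [simp]: "ix (jx i) = i"
  unfolding jx_def using bij_ix by (intro f_the_inv_into_f) (auto simp: bij_betw_def)

lemma jx_ix: "l < CARD('n) \<Longrightarrow> jx (ix l :: 'n::finite) = l"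
  unfolding jx_def using bij_ix by (intro the_inv_into_f_f) (auto simp: bij_betw_def)

lemma jx_less: "jx (i :: 'n::finite) < CARD('n)"
  unfolding jx_def using bij_ix[where 'n='n] the_inv_into_into[of ix "{..<CARD('n)}" i "{..<CARD('n)}"]
  by (auto simp: bij_betw_def)

lemma all_ix: "(\<forall>l<CARD('n). P (ix l :: 'n::finite)) \<longleftrightarrow> (\<forall>i. P i)"
  by (metis ix_jx jx_less)

lemma sum_ix: "(\<Sum>l<CARD('n). f (ix l :: 'n::finite)) = (\<Sum>i\<in>UNIV. f i)"
  by (rule sum.reindex_bij_betw[OF bij_ix])

definition pencil_vec :: "(nat \<times> nat \<times> nat \<Rightarrow> real) \<Rightarrow> real^3^3^4" where
  "pencil_vec M = (\<chi> l r c. M (jx l, jx r, jx c))"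

definition tensor_vec :: "(nat \<times> nat \<times> nat \<Rightarrow> real) \<Rightarrow> real^3^3^5" where
  "tensor_vec T = (\<chi> k i j. T (jx i, jx j, jx k))"

definition coords :: "complex^4 \<Rightarrow> nat \<Rightarrow> complex" where
  "coords z = (\<lambda>l. if l < 4 then z $ ix l else 0)"

lemma coords_inj: "inj coords"
proof (rule injI)
  fix z w assume e: "coords z = coords w"
  have "z $ i = w $ i" for i using fun_cong[OF e, of "jx i"] jx_less[of i] by (simp add: coords_def)
  then show "z = w" by (simp add: cart_eq_iff)
qed

lemma range_coords: "range coords = cvec4"
proof
  show "cvec4 \<subseteq> range coords"
  proof
    fix u assume u: "u \<in> cvec4"
    have "u = coords (\<chi> i. u (jx i))"
      using u by (auto simp: coords_def cvec4_def fun_eq_iff jx_ix[where 'n=4, simplified])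
    then show "u \<in> range coords" by blast
  qed
qed (auto simp: coords_def cvec4_def)

lemma coords_comb: "(\<lambda>l. a * coords u l + b * coords v l) = coords (a *s u + b *s v)"
  by (auto simp: coords_def)

lemma cspan2_coords: "cspan2 (coords u) (coords v) = coords ` span2 u v"
  by (auto simp: cspan2_def span2_def coords_comb)

lemma indep2_coords: "indep2 (coords u) (coords v) \<longleftrightarrow> ind2 u v"
proof -
  have "coords 0 = (\<lambda>_. 0)" by (auto simp: coords_def)
  then have "(\<lambda>l. a * coords u l + b * coords v l) = (\<lambda>_. 0) \<longleftrightarrow> a *s u + b *s v = 0" for a b
    unfolding coords_comb using coords_inj by (metis injD)
  then show ?thesis unfolding indep2_def ind2_def by simp
qed

text \<open>A vanishing determinant and \<open>sing\<close> both mean a nontrivial kernel, and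
  kernel vectors translate directly between the two matrix formalisms.\<close>

lemma surface_coords: "coords z \<in> surface_cone M \<longleftrightarrow> z \<in> surf (pencil_vec M)"
proof -
  let ?A = "pencil_mat M (coords z)"
  let ?N = "pmat (cM (pencil_vec M)) z"
  have A: "?A \<in> carrier_mat 3 3" by (simp add: pencil_mat_def)
  have cv3: "vec 3 (\<lambda>j. y $ ix j) \<noteq> 0\<^sub>v 3 \<longleftrightarrow> y \<noteq> 0" for y :: "complex^3"
  proof -
    have "vec 3 (\<lambda>j. y $ ix j) = 0\<^sub>v 3 \<longleftrightarrow> (\<forall>j<3. y $ ix j = 0)"
      by (auto simp: Matrix.vec_eq_iff)
    also have "\<dots> \<longleftrightarrow> (\<forall>i. y $ i = 0)"
      using all_ix[where 'n=3, of "\<lambda>i. y $ i = 0"] by simp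
    finally show ?thesis by (simp add: cart_eq_iff)
  qed
  have ent: "vec_index (?A *\<^sub>v vec 3 (\<lambda>j. y $ ix j)) i = (?N *v y) $ ix i" if "i < 3" for y i
  proof -
    have "vec_index (?A *\<^sub>v vec 3 (\<lambda>j. y $ ix j)) i
      = (\<Sum>j<3. (\<Sum>l<4. coords z l * complex_of_real (M (l,i,j))) * y $ ix j)"
      using that by (simp add: pencil_mat_def mult_mat_vec_def scalar_prod_def atLeast0LessThan)
    also have "\<dots> = (\<Sum>j<3. (\<Sum>l<4. z $ ix l * cM (pencil_vec M) $ ix l $ ix i $ ix j) * y $ ix j)"
      using that by (intro sum.cong refl arg_cong2[where f="(*)"])
        (simp_all add: coords_def cM_def pencil_vec_def jx_ix[where 'n=4, simplified] jx_ix[where 'n=3, simplified])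
    also have "\<dots> = (\<Sum>j\<in>UNIV. (\<Sum>l\<in>UNIV. z $ l * cM (pencil_vec M) $ l $ ix i $ j) * y $ j)"
      using sum_ix[where 'n=3, of "\<lambda>j. (\<Sum>l<4. z $ ix l * cM (pencil_vec M) $ ix l $ ix i $ j) * y $ j"]
        sum_ix[where 'n=4, of "\<lambda>l. z $ l * cM (pencil_vec M) $ l $ ix i $ j" for j] by simp
    finally show ?thesis by (simp add: matrix_vector_mult_def pmat_def)
  qed
  have zero: "?A *\<^sub>v vec 3 (\<lambda>j. y $ ix j) = 0\<^sub>v 3 \<longleftrightarrow> ?N *v y = 0" for y
  proof -
    have "?A *\<^sub>v vec 3 (\<lambda>j. y $ ix j) = 0\<^sub>v 3 \<longleftrightarrow> (\<forall>i<3. (?N *v y) $ ix i = 0)"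
      using A ent by (auto simp: Matrix.vec_eq_iff)
    also have "\<dots> \<longleftrightarrow> (\<forall>i. (?N *v y) $ i = 0)"
      using all_ix[where 'n=3, of "\<lambda>i. (?N *v y) $ i = 0"] by simp
    finally show ?thesis by (simp add: cart_eq_iff)
  qed
  have vform: "v = vec 3 (\<lambda>j. (\<chi> i::3. vec_index v (jx i)) $ ix j)" if "v \<in> carrier_vec 3" for v :: "complex vec"
    using that by (auto simp: Matrix.vec_eq_iff jx_ix[where 'n=3, simplified])
  have "det ?A = 0 \<longleftrightarrow> (\<exists>v. v \<in> carrier_vec 3 \<and> v \<noteq> 0\<^sub>v 3 \<and> ?A *\<^sub>v v = 0\<^sub>v 3)"
    by (rule det_0_iff_vec_prod_zero_field[OF A])
  also have "\<dots> \<longleftrightarrow> (\<exists>y. y \<noteq> 0 \<and> ?N *v y = 0)"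
  proof
    assume "\<exists>v. v \<in> carrier_vec 3 \<and> v \<noteq> 0\<^sub>v 3 \<and> ?A *\<^sub>v v = 0\<^sub>v 3"
    then obtain v where v: "v \<in> carrier_vec 3" "v \<noteq> 0\<^sub>v 3" "?A *\<^sub>v v = 0\<^sub>v 3" by blast
    then show "\<exists>y. y \<noteq> 0 \<and> ?N *v y = 0" using vform[OF v(1)] cv3 zero by metis
  next
    assume "\<exists>y. y \<noteq> 0 \<and> ?N *v y = 0"
    then obtain y where "y \<noteq> 0" "?N *v y = 0" by blast
    then show "\<exists>v. v \<in> carrier_vec 3 \<and> v \<noteq> 0\<^sub>v 3 \<and> ?A *\<^sub>v v = 0\<^sub>v 3"
      using cv3 zero by (intro exI[of _ "vec 3 (\<lambda>j. y $ ix j)"]) simp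
  qed
  finally show ?thesis
    using range_coords unfolding surface_cone_def surf_def sing_def by blast
qed

lemma lines_on_coords: "lines_on M = image coords ` lines (pencil_vec M)"
proof -
  have s: "coords ` L \<subseteq> surface_cone M \<longleftrightarrow> L \<subseteq> surf (pencil_vec M)" for L
    using surface_coords by auto
  have "lines_on M = {coords ` span2 u v | u v. ind2 u v \<and> coords ` span2 u v \<subseteq> surface_cone M}"
    unfolding lines_on_def cline_def range_coords[symmetric]
    using indep2_coords cspan2_coords by fastforce
  also have "\<dots> = image coords ` lines (pencil_vec M)"
  proof (intro equalityI subsetI)
    fix K assume "K \<in> {coords ` span2 u v | u v. ind2 u v \<and> coords ` span2 u v \<subseteq> surface_cone M}"
    then obtain u v where K: "K = coords ` span2 u v" and "ind2 u v" "span2 u v \<subseteq> surf (pencil_vec M)" unfolding s by blast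
    then have "span2 u v \<in> lines (pencil_vec M)" unfolding lines_def by blast
    then show "K \<in> image coords ` lines (pencil_vec M)" unfolding K by (rule imageI)
  next
    fix K assume "K \<in> image coords ` lines (pencil_vec M)"
    then obtain L where K: "K = coords ` L" and "L \<in> lines (pencil_vec M)" by (rule imageE)
    then obtain u v where "L = span2 u v" "ind2 u v" "L \<subseteq> surf (pencil_vec M)" unfolding lines_def by blast
    then show "K \<in> {coords ` span2 u v | u v. ind2 u v \<and> coords ` span2 u v \<subseteq> surface_cone M}"
      unfolding K s by blast
  qed
  finally show ?thesis .
qed

lemma real_line_coords: "real_line (coords ` L) \<longleftrightarrow> real_span L"
proof
  assume "real_line (coords ` L)"
  then obtain u v where uv: "u \<in> cvec4" "v \<in> cvec4" "\<And>l. Im (u l) = 0 \<and> Im (v l) = 0" "indep2 u v" "coords ` L = cspan2 u v"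
    unfolding real_line_def by blast
  obtain u' v' where u': "u = coords u'" "v = coords v'" using uv(1,2) unfolding range_coords[symmetric] by blast
  have "Im (coords w (jx i)) = Im (w $ i)" for w i using jx_less[of i] by (simp add: coords_def)
  then have "Im (u' $ i) = 0" "Im (v' $ i) = 0" for i using uv(3)[of "jx i"] unfolding u' by auto
  then have r: "u' = cv (Rev u')" "v' = cv (Rev v')" by (simp_all add: cart_eq_iff complex_eq_iff)
  have "ind2 u' v'" using uv(4) unfolding u' indep2_coords .
  then have "ind2 (Rev u') (Rev v')" using r unfolding ind2_def
    by (metis (no_types) cv_linear cv_eq_0 of_real_eq_0_iff)
  moreover have "L = span2 u' v'" using uv(5) unfolding u' cspan2_coords using inj_image_eq_iff[OF coords_inj] by blast
  ultimately show "real_span L" unfolding real_span_def using r by metis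
next
  assume "real_span L"
  then obtain u v where uv: "ind2 u v" "L = span2 (cv u) (cv v)" unfolding real_span_def by blast
  have "coords (cv u) \<in> cvec4" "coords (cv v) \<in> cvec4" unfolding range_coords[symmetric] by auto
  moreover have "Im (coords (cv u) l) = 0 \<and> Im (coords (cv v) l) = 0" for l by (simp add: coords_def)
  moreover have "indep2 (coords (cv u)) (coords (cv v))" using uv ind2_cv indep2_coords by blast
  ultimately show "real_line (coords ` L)" unfolding real_line_def uv(2) using cspan2_coords by blast
qed

definition all27 :: "real^3^3^4 \<Rightarrow> bool" where
  "all27 M \<longleftrightarrow> card (lines M) = 27 \<and> (\<forall>L\<in>lines M. real_span L)"

lemma all_27_lines_real_iff: "all_27_lines_real M \<longleftrightarrow> all27 (pencil_vec M)"
proof -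
  have "inj_on (image coords) (lines (pencil_vec M))"
    using coords_inj by (auto intro!: inj_onI dest: injD simp: inj_image_eq_iff)
  then show ?thesis
    unfolding all_27_lines_real_def all27_def lines_on_coords by (simp add: card_image real_line_coords)
qed

definition decomp :: "nat \<Rightarrow> real^3^3^5 \<Rightarrow> bool" where
  "decomp r T \<longleftrightarrow> (\<exists>a b (c :: nat \<Rightarrow> real^5). \<forall>k. T$k = (\<Sum>l<r. c l$k *\<^sub>R outer (a l) (b l)))"

lemma decomp_tensor_vec:
  "(\<exists>a b c :: nat \<Rightarrow> nat \<Rightarrow> real. \<forall>i j k. (i,j,k) \<in> tensor_idx \<longrightarrow> T (i,j,k) = (\<Sum>l<r. a l i * b l j * c l k))
    \<longleftrightarrow> decomp r (tensor_vec T)"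
proof
  assume "\<exists>a b c :: nat \<Rightarrow> nat \<Rightarrow> real. \<forall>i j k. (i,j,k) \<in> tensor_idx \<longrightarrow> T (i,j,k) = (\<Sum>l<r. a l i * b l j * c l k)"
  then obtain a b c :: "nat \<Rightarrow> nat \<Rightarrow> real" where
    abc: "\<And>i j k. i < 3 \<Longrightarrow> j < 3 \<Longrightarrow> k < 5 \<Longrightarrow> T (i,j,k) = (\<Sum>l<r. a l i * b l j * c l k)"
    unfolding tensor_idx_def by blast
  have "tensor_vec T$k$i$j = (\<Sum>l<r. (\<chi> k. c l (jx k))$k *\<^sub>R outer (\<chi> i. a l (jx i)) (\<chi> j. b l (jx j)))$i$j" for k i j
    using abc[of "jx i" "jx j" "jx k"] jx_less[of i] jx_less[of j] jx_less[of k]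
    by (simp add: tensor_vec_def mult_ac)
  then have "tensor_vec T$k = (\<Sum>l<r. (\<chi> k. c l (jx k))$k *\<^sub>R outer (\<chi> i. a l (jx i)) (\<chi> j. b l (jx j)))" for k
    unfolding cart_eq_iff by blast
  then show "decomp r (tensor_vec T)" unfolding decomp_def by meson
next
  assume "decomp r (tensor_vec T)"
  then obtain a b and c :: "nat \<Rightarrow> real^5" where abc: "\<And>k. tensor_vec T$k = (\<Sum>l<r. c l$k *\<^sub>R outer (a l) (b l))"
    unfolding decomp_def by blast
  have D: "T (i,j,k) = (\<Sum>l<r. a l$ix i * b l$ix j * c l$ix k)" if "i < 3" "j < 3" "k < 5" for i j k
  proof -
    have "T (i,j,k) = tensor_vec T$ix k$ix i$ix j"
      using that by (simp add: tensor_vec_def jx_ix[where 'n=3, simplified] jx_ix[where 'n=5, simplified])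
    then show ?thesis unfolding abc by (simp add: mult_ac)
  qed
  show "\<exists>a b c :: nat \<Rightarrow> nat \<Rightarrow> real. \<forall>i j k. (i,j,k) \<in> tensor_idx \<longrightarrow> T (i,j,k) = (\<Sum>l<r. a l i * b l j * c l k)"
    by (rule exI[of _ "\<lambda>l i. a l$ix i"], rule exI[of _ "\<lambda>l i. b l$ix i"], rule exI[of _ "\<lambda>l i. c l$ix i"])
      (use D in \<open>auto simp: tensor_idx_def\<close>)
qed

lemma decomp_span: "decomp r T \<longleftrightarrow> (\<exists>a b. \<forall>k. T$k \<in> span ((\<lambda>i. outer (a i) (b i)) ` {..<r}))"
proof
  assume "decomp r T"
  then obtain a b and c :: "nat \<Rightarrow> real^5" where abc: "\<And>k. T$k = (\<Sum>l<r. c l$k *\<^sub>R outer (a l) (b l))"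
    unfolding decomp_def by blast
  have "T$k \<in> span ((\<lambda>i. outer (a i) (b i)) ` {..<r})" for k
    unfolding abc by (intro span_sum span_scale span_base) auto
  then show "\<exists>a b. \<forall>k. T$k \<in> span ((\<lambda>i. outer (a i) (b i)) ` {..<r})" by blast
next
  assume "\<exists>a b. \<forall>k. T$k \<in> span ((\<lambda>i. outer (a i) (b i)) ` {..<r})"
  then obtain a b where ab: "\<And>k. T$k \<in> span ((\<lambda>i. outer (a i) (b i)) ` {..<r})" by blast
  have "\<exists>c. T$k = (\<Sum>l<r. c l *\<^sub>R outer (a l) (b l))" for k
    using span_image_combination[OF _ ab[of k]] by blast
  then obtain c where D: "\<And>k. T$k = (\<Sum>l<r. c k l *\<^sub>R outer (a l) (b l))" by metis
  have "T$k = (\<Sum>l<r. (\<chi> k. c k l)$k *\<^sub>R outer (a l) (b l))" for k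
    by (simp add: D)
  then show "decomp r T" unfolding decomp_def by meson
qed

lemma rank_le5_decomp: "rank_le5 T \<longleftrightarrow> decomp 5 T"
  unfolding decomp_span rank_le5_def ..

lemma decomp_mono: "decomp r T \<Longrightarrow> r \<le> s \<Longrightarrow> decomp s T"
  unfolding decomp_span by (meson image_mono lessThan_subset_iff span_mono subsetD)

text \<open>The nine matrix units decompose every tensor, so the \<open>LEAST\<close> in
  \<open>tensor_rank\<close> is attained.\<close>

lemma decomp_9: "decomp 9 T"
proof -
  obtain e where e: "bij_betw e {..<9::nat} (UNIV :: (3 \<times> 3) set)"
    using ex_bij_betw_nat_finite[of "UNIV :: (3 \<times> 3) set"] by (auto simp: atLeast0LessThan)
  have "T$k = (\<Sum>l<9. (\<chi> k. T$k$fst (e l)$snd (e l))$k *\<^sub>R outer (axis (fst (e l)) 1) (axis (snd (e l)) 1))" for k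
  proof -
    have "(\<Sum>l<9. T$k$fst (e l)$snd (e l) *\<^sub>R outer (axis (fst (e l)) 1) (axis (snd (e l)) 1))
       = (\<Sum>(i,j)\<in>UNIV. T$k$i$j *\<^sub>R outer (axis i 1) (axis j 1))"
      using sum.reindex_bij_betw[OF e, of "\<lambda>(i,j). T$k$i$j *\<^sub>R outer (axis i 1) (axis j 1)"]
      by (simp add: case_prod_unfold)
    also have "\<dots> = (\<Sum>i\<in>UNIV. \<Sum>j\<in>UNIV. T$k$i$j *\<^sub>R outer (axis i 1) (axis j 1))"
      unfolding UNIV_Times_UNIV[symmetric] by (simp add: sum.cartesian_product)
    also have "\<dots> = T$k"
      by (simp add: cart_eq_iff sum_3 forall_3 axis_def)
    finally show ?thesis by simp
  qed
  then show ?thesis unfolding decomp_def by meson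
qed

lemma tensor_rank_5_iff: "tensor_rank T = 5 \<longleftrightarrow> decomp 5 (tensor_vec T) \<and> \<not> decomp 4 (tensor_vec T)"
proof -
  have r: "tensor_rank T = (LEAST r. decomp r (tensor_vec T))"
    unfolding tensor_rank_def decomp_tensor_vec ..
  show ?thesis
  proof
    assume "tensor_rank T = 5"
    then have L: "(LEAST r. decomp r (tensor_vec T)) = 5" using r by simp
    have "decomp 5 (tensor_vec T)" using LeastI[of "\<lambda>r. decomp r (tensor_vec T)", OF decomp_9] unfolding L .
    moreover have "\<not> decomp 4 (tensor_vec T)" by (rule not_less_Least) (simp add: L)
    ultimately show "decomp 5 (tensor_vec T) \<and> \<not> decomp 4 (tensor_vec T)" ..
  next
    assume A: "decomp 5 (tensor_vec T) \<and> \<not> decomp 4 (tensor_vec T)"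
    have "(LEAST r. decomp r (tensor_vec T)) = 5"
    proof (rule Least_equality)
      fix s assume "decomp s (tensor_vec T)"
      then show "5 \<le> s" using A decomp_mono[of s "tensor_vec T" 4] by (cases "s \<le> 4") auto
    qed (use A in simp)
    then show "tensor_rank T = 5" using r by simp
  qed
qed

lemma not_decomp_4: "findep UNIV (($) T) \<Longrightarrow> \<not> decomp 4 T"
proof
  assume T: "findep UNIV (($) T)" and "decomp 4 T"
  then obtain a b where ab: "\<And>k. T$k \<in> span ((\<lambda>i. outer (a i) (b i)) ` {..<4::nat})" unfolding decomp_span by blast
  have "span (range (($) T)) \<subseteq> span ((\<lambda>i. outer (a i) (b i)) ` {..<4::nat})"
    by (rule span_minimal) (use ab in \<open>auto simp: subspace_span\<close>)
  then have "dim (span (range (($) T))) \<le> card ((\<lambda>i. outer (a i) (b i)) ` {..<4::nat})" by (intro dim_le_card) simp_all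
  also have "\<dots> \<le> 4" using card_image_le[of "{..<4::nat}"] by simp
  finally show False using findep_dim[OF _ T] by simp
qed

section \<open>Borel measurability of the two events\<close>

lemma continuous_on_outer [continuous_intros]:
  "continuous_on S f \<Longrightarrow> continuous_on S g \<Longrightarrow> continuous_on S (\<lambda>x. outer (f x) (g x))"
  unfolding outer_def by (intro continuous_intros)

lemma continuous_on_dt [continuous_intros]:
  fixes f g :: "'a::topological_space \<Rightarrow> 'b::{real_normed_algebra,comm_ring_1}^'n"
  shows "continuous_on S f \<Longrightarrow> continuous_on S g \<Longrightarrow> continuous_on S (\<lambda>x. dt (f x) (g x))"
  unfolding dt_def by (intro continuous_intros)

text \<open>Indexing the terms by a finite type makes the parameters a Euclidean space, as
  \<open>borel_closed_image\<close> requires.\<close>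

lemma decomp_CARD:
  "decomp CARD('r::finite) T \<longleftrightarrow> T \<in> range (\<lambda>(a::(real^3)^'r, b::(real^3)^'r, c::(real^5)^'r). \<chi> k. \<Sum>l\<in>UNIV. c$l$k *\<^sub>R outer (a$l) (b$l))"
proof
  assume "decomp CARD('r) T"
  then obtain a b and c :: "nat \<Rightarrow> real^5" where abc: "\<And>k. T$k = (\<Sum>l<CARD('r). c l$k *\<^sub>R outer (a l) (b l))"
    unfolding decomp_def by blast
  have "T$k = (\<Sum>l\<in>UNIV. (\<chi> l::'r. c (jx l))$l$k *\<^sub>R outer ((\<chi> l::'r. a (jx l))$l) ((\<chi> l::'r. b (jx l))$l))" for k
    unfolding abc sum_ix[symmetric] by (intro sum.cong) (simp_all add: jx_ix)
  then have "T = (\<lambda>(a::(real^3)^'r, b::(real^3)^'r, c::(real^5)^'r). \<chi> k. \<Sum>l\<in>UNIV. c$l$k *\<^sub>R outer (a$l) (b$l))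
      (\<chi> l. a (jx l), \<chi> l. b (jx l), \<chi> l. c (jx l))" by (simp add: cart_eq_iff)
  then show "T \<in> range (\<lambda>(a::(real^3)^'r, b::(real^3)^'r, c::(real^5)^'r). \<chi> k. \<Sum>l\<in>UNIV. c$l$k *\<^sub>R outer (a$l) (b$l))" by (rule range_eqI)
next
  assume "T \<in> range (\<lambda>(a::(real^3)^'r, b::(real^3)^'r, c::(real^5)^'r). \<chi> k. \<Sum>l\<in>UNIV. c$l$k *\<^sub>R outer (a$l) (b$l))"
  then obtain a b :: "(real^3)^'r" and c :: "(real^5)^'r" where T: "T = (\<chi> k. \<Sum>l\<in>UNIV. c$l$k *\<^sub>R outer (a$l) (b$l))" by auto
  have "T$k = (\<Sum>l<CARD('r). c$ix l$k *\<^sub>R outer (a$ix l) (b$ix l))" for k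
    using sum_ix[where 'n='r, of "\<lambda>l. c$l$k *\<^sub>R outer (a$l) (b$l)"] by (simp add: T)
  then show "decomp CARD('r) T" unfolding decomp_def by meson
qed

lemma decomp_borel: "{T. decomp CARD('r::finite) T} \<in> sets borel"
proof -
  let ?f = "\<lambda>(a::(real^3)^'r, b::(real^3)^'r, c::(real^5)^'r). \<chi> k. \<Sum>l\<in>UNIV. c$l$k *\<^sub>R outer (a$l) (b$l)"
  have "range ?f \<in> sets borel"
    unfolding case_prod_unfold by (intro borel_closed_image closed_UNIV continuous_intros)
  then show ?thesis unfolding decomp_CARD by simp
qed

lemma rank5_borel: "{T. decomp 5 T \<and> \<not> decomp 4 T} \<in> sets borel"
proof -
  have "{T. decomp 5 T \<and> \<not> decomp 4 T} = {T. decomp CARD(5) T} - {T. decomp CARD(4) T}" by auto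
  then show ?thesis using decomp_borel[where 'r=5] decomp_borel[where 'r=4] by auto
qed

lemma ind2_dual:
  assumes "ind2 (u::'a::field^'n) v"
  obtains p q where "dt p u = 1" "dt p v = 0" "dt q u = 0" "dt q v = 1"
proof -
  obtain i j where ij: "i \<noteq> j" and m: "u$i * v$j - u$j * v$i \<noteq> 0" using ind2_minor[OF assms] .
  define D where "D = u$i * v$j - u$j * v$i"
  have D: "D \<noteq> 0" using m by (simp add: D_def)
  define p where "p = (1/D) *s (v$j *s axis i 1 - v$i *s axis j 1)"
  define q where "q = (1/D) *s (u$i *s axis j 1 - u$j *s axis i 1)"
  have "dt p u = (1/D) * D" "dt q v = (1/D) * D" unfolding p_def q_def D_def by (simp_all only: dt_linear dt_axis) (simp_all add: algebra_simps)
  moreover have "dt p v = 0" "dt q u = 0" unfolding p_def q_def by (simp_all only: dt_linear dt_axis) (simp_all add: algebra_simps)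
  ultimately show ?thesis using that D by simp
qed

lemma ind2_if_dual:
  assumes "dt p u = 1" "dt p v = 0" "dt q u = 0" "dt q v = (1::'a::field)"
  shows "ind2 u v"
  unfolding ind2_def
proof (intro allI impI)
  fix a b assume e: "a *s u + b *s v = 0"
  have "a = dt p (a *s u + b *s v)" "b = dt q (a *s u + b *s v)" using assms by simp_all
  then show "a = 0 \<and> b = 0" unfolding e by simp
qed

text \<open>A separating form is scaled to the value 1. The outcome consists of equations, hence of
  closed conditions, unlike the non-membership that it certifies.\<close>

lemma not_in_span2_dual:
  assumes "ind2 (u::'a::field^'n) v" "w \<notin> span2 u v"
  obtains f where "dt f u = 0" "dt f v = 0" "dt f w = 1"
proof -
  obtain p q where pq: "dt p u = 1" "dt p v = 0" "dt q u = 0" "dt q v = 1" using ind2_dual[OF assms(1)] .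
  define w' where "w' = w - (dt p w *s u + dt q w *s v)"
  have "w' \<noteq> 0" using assms(2) span2I[of "dt p w" u "dt q w" v] by (auto simp: w'_def)
  then obtain m where m: "w' $ m \<noteq> 0" by (auto simp: cart_eq_iff)
  define f where "f = (1/w'$m) *s (axis m 1 - (u$m *s p + v$m *s q))"
  have "dt f u = 0" "dt f v = 0" unfolding f_def by (simp_all only: dt_linear dt_axis pq) simp_all
  moreover have "dt f w = (1/w'$m) * w'$m" unfolding f_def by (simp only: dt_linear dt_axis) (simp add: w'_def mult.commute)
  ultimately show ?thesis using that m by simp
qed

type_synonym 'k line_data =
  "((complex^4)^'k) \<times> ((complex^4)^'k) \<times> ((complex^4)^'k) \<times> ((complex^4)^'k) \<times> ((complex^4)^'k^'k)"

text \<open>\<open>p\<close>, \<open>q\<close> and \<open>w\<close> certify by closed conditions the open properties that \<open>u$i, v$i\<close> are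
  independent and that the lines \<open>i\<close>, \<open>j\<close> differ.\<close>
definition line_certificate :: "bool \<Rightarrow> ((real^3^3^4) \<times> 'k::finite line_data) set" where
  "line_certificate r = {(M, u, v, p, q, w).
     (\<forall>i. dt (p$i) (u$i) = 1) \<and> (\<forall>i. dt (p$i) (v$i) = 0) \<and> (\<forall>i. dt (q$i) (u$i) = 0) \<and> (\<forall>i. dt (q$i) (v$i) = 1) \<and>
     (\<forall>i a b. det3 (pmat (cM M) (a *s u$i + b *s v$i) $ 1) (pmat (cM M) (a *s u$i + b *s v$i) $ 2)
        (pmat (cM M) (a *s u$i + b *s v$i) $ 3) = 0) \<and>
     (\<forall>i j. i = j \<or> dt (w$i$j) (u$i) = 0 \<and> dt (w$i$j) (v$i) = 0 \<and> (dt (w$i$j) (u$j) = 1 \<or> dt (w$i$j) (v$j) = 1)) \<and>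
     (r \<longrightarrow> (\<forall>i l. Im (u$i$l) = 0 \<and> Im (v$i$l) = 0))}"

lemma continuous_on_vec_scale [continuous_intros]:
  fixes f :: "'a::topological_space \<Rightarrow> 'b::{real_normed_algebra,comm_ring_1}^'n"
  shows "continuous_on S c \<Longrightarrow> continuous_on S f \<Longrightarrow> continuous_on S (\<lambda>x. c x *s f x)"
  unfolding vector_scalar_mult_def by (intro continuous_intros)

lemma continuous_on_pmat_cM [continuous_intros]:
  "continuous_on S M \<Longrightarrow> continuous_on S z \<Longrightarrow> continuous_on S (\<lambda>x. pmat (cM (M x)) (z x))"
  unfolding pmat_def cM_def by (simp, intro continuous_intros)

lemma continuous_on_det3 [continuous_intros]:
  fixes f g h :: "'a::topological_space \<Rightarrow> complex^3"
  shows "continuous_on S f \<Longrightarrow> continuous_on S g \<Longrightarrow> continuous_on S h \<Longrightarrow> continuous_on S (\<lambda>x. det3 (f x) (g x) (h x))"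
  unfolding det3_expand by (intro continuous_intros)

lemma closed_line_certificate: "closed (line_certificate r :: ((real^3^3^4) \<times> 'k::finite line_data) set)"
proof -
  have "closed (line_certificate False :: ((real^3^3^4) \<times> 'k line_data) set)"
    unfolding line_certificate_def case_prod_unfold
    by (simp, intro closed_Collect_conj closed_Collect_all closed_Collect_disj closed_Collect_eq closed_Collect_const continuous_intros)
  moreover have "closed {x :: (real^3^3^4) \<times> 'k line_data. \<forall>i l. Im (fst (snd x)$i$l) = 0 \<and> Im (fst (snd (snd x))$i$l) = 0}"
    by (intro closed_Collect_conj closed_Collect_all closed_Collect_eq continuous_intros)
  moreover have "line_certificate True = line_certificate False \<inter>
      {x :: (real^3^3^4) \<times> 'k line_data. \<forall>i l. Im (fst (snd x)$i$l) = 0 \<and> Im (fst (snd (snd x))$i$l) = 0}"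
    unfolding line_certificate_def by auto
  ultimately show ?thesis by (cases r) auto
qed

lemma sing_det3: "sing N \<longleftrightarrow> det3 (N$1) (N$2) (N$3) = 0"
  unfolding sing_def kernel3[symmetric]
  by (simp add: matrix_vector_mult_def dt_def cart_eq_iff[of _ 0] forall_3)

lemma surf_span2: "span2 u v \<subseteq> surf M \<longleftrightarrow> (\<forall>a b. det3 (pmat (cM M) (a *s u + b *s v) $ 1)
   (pmat (cM M) (a *s u + b *s v) $ 2) (pmat (cM M) (a *s u + b *s v) $ 3) = 0)"
  unfolding span2_def surf_def sing_det3 by auto

lemma line_certificate_iff:
  "M \<in> fst ` (line_certificate r :: ((real^3^3^4) \<times> 'k::finite line_data) set) \<longleftrightarrow>
    (\<exists>L :: 'k \<Rightarrow> (complex^4) set. inj L \<and> (\<forall>i. L i \<in> lines M \<and> (r \<longrightarrow> real_span (L i))))"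
proof
  assume "M \<in> fst ` (line_certificate r :: ((real^3^3^4) \<times> 'k line_data) set)"
  then obtain u v p q and w :: "(complex^4)^'k^'k" where c: "(M,u,v,p,q,w) \<in> line_certificate r" by auto
  then have ind: "ind2 (u$i) (v$i)" for i using ind2_if_dual[of "p$i" "u$i" "v$i" "q$i"] by (simp add: line_certificate_def)
  have s: "span2 (u$i) (v$i) \<subseteq> surf M" for i using c unfolding surf_span2 by (simp add: line_certificate_def)
  have "span2 (u$i) (v$i) \<noteq> span2 (u$j) (v$j)" if "i \<noteq> j" for i j
  proof
    assume e: "span2 (u$i) (v$i) = span2 (u$j) (v$j)"
    have m: "u$j \<in> span2 (u$i) (v$i)" "v$j \<in> span2 (u$i) (v$i)" unfolding e by (rule span2_base)+
    have d: "dt (w$i$j) (u$i) = 0" "dt (w$i$j) (v$i) = 0" and "dt (w$i$j) (u$j) = 1 \<or> dt (w$i$j) (v$j) = 1"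
      using c that unfolding line_certificate_def by auto
    then show False using span2_in_kernel[OF d m(1)] span2_in_kernel[OF d m(2)] by simp
  qed
  then have "inj (\<lambda>i. span2 (u$i) (v$i))" by (auto simp: inj_def)
  moreover have "real_span (span2 (u$i) (v$i))" if r for i
  proof -
    have "Im (u$i$l) = 0" "Im (v$i$l) = 0" for l using c that by (auto simp: line_certificate_def)
    then have e: "u$i = cv (Rev (u$i))" "v$i = cv (Rev (v$i))" by (simp_all add: cart_eq_iff complex_eq_iff)
    have "ind2 (Rev (u$i)) (Rev (v$i))" unfolding ind2_def
    proof (intro allI impI)
      fix a b :: real assume "a *s Rev (u$i) + b *s Rev (v$i) = 0"
      then have "cv (a *s Rev (u$i) + b *s Rev (v$i)) = 0" by simp
      then have "of_real a *s u$i + of_real b *s v$i = 0" using e by (simp del: cv_eq_0)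
      then have "complex_of_real a = 0 \<and> complex_of_real b = 0" using ind unfolding ind2_def by blast
      then show "a = 0 \<and> b = 0" by simp
    qed
    then show ?thesis using e unfolding real_span_def by metis
  qed
  moreover have "span2 (u$i) (v$i) \<in> lines M" for i using ind s unfolding lines_def by blast
  ultimately show "\<exists>L :: 'k \<Rightarrow> (complex^4) set. inj L \<and> (\<forall>i. L i \<in> lines M \<and> (r \<longrightarrow> real_span (L i)))"
    by (intro exI[of _ "\<lambda>i. span2 (u$i) (v$i)"]) blast
next
  assume "\<exists>L :: 'k \<Rightarrow> (complex^4) set. inj L \<and> (\<forall>i. L i \<in> lines M \<and> (r \<longrightarrow> real_span (L i)))"
  then obtain L :: "'k \<Rightarrow> (complex^4) set" where L: "inj L" "\<And>i. L i \<in> lines M" "\<And>i. r \<Longrightarrow> real_span (L i)" by blast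
  have "\<exists>u v. ind2 u v \<and> L i = span2 u v \<and> (r \<longrightarrow> (\<forall>l. Im (u$l) = 0 \<and> Im (v$l) = 0))" for i
  proof (cases r)
    case True
    then obtain u v where "ind2 u v" "L i = span2 (cv u) (cv v)" using L(3) unfolding real_span_def by blast
    then show ?thesis using ind2_cv by (intro exI[of _ "cv u"] exI[of _ "cv v"]) simp
  next
    case False then show ?thesis using L(2)[of i] unfolding lines_def by blast
  qed
  then obtain u v where uv: "\<And>i. ind2 (u i) (v i)" "\<And>i. L i = span2 (u i) (v i)"
    "\<And>i l. r \<Longrightarrow> Im (u i$l) = 0 \<and> Im (v i$l) = 0" by metis
  have "\<exists>p q. dt p (u i) = 1 \<and> dt p (v i) = 0 \<and> dt q (u i) = 0 \<and> dt q (v i) = 1" for i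
    using ind2_dual[OF uv(1)[of i]] by metis
  then obtain p q where pq: "\<And>i. dt (p i) (u i) = 1 \<and> dt (p i) (v i) = 0 \<and> dt (q i) (u i) = 0 \<and> dt (q i) (v i) = 1" by metis
  have "\<exists>w. i = j \<or> dt w (u i) = 0 \<and> dt w (v i) = 0 \<and> (dt w (u j) = 1 \<or> dt w (v j) = 1)" for i j
  proof (cases "i = j")
    case False
    then have "span2 (u j) (v j) \<noteq> span2 (u i) (v i)" using L(1) uv(2) by (metis injD)
    then have "u j \<notin> span2 (u i) (v i) \<or> v j \<notin> span2 (u i) (v i)" using span2_eqI[OF uv(1)[of j]] by blast
    then show ?thesis using not_in_span2_dual[OF uv(1)[of i]] by metis
  qed simp
  then obtain w where w: "\<And>i j. i = j \<or> dt (w i j) (u i) = 0 \<and> dt (w i j) (v i) = 0 \<and> (dt (w i j) (u j) = 1 \<or> dt (w i j) (v j) = 1)" by metis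
  have s: "span2 (u i) (v i) \<subseteq> surf M" for i using L(2)[of i] unfolding uv(2) lines_def by auto
  have "(M, (\<chi> i. u i), (\<chi> i. v i), (\<chi> i. p i), (\<chi> i. q i), (\<chi> i j. w i j)) \<in> line_certificate r"
    using pq w uv(3) s unfolding surf_span2 line_certificate_def by simp
  then show "M \<in> fst ` (line_certificate r :: ((real^3^3^4) \<times> 'k line_data) set)" by (metis fst_conv imageI)
qed

text \<open>Turns a cardinality into existence statements over the types 27 and 28, which
  \<open>line_certificate\<close> can express. The absence of 28 distinct members also rules out an
  infinite \<open>A\<close>.\<close>

lemma card_eq_via_families:
  "card A = 27 \<and> (\<forall>a\<in>A. P a) \<longleftrightarrow> (\<exists>f :: 27 \<Rightarrow> 'a. inj f \<and> (\<forall>i. f i \<in> A \<and> P (f i))) \<and> \<not> (\<exists>f :: 28 \<Rightarrow> 'a. inj f \<and> (\<forall>i. f i \<in> A))"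
proof
  assume A: "card A = 27 \<and> (\<forall>a\<in>A. P a)"
  then have fin: "finite A" by (metis card.infinite zero_neq_numeral)
  obtain f :: "27 \<Rightarrow> 'a" where "bij_betw f UNIV A"
    using finite_same_card_bij[of "UNIV :: 27 set" A] fin A by auto
  then have "inj f \<and> (\<forall>i. f i \<in> A \<and> P (f i))" using A by (auto simp: bij_betw_def)
  moreover have False if "inj g" "\<forall>i. g i \<in> A" for g :: "28 \<Rightarrow> 'a"
    using card_inj_on_le[OF that(1) _ fin] that(2) A by auto
  ultimately show "(\<exists>f :: 27 \<Rightarrow> 'a. inj f \<and> (\<forall>i. f i \<in> A \<and> P (f i))) \<and> \<not> (\<exists>f :: 28 \<Rightarrow> 'a. inj f \<and> (\<forall>i. f i \<in> A))" by blast
next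
  assume R: "(\<exists>f :: 27 \<Rightarrow> 'a. inj f \<and> (\<forall>i. f i \<in> A \<and> P (f i))) \<and> \<not> (\<exists>f :: 28 \<Rightarrow> 'a. inj f \<and> (\<forall>i. f i \<in> A))"
  then obtain f :: "27 \<Rightarrow> 'a" where f: "inj f" "\<And>i. f i \<in> A" "\<And>i. P (f i)" by blast
  have no: "\<not> (B \<subseteq> A \<and> card B = 28)" for B
  proof
    assume B: "B \<subseteq> A \<and> card B = 28"
    then have "finite B" by (metis card.infinite zero_neq_numeral)
    then obtain g :: "28 \<Rightarrow> 'a" where "bij_betw g UNIV B" using finite_same_card_bij[of "UNIV :: 28 set" B] B by auto
    then have "inj g \<and> (\<forall>i. g i \<in> A)" using B by (auto simp: bij_betw_def)
    then show False using R by blast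
  qed
  have fin: "finite A"
  proof (rule ccontr)
    assume "infinite A"
    then obtain B where "finite B" "card B = 28" "B \<subseteq> A" using infinite_arbitrarily_large by blast
    then show False using no by blast
  qed
  have "\<not> 28 \<le> card A" using no obtain_subset_with_card_n[of 28 A] by metis
  moreover have r: "card (range f) = 27" using card_image[OF f(1)] by simp
  moreover have "card (range f) \<le> card A" using f(2) fin by (intro card_mono) auto
  ultimately have c: "card A = 27" by simp
  have "range f = A" using card_subset_eq[OF fin, of "range f"] f(2) c r by auto
  then show "card A = 27 \<and> (\<forall>a\<in>A. P a)" using c f(3) by auto
qed

lemma all27_borel: "{M. all27 M} \<in> sets borel"
proof -
  have e: "{M. all27 M} = fst ` (line_certificate True :: ((real^3^3^4) \<times> 27 line_data) set)
     - fst ` (line_certificate False :: ((real^3^3^4) \<times> 28 line_data) set)"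
    unfolding all27_def card_eq_via_families set_eq_iff Diff_iff line_certificate_iff mem_Collect_eq by simp
  show ?thesis unfolding e
    by (intro sets.Diff borel_closed_image closed_line_certificate continuous_intros)
qed

section \<open>Rotation invariance of the Gaussian measure\<close>

definition gauss :: "'e::euclidean_space measure" where
  "gauss = distr (PiM Basis (\<lambda>_. std_gauss)) borel (\<lambda>f. \<Sum>b\<in>Basis. f b *\<^sub>R b)"

lemma prob_space_std_gauss: "prob_space std_gauss"
  unfolding std_gauss_def by (rule prob_space_normal_density) simp

lemma sets_std_gauss [measurable_cong, simp]: "sets std_gauss = sets borel"
  by (simp add: std_gauss_def)

lemma measurable_sum_coordinates:
  assumes "finite K" "\<And>i. i \<in> K \<Longrightarrow> sets (N i) = sets borel"
  shows "(\<lambda>f. \<Sum>b\<in>K. f b *\<^sub>R (\<beta> b :: 'e::euclidean_space)) \<in> borel_measurable (PiM K N)"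
proof (rule borel_measurable_sum)
  fix b assume b: "b \<in> K"
  have "(\<lambda>f. f b) \<in> measurable (PiM K N) borel"
    using measurable_component_singleton[OF b, of N] measurable_cong_sets[OF refl assms(2)[OF b]] by blast
  then show "(\<lambda>f. f b *\<^sub>R \<beta> b) \<in> borel_measurable (PiM K N)" by measurable
qed

lemma prob_space_gauss: "prob_space (gauss :: 'e::euclidean_space measure)"
proof -
  interpret product_prob_space "\<lambda>_. std_gauss" "Basis :: 'e set"
    by (simp add: product_prob_space_def product_prob_space_axioms_def product_sigma_finite_def prob_space_std_gauss prob_space_imp_sigma_finite)
  show ?thesis unfolding gauss_def
    by (rule prob_space_distr) (simp add: measurable_sum_coordinates)
qed

lemma sets_gauss [measurable_cong, simp]: "sets gauss = sets borel"
  by (simp add: gauss_def)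

lemma space_gauss [simp]: "space gauss = UNIV"
  by (simp add: gauss_def)

lemma PiM_density_finite:
  fixes M :: "'i \<Rightarrow> 'a measure"
  assumes fin: "finite I" and M: "\<And>i. sigma_finite_measure (M i)" and D: "\<And>i. sigma_finite_measure (density (M i) (g i))"
    and g [measurable]: "\<And>i. g i \<in> borel_measurable (M i)"
  shows "PiM I (\<lambda>i. density (M i) (g i)) = density (PiM I M) (\<lambda>x. \<Prod>i\<in>I. g i (x i))"
proof -
  interpret M: product_sigma_finite M by (rule product_sigma_finite.intro) (rule M)
  interpret D: product_sigma_finite "\<lambda>i. density (M i) (g i)" by (rule product_sigma_finite.intro) (rule D)
  have gm [measurable]: "(\<lambda>x. \<Prod>i\<in>I. g i (x i)) \<in> borel_measurable (PiM I M)"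
  proof (rule borel_measurable_prod_ennreal)
    fix i assume "i \<in> I"
    from measurable_component_singleton[OF this] g
    show "(\<lambda>x. g i (x i)) \<in> borel_measurable (PiM I M)" by (rule measurable_compose)
  qed
  show ?thesis
  proof (rule D.PiM_eqI[symmetric, OF fin])
    show "sets (density (PiM I M) (\<lambda>x. \<Prod>i\<in>I. g i (x i))) = sets (PiM I (\<lambda>i. density (M i) (g i)))"
      by (simp cong: sets_PiM_cong)
    fix A assume "\<And>i. i \<in> I \<Longrightarrow> A i \<in> sets (density (M i) (g i))"
    then have A: "\<And>i. i \<in> I \<Longrightarrow> A i \<in> sets (M i)" by simp
    have "emeasure (density (PiM I M) (\<lambda>x. \<Prod>i\<in>I. g i (x i))) (Pi\<^sub>E I A)
      = (\<integral>\<^sup>+x. (\<Prod>i\<in>I. g i (x i)) * indicator (Pi\<^sub>E I A) x \<partial>PiM I M)"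
      using A fin by (intro emeasure_density gm sets_PiM_I_finite) auto
    also have "\<dots> = (\<integral>\<^sup>+x. (\<Prod>i\<in>I. g i (x i) * indicator (A i) (x i)) \<partial>PiM I M)"
    proof (rule nn_integral_cong)
      fix x assume "x \<in> space (PiM I M)"
      then have "x \<in> Pi\<^sub>E I A \<longleftrightarrow> (\<forall>i\<in>I. x i \<in> A i)" by (auto simp: space_PiM PiE_iff)
      then have "indicator (Pi\<^sub>E I A) x = (\<Prod>i\<in>I. indicator (A i) (x i) :: ennreal)"
        using fin by (auto simp: indicator_def prod_zero_iff)
      then show "(\<Prod>i\<in>I. g i (x i)) * indicator (Pi\<^sub>E I A) x = (\<Prod>i\<in>I. g i (x i) * indicator (A i) (x i))"
        by (simp add: prod.distrib)
    qed
    also have "\<dots> = (\<Prod>i\<in>I. \<integral>\<^sup>+x. g i x * indicator (A i) x \<partial>M i)"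
      by (intro M.product_nn_integral_prod fin borel_measurable_times_ennreal g borel_measurable_indicator A)
    also have "\<dots> = (\<Prod>i\<in>I. emeasure (density (M i) (g i)) (A i))"
      using A by (intro prod.cong refl emeasure_density[symmetric]) auto
    finally show "emeasure (density (PiM I M) (\<lambda>x. \<Prod>i\<in>I. g i (x i))) (Pi\<^sub>E I A) = (\<Prod>i\<in>I. emeasure (density (M i) (g i)) (A i))" .
  qed
qed

definition gauss_density :: "'e::euclidean_space \<Rightarrow> ennreal" where
  "gauss_density x = (\<Prod>b\<in>Basis. ennreal (std_normal_density (x \<bullet> b)))"

lemma gauss_density_measurable [measurable]: "gauss_density \<in> borel_measurable borel"
  unfolding gauss_density_def by measurable

lemma gauss_eq_density: "gauss = density lborel (gauss_density :: 'e::euclidean_space \<Rightarrow> ennreal)"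
proof -
  let ?\<phi> = "\<lambda>f. \<Sum>b\<in>Basis. f b *\<^sub>R (b :: 'e)"
  have m: "?\<phi> \<in> borel_measurable (PiM Basis (\<lambda>_. lborel))" by (rule measurable_sum_coordinates) simp_all
  have "PiM Basis (\<lambda>_::'e. std_gauss) = density (PiM Basis (\<lambda>_. lborel)) (\<lambda>x. \<Prod>i\<in>Basis. ennreal (std_normal_density (x i)))"
    unfolding std_gauss_def
    by (rule PiM_density_finite)
      (simp_all add: sigma_finite_lborel prob_space_imp_sigma_finite[OF prob_space_std_gauss[unfolded std_gauss_def]])
  also have "\<dots> = density (PiM Basis (\<lambda>_. lborel)) (\<lambda>x. gauss_density (?\<phi> x))"
    unfolding gauss_density_def by simp
  finally have "gauss = distr (density (PiM Basis (\<lambda>_. lborel)) (\<lambda>x. gauss_density (?\<phi> x))) borel ?\<phi>"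
    unfolding gauss_def by simp
  also have "\<dots> = density (distr (PiM Basis (\<lambda>_. lborel)) borel ?\<phi>) gauss_density"
    by (rule density_distr[OF gauss_density_measurable m, symmetric])
  finally show ?thesis unfolding lborel_eq[symmetric] .
qed

text \<open>The product of the one-dimensional densities depends on \<open>x\<close> through its
  norm only; with the invariance of Lebesgue measure this gives rotation invariance.\<close>

lemma gauss_density_norm: "gauss_density x = ennreal ((1 / sqrt (2 * pi)) ^ DIM('e) * exp (- (norm x)\<^sup>2 / 2))"
  for x :: "'e::euclidean_space"
proof -
  have "gauss_density x = ennreal (\<Prod>b\<in>Basis. std_normal_density (x \<bullet> b))"
    unfolding gauss_density_def by (rule prod_ennreal) (simp add: normal_density_nonneg)
  also have "(\<Prod>b\<in>Basis. std_normal_density (x \<bullet> b)) = (1 / sqrt (2 * pi)) ^ DIM('e) * exp (\<Sum>b\<in>Basis. - (x \<bullet> b)\<^sup>2 / 2)"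
    by (simp add: std_normal_density_def prod.distrib exp_sum del: times_divide_eq_left times_divide_eq_right)
  also have "(\<Sum>b\<in>Basis. - (x \<bullet> b)\<^sup>2 / 2) = - (norm x)\<^sup>2 / 2"
    unfolding norm_eq_sqrt_inner euclidean_inner[of x x]
    by (simp add: sum_nonneg sum_divide_distrib[symmetric] sum_negf power2_eq_square)
  finally show ?thesis .
qed

text \<open>A negligible set is in general only Lebesgue measurable, hence the detour through the
  completion.\<close>

lemma AE_gauss_negligible:
  assumes "negligible (N :: 'e::euclidean_space set)"
  shows "AE x in gauss. x \<notin> N"
proof -
  have "AE x in completion lborel. x \<notin> N"
    using assms by (intro AE_not_in) (simp add: negligible_iff_null_sets)
  then have "AE x in lborel. x \<notin> N" by (simp add: AE_completion_iff)
  then show ?thesis unfolding gauss_eq_density by (subst AE_density) auto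
qed

text \<open>The determinant of an orthogonal matrix is 1 or -1, so preimages of boxes keep their
  volume.\<close>

lemma lborel_orthogonal_cart:
  fixes g :: "real^'n::{finite,wellorder} \<Rightarrow> real^'n::_"
  assumes g: "orthogonal_transformation g"
  shows "distr lborel borel g = lborel"
proof (rule lborel_eqI[symmetric])
  have lin: "linear g" using g by (simp add: orthogonal_transformation_linear)
  have bij: "bij g" by (rule orthogonal_transformation_bij[OF g])
  have gm: "g \<in> borel_measurable borel" using lin by (intro borel_measurable_continuous_onI linear_continuous_on) (simp add: linear_conv_bounded_linear)
  fix l u :: "(real,'n) Finite_Cartesian_Product.vec" assume lu: "\<And>b. b \<in> Basis \<Longrightarrow> l \<bullet> b \<le> u \<bullet> b"
  define h where "h = inv_into UNIV g"
  have h: "orthogonal_transformation h" unfolding h_def by (rule orthogonal_transformation_inv[OF g])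
  have pre: "g -` box l u = h ` box l u" unfolding h_def using bij by (simp add: bij_vimage_eq_inv_image)
  have hm: "h ` box l u \<in> lmeasurable"
    using h by (intro measurable_linear_image) (simp_all add: orthogonal_transformation_linear)
  have "g -` box l u \<in> sets borel" using measurable_sets[OF gm, of "box l u"] by simp
  then have hb: "h ` box l u \<in> sets borel" unfolding pre .
  have "emeasure (distr lborel borel g) (box l u) = emeasure lborel (h ` box l u)"
    using gm by (subst emeasure_distr) (auto simp: pre)
  also have "\<dots> = emeasure lebesgue (h ` box l u)" using hb by simp
  also have "\<dots> = ennreal (measure lebesgue (h ` box l u))" using hm by (rule emeasure_eq_measure2)
  also have "measure lebesgue (h ` box l u) = \<bar>Determinants.det (matrix h)\<bar> * measure lebesgue (box l u)"
    using h by (intro measure_linear_image) (simp_all add: orthogonal_transformation_linear)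
  also have "\<dots> = measure lebesgue (box l u)" using orthogonal_transformation_det[OF h] by simp
  also have "ennreal (measure lebesgue (box l u)) = emeasure lebesgue (box l u)"
    by (rule emeasure_eq_measure2[symmetric]) simp
  also have "\<dots> = emeasure lborel (box l u)" by simp
  also have "\<dots> = (\<Prod>b\<in>Basis. (u - l) \<bullet> b)" using lu by (rule emeasure_lborel_box)
  finally show "emeasure (distr lborel borel g) (box l u) = (\<Prod>b\<in>Basis. (u - l) \<bullet> b)" .
qed simp

lemma lborel_basis_isometry:
  fixes b :: "'n::finite \<Rightarrow> 'e::euclidean_space"
  assumes b: "bij_betw b UNIV Basis"
  shows "distr lborel borel (\<lambda>x::real^'n. \<Sum>i\<in>UNIV. x$i *\<^sub>R b i) = lborel"
proof (rule lborel_eqI[symmetric])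
  let ?\<phi> = "\<lambda>x::real^'n. \<Sum>i\<in>UNIV. x$i *\<^sub>R b i"
  have bB: "b i \<in> Basis" for i using b by (auto simp: bij_betw_def)
  have bij: "b i \<bullet> b j = of_bool (i = j)" for i j
    using inner_Basis[OF bB bB, of i j] b by (auto simp: bij_betw_def inj_on_def)
  have \<phi>b: "?\<phi> x \<bullet> b i = x$i" for x i
    by (simp add: inner_sum_left bij)
  have m: "?\<phi> \<in> borel_measurable borel" by (intro borel_measurable_continuous_onI continuous_intros)
  fix l u :: 'e assume lu: "\<And>b. b \<in> Basis \<Longrightarrow> l \<bullet> b \<le> u \<bullet> b"
  have all: "(\<forall>c\<in>Basis. P c) \<longleftrightarrow> (\<forall>i. P (b i))" for P
    unfolding bij_betw_imp_surj_on[OF b, symmetric] by blast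
  have pre: "?\<phi> -` box l u = box (\<chi> i. l \<bullet> b i) (\<chi> i. u \<bullet> b i)"
    by (auto simp: box_def all \<phi>b Basis_vec_def inner_axis)
  have "emeasure (distr lborel borel ?\<phi>) (box l u) = emeasure lborel (box (\<chi> i::'n. l \<bullet> b i) (\<chi> i::'n. u \<bullet> b i))"
    using m by (subst emeasure_distr) (auto simp: pre)
  also have "\<dots> = (\<Prod>c\<in>Basis. ((\<chi> i. u \<bullet> b i) - (\<chi> i::'n. l \<bullet> b i)) \<bullet> c)"
    by (rule emeasure_lborel_box) (use lu bB in \<open>auto simp: Basis_vec_def inner_axis\<close>)
  also have "(Basis :: (real^'n) set) = (\<lambda>i. axis i 1) ` UNIV" by (auto simp: Basis_vec_def)
  also have "(\<Prod>c\<in>(\<lambda>i. axis i 1) ` UNIV. ((\<chi> i. u \<bullet> b i) - (\<chi> i::'n. l \<bullet> b i)) \<bullet> c) = (\<Prod>i\<in>UNIV. (u - l) \<bullet> b i)"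
    by (subst prod.reindex) (auto simp: inj_on_def axis_eq_axis inner_axis inner_diff_left)
  also have "\<dots> = (\<Prod>c\<in>Basis. (u - l) \<bullet> c)" by (rule prod.reindex_bij_betw[OF b])
  finally show "emeasure (distr lborel borel ?\<phi>) (box l u) = (\<Prod>c\<in>Basis. (u - l) \<bullet> c)" .
qed simp

text \<open>Coordinates over \<open>'n\<close> carry the statement from \<open>real^'n\<close> to
  any Euclidean space of that dimension. In the statement \<open>'n\<close> occurs only in the
  premise \<open>n\<close>, so it is instantiated by hand later on, with the numeral types 45, 36
  and 81.\<close>

lemma lborel_orthogonal:
  fixes f :: "'e::euclidean_space \<Rightarrow> 'e"
  assumes n: "CARD('n::{finite,wellorder}) = DIM('e)" and f: "orthogonal_transformation f"
  shows "distr lborel borel f = lborel"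
proof -
  obtain b :: "'n \<Rightarrow> 'e" where b: "bij_betw b UNIV Basis"
    using finite_same_card_bij[of "UNIV :: 'n set" "Basis :: 'e set"] n by auto
  have bB: "b i \<in> Basis" for i using b by (auto simp: bij_betw_def)
  have bij: "b i \<bullet> b j = of_bool (i = j)" for i j
    using inner_Basis[OF bB bB, of i j] b by (auto simp: bij_betw_def inj_on_def)
  define \<phi> where "\<phi> x = (\<Sum>i\<in>UNIV. x$i *\<^sub>R b i)" for x :: "(real,'n) Finite_Cartesian_Product.vec"
  define \<psi> where "\<psi> y = (\<chi> i. y \<bullet> b i)" for y :: 'e
  have \<phi>\<psi>: "\<phi> (\<psi> y) = y" for y
  proof -
    have "\<phi> (\<psi> y) = (\<Sum>c\<in>Basis. (y \<bullet> c) *\<^sub>R c)"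
      unfolding \<phi>_def \<psi>_def using sum.reindex_bij_betw[OF b, of "\<lambda>c. (y \<bullet> c) *\<^sub>R c"] by simp
    then show ?thesis by (simp add: euclidean_representation)
  qed
  have \<phi>n: "\<phi> x \<bullet> \<phi> y = x \<bullet> y" for x y
    by (simp add: \<phi>_def inner_sum_left inner_sum_right bij inner_vec_def mult.commute)
  have l\<phi>: "linear \<phi>" unfolding \<phi>_def by (intro linearI) (simp_all add: algebra_simps sum.distrib scaleR_sum_right)
  have l\<psi>: "linear \<psi>" unfolding \<psi>_def by (intro linearI) (simp_all add: cart_eq_iff inner_add_left)
  have lf: "linear f" using f by (simp add: orthogonal_transformation_linear)
  define g where "g = \<psi> \<circ> f \<circ> \<phi>"
  have "linear g" unfolding g_def using l\<phi> l\<psi> lf by (intro linear_compose)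
  moreover have "norm (g x) = norm x" for x
  proof -
    have "norm (g x) = norm (\<phi> (g x))" by (simp add: norm_eq_sqrt_inner \<phi>n)
    also have "\<dots> = norm (f (\<phi> x))" by (simp add: g_def \<phi>\<psi>)
    also have "\<dots> = norm (\<phi> x)" using f by (simp add: orthogonal_transformation)
    also have "\<dots> = norm x" by (simp add: norm_eq_sqrt_inner \<phi>n)
    finally show ?thesis .
  qed
  ultimately have g: "orthogonal_transformation g" by (simp add: orthogonal_transformation)
  have fm [measurable]: "f \<in> borel_measurable borel" "\<phi> \<in> borel_measurable borel" "g \<in> borel_measurable borel"
    using lf l\<phi> \<open>linear g\<close> by (auto intro!: borel_measurable_continuous_onI linear_continuous_on simp: linear_conv_bounded_linear)
  have \<phi>l: "distr lborel borel \<phi> = lborel" using lborel_basis_isometry[OF b] unfolding \<phi>_def[abs_def] .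
  have "distr lborel borel f = distr (distr lborel borel \<phi>) borel f" unfolding \<phi>l ..
  also have "\<dots> = distr lborel borel (f \<circ> \<phi>)" by (rule distr_distr) simp_all
  also have "f \<circ> \<phi> = \<phi> \<circ> g" by (auto simp: g_def \<phi>\<psi>)
  also have "distr lborel borel (\<phi> \<circ> g) = distr (distr lborel borel g) borel \<phi>" by (rule distr_distr[symmetric]) simp_all
  also have "\<dots> = lborel" unfolding lborel_orthogonal_cart[OF g] \<phi>l ..
  finally show ?thesis .
qed

lemma gauss_orthogonal:
  fixes f :: "'e::euclidean_space \<Rightarrow> 'e"
  assumes n: "CARD('n::{finite,wellorder}) = DIM('e)" and f: "orthogonal_transformation f"
  shows "distr gauss borel f = gauss"
proof -
  have lf: "linear f" using f by (simp add: orthogonal_transformation_linear)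
  have fm [measurable]: "f \<in> borel_measurable borel"
    using lf by (auto intro!: borel_measurable_continuous_onI linear_continuous_on simp: linear_conv_bounded_linear)
  have "gauss_density (f x) = gauss_density x" for x
    using f by (simp add: gauss_density_norm orthogonal_transformation)
  then have "distr gauss borel f = distr (density lborel (\<lambda>x. gauss_density (f x))) borel f"
    by (simp add: gauss_eq_density)
  also have "\<dots> = density (distr lborel borel f) gauss_density"
    by (rule density_distr[symmetric]) simp_all
  also have "\<dots> = gauss" unfolding lborel_orthogonal[OF n f] gauss_eq_density ..
  finally show ?thesis .
qed

section \<open>The product measures over index triples as Gaussian measures on vectors\<close>

lemma gauss_from_index:
  fixes \<beta> :: "'i \<Rightarrow> 'e::euclidean_space"
  assumes \<beta>: "bij_betw \<beta> K Basis" and fin: "finite K"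
  shows "distr (PiM K (\<lambda>_. std_gauss)) borel (\<lambda>\<omega>. \<Sum>t\<in>K. \<omega> t *\<^sub>R \<beta> t) = gauss"
proof -
  define g where "g = the_inv_into K \<beta>"
  have gb: "bij_betw g Basis K" unfolding g_def by (rule bij_betw_the_inv_into[OF \<beta>])
  have \<beta>g: "\<beta> (g c) = c" if "c \<in> Basis" for c
    unfolding g_def using \<beta> that by (intro f_the_inv_into_f) (auto simp: bij_betw_def)
  let ?r = "\<lambda>\<omega>. \<lambda>n\<in>Basis. \<omega> (g n)"
  have rm: "?r \<in> measurable (PiM K (\<lambda>_. std_gauss)) (PiM Basis (\<lambda>_. std_gauss))"
    using gb by (intro measurable_restrict measurable_component_singleton) (auto simp: bij_betw_def)
  have "gauss = distr (distr (PiM K (\<lambda>_. std_gauss)) (PiM Basis (\<lambda>_. std_gauss)) ?r) borel (\<lambda>f. \<Sum>b\<in>Basis. f b *\<^sub>R b)"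
    unfolding gauss_def using gb prob_space_std_gauss
    by (subst distr_PiM_reindex[of K "\<lambda>_. std_gauss" g Basis]) (auto simp: bij_betw_def)
  also have "\<dots> = distr (PiM K (\<lambda>_. std_gauss)) borel ((\<lambda>f. \<Sum>b\<in>Basis. f b *\<^sub>R b) \<circ> ?r)"
    by (rule distr_distr[OF _ rm]) (rule measurable_sum_coordinates; simp)
  also have "(\<lambda>f. \<Sum>b\<in>Basis. f b *\<^sub>R (b::'e)) \<circ> ?r = (\<lambda>\<omega>. \<Sum>t\<in>K. \<omega> t *\<^sub>R \<beta> t)"
  proof
    fix \<omega> :: "'i \<Rightarrow> real"
    have "((\<lambda>f. \<Sum>b\<in>Basis. f b *\<^sub>R (b::'e)) \<circ> ?r) \<omega> = (\<Sum>b\<in>Basis. \<omega> (g b) *\<^sub>R \<beta> (g b))" by (simp add: \<beta>g)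
    also have "\<dots> = (\<Sum>t\<in>K. \<omega> t *\<^sub>R \<beta> t)" by (rule sum.reindex_bij_betw[OF gb])
    finally show "((\<lambda>f. \<Sum>b\<in>Basis. f b *\<^sub>R (b::'e)) \<circ> ?r) \<omega> = (\<Sum>t\<in>K. \<omega> t *\<^sub>R \<beta> t)" .
  qed
  finally show ?thesis ..
qed

lemma bij_axis3:
  assumes f: "bij_betw f K (UNIV :: ('k::finite \<times> 'i::finite \<times> 'j::finite) set)"
  shows "bij_betw (\<lambda>t. case f t of (k,i,j) \<Rightarrow> axis k (axis i (axis j (1::real)))) K (Basis :: (real^'j^'i^'k) set)"
proof -
  have "bij_betw (\<lambda>(k,i,j). axis k (axis i (axis j (1::real)))) (UNIV :: ('k \<times> 'i \<times> 'j) set) (Basis :: (real^'j^'i^'k) set)"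
    unfolding bij_betw_def
    by (auto simp: inj_on_def axis_eq_axis Basis_vec_def axis_eq_0_iff image_iff)
  from bij_betw_trans[OF f this] show ?thesis by (simp add: comp_def case_prod_unfold)
qed

lemma measure_gauss_from_index:
  fixes f :: "'t \<Rightarrow> 'k::finite \<times> 'i::finite \<times> 'j::finite" and P :: "real^'j^'i^'k \<Rightarrow> bool"
  assumes f: "bij_betw f K UNIV" and fin: "finite K" and P: "{x. P x} \<in> sets borel"
    and v: "\<And>\<omega> k i j t. t \<in> K \<Longrightarrow> f t = (k,i,j) \<Longrightarrow> v \<omega> $k$i$j = \<omega> t"
  shows "measure (PiM K (\<lambda>_. std_gauss)) {\<omega> \<in> space (PiM K (\<lambda>_. std_gauss)). P (v \<omega>)} = measure gauss {x. P x}"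
proof -
  let ?\<beta> = "\<lambda>t. case f t of (k,i,j) \<Rightarrow> axis k (axis i (axis j (1::real)))"
  note b = bij_axis3[OF f]
  have ve: "v \<omega> = (\<Sum>t\<in>K. \<omega> t *\<^sub>R ?\<beta> t)" for \<omega>
  proof -
    have "(\<Sum>t\<in>K. \<omega> t *\<^sub>R ?\<beta> t) $k$i$j = v \<omega> $k$i$j" for k i j
    proof -
      obtain t0 where t0: "t0 \<in> K" "f t0 = (k,i,j)" using f unfolding bij_betw_def by (metis UNIV_I imageE)
      have u: "f t = (k,i,j) \<longleftrightarrow> t = t0" if "t \<in> K" for t using f t0 that by (auto simp: bij_betw_def inj_on_def)
      have "(\<Sum>t\<in>K. \<omega> t *\<^sub>R ?\<beta> t) $k$i$j = (\<Sum>t\<in>K. \<omega> t * of_bool (f t = (k,i,j)))"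
        unfolding sum_component by (intro sum.cong refl) (auto simp: axis_def split: prod.splits)
      also have "\<dots> = (\<Sum>t\<in>K. if t = t0 then \<omega> t else 0)" by (intro sum.cong refl) (auto simp: u)
      finally show ?thesis using fin t0 v[OF t0] by simp
    qed
    then show ?thesis unfolding cart_eq_iff by simp
  qed
  have m: "(\<lambda>\<omega>. \<Sum>t\<in>K. \<omega> t *\<^sub>R ?\<beta> t) \<in> measurable (PiM K (\<lambda>_. std_gauss)) borel"
    using fin by (rule measurable_sum_coordinates) simp
  have "measure gauss {x. P x} = measure (distr (PiM K (\<lambda>_. std_gauss)) borel (\<lambda>\<omega>. \<Sum>t\<in>K. \<omega> t *\<^sub>R ?\<beta> t)) {x. P x}"
    unfolding gauss_from_index[OF b fin] ..
  also have "\<dots> = measure (PiM K (\<lambda>_. std_gauss)) {\<omega> \<in> space (PiM K (\<lambda>_. std_gauss)). P (v \<omega>)}"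
    unfolding ve by (subst measure_distr[OF m P]) (auto intro!: arg_cong[where f="measure _"])
  finally show ?thesis ..
qed

lemma bij_tensor_idx: "bij_betw (\<lambda>(i,j,k). (ix k, ix i, ix j)) tensor_idx (UNIV :: (5 \<times> 3 \<times> 3) set)"
  unfolding bij_betw_def
proof
  show "inj_on (\<lambda>(i,j,k). (ix k :: 5, ix i :: 3, ix j :: 3)) tensor_idx"
    unfolding inj_on_def tensor_idx_def
    by (clarsimp, metis jx_ix card_num1 jx_ix[where 'n=3, simplified] jx_ix[where 'n=5, simplified])
  show "(\<lambda>(i,j,k). (ix k, ix i, ix j)) ` tensor_idx = (UNIV :: (5 \<times> 3 \<times> 3) set)"
  proof (intro equalityI subset_UNIV subsetI)
    fix t :: "5 \<times> 3 \<times> 3"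
    obtain k i j where t: "t = (k,i,j)" by (cases t)
    have "(jx i, jx j, jx k) \<in> tensor_idx"
      using jx_less[of i] jx_less[of j] jx_less[of k] by (simp add: tensor_idx_def)
    then show "t \<in> (\<lambda>(i,j,k). (ix k, ix i, ix j)) ` tensor_idx" by (rule rev_image_eqI) (simp add: t)
  qed
qed

lemma bij_pencil_idx: "bij_betw (\<lambda>(l,r,c). (ix l, ix r, ix c)) pencil_idx (UNIV :: (4 \<times> 3 \<times> 3) set)"
  unfolding bij_betw_def
proof
  show "inj_on (\<lambda>(l,r,c). (ix l :: 4, ix r :: 3, ix c :: 3)) pencil_idx"
    unfolding inj_on_def pencil_idx_def
    by (clarsimp, metis jx_ix[where 'n=3, simplified] jx_ix[where 'n=4, simplified])
  show "(\<lambda>(l,r,c). (ix l, ix r, ix c)) ` pencil_idx = (UNIV :: (4 \<times> 3 \<times> 3) set)"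
  proof (intro equalityI subset_UNIV subsetI)
    fix t :: "4 \<times> 3 \<times> 3"
    obtain l r c where t: "t = (l,r,c)" by (cases t)
    have "(jx l, jx r, jx c) \<in> pencil_idx"
      using jx_less[of l] jx_less[of r] jx_less[of c] by (simp add: pencil_idx_def)
    then show "t \<in> (\<lambda>(l,r,c). (ix l, ix r, ix c)) ` pencil_idx" by (rule rev_image_eqI) (simp add: t)
  qed
qed

lemma finite_idx: "finite tensor_idx" "finite pencil_idx"
  using bij_betw_finite[OF bij_tensor_idx] bij_betw_finite[OF bij_pencil_idx] by simp_all

lemma tensor_probability:
  "measure gauss_tensor {T \<in> space gauss_tensor. tensor_rank T = 5} = measure gauss {T. decomp 5 T \<and> \<not> decomp 4 T}"
  unfolding gauss_tensor_def tensor_rank_5_iff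
  by (rule measure_gauss_from_index[OF bij_tensor_idx finite_idx(1) rank5_borel])
    (auto simp: tensor_vec_def tensor_idx_def jx_ix[where 'n=3, simplified] jx_ix[where 'n=5, simplified])

lemma pencil_probability:
  "measure gauss_pencil {M \<in> space gauss_pencil. all_27_lines_real M} = measure gauss {M. all27 M}"
  unfolding gauss_pencil_def all_27_lines_real_iff
  by (rule measure_gauss_from_index[OF bij_pencil_idx finite_idx(2) all27_borel])
    (auto simp: pencil_vec_def pencil_idx_def jx_ix[where 'n=3, simplified] jx_ix[where 'n=4, simplified])

section \<open>Genericity\<close>

lemma polynomial_function_vec_nth [intro]:
  fixes f :: "'a::real_normed_vector \<Rightarrow> 'b::euclidean_space^'n"
  assumes "polynomial_function f" shows "polynomial_function (\<lambda>x. f x $ i)"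
  unfolding polynomial_function_iff_Basis_inner
proof
  fix b :: 'b assume b: "b \<in> Basis"
  then have "axis i b \<in> (Basis :: ('b^'n) set)" by (auto simp: Basis_vec_def)
  then have "real_polynomial_function (\<lambda>x. f x \<bullet> axis i b)" using assms unfolding polynomial_function_iff_Basis_inner by blast
  then show "real_polynomial_function (\<lambda>x. f x $ i \<bullet> b)" by (simp add: inner_axis)
qed

lemma polynomial_function_vec [intro]:
  fixes f :: "'a::real_normed_vector \<Rightarrow> 'b::euclidean_space^'n"
  assumes "\<And>i. polynomial_function (\<lambda>x. f x $ i)" shows "polynomial_function f"
  unfolding polynomial_function_iff_Basis_inner
proof
  fix c :: "'b^'n" assume "c \<in> Basis"
  then obtain i b where "b \<in> Basis" "c = axis i b" by (auto simp: Basis_vec_def)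
  then show "real_polynomial_function (\<lambda>x. f x \<bullet> c)"
    using assms[of i] unfolding polynomial_function_iff_Basis_inner by (simp add: inner_axis)
qed

lemma polynomial_function_fst [intro]:
  assumes "polynomial_function f" shows "polynomial_function (\<lambda>x. fst (f x))"
  using polynomial_function_compose[OF assms polynomial_function_bounded_linear[OF bounded_linear_fst]] by (simp add: comp_def)

lemma polynomial_function_snd [intro]:
  assumes "polynomial_function f" shows "polynomial_function (\<lambda>x. snd (f x))"
  using polynomial_function_compose[OF assms polynomial_function_bounded_linear[OF bounded_linear_snd]] by (simp add: comp_def)

lemma polynomial_function_outer [intro]:
  assumes "polynomial_function f" "polynomial_function g"
  shows "polynomial_function (\<lambda>x. outer (f x) (g x))"
proof (intro polynomial_function_vec)
  fix i j
  have "polynomial_function (\<lambda>x. f x $ i *\<^sub>R g x $ j)" using assms by (intro polynomial_function_mult polynomial_function_vec_nth)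
  then show "polynomial_function (\<lambda>x. outer (f x) (g x) $ i $ j)" by simp
qed

text \<open>Some member is a combination of the others; \<open>\<sigma>\<close> marks its position
  by \<open>None\<close> and numbers the other positions. Such families have
  \<open>CARD('m) * (DIM('e) + 1)\<close> parameters, which by \<open>d\<close> is less than
  \<open>CARD('n) * DIM('e)\<close>.\<close>

lemma dependent_negligible:
  assumes n: "CARD('n::finite) = Suc CARD('m::finite)" and d: "CARD('m) < DIM('e)"
  shows "negligible {T :: 'e::euclidean_space^'n. \<not> findep UNIV (($) T)}"
proof -
  define \<Psi> where "\<Psi> \<sigma> z = (\<chi> n. case \<sigma> n of Some j \<Rightarrow> fst z $ j | None \<Rightarrow> \<Sum>j\<in>UNIV. snd z $ j *\<^sub>R fst z $ j)"
    for \<sigma> :: "'n \<Rightarrow> 'm option" and z :: "('e^'m) \<times> (real^'m)"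
  have "negligible (range (\<Psi> \<sigma>))" for \<sigma>
  proof (rule negligible_differentiable_image_lowdim)
    show "DIM(('e^'m) \<times> (real^'m)) < DIM('e^'n)" using d by (simp add: n algebra_simps)
    have "polynomial_function (\<Psi> \<sigma>)"
    proof (rule polynomial_function_vec)
      fix i show "polynomial_function (\<lambda>z. \<Psi> \<sigma> z $ i)"
        unfolding \<Psi>_def by (cases "\<sigma> i") (auto intro!: polynomial_function_sum polynomial_function_mult)
    qed
    then show "\<Psi> \<sigma> differentiable_on UNIV" by (rule differentiable_on_polynomial_function)
  qed
  then have "negligible (\<Union>(range (\<lambda>\<sigma>. range (\<Psi> \<sigma>))))" by (intro negligible_Union) auto
  moreover have "{T :: 'e^'n. \<not> findep UNIV (($) T)} \<subseteq> \<Union>(range (\<lambda>\<sigma>. range (\<Psi> \<sigma>)))"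
  proof clarify
    fix T :: "'e^'n" assume "\<not> findep UNIV (($) T)"
    then obtain c k where c: "(\<Sum>i\<in>UNIV. c i *\<^sub>R T$i) = 0" "c k \<noteq> 0" unfolding findep_def by auto
    obtain e :: "'m \<Rightarrow> 'n" where e: "bij_betw e UNIV (UNIV - {k})"
      using finite_same_card_bij[of "UNIV :: 'm set" "UNIV - {k}"] n by (auto simp: card_Diff_singleton)
    define \<sigma> where "\<sigma> n = (if n = k then None else Some (the_inv_into UNIV e n))" for n
    have inv: "e (the_inv_into UNIV e n) = n" if "n \<noteq> k" for n
      using e that by (intro f_the_inv_into_f) (auto simp: bij_betw_def)
    have "(\<Sum>i\<in>UNIV. c i *\<^sub>R T$i) = c k *\<^sub>R T$k + (\<Sum>i\<in>UNIV - {k}. c i *\<^sub>R T$i)" by (rule sum.remove) simp_all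
    then have "c k *\<^sub>R T$k = - (\<Sum>i\<in>UNIV - {k}. c i *\<^sub>R T$i)" using c(1) by (simp add: eq_neg_iff_add_eq_0)
    then have "(1/c k) *\<^sub>R (c k *\<^sub>R T$k) = (1/c k) *\<^sub>R (- (\<Sum>i\<in>UNIV - {k}. c i *\<^sub>R T$i))" by simp
    then have "T$k = (\<Sum>i\<in>UNIV - {k}. (- c i / c k) *\<^sub>R T$i)"
      using c(2) by (simp add: scaleR_sum_right sum_negf)
    also have "\<dots> = (\<Sum>j\<in>UNIV. (- c (e j) / c k) *\<^sub>R T$(e j))"
      by (rule sum.reindex_bij_betw[OF e, symmetric])
    finally have Tk: "T$k = (\<Sum>j\<in>UNIV. (- c (e j) / c k) *\<^sub>R T$(e j))" .
    have "T$n = \<Psi> \<sigma> ((\<chi> j. T$(e j)), (\<chi> j. - c (e j) / c k)) $ n" for n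
      using inv[of n] Tk by (cases "n = k") (simp_all add: \<Psi>_def \<sigma>_def)
    then have "T = \<Psi> \<sigma> ((\<chi> j. T$(e j)), (\<chi> j. - c (e j) / c k))" unfolding cart_eq_iff by blast
    then show "T \<in> \<Union>(range (\<lambda>\<sigma>. range (\<Psi> \<sigma>)))" by blast
  qed
  ultimately show ?thesis by (rule negligible_subset)
qed

text \<open>Dimension count: a subspace containing a configuration \<open>\<phi> \<theta>\<close> of \<open>k\<close> independent vectors is spanned by these and
  \<open>m\<close> of the \<open>T$n\<close>, and the remaining \<open>k\<close> of the \<open>T$n\<close> are combinations; this leaves
  \<open>dim \<theta> + m DIM('e) + k (m + k)\<close> parameters.\<close>
lemma configuration_negligible:
  fixes \<phi> :: "'p::euclidean_space \<Rightarrow> 'k::finite \<Rightarrow> 'e::euclidean_space"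
  assumes n: "CARD('n::finite) = CARD('m::finite) + CARD('k)"
    and d: "DIM('p) + CARD('n) * CARD('k) < DIM('e) * CARD('k)"
    and \<phi>: "\<And>l. polynomial_function (\<lambda>\<theta>. \<phi> \<theta> l)"
  shows "negligible {T :: 'e^'n. findep UNIV (($) T) \<and>
    (\<exists>\<theta>. findep UNIV (\<phi> \<theta>) \<and> (\<forall>l. \<phi> \<theta> l \<in> span (range (($) T))))}" (is "negligible ?B")
proof -
  define g where "g \<theta> t s = (case s of Inl j \<Rightarrow> t $ j | Inr l \<Rightarrow> \<phi> \<theta> l)"
    for \<theta> and t :: "'e^'m" and s :: "'m + 'k"
  define \<Psi> where "\<Psi> \<sigma> z = (\<chi> n. case \<sigma> n of Inl j \<Rightarrow> fst (snd z) $ j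
      | Inr i \<Rightarrow> \<Sum>s\<in>UNIV. snd (snd z) $ i $ s *\<^sub>R g (fst z) (fst (snd z)) s)"
    for \<sigma> :: "'n \<Rightarrow> 'm + 'k" and z :: "'p \<times> ('e^'m) \<times> (real^('m + 'k)^'k)"
  have "negligible (range (\<Psi> \<sigma>))" for \<sigma>
  proof (rule negligible_differentiable_image_lowdim)
    show "DIM('p \<times> ('e^'m) \<times> (real^('m + 'k)^'k)) < DIM('e^'n)"
      using d by (simp add: n algebra_simps)
    have gp: "polynomial_function (\<lambda>z :: 'p \<times> ('e^'m) \<times> (real^('m + 'k)^'k). g (fst z) (fst (snd z)) s)" for s
    proof (cases s)
      case (Inr l)
      have "polynomial_function ((\<lambda>\<theta>. \<phi> \<theta> l) \<circ> (\<lambda>z :: 'p \<times> ('e^'m) \<times> (real^('m + 'k)^'k). fst z))"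
        by (rule polynomial_function_compose) (auto intro: \<phi>)
      then show ?thesis by (simp add: g_def Inr comp_def)
    next
      case (Inl j)
      have "polynomial_function (\<lambda>z :: 'p \<times> ('e^'m) \<times> (real^('m + 'k)^'k). fst (snd z) $ j)"
        by (intro polynomial_function_vec_nth polynomial_function_fst polynomial_function_snd polynomial_function_id)
      then show ?thesis by (simp add: g_def Inl)
    qed
    have "polynomial_function (\<Psi> \<sigma>)"
    proof (rule polynomial_function_vec)
      fix i show "polynomial_function (\<lambda>z. \<Psi> \<sigma> z $ i)"
      proof (cases "\<sigma> i")
        case (Inl j)
        have "polynomial_function (\<lambda>z :: 'p \<times> ('e^'m) \<times> (real^('m + 'k)^'k). fst (snd z) $ j)"
          by (intro polynomial_function_vec_nth polynomial_function_fst polynomial_function_snd polynomial_function_id)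
        then show ?thesis by (simp add: \<Psi>_def Inl)
      next
        case (Inr l)
        have "polynomial_function (\<lambda>z :: 'p \<times> ('e^'m) \<times> (real^('m + 'k)^'k).
            \<Sum>s\<in>UNIV. snd (snd z) $ l $ s *\<^sub>R g (fst z) (fst (snd z)) s)"
          by (intro polynomial_function_sum polynomial_function_mult gp finite_class.finite_UNIV
              polynomial_function_vec_nth polynomial_function_snd polynomial_function_id)
        then show ?thesis by (simp add: \<Psi>_def Inr)
      qed
    qed
    then show "\<Psi> \<sigma> differentiable_on UNIV" by (rule differentiable_on_polynomial_function)
  qed
  then have "negligible (\<Union>(range (\<lambda>\<sigma>. range (\<Psi> \<sigma>))))" by (intro negligible_Union) auto
  moreover have "?B \<subseteq> \<Union>(range (\<lambda>\<sigma>. range (\<Psi> \<sigma>)))"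
  proof clarify
    fix T :: "'e^'n" and \<theta>
    assume T: "findep UNIV (($) T)" and f: "findep UNIV (\<phi> \<theta>)" and W: "\<forall>l. \<phi> \<theta> l \<in> span (range (($) T))"
    let ?V = "range (\<phi> \<theta>) \<union> range (($) T)"
    have fi: "inj (\<phi> \<theta>)" "independent (range (\<phi> \<theta>))" and Ti: "inj (($) T)" "independent (range (($) T))"
      using f T by (simp_all add: findep_iff)
    obtain B where B: "range (\<phi> \<theta>) \<subseteq> B" "B \<subseteq> ?V" "independent B" "?V \<subseteq> span B"
      using maximal_independent_subset_extend[of "range (\<phi> \<theta>)" ?V] fi by auto
    have fB: "finite B" using B(2) by (rule finite_subset) simp
    have "span B = span (range (($) T))"
    proof
      show "span B \<subseteq> span (range (($) T))" using B(2) W by (intro span_minimal) (auto simp: subspace_span span_base)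
      show "span (range (($) T)) \<subseteq> span B" using B(4) by (intro span_minimal) (auto simp: subspace_span)
    qed
    then have "card B = CARD('n)" using findep_dim[OF _ T] dim_eq_card_independent[OF B(3)] by (metis dim_span finite_class.finite_UNIV)
    then have cB: "card (B - range (\<phi> \<theta>)) = CARD('m)"
      using B(1) fB n card_image[OF fi(1)] by (simp add: card_Diff_subset)
    obtain e :: "'m \<Rightarrow> 'e" where e: "bij_betw e UNIV (B - range (\<phi> \<theta>))"
      using finite_same_card_bij[of "UNIV :: 'm set" "B - range (\<phi> \<theta>)"] cB fB by auto
    define N where "N = {n. T$n \<in> B - range (\<phi> \<theta>)}"
    have imN: "($) T ` N = B - range (\<phi> \<theta>)" using B(2) by (auto simp: N_def)
    have "card N = CARD('m)" using cB card_image[of "($) T" N] Ti(1) imN by (simp add: inj_on_subset)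
    then have "card (UNIV - N) = CARD('k)" using n by (simp add: card_Diff_subset)
    then obtain \<tau> :: "'n \<Rightarrow> 'k" where \<tau>: "bij_betw \<tau> (UNIV - N) UNIV"
      using finite_same_card_bij[of "UNIV - N" "UNIV :: 'k set"] by auto
    define \<sigma> where "\<sigma> n = (if n \<in> N then Inl (the_inv_into UNIV e (T$n)) else Inr (\<tau> n))" for n
    have inv: "e (the_inv_into UNIV e (T$n)) = T$n" if "n \<in> N" for n
      using e that by (intro f_the_inv_into_f) (auto simp: bij_betw_def N_def)
    define t where "t = (\<chi> j. e j)"
    have rg: "range (g \<theta> t) = B"
    proof -
      have "range (g \<theta> t) = range e \<union> range (\<phi> \<theta>)"
        unfolding UNIV_sum image_Un image_image by (simp add: g_def t_def)
      then show ?thesis using e B(1) by (auto simp: bij_betw_def)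
    qed
    have "\<exists>c. T$n = (\<Sum>s\<in>UNIV. c s *\<^sub>R g \<theta> t s)" for n
    proof -
      have "T$n \<in> span (range (g \<theta> t))" unfolding rg using B(4) by auto
      then show ?thesis using span_image_combination[of UNIV "T$n" "g \<theta> t"] by auto
    qed
    then obtain c where c: "\<And>n. T$n = (\<Sum>s\<in>UNIV. c n s *\<^sub>R g \<theta> t s)" by metis
    define \<tau>' where "\<tau>' = the_inv_into (UNIV - N) \<tau>"
    have \<tau>': "\<tau>' (\<tau> n) = n" if "n \<notin> N" for n
      unfolding \<tau>'_def using \<tau> that by (intro the_inv_into_f_f) (auto simp: bij_betw_def)
    have "T$n = \<Psi> \<sigma> (\<theta>, t, (\<chi> i s. c (\<tau>' i) s)) $ n" for n
    proof (cases "n \<in> N")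
      case True then show ?thesis using inv[of n] by (simp add: \<Psi>_def \<sigma>_def t_def)
    next
      case False then show ?thesis using c[of n] \<tau>'[OF False] by (simp add: \<Psi>_def \<sigma>_def)
    qed
    then have "T = \<Psi> \<sigma> (\<theta>, t, (\<chi> i s. c (\<tau>' i) s))" unfolding cart_eq_iff by blast
    then show "T \<in> \<Union>(range (\<lambda>\<sigma>. range (\<Psi> \<sigma>)))" by blast
  qed
  ultimately show ?thesis by (rule negligible_subset)
qed

text \<open>With \<open>a = 1\<close> an affine chart of the projective plane, which saves the
  parameter of the scale. With \<open>a = 0\<close> a vector already reduced modulo one that has 1
  at position \<open>p\<close>.\<close>

definition chart :: "3 \<Rightarrow> 3 \<Rightarrow> real \<Rightarrow> real \<Rightarrow> real \<Rightarrow> real^3" where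
  "chart p q a r s = (\<chi> i. if i = p then a else if i = q then r else s)"

lemma chart_nth [simp]: "chart p q a r s $ p = a" "chart p q a r s $ i = (if i = p then a else if i = q then r else s)"
  by (simp_all add: chart_def)

lemma chart_cover:
  fixes x :: "real^3"
  assumes "q \<noteq> p"
  obtains r s where "x = chart p q (x$p) r s" "r = x$q"
proof -
  have "card (UNIV - {p,q}) = 1" using assms by (simp add: card_Diff_subset)
  then obtain m where m: "UNIV - {p,q} = {m}" by (auto simp: card_1_singleton_iff)
  have "x = chart p q (x$p) (x$q) (x$m)"
  proof -
    have "x$i = chart p q (x$p) (x$q) (x$m) $ i" for i
    proof (cases "i = p \<or> i = q")
      case False
      then have "i \<in> UNIV - {p,q}" by simp
      then have "i = m" unfolding m by simp
      then show ?thesis using False by (simp add: chart_def)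
    qed (auto simp: chart_def)
    then show ?thesis unfolding cart_eq_iff by blast
  qed
  then show ?thesis using that by blast
qed

lemma chart_normalised:
  fixes x :: "real^3"
  assumes "x$p \<noteq> 0" "q \<noteq> p"
  obtains r s where "x = (x$p) *s chart p q 1 r s"
proof -
  obtain r s where rs: "x = chart p q (x$p) r s" using chart_cover[OF assms(2)] .
  have "x = (x$p) *s chart p q 1 (r/x$p) (s/x$p)"
    using assms(1) by (subst rs) (simp add: cart_eq_iff chart_def)
  then show ?thesis using that by blast
qed

lemma other_index: obtains q where "q \<noteq> (p::3)"
proof
  show "p + 1 \<noteq> p" by simp
qed

lemma nonzero_chart:
  fixes x :: "real^3"
  assumes "x \<noteq> 0"
  obtains p q c r s where "q \<noteq> p" "c \<noteq> 0" "x = c *s chart p q 1 r s"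
proof -
  obtain p where p: "x$p \<noteq> 0" using assms by (auto simp: cart_eq_iff)
  obtain q where "q \<noteq> p" using other_index .
  then show ?thesis using that p chart_normalised[OF p] by metis
qed

lemma polynomial_function_chart [intro]:
  assumes "polynomial_function a" "polynomial_function r" "polynomial_function s"
  shows "polynomial_function (\<lambda>x. chart p q (a x) (r x) (s x))"
proof (rule polynomial_function_vec)
  fix i show "polynomial_function (\<lambda>x. chart p q (a x) (r x) (s x) $ i)"
    using assms by (cases "i = p"; cases "i = q") simp_all
qed

definition contr :: "real^3 \<Rightarrow> real^3^3 \<Rightarrow> real^3" where
  "contr f w = (\<chi> j. \<Sum>i\<in>UNIV. f$i * w$i$j)"

lemma contr_linear [simp]: "contr f (v + w) = contr f v + contr f w" "contr f (c *\<^sub>R w) = c *s contr f w"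
  "contr f 0 = 0" "contr f (outer x y) = dt f x *s y"
  by (simp_all add: contr_def cart_eq_iff sum_3 dt_3 algebra_simps)

definition trW :: "real^3^3 \<Rightarrow> real^3^3" where "trW w = (\<chi> i j. w$j$i)"

lemma trW_simps [simp]: "trW (v + w) = trW v + trW w" "trW (c *\<^sub>R w) = c *\<^sub>R trW w" "trW 0 = 0"
  "trW (outer x y) = outer y x" "trW (trW w) = w"
  by (simp_all add: trW_def cart_eq_iff mult.commute)

lemma linear_trW: "linear trW"
  by (intro linearI) simp_all

lemma subspace_outer_scale:
  assumes "subspace W" "c \<noteq> 0"
  shows "outer (c *s x) y \<in> W \<longleftrightarrow> outer x y \<in> W" "outer x (c *s y) \<in> W \<longleftrightarrow> outer x y \<in> W"
proof -
  have s: "c *\<^sub>R w \<in> W \<longleftrightarrow> w \<in> W" for w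
  proof
    assume "c *\<^sub>R w \<in> W"
    then have "(1/c) *\<^sub>R (c *\<^sub>R w) \<in> W" using assms(1) by (rule subspace_scale[rotated])
    then show "w \<in> W" using assms(2) by simp
  qed (use assms(1) subspace_scale in blast)
  show "outer (c *s x) y \<in> W \<longleftrightarrow> outer x y \<in> W" "outer x (c *s y) \<in> W \<longleftrightarrow> outer x y \<in> W"
    by (simp_all add: s)
qed

definition in_config :: "(real^3^3) set \<Rightarrow> ('k::finite \<Rightarrow> real^3^3) \<Rightarrow> bool" where
  "in_config W f \<longleftrightarrow> findep UNIV f \<and> (\<forall>l. f l \<in> W)"

lemma in_config_bool:
  assumes "f \<in> W" "g \<in> W" "\<And>a b. a *\<^sub>R f + b *\<^sub>R g = 0 \<Longrightarrow> a = 0 \<and> b = 0"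
  shows "in_config W (\<lambda>l. if l then f else g)"
proof -
  have "c True = 0 \<and> c False = 0" if "(\<Sum>l\<in>UNIV. c l *\<^sub>R (if l then f else g)) = 0" for c
    using assms(3)[of "c True" "c False"] that by (simp add: UNIV_bool add.commute)
  then have "findep UNIV (\<lambda>l. if l then f else g)" unfolding findep_def UNIV_bool by blast
  then show ?thesis using assms(1,2) unfolding in_config_def by simp
qed

lemma in_config_option:
  assumes "f \<in> W" "g \<in> W" "h \<in> W" "\<And>a b c. a *\<^sub>R f + b *\<^sub>R g + c *\<^sub>R h = 0 \<Longrightarrow> a = 0 \<and> b = 0 \<and> c = 0"
  shows "in_config W (\<lambda>l. case l of None \<Rightarrow> f | Some True \<Rightarrow> g | Some False \<Rightarrow> h)"
proof -
  have s: "(\<Sum>l\<in>UNIV. F l) = F None + F (Some True) + F (Some False)" for F :: "bool option \<Rightarrow> real^3^3"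
    by (simp add: UNIV_option_conv UNIV_bool add_ac)
  have z: "a None = 0 \<and> a (Some True) = 0 \<and> a (Some False) = 0"
    if "(\<Sum>l\<in>UNIV. a l *\<^sub>R (case l of None \<Rightarrow> f | Some True \<Rightarrow> g | Some False \<Rightarrow> h)) = 0" for a
    using that assms(4)[of "a None" "a (Some True)" "a (Some False)"] unfolding s by simp
  have "findep UNIV (\<lambda>l. case l of None \<Rightarrow> f | Some True \<Rightarrow> g | Some False \<Rightarrow> h)"
    unfolding findep_def
  proof (intro allI impI ballI)
    fix a and l :: "bool option"
    assume "(\<Sum>l\<in>UNIV. a l *\<^sub>R (case l of None \<Rightarrow> f | Some True \<Rightarrow> g | Some False \<Rightarrow> h)) = 0"
    from z[OF this] show "a l = 0" by (cases l) (simp, metis (full_types))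
  qed
  then show ?thesis using assms(1-3) unfolding in_config_def by (auto split: option.splits bool.splits)
qed

text \<open>Two rank-one matrices with a common left factor. There are 6 parameters; fewer than 4 *
  2 are allowed, since membership in a five-dimensional subspace of nine-space imposes four
  conditions on each vector.\<close>

definition config1 :: "3 \<times> 3 \<times> 3 \<times> 3 \<Rightarrow> real \<times> real \<times> real \<times> real \<times> real \<times> real \<Rightarrow> bool \<Rightarrow> real^3^3" where
  "config1 = (\<lambda>(p,q,p',q') (r,s,r',s',t,u) l. if l then outer (chart p q 1 r s) (chart p' q' 1 r' s')
     else outer (chart p q 1 r s) (chart p' q' 0 t u))"

text \<open>Three solutions with collinear left factors. Only the common scale of the first two left
  factors can be removed, so \<open>x\<close> remains a free vector: 2 + 3 + 2 + 2 + 2 = 11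
  parameters, just below 4 * 3.\<close>

definition config2 :: "3 \<times> 3 \<times> (3 \<times> 3) \<times> (3 \<times> 3) \<times> (3 \<times> 3) \<Rightarrow>
    (real \<times> real) \<times> (real^3) \<times> (real \<times> real) \<times> (real \<times> real) \<times> (real \<times> real) \<Rightarrow> bool option \<Rightarrow> real^3^3" where
  "config2 = (\<lambda>(p,q,(p1,q1),(p2,q2),(p3,q3)) ((r,s),x,(r1,s1),(r2,s2),(r3,s3)) l. case l of
      None \<Rightarrow> outer (chart p q 1 r s) (chart p1 q1 1 r1 s1)
    | Some True \<Rightarrow> outer x (chart p2 q2 1 r2 s2)
    | Some False \<Rightarrow> outer (chart p q 1 r s + x) (chart p3 q3 1 r3 s3))"

text \<open>A solution and a tangent vector x v^T + u y^T at it. Reducing u modulo x and v modulo y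
  changes the tangent vector by multiples of the solution, and scaling puts 1 into the
  \<open>q\<close>-coordinate of u: 7 parameters, just below 4 * 2.\<close>

definition config3 :: "3 \<times> 3 \<times> 3 \<times> 3 \<Rightarrow> real \<times> real \<times> real \<times> real \<times> real \<times> real \<times> real \<Rightarrow> bool \<Rightarrow> real^3^3" where
  "config3 = (\<lambda>(p,q,p',q') (r,s,r',s',s'',t,u) l. if l then outer (chart p q 1 r s) (chart p' q' 1 r' s')
     else outer (chart p q 1 r s) (chart p' q' 0 t u) + outer (chart p q 0 1 s'') (chart p' q' 1 r' s'))"

lemma config1_polynomial: "polynomial_function (\<lambda>\<theta>. config1 i \<theta> l)"
  unfolding config1_def case_prod_unfold
  by (cases l; simp; intro polynomial_function_outer polynomial_function_chart polynomial_function_add polynomial_function_fst polynomial_function_snd polynomial_function_id polynomial_function_const)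

lemma config2_polynomial: "polynomial_function (\<lambda>\<theta>. config2 i \<theta> l)"
proof -
  consider "l = None" | "l = Some True" | "l = Some False" by (cases l) auto
  then show ?thesis unfolding config2_def case_prod_unfold
    by cases (simp; intro polynomial_function_outer polynomial_function_chart polynomial_function_add polynomial_function_fst polynomial_function_snd polynomial_function_id polynomial_function_const)+
qed

lemma config3_polynomial: "polynomial_function (\<lambda>\<theta>. config3 i \<theta> l)"
  unfolding config3_def case_prod_unfold
  by (cases l; simp; intro polynomial_function_outer polynomial_function_chart polynomial_function_add polynomial_function_fst polynomial_function_snd polynomial_function_id polynomial_function_const)

lemmas config_polynomial = config1_polynomial config2_polynomial config3_polynomial

lemma config1_cover:
  assumes W: "subspace W" and x: "x \<noteq> 0" "outer x y \<in> W" "outer x y' \<in> W" "crs y y' \<noteq> 0"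
  shows "\<exists>i \<theta>. in_config W (config1 i \<theta>)"
proof -
  obtain p q c r s where px: "c \<noteq> 0" "x = c *s chart p q 1 r s" using nonzero_chart[OF x(1)] .
  have "y \<noteq> 0" using x(4) by auto
  then obtain p' q' c' r' s' where py: "q' \<noteq> p'" "c' \<noteq> 0" "y = c' *s chart p' q' 1 r' s'" by (rule nonzero_chart)
  define X Y Z where "X = chart p q 1 r s" and "Y = chart p' q' 1 r' s'" and "Z = y' - (y'$p') *s Y"
  obtain t u where Z: "Z = chart p' q' (Z$p') t u" using chart_cover[OF py(1)] .
  have Zp: "Z$p' = 0" by (simp add: Z_def Y_def)
  have 1: "outer X Y \<in> W" using x(2) unfolding px(2) py(3) X_def[symmetric] Y_def[symmetric] subspace_outer_scale[OF W px(1)] subspace_outer_scale[OF W py(2)] .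
  have y': "outer X y' \<in> W" using x(3) unfolding px(2) X_def[symmetric] subspace_outer_scale[OF W px(1)] .
  have "outer X Z = outer X y' - (y'$p') *\<^sub>R outer X Y"
    by (simp add: Z_def cart_eq_iff algebra_simps)
  then have 2: "outer X Z \<in> W" using W 1 y' by (simp add: subspace_diff subspace_scale)
  have cr: "crs Y Z \<noteq> 0" using x(4) py(2) unfolding py(3) Y_def[symmetric] Z_def by simp
  have "X \<noteq> 0" using x(1) px by (auto simp: X_def)
  then obtain k where k: "X $ k \<noteq> 0" by (auto simp: cart_eq_iff)
  have "in_config W (\<lambda>l. if l then outer X Y else outer X Z)"
  proof (rule in_config_bool[OF 1 2])
    fix a b assume "a *\<^sub>R outer X Y + b *\<^sub>R outer X Z = 0"
    then have "contr (axis k 1) (a *\<^sub>R outer X Y + b *\<^sub>R outer X Z) = 0" by simp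
    then have "(a * X$k) *s Y + (b * X$k) *s Z = 0" by (simp add: vector_smult_assoc)
    then show "a = 0 \<and> b = 0" using cr k unfolding ind2_3[symmetric] ind2_def by (metis mult_eq_0_iff)
  qed
  also have "(\<lambda>l. if l then outer X Y else outer X Z) = config1 (p,q,p',q') (r,s,r',s',t,u)"
    using Z Zp by (simp add: config1_def X_def Y_def fun_eq_iff)
  finally show ?thesis by blast
qed

text \<open>The three matrices are independent thanks to \<open>g1'\<close>: a nontrivial relation
  would make all right factors parallel, and then two independent left factors would share a right
  one.\<close>

lemma config2_cover:
  assumes W: "subspace W" and y: "y1 \<noteq> 0" "y2 \<noteq> 0" "y3 \<noteq> 0" and x: "outer x1 y1 \<in> W" "outer x2 y2 \<in> W" "outer (x1 + x2) y3 \<in> W"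
    and cx: "crs x1 x2 \<noteq> 0" and g1': "\<And>y x x'. y \<noteq> 0 \<Longrightarrow> outer x y \<in> W \<Longrightarrow> outer x' y \<in> W \<Longrightarrow> crs x x' = 0"
  shows "\<exists>i \<theta>. in_config W (config2 i \<theta>)"
proof -
  have "x1 \<noteq> 0" using cx by auto
  then obtain p q c r s where px: "c \<noteq> 0" "x1 = c *s chart p q 1 r s" by (rule nonzero_chart)
  obtain p1 q1 c1 r1 s1 where p1: "c1 \<noteq> 0" "y1 = c1 *s chart p1 q1 1 r1 s1" using nonzero_chart[OF y(1)] .
  obtain p2 q2 c2 r2 s2 where p2: "c2 \<noteq> 0" "y2 = c2 *s chart p2 q2 1 r2 s2" using nonzero_chart[OF y(2)] .
  obtain p3 q3 c3 r3 s3 where p3: "c3 \<noteq> 0" "y3 = c3 *s chart p3 q3 1 r3 s3" using nonzero_chart[OF y(3)] .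
  define X1 X2 Y1 Y2 Y3 where D: "X1 = chart p q 1 r s" "X2 = (1/c) *s x2" "Y1 = chart p1 q1 1 r1 s1"
    "Y2 = chart p2 q2 1 r2 s2" "Y3 = chart p3 q3 1 r3 s3"
  have x2: "x2 = c *s X2" "x1 + x2 = c *s (X1 + X2)" "x1 = c *s X1" using px by (simp_all add: D vector_add_ldistrib vector_smult_assoc)
  have yy: "y1 = c1 *s Y1" "y2 = c2 *s Y2" "y3 = c3 *s Y3" using p1 p2 p3 by (simp_all add: D)
  note sc = subspace_outer_scale[OF W px(1)] subspace_outer_scale[OF W p1(1)] subspace_outer_scale[OF W p2(1)] subspace_outer_scale[OF W p3(1)]
  have m: "outer X1 Y1 \<in> W" "outer X2 Y2 \<in> W" "outer (X1 + X2) Y3 \<in> W"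
    using x unfolding x2(2) unfolding x2(1,3) yy sc .
  have crX: "crs X1 X2 \<noteq> 0" using cx unfolding x2(1,3) using px(1) by (simp add: vector_mul_eq_0)
  have Yn: "Y1 \<noteq> 0" "Y2 \<noteq> 0" "Y3 \<noteq> 0" using y yy by auto
  obtain f g where fg: "dt f X1 = 1" "dt f X2 = 0" "dt g X1 = 0" "dt g X2 = 1"
    using ind2_dual[of X1 X2] crX unfolding ind2_3 by metis
  have "in_config W (\<lambda>l. case l of None \<Rightarrow> outer X1 Y1 | Some True \<Rightarrow> outer X2 Y2 | Some False \<Rightarrow> outer (X1 + X2) Y3)"
  proof (rule in_config_option[OF m])
    fix a b k assume e: "a *\<^sub>R outer X1 Y1 + b *\<^sub>R outer X2 Y2 + k *\<^sub>R outer (X1 + X2) Y3 = 0"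
    have e1: "a *s Y1 + k *s Y3 = 0" using arg_cong[OF e, of "contr f"] fg by (simp del: outer_linear)
    have e2: "b *s Y2 + k *s Y3 = 0" using arg_cong[OF e, of "contr g"] fg by (simp del: outer_linear)
    have "k = 0"
    proof (rule ccontr)
      assume k: "k \<noteq> 0"
      have y3: "Y3 = (-a/k) *s Y1" "Y3 = (-b/k) *s Y2"
      proof -
        have h: "Y3 = (-t/k) *s Y" if "t *s Y + k *s Y3 = 0" for t Y
        proof -
          have "k *s Y3 = (-t) *s Y" using that by (simp add: cart_eq_iff eq_neg_iff_add_eq_0 add.commute)
          then have "(1/k) *s (k *s Y3) = (1/k) *s ((-t) *s Y)" by simp
          then show ?thesis using k by (simp add: vector_smult_assoc)
        qed
        show "Y3 = (-a/k) *s Y1" "Y3 = (-b/k) *s Y2" using h e1 e2 by blast+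
      qed
      have ab: "-a/k \<noteq> 0" "-b/k \<noteq> 0" using y3 Yn by (metis vector_smult_lzero)+
      have "outer X1 Y3 \<in> W" unfolding y3(1) subspace_outer_scale(2)[OF W ab(1)] by (rule m(1))
      moreover have "outer X2 Y3 \<in> W" unfolding y3(2) subspace_outer_scale(2)[OF W ab(2)] by (rule m(2))
      ultimately show False using g1'[OF Yn(3)] crX by blast
    qed
    then show "a = 0 \<and> b = 0 \<and> k = 0" using e1 e2 Yn by (simp add: vector_mul_eq_0)
  qed
  also have "(\<lambda>l. case l of None \<Rightarrow> outer X1 Y1 | Some True \<Rightarrow> outer X2 Y2 | Some False \<Rightarrow> outer (X1 + X2) Y3)
     = config2 (p,q,(p1,q1),(p2,q2),(p3,q3)) ((r,s),X2,(r1,s1),(r2,s2),(r3,s3))"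
    unfolding config2_def D by (simp only: prod.case)
  finally show ?thesis by blast
qed

lemma config3_cover:
  assumes W: "subspace W" and n: "x \<noteq> 0" "y \<noteq> 0" and m: "outer x y \<in> W" "outer x v + outer u y \<in> W" and cu: "crs u x \<noteq> 0"
  shows "\<exists>i \<theta>. in_config W (config3 i \<theta>)"
proof -
  obtain p where p: "x$p \<noteq> 0" using n(1) by (auto simp: cart_eq_iff)
  \<comment> \<open>\<open>u\<close> is reduced modulo \<open>x\<close> at a coordinate
    \<open>p\<close> where \<open>x\<close> does not vanish. The remainder is nonzero at some other
    coordinate \<open>q\<close>, and this pair selects the chart.\<close>
  define u0 where "u0 = u - (u$p / x$p) *s x"
  have u0p: "u0$p = 0" using p by (simp add: u0_def)
  have cu0: "crs u0 x \<noteq> 0" using cu by (simp add: u0_def)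
  then have "u0 \<noteq> 0" by auto
  then obtain q where q: "u0$q \<noteq> 0" by (auto simp: cart_eq_iff)
  then have qp: "q \<noteq> p" using u0p by auto
  obtain r s where X: "x = (x$p) *s chart p q 1 r s" using chart_normalised[OF p qp] .
  obtain p' q' c r' s' where py: "q' \<noteq> p'" "c \<noteq> 0" "y = c *s chart p' q' 1 r' s'" using nonzero_chart[OF n(2)] .
  define X1 Y where XY: "X1 = chart p q 1 r s" "Y = chart p' q' 1 r' s'"
  have x: "x = (x$p) *s X1" and y: "y = c *s Y" using X py by (simp_all add: XY)
  have 1: "outer X1 Y \<in> W" using m(1) x y subspace_outer_scale[OF W p] subspace_outer_scale[OF W py(2)] by metis
  \<comment> \<open>The given tangent vector is \<open>d\<close> times the normalised one, up to
    multiples of the solution.\<close>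
  define d where "d = c * u0$q"
  have d: "d \<noteq> 0" using py(2) q by (simp add: d_def)
  define U where "U = (1/u0$q) *s u0"
  have U1: "U$p = 0" "U$q = 1" using u0p q by (simp_all add: U_def)
  obtain rr s'' where U: "U = chart p q (U$p) rr s''" "rr = U$q" using chart_cover[OF qp] .
  define V0 where "V0 = (x$p / d) *s v"
  define V where "V = V0 - V0$p' *s Y"
  have Vp: "V$p' = 0" by (simp add: V_def XY)
  obtain t w where V: "V = chart p' q' (V$p') t w" using chart_cover[OF py(1)] .
  have "outer x v + outer u y = d *\<^sub>R (outer X1 V + outer U Y) + (u$p * c + d * V0$p') *\<^sub>R outer X1 Y"
  proof -
    have "(u$p / x$p) *s ((x$p) *s X1) = u$p *s X1" using p by (simp add: vector_smult_assoc)
    then have "(u$p / x$p) *s x = u$p *s X1" unfolding x[symmetric] .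
    then have "u = u0 + u$p *s X1" by (simp add: u0_def)
    moreover have "u0 = u0$q *s U" using q by (simp add: U_def vector_smult_assoc)
    ultimately have u: "outer u y = (c * u0$q) *\<^sub>R outer U Y + (c * u$p) *\<^sub>R outer X1 Y"
      by (metis (no_types, lifting) y outer_linear(1,3,4) scaleR_add_right scaleR_scaleR)
    have "outer ((x$p) *s X1) v = (x$p) *\<^sub>R outer X1 v" by simp
    then have "outer x v = (x$p) *\<^sub>R outer X1 v" unfolding x[symmetric] .
    also have "\<dots> = d *\<^sub>R outer X1 V0" using d by (simp add: V0_def)
    also have "V0 = V + V0$p' *s Y" by (simp add: V_def)
    finally have v: "outer x v = d *\<^sub>R outer X1 V + (d * V0$p') *\<^sub>R outer X1 Y"
      by (metis (no_types, lifting) outer_linear(2,4) scaleR_add_right scaleR_scaleR)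
    show ?thesis unfolding u v by (simp add: d_def algebra_simps)
  qed
  then have "d *\<^sub>R (outer X1 V + outer U Y) = (outer x v + outer u y) - (u$p * c + d * V0$p') *\<^sub>R outer X1 Y"
    by simp
  then have "d *\<^sub>R (outer X1 V + outer U Y) \<in> W" using m(2) 1 W by (metis subspace_diff subspace_scale)
  then have "(1/d) *\<^sub>R (d *\<^sub>R (outer X1 V + outer U Y)) \<in> W" using W by (metis subspace_scale)
  then have 2: "outer X1 V + outer U Y \<in> W" using d by simp
  have "crs X1 U \<noteq> 0"
  proof
    assume 0: "crs X1 U = 0"
    have "crs ((x$p) *s X1) u0 = (x$p * u0$q) *s crs X1 U"
      using q by (simp add: U_def vector_smult_assoc)
    then have "crs x u0 = (x$p * u0$q) *s crs X1 U" unfolding x[symmetric] .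
    then show False using cu0 crs_eq_0_commute 0 by auto
  qed
  then obtain f g where fg: "dt f X1 = 1" "dt f U = 0" "dt g X1 = 0" "dt g U = 1"
    using ind2_dual[of X1 U] unfolding ind2_3 by metis
  have Y0: "Y \<noteq> 0" using n(2) y by auto
  have "in_config W (\<lambda>l. if l then outer X1 Y else outer X1 V + outer U Y)"
  proof (rule in_config_bool[OF 1 2])
    fix a b assume e: "a *\<^sub>R outer X1 Y + b *\<^sub>R (outer X1 V + outer U Y) = 0"
    have "b *s Y = 0" using arg_cong[OF e, of "contr g"] fg by simp
    then have b: "b = 0" using Y0 by (simp add: vector_mul_eq_0)
    have "a *s Y = 0" using arg_cong[OF e, of "contr f"] fg b by simp
    then show "a = 0 \<and> b = 0" using Y0 b by (simp add: vector_mul_eq_0)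
  qed
  also have "(\<lambda>l. if l then outer X1 Y else outer X1 V + outer U Y) = config3 (p,q,p',q') (r,s,r',s',s'',t,w)"
    using U V U1 Vp by (simp add: config3_def XY fun_eq_iff)
  finally show ?thesis by blast
qed

text \<open>The conditions on right factors are those on left factors for the transposed subspace.
  Each use of \<open>config2_cover\<close> draws on the \<open>config1\<close> condition of the
  opposite side.\<close>

lemma good_spaceI:
  assumes W: "subspace W"
    and n: "\<And>i \<theta>. \<not> in_config W (config1 i \<theta>)" "\<And>i \<theta>. \<not> in_config W (config2 i \<theta>)" "\<And>i \<theta>. \<not> in_config W (config3 i \<theta>)"
    "\<And>i \<theta>. \<not> in_config (trW ` W) (config1 i \<theta>)" "\<And>i \<theta>. \<not> in_config (trW ` W) (config2 i \<theta>)"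
  shows "good_space W"
proof -
  have W': "subspace (trW ` W)" by (rule linear_subspace_image[OF linear_trW W])
  have mem': "w \<in> trW ` W \<longleftrightarrow> trW w \<in> W" for w
    by (metis image_iff trW_simps(5))
  have mem: "outer x y \<in> trW ` W \<longleftrightarrow> outer y x \<in> W" for x y
    unfolding mem' trW_simps ..
  have g1: "crs y y' = 0" if "x \<noteq> 0" "outer x y \<in> W" "outer x y' \<in> W" for x y y'
    using config1_cover[OF W that] n(1) by blast
  have g1': "crs x x' = 0" if "y \<noteq> 0" "outer x y \<in> W" "outer x' y \<in> W" for y x x'
    using config1_cover[OF W', of y x x'] that n(4) unfolding mem by blast
  have g2: "crs x1 x2 = 0" if "y1 \<noteq> 0" "y2 \<noteq> 0" "y3 \<noteq> 0" "outer x1 y1 \<in> W" "outer x2 y2 \<in> W" "outer (x1 + x2) y3 \<in> W"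
    for x1 x2 y1 y2 y3
  proof (rule ccontr)
    assume c: "crs x1 x2 \<noteq> 0"
    have "\<exists>i \<theta>. in_config W (config2 i \<theta>)"
      by (rule config2_cover[OF W that c]) (rule g1'; assumption)
    then show False using n(2) by blast
  qed
  have g2': "crs y1 y2 = 0" if "x1 \<noteq> 0" "x2 \<noteq> 0" "x3 \<noteq> 0" "outer x1 y1 \<in> W" "outer x2 y2 \<in> W" "outer x3 (y1 + y2) \<in> W"
    for x1 x2 x3 y1 y2
  proof (rule ccontr)
    assume c: "crs y1 y2 \<noteq> 0"
    have "\<exists>i \<theta>. in_config (trW ` W) (config2 i \<theta>)"
    proof (rule config2_cover[OF W' that(1-3) _ _ _ c])
      show "outer y1 x1 \<in> trW ` W" "outer y2 x2 \<in> trW ` W" "outer (y1 + y2) x3 \<in> trW ` W"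
        using that(4-6) unfolding mem .
      show "crs x x' = 0" if "y \<noteq> 0" "outer x y \<in> trW ` W" "outer x' y \<in> trW ` W" for y x x'
        using that unfolding mem by (rule g1)
    qed
    then show False using n(5) by blast
  qed
  have g3: "crs u x = 0" if "x \<noteq> 0" "y \<noteq> 0" "outer x y \<in> W" "outer x v + outer u y \<in> W" for x y u v
    using config3_cover[OF W that] n(3) by blast
  show ?thesis unfolding good_space_def
    by (intro conjI allI impI; (rule g1 g1' g2 g2' g3; assumption))
qed

text \<open>The general count for five slices in nine-space: 9 - 5 = 4 is the bound on parameters
  per vector.\<close>

lemma config_negligible:
  fixes \<phi> :: "'i::finite \<Rightarrow> 'p::euclidean_space \<Rightarrow> 'k::finite \<Rightarrow> real^3^3"
  assumes n: "5 = CARD('m::finite) + CARD('k)" and d: "DIM('p) < 4 * CARD('k)" and \<phi>: "\<And>i l. polynomial_function (\<lambda>\<theta>. \<phi> i \<theta> l)"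
  shows "negligible {T :: (real^3^3)^5. findep UNIV (($) T) \<and> (\<exists>i \<theta>. in_config (span (range (($) T))) (\<phi> i \<theta>))}"
proof -
  have "negligible (\<Union>i. {T :: (real^3^3)^5. findep UNIV (($) T) \<and> (\<exists>\<theta>. in_config (span (range (($) T))) (\<phi> i \<theta>))})"
  proof (rule negligible_Union)
    fix S assume "S \<in> range (\<lambda>i. {T :: (real^3^3)^5. findep UNIV (($) T) \<and> (\<exists>\<theta>. in_config (span (range (($) T))) (\<phi> i \<theta>))})"
    then obtain i where S: "S = {T :: (real^3^3)^5. findep UNIV (($) T) \<and> (\<exists>\<theta>. in_config (span (range (($) T))) (\<phi> i \<theta>))}" by blast
    show "negligible S" unfolding S in_config_def
      by (rule configuration_negligible[where 'm='m]) (use n d \<phi> in simp_all)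
  qed simp
  then show ?thesis by (rule negligible_subset) auto
qed

lemma trW_span: "trW ` span S = span (trW ` S)"
  by (rule linear_span_image[OF linear_trW, symmetric])

lemma bad_negligible:
  "negligible {T :: (real^3^3)^5. \<not> (findep UNIV (($) T) \<and> good_space (span (range (($) T))))}"
proof -
  have c1: "negligible {T :: (real^3^3)^5. findep UNIV (($) T) \<and> (\<exists>i \<theta>. in_config (span (range (($) T))) (config1 i \<theta>))}"
    by (rule config_negligible[where 'm=3]) (simp_all add: config_polynomial)
  have c2: "negligible {T :: (real^3^3)^5. findep UNIV (($) T) \<and> (\<exists>i \<theta>. in_config (span (range (($) T))) (config2 i \<theta>))}"
    by (rule config_negligible[where 'm=2]) (simp_all add: config_polynomial)
  have c3: "negligible {T :: (real^3^3)^5. findep UNIV (($) T) \<and> (\<exists>i \<theta>. in_config (span (range (($) T))) (config3 i \<theta>))}"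
    by (rule config_negligible[where 'm=3]) (simp_all add: config_polynomial)
  have c0: "negligible {T :: (real^3^3)^5. \<not> findep UNIV (($) T)}"
    by (rule dependent_negligible[where 'm=4]) simp_all
  \<comment> \<open>Slicewise transposition carries the exceptional sets to those of the transposed
    span; as a linear map it preserves negligible sets.\<close>
  define \<iota> where "\<iota> T = (\<chi> k. trW (T$k))" for T :: "(real^3^3)^5"
  have lin: "linear \<iota>" by (intro linearI) (simp_all add: \<iota>_def cart_eq_iff trW_def)
  have \<iota>\<iota>: "\<iota> (\<iota> T) = T" for T by (simp add: \<iota>_def cart_eq_iff[of _ T])
  have sp: "span (range (($) (\<iota> T))) = trW ` span (range (($) T))" for T
    unfolding trW_span by (simp add: \<iota>_def image_image)
  have fi: "findep UNIV (($) (\<iota> T))" if "findep UNIV (($) T)" for T unfolding findep_def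
  proof (intro allI impI)
    fix c assume "(\<Sum>i\<in>UNIV. c i *\<^sub>R \<iota> T $ i) = 0"
    then have "trW (\<Sum>i\<in>UNIV. c i *\<^sub>R trW (T $ i)) = 0" by (simp add: \<iota>_def)
    moreover have "trW (\<Sum>i\<in>UNIV. c i *\<^sub>R trW (T $ i)) = (\<Sum>i\<in>UNIV. c i *\<^sub>R T $ i)"
      by (simp add: trW_def cart_eq_iff)
    ultimately show "\<forall>i\<in>UNIV. c i = 0" using that unfolding findep_def by simp
  qed
  let ?C1 = "{T :: (real^3^3)^5. findep UNIV (($) T) \<and> (\<exists>i \<theta>. in_config (span (range (($) T))) (config1 i \<theta>))}"
  let ?C2 = "{T :: (real^3^3)^5. findep UNIV (($) T) \<and> (\<exists>i \<theta>. in_config (span (range (($) T))) (config2 i \<theta>))}"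
  let ?C3 = "{T :: (real^3^3)^5. findep UNIV (($) T) \<and> (\<exists>i \<theta>. in_config (span (range (($) T))) (config3 i \<theta>))}"
  let ?C0 = "{T :: (real^3^3)^5. \<not> findep UNIV (($) T)}"
  have "negligible (\<iota> ` ?C1)" "negligible (\<iota> ` ?C2)" 
    by (rule negligible_differentiable_image_negligible[OF order_refl c1 linear_imp_differentiable_on[OF lin]],
        rule negligible_differentiable_image_negligible[OF order_refl c2 linear_imp_differentiable_on[OF lin]])
  then have "negligible (?C0 \<union> ?C1 \<union> ?C2 \<union> ?C3 \<union> \<iota> ` ?C1 \<union> \<iota> ` ?C2)" using c0 c1 c2 c3 by (intro negligible_Un)
  then show ?thesis
  proof (rule negligible_subset, intro subsetI)
    fix T :: "(real^3^3)^5" assume T: "T \<in> {T. \<not> (findep UNIV (($) T) \<and> good_space (span (range (($) T))))}"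
    show "T \<in> ?C0 \<union> ?C1 \<union> ?C2 \<union> ?C3 \<union> \<iota> ` ?C1 \<union> \<iota> ` ?C2"
    proof (rule ccontr)
      assume n: "T \<notin> ?C0 \<union> ?C1 \<union> ?C2 \<union> ?C3 \<union> \<iota> ` ?C1 \<union> \<iota> ` ?C2"
      then have nn: "T \<notin> ?C0" "T \<notin> ?C1" "T \<notin> ?C2" "T \<notin> ?C3" "T \<notin> \<iota> ` ?C1" "T \<notin> \<iota> ` ?C2"
        by (simp_all only: Un_iff de_Morgan_disj not_False_eq_True)
      from nn(1) have F: "findep UNIV (($) T)" by simp
      have i: "T \<in> \<iota> ` S" if "\<iota> T \<in> S" for S
        using imageI[OF that, of \<iota>] unfolding \<iota>\<iota> .
      have "\<iota> T \<notin> ?C1" "\<iota> T \<notin> ?C2" using i[of ?C1] i[of ?C2] nn(5,6) by satx+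
      then have n': "\<not> (\<exists>i \<theta>. in_config (trW ` span (range (($) T))) (config1 i \<theta>))"
        "\<not> (\<exists>i \<theta>. in_config (trW ` span (range (($) T))) (config2 i \<theta>))"
        using fi[OF F] unfolding mem_Collect_eq sp by blast+
      have "good_space (span (range (($) T)))"
      proof (rule good_spaceI)
        show "\<not> in_config (span (range (($) T))) (config1 i \<theta>)" for i \<theta> using nn(2) F unfolding mem_Collect_eq by blast
        show "\<not> in_config (span (range (($) T))) (config2 i \<theta>)" for i \<theta> using nn(3) F unfolding mem_Collect_eq by blast
        show "\<not> in_config (span (range (($) T))) (config3 i \<theta>)" for i \<theta> using nn(4) F unfolding mem_Collect_eq by blast
        show "\<not> in_config (trW ` span (range (($) T))) (config1 i \<theta>)" for i \<theta> using n'(1) by blast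
        show "\<not> in_config (trW ` span (range (($) T))) (config2 i \<theta>)" for i \<theta> using n'(2) by blast
      qed (rule subspace_span)
      then show False using T F by simp
    qed
  qed
qed

section \<open>Averaging over rotations\<close>

text \<open>Normalisation by \<open>sgn\<close> sends 0 to 0, which keeps the recursion total, and
  measurable, on dependent families as well.\<close>

function gs :: "(nat \<Rightarrow> 'e::euclidean_space) \<Rightarrow> nat \<Rightarrow> 'e" where
  "gs g n = sgn (g n - (\<Sum>j<n. (g n \<bullet> gs g j) *\<^sub>R gs g j))"
  by auto
termination by (relation "Wellfounded.measure snd") auto

declare gs.simps [simp del]

text \<open>Only inner products, norms and linear combinations enter the recursion, and an
  orthogonal map respects all of them.\<close>

lemma gs_equivariant:
  assumes A: "orthogonal_transformation A" shows "gs (\<lambda>n. A (g n)) n = A (gs g n)"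
proof (induction n rule: less_induct)
  case (less n)
  have lin: "linear A" and ip: "\<And>x y. A x \<bullet> A y = x \<bullet> y" and nm: "\<And>x. norm (A x) = norm x"
    using A by (auto simp: orthogonal_transformation_def orthogonal_transformation_norm[OF A])
  have "A (g n) - (\<Sum>j<n. (A (g n) \<bullet> gs (\<lambda>n. A (g n)) j) *\<^sub>R gs (\<lambda>n. A (g n)) j)
      = A (g n) - (\<Sum>j<n. (g n \<bullet> gs g j) *\<^sub>R A (gs g j))"
    using less by (simp add: ip)
  also have "\<dots> = A (g n - (\<Sum>j<n. (g n \<bullet> gs g j) *\<^sub>R gs g j))"
    using lin by (simp add: linear_diff linear_sum linear_cmul)
  finally have e: "A (g n) - (\<Sum>j<n. (A (g n) \<bullet> gs (\<lambda>n. A (g n)) j) *\<^sub>R gs (\<lambda>n. A (g n)) j)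
      = A (g n - (\<Sum>j<n. (g n \<bullet> gs g j) *\<^sub>R gs g j))" .
  have "sgn (A z) = A (sgn z)" for z using lin by (simp add: sgn_div_norm nm linear_cmul)
  then show ?case unfolding gs.simps[of "\<lambda>n. A (g n)" n] gs.simps[of g n] e by simp
qed

lemma gs_span: "gs g n \<in> span (g ` {..n})"
proof (induction n rule: less_induct)
  case (less n)
  have "gs g j \<in> span (g ` {..n})" if "j < n" for j
    using less[OF that] span_mono[of "g ` {..j}" "g ` {..n}"] that by (auto simp: image_mono)
  then show ?case
    unfolding gs.simps[of g n] sgn_div_norm
    by (intro span_scale span_diff span_sum) (auto intro: span_base span_scale)
qed

lemma gs_orthonormal:
  assumes g: "findep {..<N} g"
  shows "n < N \<Longrightarrow> norm (gs g n) = 1 \<and> (\<forall>j<n. gs g n \<bullet> gs g j = 0)"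
proof (induction n rule: less_induct)
  case (less n)
  define h where "h = g n - (\<Sum>j<n. (g n \<bullet> gs g j) *\<^sub>R gs g j)"
  have inj: "inj_on g {..<N}" and ind: "independent (g ` {..<N})" using g by (simp_all add: findep_iff)
  have "h \<noteq> 0"
  proof
    assume "h = 0"
    then have "g n = (\<Sum>j<n. (g n \<bullet> gs g j) *\<^sub>R gs g j)" by (simp add: h_def)
    also have "\<dots> \<in> span (g ` ({..<N} - {n}))"
    proof (intro span_sum span_scale)
      fix j assume "j \<in> {..<n}"
      then show "gs g j \<in> span (g ` ({..<N} - {n}))"
        using less.prems by (intro subsetD[OF span_mono gs_span]) auto
    qed
    also have "g ` ({..<N} - {n}) = g ` {..<N} - {g n}" using inj less.prems by (auto simp: inj_on_def)
    finally show False using ind less.prems unfolding dependent_def by auto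
  qed
  have gsh: "gs g n = h /\<^sub>R norm h" unfolding gs.simps[of g n] h_def sgn_div_norm ..
  have "h \<bullet> gs g i = 0" if i: "i < n" for i
  proof -
    have "gs g j \<bullet> gs g i = of_bool (j = i)" if "j < n" for j
    proof (cases j i rule: linorder_cases)
      case equal with less.IH[OF that] less.prems that show ?thesis by (simp add: norm_eq_1)
    next
      case less then show ?thesis using less.IH[OF i] less.prems i by (simp add: inner_commute[of "gs g j"])
    next
      case greater then show ?thesis using less.IH[OF that] less.prems that by simp
    qed
    then show ?thesis using i by (simp add: h_def inner_diff_left inner_sum_left)
  qed
  then show ?case using \<open>h \<noteq> 0\<close> by (simp add: gsh)
qed

lemma gs_inner: "findep {..<N} g \<Longrightarrow> m < N \<Longrightarrow> n < N \<Longrightarrow> gs g m \<bullet> gs g n = of_bool (m = n)"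
  using gs_orthonormal[of N g m] gs_orthonormal[of N g n]
  by (cases m n rule: linorder_cases) (auto simp: norm_eq_1 inner_commute)

lemma gs_measurable:
  assumes "\<And>n. (\<lambda>x. g x n) \<in> borel_measurable M"
  shows "(\<lambda>x. gs (g x) n) \<in> borel_measurable M"
proof (induction n rule: less_induct)
  case (less n)
  have [measurable]: "(\<lambda>x. \<Sum>j<n. (g x n \<bullet> gs (g x) j) *\<^sub>R gs (g x) j) \<in> borel_measurable M"
    using less by (intro borel_measurable_sum borel_measurable_scaleR borel_measurable_inner assms) auto
  note assms [measurable]
  show ?case unfolding gs.simps[of "g _" n] sgn_div_norm by measurable
qed

definition bs :: "nat \<Rightarrow> 'e::euclidean_space" where
  "bs = (SOME f. bij_betw f {..<DIM('e)} Basis)"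

lemma bij_bs: "bij_betw bs {..<DIM('e)} (Basis :: 'e::euclidean_space set)"
proof -
  have "\<exists>f :: nat \<Rightarrow> 'e. bij_betw f {..<DIM('e)} Basis" by (rule finite_same_card_bij) simp_all
  then show ?thesis unfolding bs_def by (rule someI_ex)
qed

text \<open>Sends the Gram--Schmidt basis of \<open>g\<close> to the standard basis.\<close>
definition frame_map :: "(nat \<Rightarrow> 'e) \<Rightarrow> 'e \<Rightarrow> 'e::euclidean_space" where
  "frame_map g x = (\<Sum>n<DIM('e). (gs g n \<bullet> x) *\<^sub>R bs n)"

text \<open>The inverse \<open>P\<close> sends the standard basis to the Gram-Schmidt basis and
  visibly preserves inner products; being surjective, it passes this on to
  \<open>frame_map g\<close>.\<close>

lemma frame_map_orthogonal:
  fixes g :: "nat \<Rightarrow> 'e::euclidean_space"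
  assumes g: "findep {..<DIM('e)} g"
  shows "orthogonal_transformation (frame_map g)"
proof -
  define P where "P y = (\<Sum>n<DIM('e). (bs n \<bullet> y) *\<^sub>R gs g n)" for y :: 'e
  have "linear P" unfolding P_def by (intro linearI) (simp_all add: algebra_simps inner_add_right sum.distrib scaleR_sum_right)
  moreover have Pip: "P y \<bullet> P z = y \<bullet> z" for y z
  proof -
    have "P y \<bullet> P z = (\<Sum>n<DIM('e). (bs n \<bullet> y) * (bs n \<bullet> z))"
      unfolding P_def by (simp add: inner_sum_left inner_sum_right gs_inner[OF g] mult.commute)
    also have "\<dots> = (\<Sum>b\<in>Basis. (b \<bullet> y) * (b \<bullet> z))" by (rule sum.reindex_bij_betw[OF bij_bs])
    finally show ?thesis by (simp add: euclidean_inner[of y z] inner_commute)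
  qed
  ultimately have P: "orthogonal_transformation P" by (simp add: orthogonal_transformation_def)
  have QP: "frame_map g (P y) = y" for y
  proof -
    have "gs g n \<bullet> P y = bs n \<bullet> y" if "n < DIM('e)" for n
      using that by (simp add: P_def inner_sum_right gs_inner[OF g])
    then have "frame_map g (P y) = (\<Sum>n<DIM('e). (bs n \<bullet> y) *\<^sub>R bs n)" by (simp add: frame_map_def)
    also have "\<dots> = (\<Sum>b\<in>Basis. (b \<bullet> y) *\<^sub>R b)" by (rule sum.reindex_bij_betw[OF bij_bs])
    finally show ?thesis using euclidean_representation[of y] by (simp add: inner_commute)
  qed
  have "surj P" by (rule orthogonal_transformation_surj[OF P])
  then have "norm (frame_map g x) = norm x" for x
    by (metis QP P orthogonal_transformation_norm surjD)
  moreover have "linear (frame_map g)"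
    unfolding frame_map_def by (intro linearI) (simp_all add: algebra_simps inner_add_right sum.distrib scaleR_sum_right)
  ultimately show ?thesis by (simp add: orthogonal_transformation)
qed

text \<open>The coefficients are inner products with the Gram-Schmidt basis, which rotates
  along.\<close>

lemma frame_map_equivariant:
  assumes A: "orthogonal_transformation A" shows "frame_map (\<lambda>n. A (g n)) (A x) = frame_map g x"
  unfolding frame_map_def gs_equivariant[OF A] using A by (simp add: orthogonal_transformation_def)

section \<open>The action of a random frame on families of vectors\<close>

definition rot :: "'e::euclidean_space^'g::finite \<Rightarrow> 'e^'k \<Rightarrow> 'e^'k" where
  "rot G T = (\<chi> k. frame_map (\<lambda>n. G $ ix n) (T $ k))"

definition act :: "('e \<Rightarrow> 'e) \<Rightarrow> 'e^'k \<Rightarrow> 'e^'k" where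
  "act A T = (\<chi> k. A (T $ k))"

lemma act_nth [simp]: "act A T $ k = A (T $ k)" by (simp add: act_def)

lemma rot_act: "rot G T = act (frame_map (\<lambda>n. G $ ix n)) T"
  by (simp add: rot_def act_def)

lemma act_orthogonal:
  fixes A :: "'e::euclidean_space \<Rightarrow> 'e"
  assumes A: "orthogonal_transformation A" shows "orthogonal_transformation (act A :: 'e^'k::finite \<Rightarrow> 'e^'k)"
proof -
  have "linear A" using A by (simp add: orthogonal_transformation_def)
  then have "linear (act A :: 'e^'k \<Rightarrow> 'e^'k)" by (intro linearI) (simp_all add: cart_eq_iff linear_add linear_cmul)
  then show ?thesis using A by (simp add: orthogonal_transformation_def inner_vec_def)
qed

lemma rot_equivariant: "orthogonal_transformation A \<Longrightarrow> rot (act A G) (act A T) = rot G T"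
  by (simp add: rot_def frame_map_equivariant[of A "\<lambda>n. G $ ix n"])

lemma findep_ix:
  assumes G: "findep UNIV (($) (G :: 'e::euclidean_space^'g::finite))" shows "findep {..<CARD('g)} (\<lambda>n. G $ ix n)"
  unfolding findep_def
proof (intro allI impI)
  fix c assume "(\<Sum>i<CARD('g). c i *\<^sub>R G $ ix i) = 0"
  then have "(\<Sum>i<CARD('g). c (jx (ix i :: 'g)) *\<^sub>R G $ ix i) = 0" by (simp add: jx_ix)
  then have "(\<Sum>i\<in>UNIV. c (jx i) *\<^sub>R G $ i) = 0"
    using sum.reindex_bij_betw[OF bij_ix, of "\<lambda>i. c (jx i) *\<^sub>R G $ i"] by simp
  then have "c (jx i) = 0" for i :: 'g using findepD[OF G, of "\<lambda>i. c (jx i)" i] by simp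
  then show "\<forall>i\<in>{..<CARD('g)}. c i = 0" by (metis jx_ix lessThan_iff)
qed

lemma frame_orthogonal:
  assumes "CARD('g::finite) = DIM('e::euclidean_space)" "findep UNIV (($) (G :: 'e^'g))"
  shows "orthogonal_transformation (frame_map (\<lambda>n. G $ ix n))"
  using frame_map_orthogonal[of "\<lambda>n. G $ ix n"] findep_ix[OF assms(2)] assms(1) by simp

lemma borel_measurable_cart:
  fixes f :: "'a \<Rightarrow> 'e::euclidean_space^'k::finite"
  assumes "\<And>k. (\<lambda>x. f x $ k) \<in> borel_measurable M" shows "f \<in> borel_measurable M"
  unfolding borel_measurable_euclidean_space[of f M]
proof
  fix b :: "'e^'k" assume "b \<in> Basis"
  then obtain k c where "b = axis k c" by (auto simp: Basis_vec_def)
  then show "(\<lambda>x. f x \<bullet> b) \<in> borel_measurable M" using assms[of k] by (simp add: inner_axis borel_measurable_inner)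
qed

lemma borel_measurable_cart_nth:
  "f \<in> borel_measurable M \<Longrightarrow> (\<lambda>x. f x $ k :: 'e::euclidean_space) \<in> borel_measurable M"
  by (rule measurable_compose[of f M borel "\<lambda>x. x $ k" borel])
    (auto intro!: borel_measurable_continuous_onI continuous_intros)

lemma rot_measurable:
  assumes f: "f \<in> borel_measurable M" "h \<in> borel_measurable M"
  shows "(\<lambda>x. rot (f x :: 'e::euclidean_space^'g::finite) (h x :: 'e^'k::finite)) \<in> borel_measurable M"
proof (rule borel_measurable_cart)
  fix k
  have "(\<lambda>x. gs (\<lambda>n. f x $ ix n) m) \<in> borel_measurable M" for m
    by (rule gs_measurable) (rule borel_measurable_cart_nth[OF f(1)])
  then show "(\<lambda>x. rot (f x) (h x) $ k) \<in> borel_measurable M"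
    unfolding rot_def frame_map_def vec_lambda_beta
    by (intro borel_measurable_sum borel_measurable_scaleR borel_measurable_inner borel_measurable_cart_nth[OF f(2)] borel_measurable_const)
qed

lemma rot_sets:
  assumes "S \<in> sets borel"
  shows "{G :: 'e::euclidean_space^'g::finite. rot G (T :: 'e^'k::finite) \<in> S} \<in> sets borel"
  using measurable_sets[OF rot_measurable[of "\<lambda>G. G" borel "\<lambda>_. T"] assms] by (simp add: vimage_def)

lemma orthogonal_measurable: "orthogonal_transformation f \<Longrightarrow> f \<in> borel_measurable borel"
  for f :: "'e::euclidean_space \<Rightarrow> 'e"
  by (auto intro!: borel_measurable_continuous_onI linear_continuous_on
      simp: linear_conv_bounded_linear[symmetric] orthogonal_transformation_linear)

text \<open>Transitivity of the orthogonal group on subspaces of a given dimension: orthonormal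
  bases of the subspaces and of their complements are matched.\<close>

lemma orthogonal_map_onto:
  fixes S T :: "'e::euclidean_space set"
  assumes S: "subspace S" and T: "subspace T" and d: "dim S = dim T"
  obtains A where "orthogonal_transformation A" "A ` S = T"
proof -
  have onb: "\<exists>B. B \<subseteq> S \<and> pairwise orthogonal B \<and> (\<forall>x\<in>B. norm x = 1) \<and> independent B \<and> card B = dim S \<and> span B = S"
    if "subspace S" for S :: "'e set"
    using orthonormal_basis_subspace[OF that] by metis
  have ex: "\<exists>B U. finite B \<and> finite U \<and> B \<inter> U = {} \<and> card B = dim S \<and> card U = DIM('e) - dim S \<and> span B = S
      \<and> pairwise orthogonal (B \<union> U) \<and> (\<forall>x\<in>B \<union> U. norm x = 1) \<and> span (B \<union> U) = UNIV" if S: "subspace S" for S :: "'e set"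
  proof -
    obtain B where B: "B \<subseteq> S" "pairwise orthogonal B" "\<forall>x\<in>B. norm x = 1" "independent B" "card B = dim S" "span B = S"
      using onb[OF S] by blast
    define S' where "S' = {y. \<forall>x\<in>S. Linear_Algebra.orthogonal x y}"
    have S's: "subspace S'" unfolding S'_def by (rule subspace_orthogonal_to_vectors)
    obtain U where U: "U \<subseteq> S'" "pairwise orthogonal U" "\<forall>x\<in>U. norm x = 1" "independent U" "card U = dim S'" "span U = S'"
      using onb[OF S's] by blast
    have dU: "dim S' + dim S = DIM('e)"
      unfolding S'_def using dim_subspace_orthogonal_to_vectors[OF S subspace_UNIV] by simp
    have fin: "finite B" "finite U" using B(4) U(4) by (simp_all add: independent_imp_finite)
    have o: "Linear_Algebra.orthogonal x y" if "x \<in> B" "y \<in> U" for x y using B(1) U(1) that unfolding S'_def by blast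
    have disj: "B \<inter> U = {}" using o B(3) by (fastforce simp: Linear_Algebra.orthogonal_def norm_eq_1)
    have po: "pairwise orthogonal (B \<union> U)"
      using B(2) U(2) o unfolding pairwise_def by (meson Un_iff orthogonal_commute)
    have n1: "\<forall>x\<in>B \<union> U. norm x = 1" using B(3) U(3) by blast
    have "independent (B \<union> U)" by (rule pairwise_orthogonal_independent[OF po]) (use n1 in force)
    then have "dim (span (B \<union> U)) = DIM('e)"
      using disj fin B(5) U(5) dU by (simp add: dim_eq_card_independent card_Un_disjoint)
    then have "span (B \<union> U) = UNIV" by (simp add: dim_eq_full)
    then show ?thesis using fin disj B(5,6) U(5) dU po n1 by (intro exI[of _ B] exI[of _ U]) simp
  qed
  obtain B U where B: "finite B" "finite U" "B \<inter> U = {}" "card B = dim S" "card U = DIM('e) - dim S" "span B = S"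
      "pairwise orthogonal (B \<union> U)" "\<forall>x\<in>B \<union> U. norm x = 1" "span (B \<union> U) = UNIV" using ex[OF S] by blast
  obtain C V where C: "finite C" "finite V" "C \<inter> V = {}" "card C = dim T" "card V = DIM('e) - dim T" "span C = T"
      "pairwise orthogonal (C \<union> V)" "\<forall>x\<in>C \<union> V. norm x = 1" using ex[OF T] by blast
  obtain \<phi>1 where \<phi>1: "bij_betw \<phi>1 B C" using finite_same_card_bij[OF B(1) C(1)] B(4) C(4) d by auto
  obtain \<phi>2 where \<phi>2: "bij_betw \<phi>2 U V" using finite_same_card_bij[OF B(2) C(2)] B(5) C(5) d by auto
  define \<phi> where "\<phi> b = (if b \<in> B then \<phi>1 b else \<phi>2 b)" for b
  have \<phi>: "bij_betw \<phi> (B \<union> U) (C \<union> V)"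
  proof (rule bij_betw_combine[OF _ _ C(3)])
    show "bij_betw \<phi> B C" using \<phi>1 by (rule bij_betw_cong[THEN iffD1, rotated]) (simp add: \<phi>_def)
    show "bij_betw \<phi> U V" using \<phi>2 by (rule bij_betw_cong[THEN iffD1, rotated]) (use B(3) in \<open>auto simp: \<phi>_def\<close>)
  qed
  have \<phi>o: "\<phi> b \<bullet> \<phi> c = of_bool (b = c)" if "b \<in> B \<union> U" "c \<in> B \<union> U" for b c
  proof -
    have m: "\<phi> b \<in> C \<union> V" "\<phi> c \<in> C \<union> V" and e: "\<phi> b = \<phi> c \<longleftrightarrow> b = c"
      using \<phi> that by (auto simp: bij_betw_def inj_on_def)
    show ?thesis
    proof (cases "b = c")
      case True then show ?thesis using C(8) m by (simp add: norm_eq_1)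
    next
      case False then show ?thesis using C(7) m e by (simp add: pairwise_def Linear_Algebra.orthogonal_def)
    qed
  qed
  have bo: "b \<bullet> c = of_bool (b = c)" if "b \<in> B \<union> U" "c \<in> B \<union> U" for b c
    using B(7,8) that by (cases "b = c") (simp_all add: pairwise_def Linear_Algebra.orthogonal_def norm_eq_1)
  define A where "A x = (\<Sum>b\<in>B \<union> U. (x \<bullet> b) *\<^sub>R \<phi> b)" for x
  have lin: "linear A" unfolding A_def by (intro linearI) (simp_all add: algebra_simps inner_add_left sum.distrib scaleR_sum_right)
  have fin: "finite (B \<union> U)" using B by simp
  have "A x \<bullet> A y = x \<bullet> y" for x y
  proof -
    have ex: "(\<Sum>b\<in>B \<union> U. (z \<bullet> b) *\<^sub>R b) = z" for z
      using B(7,8,9) fin by (intro orthonormal_basis_expand) auto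
    have "A x \<bullet> A y = (\<Sum>b\<in>B \<union> U. \<Sum>c\<in>B \<union> U. (x \<bullet> b) * ((y \<bullet> c) * (\<phi> b \<bullet> \<phi> c)))"
      unfolding A_def inner_sum_left unfolding inner_sum_right by (simp add: mult.left_commute)
    also have "\<dots> = (\<Sum>b\<in>B \<union> U. \<Sum>c\<in>B \<union> U. (x \<bullet> b) * ((y \<bullet> c) * (b \<bullet> c)))"
      by (intro sum.cong refl) (simp only: \<phi>o bo)
    also have "\<dots> = (\<Sum>b\<in>B \<union> U. (x \<bullet> b) *\<^sub>R b) \<bullet> (\<Sum>c\<in>B \<union> U. (y \<bullet> c) *\<^sub>R c)"
      unfolding inner_sum_left unfolding inner_sum_right by (simp add: mult.left_commute)
    finally show ?thesis unfolding ex .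
  qed
  then have "orthogonal_transformation A" using lin by (simp add: orthogonal_transformation_def)
  moreover have "A ` S = T"
  proof -
    have "A b = \<phi> b" if b: "b \<in> B" for b
    proof -
      have "A b = (\<Sum>c\<in>B \<union> U. if c = b then \<phi> c else 0)"
        unfolding A_def using b by (intro sum.cong refl) (auto simp: bo)
      then show ?thesis using b fin by simp
    qed
    then have "A ` B = C" using \<phi>1 unfolding bij_betw_def by (auto simp: \<phi>_def image_iff)
    then show ?thesis using linear_span_image[OF lin, of B] B(6) C(6) by simp
  qed
  ultimately show ?thesis using that by blast
qed


lemma prob_eq_AE:
  assumes "{x. P x} \<in> sets borel" "{x. Q x} \<in> sets borel" "AE x in gauss. P x \<longleftrightarrow> Q x"
  shows "emeasure gauss {x. P x} = emeasure gauss {x. Q x}"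
  by (rule emeasure_eq_AE) (use assms in auto)

lemma emeasure_rot:
  assumes n: "CARD('n::{finite,wellorder}) = DIM('e::euclidean_space^'k::finite)" and g: "CARD('g::finite) = DIM('e)"
    and G: "findep UNIV (($) (G :: 'e^'g))" and S: "S \<in> sets borel"
  shows "emeasure gauss {T :: 'e^'k. rot G T \<in> S} = emeasure gauss S"
proof -
  let ?f = "rot G :: 'e^'k \<Rightarrow> 'e^'k"
  have o: "orthogonal_transformation ?f"
    using act_orthogonal[OF frame_orthogonal[OF g G], where 'k='k] unfolding rot_act[abs_def] .
  have "emeasure gauss S = emeasure (distr gauss borel ?f) S" unfolding gauss_orthogonal[OF n o] ..
  also have "\<dots> = emeasure gauss (?f -` S \<inter> space gauss)"
    by (rule emeasure_distr[OF _ S]) (use orthogonal_measurable[OF o] in \<open>simp cong: measurable_cong_sets\<close>)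
  finally show ?thesis by (simp add: vimage_def)
qed

text \<open>For an independent frame \<open>G\<close> the map \<open>rot G\<close> preserves the
  Gaussian law, so averaging over \<open>G\<close> changes nothing; Fubini then allows
  \<open>T\<close> to be fixed first.\<close>

lemma gauss_average:
  assumes n: "CARD('n::{finite,wellorder}) = DIM('e::euclidean_space^'k::finite)" and g: "CARD('g::finite) = DIM('e)"
    and ae: "AE G in gauss. findep UNIV (($) (G :: 'e^'g))" and S: "S \<in> sets borel"
  shows "emeasure gauss S = (\<integral>\<^sup>+T. emeasure gauss {G :: 'e^'g. rot G T \<in> S} \<partial>(gauss :: ('e^'k) measure))"
proof -
  interpret G: prob_space "gauss :: ('e^'g) measure" by (rule prob_space_gauss)
  interpret T: prob_space "gauss :: ('e^'k) measure" by (rule prob_space_gauss)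
  interpret P: pair_sigma_finite "gauss :: ('e^'g) measure" "gauss :: ('e^'k) measure" ..
  define X where "X = {z :: ('e^'g) \<times> ('e^'k). rot (fst z) (snd z) \<in> S}"
  have "(\<lambda>z. rot (fst z) (snd z)) \<in> borel_measurable ((gauss :: ('e^'g) measure) \<Otimes>\<^sub>M (gauss :: ('e^'k) measure))"
    by (rule rot_measurable) (auto cong: measurable_cong_sets intro!: measurable_fst'' measurable_snd'')
  from measurable_sets[OF this S] have X: "X \<in> sets ((gauss :: ('e^'g) measure) \<Otimes>\<^sub>M (gauss :: ('e^'k) measure))"
    by (simp add: X_def vimage_def space_pair_measure)
  have "(\<integral>\<^sup>+G. emeasure gauss (Pair G -` X) \<partial>gauss) = (\<integral>\<^sup>+G. emeasure gauss S \<partial>(gauss :: ('e^'g) measure))"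
    by (rule nn_integral_cong_AE) (use ae in \<open>eventually_elim, simp add: X_def vimage_def emeasure_rot[OF n g _ S]\<close>)
  then have "(\<integral>\<^sup>+G. emeasure gauss (Pair G -` X) \<partial>gauss) = emeasure gauss S" using G.emeasure_space_1 by simp
  then show ?thesis
    unfolding T.emeasure_pair_measure_alt[OF X, symmetric] P.emeasure_pair_measure_alt2[OF X] by (simp add: X_def vimage_def)
qed

text \<open>A rotation moves from the family to the frame, whose law is invariant. Therefore the law
  of \<open>rot G T\<close> depends only on the orbit of \<open>T\<close>.\<close>

lemma rot_act_inv:
  assumes A: "orthogonal_transformation A"
  shows "rot G (act A T) = rot (act (inv_into UNIV A) G) T"
proof -
  have "act A (act (inv_into UNIV A) G) = G"
    using orthogonal_transformation_surj[OF A] by (simp add: cart_eq_iff surj_f_inv_f)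
  then show ?thesis using rot_equivariant[OF A, of "act (inv_into UNIV A) G" T] by simp
qed

lemma AE_rot_act:
  fixes T :: "'e::euclidean_space^'k::finite"
  assumes n: "CARD('n::{finite,wellorder}) = DIM('e^'g::finite)" and A: "orthogonal_transformation A"
    and P: "AE G :: 'e^'g in gauss. P (rot G T)"
  shows "AE G :: 'e^'g in gauss. P (rot G (act A T))"
proof -
  let ?f = "act (inv_into UNIV A) :: 'e^'g \<Rightarrow> 'e^'g"
  have o: "orthogonal_transformation ?f" by (intro act_orthogonal orthogonal_transformation_inv A)
  have "AE G in distr gauss borel ?f. P (rot G T)" unfolding gauss_orthogonal[OF n o] by (rule P)
  then have "AE G in gauss. P (rot (?f G) T)"
    by (rule AE_distrD[rotated]) (use orthogonal_measurable[OF o] in \<open>simp cong: measurable_cong_sets\<close>)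
  then show ?thesis unfolding rot_act_inv[OF A] .
qed

lemma emeasure_rot_act:
  fixes T :: "'e::euclidean_space^'k::finite"
  assumes n: "CARD('n::{finite,wellorder}) = DIM('e^'g::finite)" and A: "orthogonal_transformation A" and S: "S \<in> sets borel"
  shows "emeasure gauss {G :: 'e^'g. rot G (act A T) \<in> S} = emeasure gauss {G :: 'e^'g. rot G T \<in> S}"
proof -
  let ?f = "act (inv_into UNIV A) :: 'e^'g \<Rightarrow> 'e^'g"
  have o: "orthogonal_transformation ?f" by (intro act_orthogonal orthogonal_transformation_inv A)
  have "emeasure gauss {G :: 'e^'g. rot G T \<in> S} = emeasure (distr gauss borel ?f) {G. rot G T \<in> S}"
    unfolding gauss_orthogonal[OF n o] ..
  also have "\<dots> = emeasure gauss (?f -` {G. rot G T \<in> S} \<inter> space gauss)"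
    by (rule emeasure_distr[OF _ rot_sets[OF S]]) (use orthogonal_measurable[OF o] in \<open>simp cong: measurable_cong_sets\<close>)
  finally show ?thesis by (simp add: rot_act_inv[OF A] vimage_def)
qed

lemma span_act:
  assumes "linear A" shows "span (range (($) (act A T))) = A ` span (range (($) T))"
proof -
  have "range (($) (act A T)) = A ` range (($) T)" by auto
  then show ?thesis using linear_span_image[OF assms] by metis
qed

lemma findep_act:
  assumes A: "orthogonal_transformation A" and T: "findep UNIV (($) T)" shows "findep UNIV (($) (act A T))"
  unfolding findep_def
proof (intro allI impI)
  fix c assume "(\<Sum>i\<in>UNIV. c i *\<^sub>R act A T $ i) = 0"
  then have "A (\<Sum>i\<in>UNIV. c i *\<^sub>R T $ i) = 0"
    using A by (simp add: orthogonal_transformation_linear linear_sum linear_cmul)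
  then have "(\<Sum>i\<in>UNIV. c i *\<^sub>R T $ i) = 0" using orthogonal_transformation_norm[OF A] by (metis norm_eq_zero)
  then show "\<forall>i\<in>UNIV. c i = 0" using T unfolding findep_def by blast
qed

lemma rank_le5_span: "rank_le5 T \<longleftrightarrow> (\<exists>a b. span (range (($) T)) \<subseteq> span ((\<lambda>i. outer (a i) (b i)) ` {..<5::nat}))"
proof -
  have "(\<forall>k. T $ k \<in> span S) \<longleftrightarrow> span (range (($) T)) \<subseteq> span S" for S
    by (metis (no_types, lifting) image_subset_iff rangeI span_base span_minimal subset_iff subspace_span UNIV_I)
  then show ?thesis unfolding rank_le5_def by simp
qed

section \<open>Both probabilities as averages over frames\<close>

definition rank5_set :: "(real^3^3^5) set" where "rank5_set = {T. decomp 5 T \<and> \<not> decomp 4 T}"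

lemma rank5_set_borel: "rank5_set \<in> sets borel"
  unfolding rank5_set_def by (rule rank5_borel)

lemma rank5_set_iff: "findep UNIV (($) T) \<Longrightarrow> T \<in> rank5_set \<longleftrightarrow> rank_le5 T"
  unfolding rank5_set_def by (simp add: rank_le5_decomp not_decomp_4)

lemma AE_findep9: "AE G :: real^3^3^9 in gauss. findep UNIV (($) G)"
  using AE_gauss_negligible[OF dependent_negligible[where 'n=9 and 'm=8 and 'e="real^3^3"]] by simp

lemma AE_findep5: "AE T :: real^3^3^5 in gauss. findep UNIV (($) T)"
  using AE_gauss_negligible[OF dependent_negligible[where 'n=5 and 'm=4 and 'e="real^3^3"]] by simp

lemma AE_findep4: "AE M :: real^3^3^4 in gauss. findep UNIV (($) M)"
  using AE_gauss_negligible[OF dependent_negligible[where 'n=4 and 'm=3 and 'e="real^3^3"]] by simp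

lemma frame9: "findep UNIV (($) (G :: real^3^3^9)) \<Longrightarrow> orthogonal_transformation (frame_map (\<lambda>n. G $ ix n))"
  by (rule frame_orthogonal) simp

lemma findep_rot: "findep UNIV (($) (G :: real^3^3^9)) \<Longrightarrow> findep UNIV (($) T) \<Longrightarrow> findep UNIV (($) (rot G T))"
  unfolding rot_act by (intro findep_act frame9)

lemma span_rot: "findep UNIV (($) (G :: real^3^3^9)) \<Longrightarrow> span (range (($) (rot G T))) = frame_map (\<lambda>n. G $ ix n) ` span (range (($) T))"
  unfolding rot_act by (intro span_act orthogonal_transformation_linear frame9)

text \<open>45 = 5 * 9 is the dimension of the space of five slices, and the frame has nine members
  because the slices live in nine-space.\<close>

lemma average5: "S \<in> sets borel \<Longrightarrow>
    emeasure gauss S = (\<integral>\<^sup>+T. emeasure gauss {G :: real^3^3^9. rot G T \<in> S} \<partial>(gauss :: (real^3^3^5) measure))"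
  by (rule gauss_average[where 'n=45, OF _ _ AE_findep9]) simp_all

lemma average4: "S \<in> sets borel \<Longrightarrow>
    emeasure gauss S = (\<integral>\<^sup>+T. emeasure gauss {G :: real^3^3^9. rot G T \<in> S} \<partial>(gauss :: (real^3^3^4) measure))"
  by (rule gauss_average[where 'n=36, OF _ _ AE_findep9]) simp_all

text \<open>Only the spans are matched, not the families; this suffices for
  \<open>good_space\<close> and \<open>rank_le5\<close>, which depend on the span alone.\<close>

lemma same_span_orbit:
  fixes T1 T2 :: "real^3^3^5"
  assumes "findep UNIV (($) T1)" "findep UNIV (($) T2)"
  obtains A where "orthogonal_transformation A"
    "\<forall>G :: real^3^3^9. findep UNIV (($) G) \<longrightarrow> span (range (($) (rot G (act A T1)))) = span (range (($) (rot G T2)))"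
proof -
  have "dim (span (range (($) T1))) = dim (span (range (($) T2)))" by (simp only: findep_dim[OF finite_class.finite_UNIV assms(1)] findep_dim[OF finite_class.finite_UNIV assms(2)])
  then obtain A where A: "orthogonal_transformation A" "A ` span (range (($) T1)) = span (range (($) T2))"
    by (rule orthogonal_map_onto[OF subspace_span subspace_span])
  show ?thesis
  proof (rule that[OF A(1)], intro allI impI)
    fix G :: "real^3^3^9" assume G: "findep UNIV (($) G)"
    show "span (range (($) (rot G (act A T1)))) = span (range (($) (rot G T2)))"
      unfolding span_rot[OF G] span_act[OF orthogonal_transformation_linear[OF A(1)]] A(2) by simp
  qed
qed

text \<open>Almost every tensor is good, so by Fubini some independent \<open>T1\<close> becomes
  good under almost every frame. The span of \<open>T\<close> is a rotated copy of that of
  \<open>T1\<close>, which gives the claim for every independent \<open>T\<close>, even one whose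
  own span is not good.\<close>

lemma generic_good:
  assumes T: "findep UNIV (($) (T :: real^3^3^5))"
  shows "AE G :: real^3^3^9 in gauss. good_space (span (range (($) (rot G T))))"
proof -
  interpret G: prob_space "gauss :: (real^3^3^9) measure" by (rule prob_space_gauss)
  interpret T: prob_space "gauss :: (real^3^3^5) measure" by (rule prob_space_gauss)
  have "AE T :: real^3^3^5 in gauss. good_space (span (range (($) T)))"
    using AE_gauss_negligible[OF bad_negligible] by eventually_elim simp
  \<comment> \<open>Measurability of the exceptional set is not established, so a measurable null
    set \<open>N\<close> containing it takes its place.\<close>
  then obtain N :: "(real^3^3^5) set" where N: "{T \<in> space gauss. \<not> good_space (span (range (($) T)))} \<subseteq> N"
      "emeasure gauss N = 0" "N \<in> sets gauss" by (rule AE_E)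
  have NB: "N \<in> sets borel" using N(3) by simp
  have "(\<lambda>T. emeasure gauss {G :: real^3^3^9. rot G T \<in> N}) \<in> borel_measurable (gauss :: (real^3^3^5) measure)"
  proof -
    have "(\<lambda>z. rot (snd z) (fst z)) \<in> borel_measurable ((gauss :: (real^3^3^5) measure) \<Otimes>\<^sub>M (gauss :: (real^3^3^9) measure))"
      by (rule rot_measurable) (auto cong: measurable_cong_sets intro!: measurable_fst'' measurable_snd'')
    from measurable_sets[OF this NB]
    have "{z. rot (snd z) (fst z) \<in> N} \<in> sets ((gauss :: (real^3^3^5) measure) \<Otimes>\<^sub>M (gauss :: (real^3^3^9) measure))"
      by (simp add: vimage_def space_pair_measure)
    from G.measurable_emeasure_Pair[OF this] show ?thesis by (simp add: vimage_def)
  qed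
  then have "AE T :: real^3^3^5 in gauss. emeasure gauss {G :: real^3^3^9. rot G T \<in> N} = 0"
    using average5[OF NB] N(2) by (subst nn_integral_0_iff_AE[symmetric]) simp_all
  with AE_findep5 have "AE T :: real^3^3^5 in gauss. findep UNIV (($) T) \<and> emeasure gauss {G :: real^3^3^9. rot G T \<in> N} = 0"
    by eventually_elim simp
  then obtain T1 :: "real^3^3^5" where T1: "findep UNIV (($) T1)" "emeasure gauss {G :: real^3^3^9. rot G T1 \<in> N} = 0"
    using eventually_happens'[OF T.ae_filter_bot] by blast
  have "AE G :: real^3^3^9 in gauss. G \<notin> {G. rot G T1 \<in> N}"
    using T1(2) rot_sets[OF NB, of T1] by (intro AE_not_in) (auto simp: null_sets_def)
  then have a: "AE G :: real^3^3^9 in gauss. good_space (span (range (($) (rot G T1))))"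
    by eventually_elim (use N(1) in auto)
  obtain A where A: "orthogonal_transformation A"
    "\<forall>G :: real^3^3^9. findep UNIV (($) G) \<longrightarrow> span (range (($) (rot G (act A T1)))) = span (range (($) (rot G T)))"
    by (rule same_span_orbit[OF T1(1) T])
  note A' = A(2)[rule_format]
  have b: "AE G :: real^3^3^9 in gauss. good_space (span (range (($) (rot G (act A T1)))))"
    using AE_rot_act[where 'n=81 and P="\<lambda>T. good_space (span (range (($) T)))" and T=T1 and A=A and 'g=9] A(1) a by simp
  have "AE G :: real^3^3^9 in gauss. good_space (span (range (($) (rot G (act A T1))))) \<longrightarrow> good_space (span (range (($) (rot G T))))"
    using AE_findep9 by (rule eventually_mono) (simp only: A' simp_thms)
  with b show ?thesis by (rule eventually_rev_mp)
qed

lemma rank5_orbit: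
  fixes T1 T2 :: "real^3^3^5"
  assumes T1: "findep UNIV (($) T1)" and T2: "findep UNIV (($) T2)"
  shows "emeasure gauss {G :: real^3^3^9. rot G T1 \<in> rank5_set} = emeasure gauss {G :: real^3^3^9. rot G T2 \<in> rank5_set}"
proof -
  obtain A where A: "orthogonal_transformation A"
    "\<forall>G :: real^3^3^9. findep UNIV (($) G) \<longrightarrow> span (range (($) (rot G (act A T1)))) = span (range (($) (rot G T2)))"
    by (rule same_span_orbit[OF T1 T2])
  note A' = A(2)[rule_format]
  have "emeasure gauss {G :: real^3^3^9. rot G T1 \<in> rank5_set} = emeasure gauss {G :: real^3^3^9. rot G (act A T1) \<in> rank5_set}"
    by (rule emeasure_rot_act[where 'n=81, OF _ A(1) rank5_set_borel, symmetric]) simp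
  also have "\<dots> = emeasure gauss {G :: real^3^3^9. rot G T2 \<in> rank5_set}"
  proof (rule prob_eq_AE[OF rot_sets rot_sets], rule rank5_set_borel, rule rank5_set_borel)
    show "AE G :: real^3^3^9 in gauss. rot G (act A T1) \<in> rank5_set \<longleftrightarrow> rot G T2 \<in> rank5_set"
      using AE_findep9
    proof eventually_elim
      fix G :: "real^3^3^9" assume G: "findep UNIV (($) G)"
      show "rot G (act A T1) \<in> rank5_set \<longleftrightarrow> rot G T2 \<in> rank5_set"
        unfolding rank5_set_iff[OF findep_rot[OF G findep_act[OF A(1) T1]]] rank5_set_iff[OF findep_rot[OF G T2]]
          rank_le5_span A'[OF G] ..
    qed
  qed
  finally show ?thesis .
qed

lemma orthogonal_frame:
  assumes M: "findep UNIV (($) (M :: real^3^3^4))"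
  obtains T :: "real^3^3^5" where "findep UNIV (($) T)" "\<forall>k l. M$l \<bullet> T$k = 0"
proof -
  let ?S = "{y. \<forall>x\<in>span (range (($) M)). Linear_Algebra.orthogonal x y}"
  have "dim ?S + dim (span (range (($) M))) = DIM(real^3^3)"
    using dim_subspace_orthogonal_to_vectors[OF subspace_span subspace_UNIV, of "range (($) M)"] by simp
  then have d: "dim ?S = 5" using findep_dim[OF _ M] by simp
  obtain B where B: "B \<subseteq> ?S" "independent B" "?S \<subseteq> span B" "card B = dim ?S" by (rule basis_exists)
  have "finite B" using B(2) by (rule independent_imp_finite)
  then obtain f :: "5 \<Rightarrow> real^3^3" where f: "bij_betw f UNIV B"
    using finite_same_card_bij[of "UNIV :: 5 set" B] B(4) d by auto
  have e: "($) (vec_lambda f) = f" by (rule ext) simp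
  have "findep UNIV (($) (vec_lambda f))" unfolding e using f B(2) by (simp add: findep_iff bij_betw_def)
  moreover have "M$l \<bullet> vec_lambda f $ k = 0" for k l
  proof -
    have "f k \<in> ?S" using f B(1) by (auto simp: bij_betw_def)
    moreover have "M$l \<in> span (range (($) M))" by (simp add: span_base)
    ultimately show ?thesis by (simp add: Linear_Algebra.orthogonal_def)
  qed
  ultimately show ?thesis using that by blast
qed

text \<open>A basis \<open>T'\<close> of the orthogonal complement of \<open>M\<close> is rotated
  together with \<open>M\<close>. The two stay orthogonal, so \<open>frame_pair\<close> applies for
  almost every \<open>G\<close>, and \<open>rank5_orbit\<close> replaces \<open>T'\<close> by
  \<open>T\<close>.\<close>

lemma all27_orbit:
  assumes M: "findep UNIV (($) (M :: real^3^3^4))" and T: "findep UNIV (($) (T :: real^3^3^5))"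
  shows "emeasure gauss {G :: real^3^3^9. rot G M \<in> {M. all27 M}} = emeasure gauss {G :: real^3^3^9. rot G T \<in> rank5_set}"
proof -
  obtain T' :: "real^3^3^5" where T': "findep UNIV (($) T')" "\<forall>k l. M$l \<bullet> T'$k = 0" by (rule orthogonal_frame[OF M])
  have "emeasure gauss {G :: real^3^3^9. rot G M \<in> {M. all27 M}} = emeasure gauss {G :: real^3^3^9. rot G T' \<in> rank5_set}"
  proof (rule prob_eq_AE[OF rot_sets rot_sets], rule all27_borel, rule rank5_set_borel)
    show "AE G :: real^3^3^9 in gauss. rot G M \<in> {M. all27 M} \<longleftrightarrow> rot G T' \<in> rank5_set"
      using AE_findep9 generic_good[OF T'(1)]
    proof eventually_elim
      fix G :: "real^3^3^9" assume G: "findep UNIV (($) G)" and g: "good_space (span (range (($) (rot G T'))))"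
      have "rot G M $ l \<bullet> rot G T' $ k = 0" for k l
        using frame9[OF G] T'(2) by (simp add: rot_act orthogonal_transformation_def)
      then have "frame_pair (rot G T') (rot G M)"
        using findep_rot[OF G T'(1)] findep_rot[OF G M] g by (simp add: frame_pair_def)
      then show "rot G M \<in> {M. all27 M} \<longleftrightarrow> rot G T' \<in> rank5_set"
        using rank5_set_iff[OF findep_rot[OF G T'(1)]] by (simp add: frame_pair.rank_le5_iff all27_def)
    qed
  qed
  then show ?thesis using rank5_orbit[OF T'(1) T] by simp
qed

theorem theorem1p3:
  shows "measure gauss_tensor {T \<in> space gauss_tensor. tensor_rank T = 5}
       = measure gauss_pencil {M \<in> space gauss_pencil. all_27_lines_real M}"
proof -
  interpret T: prob_space "gauss :: (real^3^3^5) measure" by (rule prob_space_gauss)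
  interpret M: prob_space "gauss :: (real^3^3^4) measure" by (rule prob_space_gauss)
  obtain T0 :: "real^3^3^5" where T0: "findep UNIV (($) T0)"
    using eventually_happens'[OF T.ae_filter_bot AE_findep5] by blast
  \<comment> \<open>By \<open>rank5_orbit\<close> and \<open>all27_orbit\<close> this is also the
    value for any other independent tensor, and for any independent pencil with the event on lines;
    both averages are thus integrals of one constant.\<close>
  define c where "c = emeasure gauss {G :: real^3^3^9. rot G T0 \<in> rank5_set}"
  have "emeasure gauss rank5_set = (\<integral>\<^sup>+T. c \<partial>(gauss :: (real^3^3^5) measure))"
    unfolding average5[OF rank5_set_borel]
    by (rule nn_integral_cong_AE) (use AE_findep5 in \<open>eventually_elim, simp add: c_def rank5_orbit[OF _ T0]\<close>)
  moreover have "emeasure gauss {M. all27 M} = (\<integral>\<^sup>+M. c \<partial>(gauss :: (real^3^3^4) measure))"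
    unfolding average4[OF all27_borel]
    by (rule nn_integral_cong_AE) (use AE_findep4 in \<open>eventually_elim, simp only: c_def all27_orbit[OF _ T0]\<close>)
  ultimately have "emeasure gauss rank5_set = emeasure gauss {M. all27 M}"
    using T.emeasure_space_1 M.emeasure_space_1 by simp
  then show ?thesis
    unfolding tensor_probability pencil_probability unfolding rank5_set_def Sigma_Algebra.measure_def by simp
qed

end
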